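(* For $\omega,\omega'\in\overline{\mathfrak{T}}$, the following conditions are equivalent: (1) $\mathbb{O}_{\omega'}$ covers $\mathbb{O}_\omega$; (2) $\dim\mathbb{O}_{\omega'}=\dim\mathbb{O}_\omega+1$ and the graph of $\omega$ is obtained from the graph of $\omega'$ by one of the elementary moves (Cases 1--5) listed in the context. As a consequence, the boundary $\overline{\mathbb{O}}\setminus\mathbb{O}$ of every non-closed $K$-orbit $\mathbb{O}\subset\mathfrak{X}$ is equidimensional of codimension one in $\overline{\mathbb{O}}$.
   Context: Let $p,q\ge 1$ and $0\le r\le p+q$ be integers. $V=\mathbb{C}^{p+q}=V^+\oplus V^-$ with $V^+=\mathbb{C}^p\times\{0\}^q$ and $V^-=\{0\}^p\times\mathbb{C}^q$; $\mathfrak{X}=\mathrm{Gr}(V,r)\times\mathrm{Fl}(V^+)\times\mathrm{Fl}(V^-)$ (Grassmannian of $r$-dimensional subspaces and varieties of complete flags), with the diagonal action of $K=\mathrm{GL}(V^+)\times\mathrm{GL}(V^-)$. The standard flags are $\mathcal{F}_0^+=(\mathbb{C}^i\times\{0\}^{p-i}\times\{0\}^q)_{i=0}^p$ and $\mathcal{F}_0^-=(\{0\}^p\times\mathbb{C}^j\times\{0\}^{q-j})_{j=0}^q$. Let $\mathfrak{T}_{p,r}$ be the set of $p\times r$ matrices with entries in $\{0,1\}$ having at most one $1$ in each row and each column. Let $\mathfrak{T}=\mathfrak{T}_{(p,q),r}$ be the set of $(p+q)\times r$ matrices of rank $r$ of the form $\omega=\begin{pmatrix}\tau_1\\ \tau_2\end{pmatrix}$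 with $\tau_1\in\mathfrak{T}_{p,r}$, $\tau_2\in\mathfrak{T}_{q,r}$, and $\overline{\mathfrak{T}}=\mathfrak{T}/\mathfrak{S}_r$ the quotient by column permutations. For $\omega\in\overline{\mathfrak T}$, $[\omega]\in\mathrm{Gr}(V,r)$ is the column space of $\omega$, and $\mathbb{O}_\omega:=K\cdot([\omega],\mathcal{F}_0^+,\mathcal{F}_0^-)$. (The $K$-orbits of $\mathfrak{X}$ are exactly the $\mathbb{O}_\omega$, $\omega\in\overline{\mathfrak T}$, without repetition.) The graph $\mathcal{G}(\omega)$ has vertices $1^+,\ldots,p^+,1^-,\ldots,q^-$, an edge $(i^+,j^-)$ for every column of $\omega$ with exactly two $1$'s, in row $i$ of $\tau_1$ and row $j$ of $\tau_2$, and a mark at $i^+$ (resp. $j^-$) for every column with exactly one $1$, in row $i$ of $\tau_1$ (resp. row $j$ of $\tau_2$). A vertex is free if it is neither marked nor incident with an edge. The map $\omega\mapsto\mathcal{G}(\omega)$ is injective. $\mathbb{O}_{\omega'}$ covers $\mathbb{O}_\omega$ if $\overline{\mathbb{O}_{\omega'}}$ strictly contains $\overline{\mathbb{O}_\omega}$ and is minimal among the orbit closures for this property. Elementary moves (from $\omega'$ to $\omega$): $\mathcal{G}(\omega)$ is obtained from $\mathcal{G}(\omega')$ by changing only the pattern at the vertices indicated below (everything else is unchanged), where $a<b$ in $\{1,\dots,p\}$ and $c<d$ in $\{1,\dots,q\}$ whenever these letters occur together: - Case 1: edges $(a^+,d^-),(b^+,c^-)$ are replaced by edges $(a^+,c^-),(b^+,d^-)$.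 - Case 2: edge $(a^+,c^-)$ and mark at $b^+$ are replaced by edge $(b^+,c^-)$ and mark at $a^+$; or edge $(a^+,c^-)$ and mark at $d^-$ are replaced by edge $(a^+,d^-)$ and mark at $c^-$. - Case 3: edge $(b^+,c^-)$ with $a^+$ free is replaced by edge $(a^+,c^-)$ with $b^+$ free; or edge $(a^+,d^-)$ with $c^-$ free is replaced by edge $(a^+,c^-)$ with $d^-$ free. - Case 4: edge $(a^+,c^-)$ is replaced by a mark at $a^+$ with $c^-$ free; or edge $(a^+,c^-)$ is replaced by a mark at $c^-$ with $a^+$ free. - Case 5: mark at $b^+$ with $a^+$ free is replaced by a mark at $a^+$ with $b^+$ free; or mark at $d^-$ with $c^-$ free is replaced by a mark at $c^-$ with $d^-$ free. *)

theory Defs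
  imports
    "HOL-Analysis.Abstract_Topology"
    "HOL-Combinatorics.Permutations"
    "HOL-Library.Extended_Nat"
    "Jordan_Normal_Form.DL_Rank"
begin

section \<open>Dimension and irreducibility in topological spaces\<close>

definition irreducible_top :: "'a topology \<Rightarrow> bool" where
  "irreducible_top T \<longleftrightarrow> topspace T \<noteq> {} \<and>
     (\<forall>C D. closedin T C \<and> closedin T D \<and> C \<union> D = topspace T \<longrightarrow> C = topspace T \<or> D = topspace T)"

(* Krull dimension. The empty space gets 0 here, since enat has no value below 0. *)
definition krull_dim :: "'a topology \<Rightarrow> enat" where
  "krull_dim T = Sup {enat n | n. \<exists>Z :: nat \<Rightarrow> 'a set.
     (\<forall>i\<le>n. closedin T (Z i) \<and> irreducible_top (subtopology T (Z i))) \<and>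
     (\<forall>i<n. Z i \<subset> Z (Suc i))}"

definition irreducible_components :: "'a topology \<Rightarrow> 'a set set" where
  "irreducible_components T =
     {Z. Z \<subseteq> topspace T \<and> irreducible_top (subtopology T Z) \<and>
         (\<forall>Y. Y \<subseteq> topspace T \<and> irreducible_top (subtopology T Y) \<and> Z \<subseteq> Y \<longrightarrow> Y = Z)}"


section \<open>The double flag variety\<close>

type_synonym cspace = "complex vec set"
type_synonym dflag = "cspace \<times> cspace list \<times> cspace list"

abbreviation lin_subspace :: "nat \<Rightarrow> cspace \<Rightarrow> bool" where
  "lin_subspace n W \<equiv> VectorSpace.subspace class_ring W (module_vec TYPE(complex) n)"

abbreviation lin_dim :: "nat \<Rightarrow> cspace \<Rightarrow> nat" where
  "lin_dim n W \<equiv> vectorspace.dim class_ring (module_vec TYPE(complex) n\<lparr>carrier := W\<rparr>)"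

abbreviation col_span :: "nat \<Rightarrow> complex mat \<Rightarrow> cspace" where
  "col_span n A \<equiv> vec_space.col_space n A"

abbreviation mat_rank :: "nat \<Rightarrow> complex mat \<Rightarrow> nat" where
  "mat_rank n A \<equiv> vec_space.rank n A"

definition V_plus :: "nat \<Rightarrow> nat \<Rightarrow> cspace" where
  "V_plus p q = {v @\<^sub>v 0\<^sub>v q | v. v \<in> carrier_vec p}"

definition V_minus :: "nat \<Rightarrow> nat \<Rightarrow> cspace" where
  "V_minus p q = {0\<^sub>v p @\<^sub>v v | v. v \<in> carrier_vec q}"

definition Gr :: "nat \<Rightarrow> nat \<Rightarrow> cspace set" where
  "Gr n r = {W. lin_subspace n W \<and> lin_dim n W = r}"

(* A complete flag of U \<subseteq> C^n is the list of its members, in dimensions 0, ..., dim U. *)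
definition Fl :: "nat \<Rightarrow> cspace \<Rightarrow> cspace list set" where
  "Fl n U = {F. length F = lin_dim n U + 1 \<and>
     (\<forall>i\<le>lin_dim n U. lin_subspace n (F ! i) \<and> F ! i \<subseteq> U \<and> lin_dim n (F ! i) = i) \<and>
     (\<forall>i<lin_dim n U. F ! i \<subseteq> F ! Suc i)}"

definition dflag_variety :: "nat \<Rightarrow> nat \<Rightarrow> nat \<Rightarrow> dflag set" where
  "dflag_variety p q r = Gr (p + q) r \<times> Fl (p + q) (V_plus p q) \<times> Fl (p + q) (V_minus p q)"

definition std_flag_plus :: "nat \<Rightarrow> nat \<Rightarrow> cspace list" where
  "std_flag_plus p q =
     map (\<lambda>i. {v @\<^sub>v 0\<^sub>v (p - i) @\<^sub>v 0\<^sub>v q | v. v \<in> carrier_vec i}) [0..<p + 1]"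

definition std_flag_minus :: "nat \<Rightarrow> nat \<Rightarrow> cspace list" where
  "std_flag_minus p q =
     map (\<lambda>j. {0\<^sub>v p @\<^sub>v v @\<^sub>v 0\<^sub>v (q - j) | v. v \<in> carrier_vec j}) [0..<q + 1]"

definition K_group :: "nat \<Rightarrow> nat \<Rightarrow> complex mat set" where
  "K_group p q = {four_block_mat g (0\<^sub>m p q) (0\<^sub>m q p) h | g h.
     g \<in> carrier_mat p p \<and> invertible_mat g \<and> h \<in> carrier_mat q q \<and> invertible_mat h}"

fun K_act :: "complex mat \<Rightarrow> dflag \<Rightarrow> dflag" where
  "K_act k (W, F, F') =
     ((\<lambda>v. k *\<^sub>v v) ` W, map (\<lambda>U. (\<lambda>v. k *\<^sub>v v) ` U) F, map (\<lambda>U. (\<lambda>v. k *\<^sub>v v) ` U) F')"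

definition K_orbit :: "nat \<Rightarrow> nat \<Rightarrow> dflag \<Rightarrow> dflag set" where
  "K_orbit p q x = {K_act k x | k. k \<in> K_group p q}"

definition K_orbits :: "nat \<Rightarrow> nat \<Rightarrow> nat \<Rightarrow> dflag set set" where
  "K_orbits p q r = K_orbit p q ` dflag_variety p q r"


section \<open>The Zariski topology\<close>

text \<open>
  The variety is the quotient of the quasi-affine variety of pairs \<open>(A, k)\<close>, with \<open>A\<close> a
  \<open>(p + q) \<times> r\<close> matrix of rank \<open>r\<close> and \<open>k\<close> in \<open>K\<close>, by
  \<open>GL\<^sub>r\<close> times the stabilizer of the two standard flags: \<open>Gr(V, r)\<close> is the
  space of full rank matrices modulo \<open>GL\<^sub>r\<close>, and \<open>Fl(V\<^sup>+) \<times> Fl(V\<^sup>-)\<close> is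
  \<open>K\<close> modulo a Borel subgroup. The quotient map is open, so the Zariski topology downstairs is
  the quotient topology.
\<close>

definition frames :: "nat \<Rightarrow> nat \<Rightarrow> nat \<Rightarrow> (complex mat \<times> complex mat) set" where
  "frames p q r = {A. A \<in> carrier_mat (p + q) r \<and> mat_rank (p + q) A = r} \<times> K_group p q"

definition frame_map :: "nat \<Rightarrow> nat \<Rightarrow> complex mat \<times> complex mat \<Rightarrow> dflag" where
  "frame_map p q = (\<lambda>(A, k). (col_span (p + q) A,
     map (\<lambda>U. (\<lambda>v. k *\<^sub>v v) ` U) (std_flag_plus p q),
     map (\<lambda>U. (\<lambda>v. k *\<^sub>v v) ` U) (std_flag_minus p q)))"

inductive_set poly_functions :: "nat \<Rightarrow> nat \<Rightarrow> nat \<Rightarrow> (complex mat \<times> complex mat \<Rightarrow> complex) set"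
  for p q r :: nat where
  const: "(\<lambda>x. c) \<in> poly_functions p q r"
| entry1: "i < p + q \<Longrightarrow> j < r \<Longrightarrow> (\<lambda>x. fst x $$ (i, j)) \<in> poly_functions p q r"
| entry2: "i < p + q \<Longrightarrow> j < p + q \<Longrightarrow> (\<lambda>x. snd x $$ (i, j)) \<in> poly_functions p q r"
| add: "f \<in> poly_functions p q r \<Longrightarrow> g \<in> poly_functions p q r \<Longrightarrow>
    (\<lambda>x. f x + g x) \<in> poly_functions p q r"
| mult: "f \<in> poly_functions p q r \<Longrightarrow> g \<in> poly_functions p q r \<Longrightarrow>
    (\<lambda>x. f x * g x) \<in> poly_functions p q r"

definition zariski_frames :: "nat \<Rightarrow> nat \<Rightarrow> nat \<Rightarrow> (complex mat \<times> complex mat) topology" where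
  "zariski_frames p q r =
     topology_generated_by {{x \<in> frames p q r. f x \<noteq> 0} | f. f \<in> poly_functions p q r}"

definition zariski :: "nat \<Rightarrow> nat \<Rightarrow> nat \<Rightarrow> dflag topology" where
  "zariski p q r = topology (\<lambda>U. U \<subseteq> dflag_variety p q r \<and>
     openin (zariski_frames p q r) {x \<in> frames p q r. frame_map p q x \<in> U})"

lemma topspace_zariski_frames: "topspace (zariski_frames p q r) = frames p q r"
proof -
  have "frames p q r \<in> {{x \<in> frames p q r. f x \<noteq> 0} | f. f \<in> poly_functions p q r}"
    by (rule CollectI, rule exI[of _ "\<lambda>x. 1"]) (auto intro: poly_functions.const)
  then show ?thesis
    unfolding zariski_frames_def topology_generated_by_topspace by blast
qed

lemma openin_zariski:
  "openin (zariski p q r) U \<longleftrightarrow> U \<subseteq> dflag_variety p q r \<and>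
     openin (zariski_frames p q r) {x \<in> frames p q r. frame_map p q x \<in> U}"
proof -
  let ?pre = "\<lambda>U. {x \<in> frames p q r. frame_map p q x \<in> U}"
  have "istopology (\<lambda>U. U \<subseteq> dflag_variety p q r \<and> openin (zariski_frames p q r) (?pre U))"
  proof -
    have int: "?pre (S \<inter> T) = ?pre S \<inter> ?pre T" for S T by auto
    have un: "?pre (\<Union>\<K>) = \<Union>(?pre ` \<K>)" for \<K> by auto
    show ?thesis unfolding istopology_def int un by (auto intro!: openin_Union)
  qed
  then show ?thesis unfolding zariski_def by (simp add: topology_inverse')
qed

definition orbit_closure :: "nat \<Rightarrow> nat \<Rightarrow> nat \<Rightarrow> dflag set \<Rightarrow> dflag set" where
  "orbit_closure p q r Q = zariski p q r closure_of Q"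

definition zdim :: "nat \<Rightarrow> nat \<Rightarrow> nat \<Rightarrow> dflag set \<Rightarrow> enat" where
  "zdim p q r S = krull_dim (subtopology (zariski p q r) S)"

definition orbit_covers :: "nat \<Rightarrow> nat \<Rightarrow> nat \<Rightarrow> dflag set \<Rightarrow> dflag set \<Rightarrow> bool" where
  "orbit_covers p q r Q' Q \<longleftrightarrow> orbit_closure p q r Q \<subset> orbit_closure p q r Q' \<and>
     \<not> (\<exists>R\<in>K_orbits p q r. orbit_closure p q r Q \<subset> orbit_closure p q r R \<and>
                           orbit_closure p q r R \<subset> orbit_closure p q r Q')"

(* Used only for B \<subseteq> Y with Y irreducible (an orbit closure), where the codimension of an
   irreducible closed subset Z of Y is dim Y - dim Z. *)
definition equidim_codim_one :: "nat \<Rightarrow> nat \<Rightarrow> nat \<Rightarrow> dflag set \<Rightarrow> dflag set \<Rightarrow> bool" where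
  "equidim_codim_one p q r B Y \<longleftrightarrow>
     (\<forall>Z\<in>irreducible_components (subtopology (zariski p q r) B). zdim p q r Z + 1 = zdim p q r Y)"


section \<open>Orbit parameters\<close>

definition part_perms :: "nat \<Rightarrow> nat \<Rightarrow> complex mat set" where
  "part_perms p r = {\<tau> \<in> carrier_mat p r.
     (\<forall>i<p. \<forall>k<r. \<tau> $$ (i, k) \<in> {0, 1}) \<and>
     (\<forall>i<p. card {k. k < r \<and> \<tau> $$ (i, k) = 1} \<le> 1) \<and>
     (\<forall>k<r. card {i. i < p \<and> \<tau> $$ (i, k) = 1} \<le> 1)}"

definition T_mats :: "nat \<Rightarrow> nat \<Rightarrow> nat \<Rightarrow> complex mat set" where
  "T_mats p q r = {\<tau>1 @\<^sub>r \<tau>2 | \<tau>1 \<tau>2.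
     \<tau>1 \<in> part_perms p r \<and> \<tau>2 \<in> part_perms q r \<and> mat_rank (p + q) (\<tau>1 @\<^sub>r \<tau>2) = r}"

definition permute_cols :: "(nat \<Rightarrow> nat) \<Rightarrow> complex mat \<Rightarrow> complex mat" where
  "permute_cols \<sigma> A = mat (dim_row A) (dim_col A) (\<lambda>(i, k). A $$ (i, \<sigma> k))"

definition col_perm_rel :: "nat \<Rightarrow> nat \<Rightarrow> nat \<Rightarrow> (complex mat \<times> complex mat) set" where
  "col_perm_rel p q r = {(\<omega>, \<omega>'). \<omega> \<in> T_mats p q r \<and> \<omega>' \<in> T_mats p q r \<and>
     (\<exists>\<sigma>. \<sigma> permutes {..<r} \<and> \<omega>' = permute_cols \<sigma> \<omega>)}"

definition T_bar :: "nat \<Rightarrow> nat \<Rightarrow> nat \<Rightarrow> complex mat set set" where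
  "T_bar p q r = T_mats p q r // col_perm_rel p q r"

(* Well defined, since all representatives have the same columns: see col_space_class_rep. *)
definition col_space_class :: "nat \<Rightarrow> nat \<Rightarrow> complex mat set \<Rightarrow> cspace" where
  "col_space_class p q c = the_elem (col_span (p + q) ` c)"

definition orbit_of :: "nat \<Rightarrow> nat \<Rightarrow> complex mat set \<Rightarrow> dflag set" where
  "orbit_of p q c = K_orbit p q (col_space_class p q c, std_flag_plus p q, std_flag_minus p q)"


section \<open>Graphs and elementary moves\<close>

(* Vertices are numbered from 0: Pos i is the vertex (i+1)^+, in row i, and Neg j the vertex
   (j+1)^-, in row p + j. *)
datatype vertex = Pos nat | Neg nat

record marked_graph =
  verts :: "vertex set"
  edges :: "vertex set set"
  marks :: "vertex set"

definition col_ones :: "complex mat \<Rightarrow> nat \<Rightarrow> nat set" where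
  "col_ones \<omega> k = {i. i < dim_row \<omega> \<and> \<omega> $$ (i, k) = 1}"

definition mat_graph :: "nat \<Rightarrow> nat \<Rightarrow> nat \<Rightarrow> complex mat \<Rightarrow> marked_graph" where
  "mat_graph p q r \<omega> =
     \<lparr>verts = Pos ` {..<p} \<union> Neg ` {..<q},
      edges = {{Pos i, Neg j} | i j. i < p \<and> j < q \<and> (\<exists>k<r. col_ones \<omega> k = {i, p + j})},
      marks = {Pos i | i. i < p \<and> (\<exists>k<r. col_ones \<omega> k = {i})} \<union>
              {Neg j | j. j < q \<and> (\<exists>k<r. col_ones \<omega> k = {p + j})}\<rparr>"

(* Well defined: see graph_class_rep. *)
definition graph_class :: "nat \<Rightarrow> nat \<Rightarrow> nat \<Rightarrow> complex mat set \<Rightarrow> marked_graph" where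
  "graph_class p q r c = the_elem (mat_graph p q r ` c)"

definition free_vertex :: "marked_graph \<Rightarrow> vertex \<Rightarrow> bool" where
  "free_vertex G v \<longleftrightarrow> v \<in> verts G \<and> v \<notin> marks G \<and> (\<forall>e\<in>edges G. v \<notin> e)"

definition replace :: "marked_graph \<Rightarrow> vertex set set \<Rightarrow> vertex set \<Rightarrow> vertex set set \<Rightarrow> vertex set
    \<Rightarrow> marked_graph" where
  "replace G E M E' M' = G\<lparr>edges := (edges G - E) \<union> E', marks := (marks G - M) \<union> M'\<rparr>"

(* The first graph is that of \<omega>', the second that of \<omega>. In a graph \<G>(\<omega>) every vertex
   carries at most one edge or mark, so a vertex that loses its edge or mark becomes free. *)
inductive elementary_move :: "marked_graph \<Rightarrow> marked_graph \<Rightarrow> bool" for G :: marked_graph where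
  case1: "a < b \<Longrightarrow> c < d \<Longrightarrow> {Pos a, Neg d} \<in> edges G \<Longrightarrow> {Pos b, Neg c} \<in> edges G \<Longrightarrow>
    elementary_move G
      (replace G {{Pos a, Neg d}, {Pos b, Neg c}} {} {{Pos a, Neg c}, {Pos b, Neg d}} {})"
| case2_plus: "a < b \<Longrightarrow> {Pos a, Neg c} \<in> edges G \<Longrightarrow> Pos b \<in> marks G \<Longrightarrow>
    elementary_move G (replace G {{Pos a, Neg c}} {Pos b} {{Pos b, Neg c}} {Pos a})"
| case2_minus: "c < d \<Longrightarrow> {Pos a, Neg c} \<in> edges G \<Longrightarrow> Neg d \<in> marks G \<Longrightarrow>
    elementary_move G (replace G {{Pos a, Neg c}} {Neg d} {{Pos a, Neg d}} {Neg c})"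
| case3_plus: "a < b \<Longrightarrow> {Pos b, Neg c} \<in> edges G \<Longrightarrow> free_vertex G (Pos a) \<Longrightarrow>
    elementary_move G (replace G {{Pos b, Neg c}} {} {{Pos a, Neg c}} {})"
| case3_minus: "c < d \<Longrightarrow> {Pos a, Neg d} \<in> edges G \<Longrightarrow> free_vertex G (Neg c) \<Longrightarrow>
    elementary_move G (replace G {{Pos a, Neg d}} {} {{Pos a, Neg c}} {})"
| case4_plus: "{Pos a, Neg c} \<in> edges G \<Longrightarrow>
    elementary_move G (replace G {{Pos a, Neg c}} {} {} {Pos a})"
| case4_minus: "{Pos a, Neg c} \<in> edges G \<Longrightarrow>
    elementary_move G (replace G {{Pos a, Neg c}} {} {} {Neg c})"
| case5_plus: "a < b \<Longrightarrow> Pos b \<in> marks G \<Longrightarrow> free_vertex G (Pos a) \<Longrightarrow>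
    elementary_move G (replace G {} {Pos b} {} {Pos a})"
| case5_minus: "c < d \<Longrightarrow> Neg d \<in> marks G \<Longrightarrow> free_vertex G (Neg c) \<Longrightarrow>
    elementary_move G (replace G {} {Neg d} {} {Neg c})"


section \<open>Independence of the chosen representative\<close>

lemma T_mats_carrier:
  assumes "\<omega> \<in> T_mats p q r" shows "\<omega> \<in> carrier_mat (p + q) r"
  using assms unfolding T_mats_def part_perms_def by auto

lemma permute_cols_set_cols:
  assumes A: "A \<in> carrier_mat n r" and s: "\<sigma> permutes {..<r}"
  shows "set (cols (permute_cols \<sigma> A)) = set (cols A)"
proof -
  have c: "col (permute_cols \<sigma> A) k = col A (\<sigma> k)" if "k < r" for k
  proof -
    have "\<sigma> k < r" using permutes_in_image[OF s, of k] that by simp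
    then show ?thesis using A that by (intro eq_vecI) (auto simp: permute_cols_def)
  qed
  have d: "dim_col (permute_cols \<sigma> A) = r" "dim_col A = r"
    using A by (auto simp: permute_cols_def)
  have "set (cols (permute_cols \<sigma> A)) = (\<lambda>k. col A (\<sigma> k)) ` {..<r}"
    using c d by (auto simp: cols_def)
  also have "\<dots> = col A ` (\<sigma> ` {..<r})" by (simp add: image_image)
  also have "\<dots> = set (cols A)" using d permutes_image[OF s] by (auto simp: cols_def)
  finally show ?thesis .
qed

lemma mat_graph_permute_cols:
  assumes A: "A \<in> carrier_mat n r" and s: "\<sigma> permutes {..<r}"
  shows "mat_graph p q r (permute_cols \<sigma> A) = mat_graph p q r A"
proof -
  have c: "col_ones (permute_cols \<sigma> A) k = col_ones A (\<sigma> k)" if "k < r" for k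
    using A that by (auto simp: col_ones_def permute_cols_def)
  have "(\<exists>k<r. col_ones (permute_cols \<sigma> A) k = S) \<longleftrightarrow> (\<exists>k<r. col_ones A k = S)" for S
  proof -
    have "(\<exists>k<r. col_ones (permute_cols \<sigma> A) k = S) \<longleftrightarrow> (\<exists>k\<in>{..<r}. col_ones A (\<sigma> k) = S)"
      using c by auto
    also have "\<dots> \<longleftrightarrow> (\<exists>k\<in>\<sigma> ` {..<r}. col_ones A k = S)" by blast
    also have "\<dots> \<longleftrightarrow> (\<exists>k<r. col_ones A k = S)" using permutes_image[OF s] by auto
    finally show ?thesis .
  qed
  then show ?thesis by (simp add: mat_graph_def)
qed

lemma equiv_col_perm_rel: "equiv (T_mats p q r) (col_perm_rel p q r)"
proof (rule equivI)
  show "col_perm_rel p q r \<subseteq> T_mats p q r \<times> T_mats p q r"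
    by (auto simp: col_perm_rel_def)
  show "refl_on (T_mats p q r) (col_perm_rel p q r)"
  proof (rule refl_onI)
    fix \<omega> assume w: "\<omega> \<in> T_mats p q r"
    have "\<omega> = permute_cols id \<omega>" by (auto simp: permute_cols_def)
    then show "(\<omega>, \<omega>) \<in> col_perm_rel p q r"
      using w permutes_id[of "{..<r}"] unfolding col_perm_rel_def by blast
  qed
  have pc: "permute_cols \<rho> (permute_cols \<sigma> \<omega>) = permute_cols (\<sigma> \<circ> \<rho>) \<omega>"
    if w: "\<omega> \<in> T_mats p q r" and r: "\<rho> permutes {..<r}" for \<omega> \<sigma> \<rho>
  proof -
    have "\<rho> k < r" if "k < r" for k using permutes_in_image[OF r, of k] that by simp
    then show ?thesis using T_mats_carrier[OF w] by (intro eq_matI) (auto simp: permute_cols_def)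
  qed
  show "sym (col_perm_rel p q r)"
  proof (rule symI)
    fix \<omega> \<omega>' assume "(\<omega>, \<omega>') \<in> col_perm_rel p q r"
    then obtain \<sigma> where w: "\<omega> \<in> T_mats p q r" "\<omega>' \<in> T_mats p q r"
      and s: "\<sigma> permutes {..<r}" and e: "\<omega>' = permute_cols \<sigma> \<omega>"
      by (auto simp: col_perm_rel_def)
    have i: "inv_into UNIV \<sigma> permutes {..<r}" using permutes_inv[OF s] .
    have "permute_cols (inv_into UNIV \<sigma>) \<omega>' = permute_cols id \<omega>"
      unfolding e pc[OF w(1) i] permutes_inv_o(1)[OF s] ..
    also have "\<dots> = \<omega>" by (auto simp: permute_cols_def)
    finally have "\<omega> = permute_cols (inv_into UNIV \<sigma>) \<omega>'" by simp
    then show "(\<omega>', \<omega>) \<in> col_perm_rel p q r"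
      using w i unfolding col_perm_rel_def by blast
  qed
  show "trans (col_perm_rel p q r)"
  proof (rule transI)
    fix x y z assume "(x, y) \<in> col_perm_rel p q r" "(y, z) \<in> col_perm_rel p q r"
    then obtain \<sigma> \<rho> where w: "x \<in> T_mats p q r" "z \<in> T_mats p q r"
      and s: "\<sigma> permutes {..<r}" and r: "\<rho> permutes {..<r}"
      and e: "z = permute_cols \<rho> (permute_cols \<sigma> x)"
      by (auto simp: col_perm_rel_def)
    have "z = permute_cols (\<sigma> \<circ> \<rho>) x" unfolding e by (rule pc[OF w(1) r])
    then show "(x, z) \<in> col_perm_rel p q r"
      using w permutes_compose[OF r s] unfolding col_perm_rel_def by blast
  qed
qed

lemma T_bar_related:
  assumes "c \<in> T_bar p q r" "\<omega> \<in> c" "\<omega>' \<in> c"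
  obtains \<sigma> where "\<omega> \<in> T_mats p q r" "\<sigma> permutes {..<r}" "\<omega>' = permute_cols \<sigma> \<omega>"
proof -
  have "(\<omega>, \<omega>') \<in> col_perm_rel p q r"
    using quotient_eq_iff[OF equiv_col_perm_rel] assms unfolding T_bar_def by metis
  then show ?thesis using that by (auto simp: col_perm_rel_def)
qed

lemma col_space_class_rep:
  assumes "c \<in> T_bar p q r" "\<omega> \<in> c"
  shows "col_space_class p q c = col_span (p + q) \<omega>"
proof -
  have "col_span (p + q) \<omega>' = col_span (p + q) \<omega>" if w: "\<omega>' \<in> c" for \<omega>'
  proof -
    obtain \<sigma> where "\<omega> \<in> T_mats p q r" "\<sigma> permutes {..<r}" "\<omega>' = permute_cols \<sigma> \<omega>"
      using T_bar_related[OF assms w] .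
    then have "set (cols \<omega>') = set (cols \<omega>)"
      using permute_cols_set_cols T_mats_carrier by blast
    then show ?thesis by (simp add: vec_space.col_space_def)
  qed
  then have "col_span (p + q) ` c = {col_span (p + q) \<omega>}" using assms(2) by blast
  then show ?thesis by (simp add: col_space_class_def)
qed

lemma graph_class_rep:
  assumes "c \<in> T_bar p q r" "\<omega> \<in> c"
  shows "graph_class p q r c = mat_graph p q r \<omega>"
proof -
  have "mat_graph p q r \<omega>' = mat_graph p q r \<omega>" if w: "\<omega>' \<in> c" for \<omega>'
  proof -
    obtain \<sigma> where "\<omega> \<in> T_mats p q r" "\<sigma> permutes {..<r}" "\<omega>' = permute_cols \<sigma> \<omega>"
      using T_bar_related[OF assms w] .
    then show ?thesis using mat_graph_permute_cols T_mats_carrier by blast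
  qed
  then have "mat_graph p q r ` c = {mat_graph p q r \<omega>}" using assms(2) by blast
  then show ?thesis by (simp add: graph_class_def)
qed

end

theory Submission
  imports Defs "HOL-Library.Function_Algebras"
begin

text \<open>
  A graph is turned into a set of points of a grid in such a way that every elementary move becomes
  the same operation: two points \<open>(a, d), (b, c)\<close> with \<open>a < b\<close>, \<open>c < d\<close> are replaced by
  \<open>(a, c), (b, d)\<close>. Let \<open>R(i, j)\<close> be the number of points in \<open>[0, i] \<times> [0, j]\<close>, which is the dimension
  of the intersection of the subspace with the sum of the \<open>i\<close>-th and the \<open>j\<close>-th flag member, and let
  \<open>S\<close> be the number of pairs of points that are strictly increasing in both coordinates.

  The closure order is the reverse pointwise order of the functions \<open>R\<close>: a lower bound on \<open>R\<close> is a
  rank condition and thus closed; conversely, if \<open>R\<^sub>\<omega> \<ge> R\<^sub>\<omega>'\<close> and \<open>\<omega> \<noteq> \<omega>'\<close>, then some swap applied to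
  \<open>\<omega>'\<close> keeps \<open>R\<close> below \<open>R\<^sub>\<omega>\<close> and increases \<open>S\<close> by exactly one, and every swap is a degeneration along
  an affine line of matrices.

  The dimension of an orbit is a constant minus \<open>S\<close>. An explicit chain of irreducible closed subsets of
  the orbit gives the lower bound. For the upper bound, a chain in the closure of an orbit extends by
  \<open>S\<close> inverse swaps, and then, after taking preimages, by a chain in a fibre of the frame map; the
  resulting chain of sets of frames has at most as many steps as there are matrix coordinates, because
  functions \<open>f\<^sub>i\<close> that vanish on the \<open>i\<close>-th member but not on the next one are algebraically independent.
  Thus the covers are exactly the swaps that change \<open>S\<close> by one, and every component of a boundary is the
  closure of an orbit obtained in this way.
\<close>

section \<open>Irreducible sets and chains\<close>

text \<open>The upper bound stacks three chains. Write \<open>u\<close> and \<open>l\<close> for the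
  numbers of weakly upper and strictly lower positions in the diagonal blocks. A chain of length
  \<open>m\<close> in an orbit closure gains \<open>S\<close> steps from swaps and
  \<open>r^2 + u\<close> steps from a fibre, and the number of coordinates is
  \<open>(p + q) r + u + l\<close>. The explicit chain has length
  \<open>r (p + q - r) - S + l\<close>, which is exactly what remains; this is why the off-block
  entries of \<open>k\<close> must not be counted and why a swap has to change \<open>S\<close> by
  one only.

  Irreducibility always comes from one source: a set of frames that contains almost all points of
  the line through any two of its members is irreducible. The members of the explicit chains are
  therefore described by equations affine in the matrix entries, up to an open condition. Being
  closed in the orbit is a separate matter, since such equations refer to chosen representatives and
  are not preserved when the frame of a point changes. It needs a second description, by zero
  entries or vanishing minors that every frame of the point satisfies, and the equality of the two
  descriptions is the main work in the dimension part.\<close>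

definition irreducible_in :: "'a topology \<Rightarrow> 'a set \<Rightarrow> bool" where
  "irreducible_in T Z \<longleftrightarrow> Z \<subseteq> topspace T \<and> Z \<noteq> {} \<and>
     (\<forall>U V. openin T U \<and> openin T V \<and> U \<inter> Z \<noteq> {} \<and> V \<inter> Z \<noteq> {} \<longrightarrow> U \<inter> V \<inter> Z \<noteq> {})"

lemma irreducible_top_subtopology:
  assumes "Z \<subseteq> topspace T"
  shows "irreducible_top (subtopology T Z) \<longleftrightarrow> irreducible_in T Z"
proof
  have ts: "topspace (subtopology T Z) = Z" using assms by auto
  {
    assume irr: "irreducible_top (subtopology T Z)"
    have "U \<inter> V \<inter> Z \<noteq> {}"
      if "openin T U" "openin T V" "U \<inter> Z \<noteq> {}" "V \<inter> Z \<noteq> {}" for U V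
    proof
      assume e: "U \<inter> V \<inter> Z = {}"
      have "closedin (subtopology T Z) (Z - U \<inter> Z)" "closedin (subtopology T Z) (Z - V \<inter> Z)"
        using that ts by (auto simp: closedin_def openin_subtopology)
      moreover have "(Z - U \<inter> Z) \<union> (Z - V \<inter> Z) = Z" using e by auto
      ultimately have "Z - U \<inter> Z = Z \<or> Z - V \<inter> Z = Z"
        using irr ts unfolding irreducible_top_def by metis
      then show False using that by auto
    qed
    then show "irreducible_in T Z"
      using irr assms ts unfolding irreducible_in_def irreducible_top_def by auto
  next
    assume irr: "irreducible_in T Z"
    have "C = Z \<or> D = Z"
      if CD: "closedin (subtopology T Z) C" "closedin (subtopology T Z) D" "C \<union> D = Z" for C D
    proof (rule ccontr)
      assume n: "\<not> (C = Z \<or> D = Z)"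
      have "openin (subtopology T Z) (Z - C)" "openin (subtopology T Z) (Z - D)"
        using CD ts by (auto simp: closedin_def)
      then obtain U V where U: "openin T U" "Z - C = U \<inter> Z" and V: "openin T V" "Z - D = V \<inter> Z"
        by (auto simp: openin_subtopology)
      have "U \<inter> Z \<noteq> {}" "V \<inter> Z \<noteq> {}" using n U V CD by auto
      then have "U \<inter> V \<inter> Z \<noteq> {}" using irr U V unfolding irreducible_in_def by auto
      then show False using U V CD by auto
    qed
    then show "irreducible_top (subtopology T Z)"
      using irr ts unfolding irreducible_in_def irreducible_top_def by auto
  }
qed

lemma irreducible_in_image:
  assumes "irreducible_in T Z" "continuous_map T T' f"
  shows "irreducible_in T' (f ` Z)"
  unfolding irreducible_in_def
proof (intro conjI allI impI)
  show "f ` Z \<subseteq> topspace T'" "f ` Z \<noteq> {}"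
    using assms unfolding irreducible_in_def continuous_map_def by auto
  fix U V assume UV: "openin T' U \<and> openin T' V \<and> U \<inter> f ` Z \<noteq> {} \<and> V \<inter> f ` Z \<noteq> {}"
  let ?p = "\<lambda>U. {x \<in> topspace T. f x \<in> U}"
  have "openin T (?p U)" "openin T (?p V)"
    using UV assms(2) by (auto simp: openin_continuous_map_preimage)
  moreover have "?p U \<inter> Z \<noteq> {}" "?p V \<inter> Z \<noteq> {}"
    using UV assms(1) unfolding irreducible_in_def by auto
  ultimately have "?p U \<inter> ?p V \<inter> Z \<noteq> {}" using assms(1) unfolding irreducible_in_def by blast
  then show "U \<inter> V \<inter> f ` Z \<noteq> {}" by auto
qed

lemma irreducible_in_closure:
  assumes "irreducible_in T Z"
  shows "irreducible_in T (T closure_of Z)"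
  unfolding irreducible_in_def
proof (intro conjI allI impI)
  show "T closure_of Z \<subseteq> topspace T" by (rule closure_of_subset_topspace)
  have "Z \<subseteq> T closure_of Z" "Z \<noteq> {}"
    using assms closure_of_subset unfolding irreducible_in_def by auto
  then show "T closure_of Z \<noteq> {}" by auto
  fix U V assume UV: "openin T U \<and> openin T V \<and> U \<inter> T closure_of Z \<noteq> {} \<and> V \<inter> T closure_of Z \<noteq> {}"
  then have "U \<inter> Z \<noteq> {}" "V \<inter> Z \<noteq> {}" using openin_Int_closure_of_eq_empty by metis+
  then have "U \<inter> V \<inter> Z \<noteq> {}" using UV assms unfolding irreducible_in_def by auto
  then show "U \<inter> V \<inter> T closure_of Z \<noteq> {}" using \<open>Z \<subseteq> T closure_of Z\<close> by blast
qed

text \<open>The union of the remaining sets is closed, so an irreducible set that is not inside the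
  new one lies in that union. Later this puts a component of a boundary into a single orbit
  closure.\<close>

lemma irreducible_in_closed_cover:
  assumes "irreducible_in T Z" "finite \<C>" "\<And>C. C \<in> \<C> \<Longrightarrow> closedin T C" "Z \<subseteq> \<Union>\<C>"
  shows "\<exists>C\<in>\<C>. Z \<subseteq> C"
  using assms(2,3,4)
proof (induction rule: finite_induct)
  case empty
  then show ?case using assms(1) unfolding irreducible_in_def by auto
next
  case (insert C \<C>)
  show ?case
  proof (rule ccontr)
    assume n: "\<not> (\<exists>D\<in>insert C \<C>. Z \<subseteq> D)"
    then have nZ: "\<not> Z \<subseteq> \<Union>\<C>" using insert by auto
    have cl: "closedin T (\<Union>\<C>)" using insert by (intro closedin_Union) auto
    have "openin T (topspace T - C)" "openin T (topspace T - \<Union>\<C>)"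
      using cl insert.prems by (auto simp: closedin_def)
    moreover have "(topspace T - C) \<inter> Z \<noteq> {}" "(topspace T - \<Union>\<C>) \<inter> Z \<noteq> {}"
      using n nZ assms(1) unfolding irreducible_in_def by auto
    ultimately have "(topspace T - C) \<inter> (topspace T - \<Union>\<C>) \<inter> Z \<noteq> {}"
      using assms(1) unfolding irreducible_in_def by blast
    then show False using insert.prems by auto
  qed
qed

text \<open>Open sets meeting the preimage have open images meeting \<open>Z\<close>. These share a
  point of \<open>Z\<close>, and over that point both open sets meet the same irreducible fibre,
  where they intersect.\<close>

lemma irreducible_in_open_preimage:
  assumes f: "continuous_map T T' f" "open_map T T' f"
    and Z: "irreducible_in T' Z"
    and fib: "\<And>y. y \<in> Z \<Longrightarrow> irreducible_in T {x \<in> topspace T. f x = y}"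
  shows "irreducible_in T {x \<in> topspace T. f x \<in> Z}"
  unfolding irreducible_in_def
proof (intro conjI allI impI)
  let ?P = "{x \<in> topspace T. f x \<in> Z}"
  show "?P \<subseteq> topspace T" by auto
  obtain y where "y \<in> Z" using Z unfolding irreducible_in_def by auto
  then show "?P \<noteq> {}" using fib[of y] unfolding irreducible_in_def by auto
  fix U V assume UV: "openin T U \<and> openin T V \<and> U \<inter> ?P \<noteq> {} \<and> V \<inter> ?P \<noteq> {}"
  then have "openin T' (f ` U)" "openin T' (f ` V)" using f(2) unfolding open_map_def by auto
  moreover have "f ` U \<inter> Z \<noteq> {}" "f ` V \<inter> Z \<noteq> {}" using UV by auto
  ultimately have "f ` U \<inter> f ` V \<inter> Z \<noteq> {}" using Z unfolding irreducible_in_def by blast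
  then obtain y where "y \<in> Z" "y \<in> f ` U" "y \<in> f ` V" by auto
  then obtain u v where y: "y \<in> Z" "u \<in> U" "f u = y" "v \<in> V" "f v = y" by auto
  let ?F = "{x \<in> topspace T. f x = y}"
  have "U \<inter> ?F \<noteq> {}" "V \<inter> ?F \<noteq> {}" using y UV openin_subset by fastforce+
  then have "U \<inter> V \<inter> ?F \<noteq> {}" using fib[OF y(1)] UV unfolding irreducible_in_def by blast
  then show "U \<inter> V \<inter> ?P \<noteq> {}" using y by auto
qed

section \<open>Chains of irreducible closed sets and Krull dimension\<close>

definition chain_in :: "'a topology \<Rightarrow> 'a set \<Rightarrow> nat \<Rightarrow> bool" where
  "chain_in T S n \<longleftrightarrow> (\<exists>Z. (\<forall>i\<le>n. closedin (subtopology T S) (Z i) \<and> irreducible_in T (Z i)) \<and>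
     (\<forall>i<n. Z i \<subset> Z (Suc i)))"

lemma krull_dim_eqI:
  assumes "S \<subseteq> topspace T" "chain_in T S d" "\<And>n. chain_in T S n \<Longrightarrow> n \<le> d"
  shows "krull_dim (subtopology T S) = enat d"
proof -
  have "closedin (subtopology T S) Z \<and> irreducible_top (subtopology (subtopology T S) Z) \<longleftrightarrow>
      closedin (subtopology T S) Z \<and> irreducible_in T Z" for Z
  proof -
    have "Z \<subseteq> S" if "closedin (subtopology T S) Z" using closedin_subset[OF that] by auto
    then show ?thesis
      using assms(1) irreducible_top_subtopology[of Z T]
      by (auto simp: subtopology_subtopology Int_absorb1)
  qed
  then have "krull_dim (subtopology T S) = Sup {enat n | n. chain_in T S n}"
    unfolding krull_dim_def chain_in_def by simp
  also have "\<dots> = enat d"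
    using assms(2,3) by (intro antisym Sup_least Sup_upper) auto
  finally show ?thesis .
qed

text \<open>Each member is replaced by its closure, cut down to \<open>S'\<close>. The member is
  dense there, which keeps irreducibility, and its trace on \<open>S\<close> is the old member,
  which keeps the inclusions strict.\<close>

lemma chain_in_mono:
  assumes "S \<subseteq> S'" "S' \<subseteq> topspace T" "chain_in T S n"
  shows "chain_in T S' n"
proof -
  obtain Z where Z: "\<And>i. i \<le> n \<Longrightarrow> closedin (subtopology T S) (Z i)"
      "\<And>i. i \<le> n \<Longrightarrow> irreducible_in T (Z i)" "\<And>i. i < n \<Longrightarrow> Z i \<subset> Z (Suc i)"
    using assms(3) unfolding chain_in_def by blast
  let ?Y = "\<lambda>i. S' \<inter> T closure_of (Z i)"
  have tr: "S \<inter> T closure_of (Z i) = Z i" if "i \<le> n" for i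
  proof -
    have "Z i \<subseteq> S" using closedin_subset[OF Z(1)[OF that]] by simp
    then have "S \<inter> Z i = Z i" by auto
    moreover have "subtopology T S closure_of Z i = Z i" using Z(1)[OF that] by (simp add: closure_of_eq)
    ultimately show ?thesis by (simp add: closure_of_subtopology)
  qed
  have sub: "Z i \<subseteq> S" if "i \<le> n" for i using tr[OF that] by blast
  have irr: "irreducible_in T (?Y i)" if i: "i \<le> n" for i
    unfolding irreducible_in_def
  proof (intro conjI allI impI)
    show "?Y i \<subseteq> topspace T" using assms(2) by auto
    have ZY: "Z i \<subseteq> ?Y i" using tr[OF i] assms(1) by auto
    then show "?Y i \<noteq> {}" using Z(2)[OF i] unfolding irreducible_in_def by auto
    fix U V assume UV: "openin T U \<and> openin T V \<and> U \<inter> ?Y i \<noteq> {} \<and> V \<inter> ?Y i \<noteq> {}"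
    then have "U \<inter> T closure_of Z i \<noteq> {}" "V \<inter> T closure_of Z i \<noteq> {}" by auto
    then have "U \<inter> Z i \<noteq> {}" "V \<inter> Z i \<noteq> {}" using UV openin_Int_closure_of_eq_empty by metis+
    then have "U \<inter> V \<inter> Z i \<noteq> {}" using UV Z(2)[OF i] unfolding irreducible_in_def by auto
    then show "U \<inter> V \<inter> ?Y i \<noteq> {}" using ZY by blast
  qed
  have "?Y i \<subset> ?Y (Suc i)" if i: "i < n" for i
  proof -
    have "?Y i \<subseteq> ?Y (Suc i)" using Z(3)[OF i] closure_of_mono by blast
    moreover have "?Y i \<noteq> ?Y (Suc i)"
    proof
      assume "?Y i = ?Y (Suc i)"
      then have "S \<inter> T closure_of Z i = S \<inter> T closure_of Z (Suc i)" using assms(1) by auto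
      then show False using tr[of i] tr[of "Suc i"] Z(3)[OF i] i by auto
    qed
    ultimately show ?thesis by auto
  qed
  moreover have "closedin (subtopology T S') (?Y i)" for i
    by (metis closedin_closure_of closedin_subtopology inf_commute)
  ultimately show ?thesis unfolding chain_in_def using irr
    by (intro exI[of _ ?Y] conjI allI impI) blast+
qed

lemma chain_in_extend:
  assumes "closedin T Z" "closedin T Y" "Z \<subset> Y" "irreducible_in T Y" "chain_in T Z n"
  shows "chain_in T Y (Suc n)"
proof -
  obtain W where W: "\<And>i. i \<le> n \<Longrightarrow> closedin (subtopology T Z) (W i)"
      "\<And>i. i \<le> n \<Longrightarrow> irreducible_in T (W i)" "\<And>i. i < n \<Longrightarrow> W i \<subset> W (Suc i)"
    using assms(5) unfolding chain_in_def by blast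
  have c: "W i \<subseteq> Z \<and> closedin (subtopology T Y) (W i)" if "i \<le> n" for i
    using W(1)[OF that] assms(1,2,3) closedin_closed_subtopology[of T] by blast
  let ?W = "\<lambda>i. if i \<le> n then W i else Y"
  have "closedin (subtopology T Y) (?W i) \<and> irreducible_in T (?W i)" if "i \<le> Suc n" for i
    using c W(2) assms(2,4) by (auto simp: closedin_closed_subtopology)
  moreover have "?W i \<subset> ?W (Suc i)" if "i < Suc n" for i
    using W(3) c[of n] assms(3) that by (cases "i = n") auto
  ultimately show ?thesis unfolding chain_in_def
    by (intro exI[of _ ?W] conjI allI impI) blast+
qed

text \<open>The explicit chains below have this form: \<open>F S\<close> lets only the coordinates
  in \<open>S\<close> vary, and coordinates are removed one at a time. The predicate
  \<open>good\<close> restricts the order of removal, for families in which \<open>F S\<close> is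
  known to be closed only for suitable \<open>S\<close>.\<close>

lemma chain_of_good_subsets:
  assumes "finite I" "good I" "\<And>S. S \<subseteq> I \<Longrightarrow> good S \<Longrightarrow> P (F S)"
    "\<And>S. S \<subseteq> I \<Longrightarrow> good S \<Longrightarrow> S \<noteq> {} \<Longrightarrow> \<exists>x\<in>S. good (S - {x}) \<and> F (S - {x}) \<subset> F S"
  shows "\<exists>Z. (\<forall>i\<le>card I. P (Z i)) \<and> (\<forall>i<card I. Z i \<subset> Z (Suc i)) \<and> Z (card I) = F I \<and> Z 0 = F {}"
  using assms
proof (induction "card I" arbitrary: I)
  case 0
  then show ?case by (intro exI[of _ "\<lambda>_. F I"]) auto
next
  case (Suc k)
  have "I \<noteq> {}" using Suc(2) by auto
  with Suc.prems(4)[OF subset_refl Suc.prems(2)]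
  obtain x where x: "x \<in> I" "good (I - {x})" "F (I - {x}) \<subset> F I" by auto
  have k: "k = card (I - {x})" using Suc(2,3) x(1) by simp
  have "\<exists>Z. (\<forall>i\<le>card (I - {x}). P (Z i)) \<and> (\<forall>i<card (I - {x}). Z i \<subset> Z (Suc i)) \<and>
      Z (card (I - {x})) = F (I - {x}) \<and> Z 0 = F {}"
    using k Suc.prems x(2) by (intro Suc(1)) auto
  then obtain Z where Z: "\<forall>i\<le>k. P (Z i)" "\<forall>i<k. Z i \<subset> Z (Suc i)" "Z k = F (I - {x})" "Z 0 = F {}"
    using k by auto
  let ?Z = "\<lambda>i. if i \<le> k then Z i else F I"
  have "P (F I)" using Suc.prems by auto
  then have "\<forall>i\<le>Suc k. P (?Z i)" using Z by auto
  moreover have "?Z i \<subset> ?Z (Suc i)" if "i < Suc k" for i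
    using Z x(3) that by (cases "i = k") auto
  ultimately show ?case using Suc(2)[symmetric] Z(4) by (intro exI[of _ ?Z]) auto
qed

lemma chain_concat:
  assumes "\<forall>i\<le>m. P (Z i)" "\<forall>i<m. Z i \<subset> Z (Suc i)" "Z m = Y 0" "\<forall>i\<le>n. P (Y i)" "\<forall>i<n. Y i \<subset> Y (Suc i)"
  shows "\<exists>W. (\<forall>i\<le>m + n. P (W i)) \<and> (\<forall>i<m + n. W i \<subset> W (Suc i))"
proof -
  let ?W = "\<lambda>i. if i < m then Z i else Y (i - m)"
  have "P (?W i)" if "i \<le> m + n" for i using assms(1,4) that by auto
  moreover have "?W i \<subset> ?W (Suc i)" if i: "i < m + n" for i
  proof (cases "i < m")
    case True
    then have "Z i \<subset> Z (Suc i)" using assms(2) by blast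
    then show ?thesis using True assms(3) by (cases "Suc i = m") auto
  next
    case False
    then have "Y (i - m) \<subset> Y (Suc (i - m))" using assms(5) i by auto
    then show ?thesis using False by (simp add: Suc_diff_le)
  qed
  ultimately show ?thesis by (intro exI[of _ ?W]) blast
qed

text \<open>One half of the additivity of dimension along a fibration: preimages of the members are
  irreducible because the fibres are, and a chain inside the fibre over a point of the smallest
  member fits underneath.\<close>

lemma chain_in_lift:
  assumes f: "continuous_map T T' f" "open_map T T' f" "f ` topspace T = topspace T'"
    and fib: "\<And>y. y \<in> topspace T' \<Longrightarrow> irreducible_in T {x \<in> topspace T. f x = y}"
    and ch: "\<And>y. y \<in> topspace T' \<Longrightarrow> \<exists>W. (\<forall>i\<le>k. closedin T (W i) \<and> irreducible_in T (W i)) \<and>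
      (\<forall>i<k. W i \<subset> W (Suc i)) \<and> W k = {x \<in> topspace T. f x = y}"
    and n: "chain_in T' (topspace T') n"
  shows "chain_in T (topspace T) (k + n)"
proof -
  obtain Z where Z: "\<And>i. i \<le> n \<Longrightarrow> closedin T' (Z i)"
      "\<And>i. i \<le> n \<Longrightarrow> irreducible_in T' (Z i)" "\<And>i. i < n \<Longrightarrow> Z i \<subset> Z (Suc i)"
    using n unfolding chain_in_def by auto
  obtain y where y: "y \<in> Z 0" using Z(2)[of 0] unfolding irreducible_in_def by auto
  then have yT: "y \<in> topspace T'" using Z(1)[of 0] closedin_subset by auto
  obtain W where W: "\<forall>i\<le>k. closedin T (W i) \<and> irreducible_in T (W i)"
      "\<forall>i<k. W i \<subset> W (Suc i)" "W k = {x \<in> topspace T. f x = y}"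
    using ch[OF yT] by (elim exE conjE)
  let ?P = "\<lambda>i. {x \<in> topspace T. f x \<in> Z i}"
  \<comment> \<open>The whole fibre \<open>W k\<close> is left out, because it coincides with the
    preimage of \<open>Z 0\<close> if \<open>Z 0\<close> is a single point. Index \<open>k\<close>
    already belongs to the preimages.\<close>
  let ?Z = "\<lambda>i. if i < k then W i else ?P (i - k)"
  have "closedin T (?P i) \<and> irreducible_in T (?P i)" if "i \<le> n" for i
    using irreducible_in_open_preimage[OF f(1,2) Z(2)[OF that] fib] Z(1)[OF that]
      closedin_continuous_map_preimage[OF f(1)] closedin_subset by blast
  then have 1: "closedin T (?Z i) \<and> irreducible_in T (?Z i)" if "i \<le> k + n" for i
    using W(1) that by auto
  have 2: "?P i \<subset> ?P (Suc i)" if i: "i < n" for i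
  proof -
    obtain z where z: "z \<in> Z (Suc i)" "z \<notin> Z i" using Z(3)[OF i] by auto
    then have "z \<in> f ` topspace T" using Z(1)[of "Suc i"] i f(3) closedin_subset by fastforce
    then show ?thesis using z Z(3)[OF i] by auto
  qed
  have 3: "?Z i \<subset> ?Z (Suc i)" if "i < k + n" for i
  proof (cases "i < k")
    case True
    then have "W i \<subset> W (Suc i)" using W(2) by auto
    moreover have "W k \<subseteq> ?P 0" using W(3) y by auto
    ultimately show ?thesis using True by (cases "Suc i = k") auto
  next
    case False
    then show ?thesis using 2[of "i - k"] that by (auto simp: Suc_diff_le)
  qed
  show ?thesis unfolding chain_in_def using 1 3 by (intro exI[of _ ?Z]) auto
qed

section \<open>The dimension bound from algebraic independence\<close>

text \<open>The head of the list is the exponent of the function with the highest index, so that an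
  induction on the list peels off the last function of a chain.\<close>

primrec monom_fun :: "(nat \<Rightarrow> 'a \<Rightarrow> complex) \<Rightarrow> nat list \<Rightarrow> 'a \<Rightarrow> complex" where
  "monom_fun f [] = (\<lambda>x. 1)"
| "monom_fun f (e # es) = (\<lambda>x. f (length es) x ^ e * monom_fun f es x)"

text \<open>Exponents are bounded one by one rather than by total degree, which makes the number of
  monomials a plain power.\<close>

abbreviation exps :: "nat \<Rightarrow> nat \<Rightarrow> nat list set" where
  "exps m t \<equiv> {es. set es \<subseteq> {..t} \<and> length es = m}"

lemma finite_exps: "finite (exps m t)" by (rule finite_lists_length_eq) simp

lemma card_exps: "card (exps m t) = (t + 1) ^ m"
  by (subst card_lists_length_eq) auto

lemma exps_Suc: "exps (Suc m) t = (\<lambda>(e, es). e # es) ` ({..t} \<times> exps m t)"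
  by (auto simp: image_iff length_Suc_conv)

lemma sum_exps_Suc: "(\<Sum>\<alpha>\<in>exps (Suc m) t. F \<alpha>) = (\<Sum>e\<le>t. \<Sum>\<beta>\<in>exps m t. F (e # \<beta>))"
proof -
  have inj: "inj_on (\<lambda>(e, es). e # es) ({..t} \<times> exps m t)" by (auto simp: inj_on_def)
  have "(\<Sum>\<alpha>\<in>exps (Suc m) t. F \<alpha>) = (\<Sum>x\<in>{..t} \<times> exps m t. F (case x of (e, es) \<Rightarrow> e # es))"
    unfolding exps_Suc by (subst sum.reindex[OF inj]) simp
  also have "\<dots> = (\<Sum>e\<le>t. \<Sum>\<beta>\<in>exps m t. F (e # \<beta>))"
    by (simp add: sum.cartesian_product split_def)
  finally show ?thesis .
qed

locale function_ring =
  fixes R :: "('a \<Rightarrow> complex) set"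
  assumes const: "\<And>c. (\<lambda>x. c) \<in> R"
    and add: "\<And>f g. f \<in> R \<Longrightarrow> g \<in> R \<Longrightarrow> (\<lambda>x. f x + g x) \<in> R"
    and mult: "\<And>f g. f \<in> R \<Longrightarrow> g \<in> R \<Longrightarrow> (\<lambda>x. f x * g x) \<in> R"
begin

lemma power: "f \<in> R \<Longrightarrow> (\<lambda>x. f x ^ k) \<in> R"
  by (induction k) (auto intro: const mult)

lemma sum: "(\<And>i. i \<in> I \<Longrightarrow> f i \<in> R) \<Longrightarrow> (\<lambda>x. \<Sum>i\<in>I. f i x) \<in> R"
  by (induction I rule: infinite_finite_induct) (auto intro: const add)

lemma prod: "(\<And>i. i \<in> I \<Longrightarrow> f i \<in> R) \<Longrightarrow> (\<lambda>x. \<Prod>i\<in>I. f i x) \<in> R"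
  by (induction I rule: infinite_finite_induct) (auto intro: const mult)

lemma monom_fun: "(\<And>i. i < length es \<Longrightarrow> f i \<in> R) \<Longrightarrow> monom_fun f es \<in> R"
proof (induction es)
  case (Cons e es)
  have "(\<lambda>x. f (length es) x ^ e) \<in> R" by (rule power, rule Cons.prems) simp
  moreover have "monom_fun f es \<in> R" by (rule Cons.IH, rule Cons.prems) simp
  ultimately show ?case by (auto dest: mult)
qed (simp add: const)

(* If f m divides a relation on Z (Suc m), it can be cancelled there by primeness, and the
   remaining relation restricts to Z m, where f m vanishes. *)
lemma independent_along_chain:
  assumes f: "\<And>i. i < m \<Longrightarrow> f i \<in> R"
    and prime: "\<And>i g h. i \<le> m \<Longrightarrow> g \<in> R \<Longrightarrow> h \<in> R \<Longrightarrow> (\<forall>x\<in>Z i. g x * h x = 0) \<Longrightarrow>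
      (\<forall>x\<in>Z i. g x = 0) \<or> (\<forall>x\<in>Z i. h x = 0)"
    and ne: "Z 0 \<noteq> {}" and sub: "\<And>i. i < m \<Longrightarrow> Z i \<subseteq> Z (Suc i)"
    and f0: "\<And>i x. i < m \<Longrightarrow> x \<in> Z i \<Longrightarrow> f i x = 0"
    and f1: "\<And>i. i < m \<Longrightarrow> \<exists>x\<in>Z (Suc i). f i x \<noteq> 0"
    and rel: "\<And>x. x \<in> Z m \<Longrightarrow> (\<Sum>\<alpha>\<in>exps m t. c \<alpha> * monom_fun f \<alpha> x) = 0"
  shows "\<forall>\<alpha>\<in>exps m t. c \<alpha> = 0"
  using assms
proof (induction m arbitrary: c)
  case 0
  obtain x where "x \<in> Z 0" using ne by auto
  moreover have "exps 0 t = {[]}" by auto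
  ultimately show ?case using "0.prems"(7)[of x] by simp
next
  case (Suc m)
  \<comment> \<open>\<open>G e\<close> is the coefficient of \<open>f m ^ e\<close> in the relation,
    a combination of monomials in the earlier functions.\<close>
  define G where "G = (\<lambda>e x. \<Sum>\<beta>\<in>exps m t. c (e # \<beta>) * monom_fun f \<beta> x)"
  have GR: "G e \<in> R" for e unfolding G_def
    by (rule sum, rule mult, rule const, rule monom_fun) (use Suc.prems(1) in auto)
  have fR: "f m \<in> R" using Suc.prems(1) by auto
  have rel': "(\<Sum>e\<le>t. f m x ^ e * G e x) = 0" if "x \<in> Z (Suc m)" for x
  proof -
    have "(\<Sum>\<alpha>\<in>exps (Suc m) t. c \<alpha> * monom_fun f \<alpha> x) = (\<Sum>e\<le>t. f m x ^ e * G e x)"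
      unfolding sum_exps_Suc G_def sum_distrib_left
      by (intro sum.cong refl) (auto simp: mult_ac)
    then show ?thesis using Suc.prems(7)[OF that] by simp
  qed
  have z: "e \<le> t \<longrightarrow> (\<forall>\<beta>\<in>exps m t. c (e # \<beta>) = 0)" for e
  proof (induction e rule: less_induct)
    case (less e)
    show ?case
    proof
      assume e: "e \<le> t"
      \<comment> \<open>The relation divided by \<open>f m ^ e\<close>; the lower coefficients
        vanish by the inner induction.\<close>
      define H where "H = (\<lambda>x. \<Sum>k\<in>{e..t}. f m x ^ (k - e) * G k x)"
      have HR: "H \<in> R" unfolding H_def by (intro sum mult power fR GR)
      have "G k x = 0" if "k < e" for k x using less that e unfolding G_def by simp
      then have "f m x ^ e * H x = 0" if x: "x \<in> Z (Suc m)" for x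
      proof -
        have "(\<Sum>k\<le>t. f m x ^ k * G k x) = (\<Sum>k\<in>{e..t}. f m x ^ k * G k x)"
          using \<open>\<And>k x. k < e \<Longrightarrow> G k x = 0\<close> by (intro sum.mono_neutral_right) auto
        also have "\<dots> = f m x ^ e * H x"
          unfolding H_def sum_distrib_left by (intro sum.cong) (auto simp flip: power_add)
        finally show ?thesis using rel'[OF x] by simp
      qed
      then have "(\<forall>x\<in>Z (Suc m). f m x ^ e = 0) \<or> (\<forall>x\<in>Z (Suc m). H x = 0)"
        by (intro Suc.prems(2) power fR HR) auto
      then have H0: "H x = 0" if "x \<in> Z m" for x
        using Suc.prems(6)[of m] Suc.prems(4)[of m] that by auto
      have "G e x = 0" if x: "x \<in> Z m" for x
      proof -
        \<comment> \<open>On \<open>Z m\<close> the function \<open>f m\<close> vanishes, so only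
          the summand \<open>k = e\<close> survives, with \<open>0 ^ 0 = 1\<close>.\<close>
        have "H x = (\<Sum>k\<in>{e..t}. if k = e then G e x else 0)"
          unfolding H_def using Suc.prems(5)[of m x] x by (intro sum.cong) auto
        also have "\<dots> = G e x" using e by simp
        finally show ?thesis using H0[OF x] by simp
      qed
      then show "\<forall>\<beta>\<in>exps m t. c (e # \<beta>) = 0"
        unfolding G_def by (intro Suc.IH) (use Suc.prems in auto)
    qed
  qed
  show ?case unfolding exps_Suc using z by auto
qed

end

section \<open>Counting monomials in finitely many coordinates\<close>

interpretation fun_space: vector_space "\<lambda>(c::complex) (f::'a \<Rightarrow> complex) x. c * f x"
  by unfold_locales (auto simp: algebra_simps fun_eq_iff)

lemma sum_fun_apply: "(\<Sum>i\<in>I. f i) x = (\<Sum>i\<in>I. f i x :: complex)"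
  by (induction I rule: infinite_finite_induct) auto

text \<open>Functions are set to zero outside \<open>X\<close>, so that agreement on
  \<open>X\<close> becomes equality and linear independence can be tested in the space of all
  functions.\<close>

definition monomials_on :: "'a set \<Rightarrow> (nat \<Rightarrow> 'a \<Rightarrow> complex) \<Rightarrow> nat \<Rightarrow> nat \<Rightarrow> ('a \<Rightarrow> complex) set" where
  "monomials_on X \<xi> v d = (\<lambda>es x. if x \<in> X then monom_fun \<xi> es x else 0) ` exps v d"

definition poly_on :: "'a set \<Rightarrow> (nat \<Rightarrow> 'a \<Rightarrow> complex) \<Rightarrow> nat \<Rightarrow> nat \<Rightarrow> ('a \<Rightarrow> complex) \<Rightarrow> bool" where
  "poly_on X \<xi> v d f \<longleftrightarrow> (\<exists>a. \<forall>x\<in>X. f x = (\<Sum>es\<in>exps v d. a es * monom_fun \<xi> es x))"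

lemma poly_on_sumI:
  assumes "finite I" "\<And>i. i \<in> I \<Longrightarrow> e i \<in> exps v d"
    "\<And>x. x \<in> X \<Longrightarrow> f x = (\<Sum>i\<in>I. a i * monom_fun \<xi> (e i) x)"
  shows "poly_on X \<xi> v d f"
proof -
  have "f x = (\<Sum>es\<in>exps v d. (\<Sum>i\<in>{i \<in> I. e i = es}. a i) * monom_fun \<xi> es x)" if x: "x \<in> X" for x
  proof -
    have "f x = (\<Sum>i\<in>I. a i * monom_fun \<xi> (e i) x)" by (rule assms(3)[OF x])
    also have "\<dots> = (\<Sum>es\<in>exps v d. \<Sum>i\<in>{i \<in> I. e i = es}. a i * monom_fun \<xi> (e i) x)"
      using assms(2) by (intro sum.group[symmetric] assms(1) finite_exps) auto
    also have "\<dots> = (\<Sum>es\<in>exps v d. (\<Sum>i\<in>{i \<in> I. e i = es}. a i) * monom_fun \<xi> es x)"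
      unfolding sum_distrib_right by (intro sum.cong) auto
    finally show ?thesis .
  qed
  then show ?thesis unfolding poly_on_def
    by (intro exI[of _ "\<lambda>es. \<Sum>i\<in>{i \<in> I. e i = es}. a i"]) simp
qed

lemma poly_on_mono:
  assumes "poly_on X \<xi> v d f" "d \<le> d'"
  shows "poly_on X \<xi> v d' f"
proof -
  obtain a where "\<forall>x\<in>X. f x = (\<Sum>es\<in>exps v d. a es * monom_fun \<xi> es x)"
    using assms(1) unfolding poly_on_def by blast
  then show ?thesis using assms(2)
    by (intro poly_on_sumI[where I = "exps v d" and e = id and a = a] finite_exps) auto
qed

lemma poly_on_add:
  assumes "poly_on X \<xi> v d f" "poly_on X \<xi> v d g"
  shows "poly_on X \<xi> v d (\<lambda>x. f x + g x)"
proof -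
  obtain a b where "\<forall>x\<in>X. f x = (\<Sum>es\<in>exps v d. a es * monom_fun \<xi> es x)"
    "\<forall>x\<in>X. g x = (\<Sum>es\<in>exps v d. b es * monom_fun \<xi> es x)"
    using assms unfolding poly_on_def by blast
  then have "\<forall>x\<in>X. f x + g x = (\<Sum>es\<in>exps v d. (a es + b es) * monom_fun \<xi> es x)"
    by (simp add: sum.distrib distrib_right)
  then show ?thesis unfolding poly_on_def by (intro exI[of _ "\<lambda>es. a es + b es"])
qed

lemma monom_fun_add:
  "length es = length es' \<Longrightarrow> monom_fun \<xi> es x * monom_fun \<xi> es' x = monom_fun \<xi> (map2 (+) es es') x"
  by (induction es es' rule: list_induct2) (auto simp: power_add algebra_simps)

lemma map2_add_exps:
  assumes "es \<in> exps v d" "es' \<in> exps v d'"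
  shows "map2 (+) es es' \<in> exps v (d + d')"
proof -
  have "length es = length es' \<Longrightarrow> set es \<subseteq> {..d} \<Longrightarrow> set es' \<subseteq> {..d'} \<Longrightarrow> set (map2 (+) es es') \<subseteq> {..d + d'}"
    by (induction es es' rule: list_induct2) auto
  then show ?thesis using assms by simp
qed

lemma poly_on_mult:
  assumes "poly_on X \<xi> v d f" "poly_on X \<xi> v d' g"
  shows "poly_on X \<xi> v (d + d') (\<lambda>x. f x * g x)"
proof -
  obtain a b where ab: "\<forall>x\<in>X. f x = (\<Sum>es\<in>exps v d. a es * monom_fun \<xi> es x)"
    "\<forall>x\<in>X. g x = (\<Sum>es\<in>exps v d'. b es * monom_fun \<xi> es x)"
    using assms unfolding poly_on_def by blast
  show ?thesis
  proof (rule poly_on_sumI[where I = "exps v d \<times> exps v d'" and e = "\<lambda>(es, es'). map2 (+) es es'"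
        and a = "\<lambda>(es, es'). a es * b es'"])
    fix x assume "x \<in> X"
    then have "f x * g x = (\<Sum>es\<in>exps v d. \<Sum>es'\<in>exps v d'. (a es * monom_fun \<xi> es x) * (b es' * monom_fun \<xi> es' x))"
      using ab by (simp add: sum_product)
    also have "\<dots> = (\<Sum>(es, es')\<in>exps v d \<times> exps v d'. (a es * monom_fun \<xi> es x) * (b es' * monom_fun \<xi> es' x))"
      by (rule sum.cartesian_product)
    also have "\<dots> = (\<Sum>i\<in>exps v d \<times> exps v d'. (case i of (es, es') \<Rightarrow> a es * b es') *
        monom_fun \<xi> (case i of (es, es') \<Rightarrow> map2 (+) es es') x)"
      by (intro sum.cong) (auto simp: monom_fun_add[symmetric])
    finally show "f x * g x = \<dots>" .
  next
    fix i assume "i \<in> exps v d \<times> exps v d'"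
    then show "(case i of (es, es') \<Rightarrow> map2 (+) es es') \<in> exps v (d + d')"
      using map2_add_exps[where v = v and d = d and d' = d'] by (cases i) (simp only: mem_Times_iff fst_conv snd_conv prod.case)
  qed (simp add: finite_exps)
qed

lemma poly_on_const: "poly_on X \<xi> v 0 (\<lambda>x. c)"
proof -
  have "monom_fun \<xi> (replicate v 0) x = 1" for x by (induction v) auto
  then show ?thesis
    by (intro poly_on_sumI[where I = "{()}" and e = "\<lambda>_. replicate v 0" and a = "\<lambda>_. c"]) auto
qed

lemma poly_on_coord:
  assumes "k < v"
  shows "poly_on X \<xi> v 1 (\<xi> k)"
proof -
  \<comment> \<open>The list is reversed because \<open>monom_fun\<close> reads exponents from the
    highest index down.\<close>
  define e where "e v = map (\<lambda>i. if i = k then 1 else 0 :: nat) (rev [0..<v])" for v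
  have "monom_fun \<xi> (e u) x = (if k < u then \<xi> k x else 1)" for x u
    unfolding e_def by (induction u) (auto simp: less_Suc_eq)
  moreover have "e v \<in> exps v 1" unfolding e_def by auto
  ultimately show ?thesis using assms
    by (intro poly_on_sumI[where I = "{()}" and e = "\<lambda>_. e v" and a = "\<lambda>_. 1"]) auto
qed

lemma poly_on_power: "poly_on X \<xi> v d f \<Longrightarrow> poly_on X \<xi> v (k * d) (\<lambda>x. f x ^ k)"
  by (induction k) (auto intro: poly_on_const poly_on_mult)

lemma poly_on_monom_fun:
  assumes "\<And>i. i < length es \<Longrightarrow> poly_on X \<xi> v d (f i)" "set es \<subseteq> {..t}"
  shows "poly_on X \<xi> v (length es * (t * d)) (monom_fun f es)"
  using assms
proof (induction es)
  case Nil
  then show ?case using poly_on_const[of X \<xi> v 1] by simp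
next
  case (Cons e es)
  have "poly_on X \<xi> v (e * d) (\<lambda>x. f (length es) x ^ e)"
    by (rule poly_on_power, rule Cons.prems) simp
  then have "poly_on X \<xi> v (t * d) (\<lambda>x. f (length es) x ^ e)"
    using Cons.prems(2) by (elim poly_on_mono) auto
  moreover have "poly_on X \<xi> v (length es * (t * d)) (monom_fun f es)"
    using Cons.prems by (intro Cons.IH) auto
  ultimately show ?case using poly_on_mult by fastforce
qed

lemma poly_on_in_span:
  assumes "poly_on X \<xi> v d f"
  shows "(\<lambda>x. if x \<in> X then f x else 0) \<in> fun_space.span (monomials_on X \<xi> v d)"
proof -
  obtain a where a: "\<forall>x\<in>X. f x = (\<Sum>es\<in>exps v d. a es * monom_fun \<xi> es x)"
    using assms unfolding poly_on_def by blast
  have "(\<lambda>x. if x \<in> X then f x else 0) =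
      (\<Sum>es\<in>exps v d. (\<lambda>x. a es * (if x \<in> X then monom_fun \<xi> es x else 0)))"
    using a by (auto simp: fun_eq_iff sum_fun_apply)
  also have "\<dots> \<in> fun_space.span (monomials_on X \<xi> v d)"
    by (intro fun_space.span_sum fun_space.span_scale fun_space.span_base) (auto simp: monomials_on_def)
  finally show ?thesis .
qed

text \<open>As functions of \<open>t\<close> the two sides grow with degree \<open>m\<close> and
  \<open>v\<close>, so \<open>m > v\<close> is impossible for large \<open>t\<close>.\<close>

lemma growth_bound:
  fixes m v d :: nat
  assumes "\<And>t. (t + 1) ^ m \<le> (m * (t * d) + 1) ^ v"
  shows "m \<le> v"
proof (rule ccontr)
  assume "\<not> m \<le> v"
  \<comment> \<open>This value equals the constant factor on the right, so that the bound reads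
    \<open>(t + 1) ^ Suc v <= t * (t + 1) ^ v\<close>.\<close>
  define t where "t = (m * d + 1) ^ v"
  have "(t + 1) ^ Suc v \<le> (t + 1) ^ m" using \<open>\<not> m \<le> v\<close> by (intro power_increasing) auto
  also have "\<dots> \<le> (m * (t * d) + 1) ^ v" by (rule assms)
  also have "\<dots> \<le> ((m * d + 1) * (t + 1)) ^ v" by (intro power_mono) (auto simp: algebra_simps)
  also have "\<dots> = t * (t + 1) ^ v" unfolding power_mult_distrib by (simp only: t_def)
  finally show False by simp
qed

text \<open>A bound on the transcendence degree by counting: the monomials with exponents up to
  \<open>t\<close> in the \<open>m\<close> independent functions are linearly independent, and they
  lie in the span of the coordinate monomials with exponents at most
  \<open>m * (t * D)\<close>.\<close>

lemma (in function_ring) chain_length_bound: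
  assumes \<xi>: "\<And>f. f \<in> R \<Longrightarrow> \<exists>d. poly_on X \<xi> v d f"
    and prime: "\<And>i g h. i \<le> m \<Longrightarrow> g \<in> R \<Longrightarrow> h \<in> R \<Longrightarrow> (\<forall>x\<in>Z i. g x * h x = 0) \<Longrightarrow>
      (\<forall>x\<in>Z i. g x = 0) \<or> (\<forall>x\<in>Z i. h x = 0)"
    and ne: "Z 0 \<noteq> {}" and sub: "\<And>i. i < m \<Longrightarrow> Z i \<subseteq> Z (Suc i)" and X: "Z m \<subseteq> X"
    and sep: "\<And>i. i < m \<Longrightarrow> \<exists>g\<in>R. (\<forall>x\<in>Z i. g x = 0) \<and> (\<exists>x\<in>Z (Suc i). g x \<noteq> 0)"
  shows "m \<le> v"
proof -
  obtain f where f: "\<And>i. i < m \<Longrightarrow> f i \<in> R \<and> (\<forall>x\<in>Z i. f i x = 0) \<and> (\<exists>x\<in>Z (Suc i). f i x \<noteq> 0)"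
    using sep by metis
  have "\<forall>i\<in>{..<m}. \<exists>d. poly_on X \<xi> v d (f i)" using \<xi> f by simp
  then obtain d where d: "\<And>i. i < m \<Longrightarrow> poly_on X \<xi> v (d i) (f i)" by (metis lessThan_iff)
  define D where "D = (\<Sum>i<m. d i)"
  have D: "poly_on X \<xi> v D (f i)" if "i < m" for i
    using d[OF that] that unfolding D_def by (elim poly_on_mono) (auto intro: member_le_sum)
  have "(t + 1) ^ m \<le> (m * (t * D) + 1) ^ v" for t
  proof -
    define F where "F = (\<lambda>\<alpha> x. if x \<in> X then monom_fun f \<alpha> x else 0)"
    let ?M = "monomials_on X \<xi> v (m * (t * D))"
    have indep: "\<forall>\<alpha>\<in>exps m t. c \<alpha> = 0" if c: "\<And>x. (\<Sum>\<alpha>\<in>exps m t. c \<alpha> * F \<alpha> x) = 0" for c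
    proof (rule independent_along_chain[where m = m and f = f and Z = Z and t = t and c = c])
      fix x assume "x \<in> Z m"
      then show "(\<Sum>\<alpha>\<in>exps m t. c \<alpha> * monom_fun f \<alpha> x) = 0"
        using c[of x] X unfolding F_def by (auto simp: subset_iff cong: sum.cong)
    qed (use f prime ne sub in auto)
    have inj: "inj_on F (exps m t)"
    proof (rule inj_onI, rule ccontr)
      fix \<alpha> \<beta> assume ab: "\<alpha> \<in> exps m t" "\<beta> \<in> exps m t" "F \<alpha> = F \<beta>" "\<alpha> \<noteq> \<beta>"
      \<comment> \<open>Independence is available for the family of monomials, but the dimension
        bound concerns the set of their values. Two exponents with the same value would give a
        relation with coefficients \<open>1\<close> and \<open>-1\<close>.\<close>
      let ?c = "\<lambda>\<gamma>. (if \<gamma> = \<alpha> then 1 else 0) - (if \<gamma> = \<beta> then 1 else 0) :: complex"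
      have "(\<Sum>\<gamma>\<in>exps m t. ?c \<gamma> * F \<gamma> x) = F \<alpha> x - F \<beta> x" for x
      proof -
        have "(\<Sum>\<gamma>\<in>exps m t. ?c \<gamma> * F \<gamma> x) =
            (\<Sum>\<gamma>\<in>exps m t. (if \<gamma> = \<alpha> then F \<gamma> x else 0)) - (\<Sum>\<gamma>\<in>exps m t. (if \<gamma> = \<beta> then F \<gamma> x else 0))"
          by (subst sum_subtractf[symmetric], intro sum.cong) auto
        then show ?thesis using ab(1,2) by (simp add: finite_exps)
      qed
      moreover have "F \<alpha> x - F \<beta> x = 0" for x using ab(3) by simp
      ultimately have "\<forall>\<gamma>\<in>exps m t. ?c \<gamma> = 0" by (intro indep) (simp only:)
      then show False using ab(1,4) by force
    qed
    have "fun_space.independent (F ` exps m t)"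
    proof (subst fun_space.independent_explicit_finite_subsets, intro allI impI ballI)
      fix S u f0
      assume S: "S \<subseteq> F ` exps m t" "finite S" "(\<Sum>f\<in>S. (\<lambda>x. u f * f x)) = 0" "f0 \<in> S"
      let ?c = "\<lambda>\<alpha>. if F \<alpha> \<in> S then u (F \<alpha>) else 0"
      have "(\<Sum>\<alpha>\<in>exps m t. ?c \<alpha> * F \<alpha> x) = 0" for x
      proof -
        have "(\<Sum>\<alpha>\<in>exps m t. ?c \<alpha> * F \<alpha> x) = (\<Sum>f\<in>F ` exps m t. (if f \<in> S then u f else 0) * f x)"
          by (subst sum.reindex[OF inj]) simp
        also have "\<dots> = (\<Sum>f\<in>S. u f * f x)"
          using S(1) by (intro sum.mono_neutral_cong_right) (auto simp: finite_exps)
        also have "\<dots> = 0" using fun_cong[OF S(3), of x] by (simp add: sum_fun_apply)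
        finally show ?thesis .
      qed
      then have c0: "\<forall>\<alpha>\<in>exps m t. ?c \<alpha> = 0" by (rule indep)
      obtain \<alpha> where "\<alpha> \<in> exps m t" "f0 = F \<alpha>" using S(1,4) by blast
      then show "u f0 = 0" using c0 S(4) by metis
    qed
    moreover have "F ` exps m t \<subseteq> fun_space.span ?M"
    proof
      fix g assume "g \<in> F ` exps m t"
      then obtain \<alpha> where a: "\<alpha> \<in> exps m t" "g = F \<alpha>" by auto
      then have "poly_on X \<xi> v (m * (t * D)) (monom_fun f \<alpha>)" using poly_on_monom_fun[of \<alpha> X \<xi> v D f t] D by auto
      then show "g \<in> fun_space.span ?M" unfolding a F_def by (rule poly_on_in_span)
    qed
    moreover have fin: "finite ?M" unfolding monomials_on_def by (intro finite_imageI finite_exps)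
    ultimately have "card (F ` exps m t) \<le> card ?M" using fun_space.independent_span_bound by blast
    also have "\<dots> \<le> card (exps v (m * (t * D)))" unfolding monomials_on_def by (rule card_image_le[OF finite_exps])
    finally show ?thesis by (simp only: card_image[OF inj] card_exps)
  qed
  then show ?thesis by (rule growth_bound)
qed

section \<open>Linear algebra\<close>

lemma mult_unit_vec_col:
  assumes "(A :: complex mat) \<in> carrier_mat n c" "j < c"
  shows "A *\<^sub>v unit_vec c j = col A j"
  using assms by (intro eq_vecI) auto

text \<open>Full column rank as a trivial kernel, a form that passes to factors and products by
  associativity.\<close>

definition inj_mat :: "complex mat \<Rightarrow> bool" where
  "inj_mat A \<longleftrightarrow> (\<forall>v\<in>carrier_vec (dim_col A). A *\<^sub>v v = 0\<^sub>v (dim_row A) \<longrightarrow> v = 0\<^sub>v (dim_col A))"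

lemma inj_mat_iff_rank:
  assumes A: "A \<in> carrier_mat n c"
  shows "inj_mat A \<longleftrightarrow> mat_rank n A = c"
proof -
  interpret vec_space "TYPE(complex)" n .
  have d: "dim_row A = n" "dim_col A = c" using A by auto
  show ?thesis
  proof
    assume i: "inj_mat A"
    \<comment> \<open>The set of columns forgets repetitions, so equal columns are excluded first:
      the difference of two unit vectors would lie in the kernel.\<close>
    have dist: "distinct (cols A)"
    proof (rule ccontr)
      assume "\<not> distinct (cols A)"
      then obtain a b where ab: "a < c" "b < c" "a \<noteq> b" "cols A ! a = cols A ! b"
        unfolding distinct_conv_nth using d by auto
      let ?v = "unit_vec c a - unit_vec c b :: complex vec"
      have "A *\<^sub>v ?v = A *\<^sub>v unit_vec c a - A *\<^sub>v unit_vec c b"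
        by (rule mult_minus_distrib_mat_vec[OF A]) auto
      also have "\<dots> = col A a - col A b" using A ab mult_unit_vec_col[OF A] by simp
      also have "\<dots> = 0\<^sub>v n" using ab d by auto
      finally have "?v = 0\<^sub>v c" using i d unfolding inj_mat_def by auto
      then have "?v $ a = 0" using ab by auto
      then show False using ab by auto
    qed
    have "lin_indpt (set (cols A))"
    proof
      assume "lin_dep (set (cols A))"
      then obtain v where "v \<in> carrier_vec c" "v \<noteq> 0\<^sub>v c" "A *\<^sub>v v = 0\<^sub>v n"
        using lin_depE[OF A _ dist] by blast
      then show False using i d unfolding inj_mat_def by auto
    qed
    then show "rank A = c" using lin_indpt_full_rank[OF A dist] by simp
  next
    assume r: "rank A = c"
    obtain S where S: "maximal S (\<lambda>T. T \<subseteq> set (cols A) \<and> lin_indpt T)"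
      using maximal_exists_superset[of "set (cols A)" "\<lambda>T. T \<subseteq> set (cols A) \<and> lin_indpt T" "{}"]
      by (auto simp: lin_dep_def)
    have "c = card S" using rank_card_indpt[OF A S] r by simp
    also have "\<dots> \<le> card (set (cols A))" using S by (intro card_mono) (auto simp: maximal_def)
    finally have "length (cols A) \<le> card (set (cols A))" using d by simp
    then have dist: "distinct (cols A)" using card_distinct card_length le_antisym by metis
    have "lin_indpt (set (cols A))" by (rule full_rank_lin_indpt[OF A r dist])
    then show "inj_mat A" unfolding inj_mat_def using lin_depI[OF A _ _ _ dist] d by auto
  qed
qed

lemma col_span_eq:
  assumes A: "A \<in> carrier_mat n c"
  shows "col_span n A = (\<lambda>x. A *\<^sub>v x) ` carrier_vec c"
proof -
  interpret vec_space "TYPE(complex)" n .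
  show ?thesis using col_space_eq[OF A] A by auto
qed

lemma col_span_subspace:
  assumes A: "A \<in> carrier_mat n c"
  shows "lin_subspace n (col_span n A)" "lin_dim n (col_span n A) = mat_rank n A"
proof -
  interpret vec_space "TYPE(complex)" n .
  have "set (cols A) \<subseteq> carrier_vec n" using cols_dim A by blast
  then show "lin_subspace n (col_span n A)"
    unfolding col_space_def by (intro span_is_subspace) auto
  show "lin_dim n (col_span n A) = mat_rank n A"
    unfolding rank_def col_space_def ..
qed

text \<open>Independent sets have at most \<open>n\<close> members, so \<open>W\<close> contains a
  maximal one. It spans \<open>W\<close>, and its vectors become the columns.\<close>

lemma subspace_col_span:
  assumes W: "lin_subspace n W" "lin_dim n W = c"
  obtains A where "A \<in> carrier_mat n c" "inj_mat A" "W = col_span n A"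
proof -
  interpret vec_space "TYPE(complex)" n .
  have sm: "submodule class_ring W V" and WV: "W \<subseteq> carrier_vec n"
    using W(1) unfolding subspace_def submodule_def by auto
  let ?P = "\<lambda>T. T \<subseteq> W \<and> lin_indpt T"
  have "finite T \<and> card T \<le> n" if "?P T" for T
    using li_le_dim[of T] fin_dim_li_fin[of T] dim_is_n that WV by auto
  moreover have "?P {}" by (auto simp: lin_dep_def)
  ultimately obtain B where B: "finite B" "maximal B ?P"
    using maximal_exists[of ?P n "{}"] by blast
  then have BW: "B \<subseteq> W" and liB: "lin_indpt B" by (auto simp: maximal_def)
  have BV: "B \<subseteq> carrier_vec n" using BW WV by auto
  have sp: "span B = W"
  proof
    show "span B \<subseteq> W" by (rule span_is_subset[OF BW sm])
    show "W \<subseteq> span B"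
    proof (rule ccontr)
      assume "\<not> W \<subseteq> span B"
      then obtain w where w: "w \<in> W" "w \<notin> span B" by auto
      have "w \<notin> B" using w(2) BV span_mem by auto
      then have "lin_indpt (B \<union> {w})"
        using lin_dep_iff_in_span[of B w] w BV liB WV by auto
      then have "B \<union> {w} = B" using B(2) BW w(1) unfolding maximal_def by blast
      then show False using \<open>w \<notin> B\<close> by auto
    qed
  qed
  obtain xs where xs: "set xs = B" "distinct xs" using finite_distinct_list B(1) by blast
  define A where "A = mat_of_cols n xs"
  have A: "A \<in> carrier_mat n (length xs)" unfolding A_def by auto
  have cA: "cols A = xs" unfolding A_def using xs BW WV by (intro cols_mat_of_cols) auto
  have rA: "rank A = length xs" by (rule lin_indpt_full_rank[OF A]) (use cA xs liB in auto)
  have WA: "W = col_span n A" unfolding col_space_def cA xs(1) sp ..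
  have "length xs = c" using W(2) rA unfolding rank_def cA xs(1) sp by simp
  then show ?thesis using A WA rA inj_mat_iff_rank[OF A] that by auto
qed

lemma inj_mat_det:
  assumes "A \<in> carrier_mat n n"
  shows "inj_mat A \<longleftrightarrow> det A \<noteq> 0"
  using det_0_iff_vec_prod_zero[OF assms] assms unfolding inj_mat_def by auto

lemma inj_mat_mult:
  assumes A: "A \<in> carrier_mat n c" and X: "X \<in> carrier_mat c d" and i: "inj_mat (A * X)"
  shows "inj_mat X"
  unfolding inj_mat_def
proof (intro ballI impI)
  fix v assume v: "v \<in> carrier_vec (dim_col X)" "X *\<^sub>v v = 0\<^sub>v (dim_row X)"
  have "(A * X) *\<^sub>v v = A *\<^sub>v (X *\<^sub>v v)" using assoc_mult_mat_vec[OF A X] v X by auto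
  also have "\<dots> = 0\<^sub>v n" using v A X by auto
  finally show "v = 0\<^sub>v (dim_col X)" using i v A X unfolding inj_mat_def by auto
qed

lemma inj_mat_multI:
  assumes A: "A \<in> carrier_mat n c" and X: "X \<in> carrier_mat c d" and i: "inj_mat A" "inj_mat X"
  shows "inj_mat (A * X)"
  unfolding inj_mat_def
proof (intro ballI impI)
  fix v assume v: "v \<in> carrier_vec (dim_col (A * X))" "(A * X) *\<^sub>v v = 0\<^sub>v (dim_row (A * X))"
  have "A *\<^sub>v (X *\<^sub>v v) = 0\<^sub>v n" using assoc_mult_mat_vec[OF A X] v X A by auto
  then have "X *\<^sub>v v = 0\<^sub>v c" using i(1) A X v unfolding inj_mat_def by auto
  then show "v = 0\<^sub>v (dim_col (A * X))" using i(2) A X v unfolding inj_mat_def by auto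
qed

lemma mult_mat_vec_index_sum:
  assumes "A \<in> carrier_mat n c" "v \<in> carrier_vec c" "i < n"
  shows "(A *\<^sub>v v) $ i = (\<Sum>j<c. A $$ (i, j) * v $ j)"
  using assms by (auto simp: scalar_prod_def atLeast0LessThan intro!: sum.cong)

lemma mult_mat_index_sum:
  assumes "A \<in> carrier_mat n c" "B \<in> carrier_mat c d" "i < n" "j < d"
  shows "(A * B) $$ (i, j) = (\<Sum>k<c. A $$ (i, k) * B $$ (k, j))"
  using assms by (auto simp: scalar_prod_def atLeast0LessThan intro!: sum.cong)

(* P is the conjugate transpose: A^* A v = 0 forces |A v| = 0. *)
lemma inj_mat_minor:
  assumes A: "A \<in> carrier_mat n c" and i: "inj_mat A"
  obtains P where "P \<in> carrier_mat c n" "det (P * A) \<noteq> 0"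
proof -
  define P where "P = mat c n (\<lambda>(i, k). cnj (A $$ (k, i)))"
  have P: "P \<in> carrier_mat c n" unfolding P_def by simp
  have PA: "P * A \<in> carrier_mat c c" using P A by auto
  have "inj_mat (P * A)" unfolding inj_mat_def
  proof (intro ballI impI)
    fix v assume v: "v \<in> carrier_vec (dim_col (P * A))" "(P * A) *\<^sub>v v = 0\<^sub>v (dim_row (P * A))"
    have vc: "v \<in> carrier_vec c" using v A by auto
    define w where "w = A *\<^sub>v v"
    have w: "w \<in> carrier_vec n" unfolding w_def using A vc by (metis mult_mat_vec_carrier)
    have Pw: "P *\<^sub>v w = 0\<^sub>v c" using assoc_mult_mat_vec[OF P A vc] v P unfolding w_def by auto
    have "0 = (\<Sum>i<c. cnj (v $ i) * (P *\<^sub>v w) $ i)" using Pw by simp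
    also have "\<dots> = (\<Sum>i<c. \<Sum>k<n. cnj (A $$ (k, i) * v $ i) * w $ k)"
      using mult_mat_vec_index_sum[OF P w]
      by (intro sum.cong refl) (auto simp: P_def sum_distrib_left mult_ac intro!: sum.cong)
    also have "\<dots> = (\<Sum>k<n. (\<Sum>i<c. cnj (A $$ (k, i) * v $ i)) * w $ k)"
      by (subst sum.swap) (simp add: sum_distrib_right)
    also have "\<dots> = (\<Sum>k<n. cnj (w $ k) * w $ k)"
      unfolding w_def using mult_mat_vec_index_sum[OF A vc] by (intro sum.cong refl) simp
    also have "\<dots> = of_real (\<Sum>k<n. (cmod (w $ k))\<^sup>2)"
      unfolding of_real_sum complex_norm_square by (simp add: mult.commute)
    finally have "(\<Sum>k<n. (cmod (w $ k))\<^sup>2) = 0" by (metis of_real_eq_0_iff)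
    then have "\<forall>k<n. w $ k = 0" by (subst (asm) sum_nonneg_eq_0_iff) auto
    then have "w = 0\<^sub>v n" using w by (intro eq_vecI) auto
    then show "v = 0\<^sub>v (dim_col (P * A))" using i vc A P unfolding w_def inj_mat_def by auto
  qed
  then show ?thesis using that P inj_mat_det[OF PA] by auto
qed

lemma det_nonzero_imp_inj_mat:
  assumes "P \<in> carrier_mat c n" "A \<in> carrier_mat n c" "det (P * A) \<noteq> 0"
  shows "inj_mat A"
  using inj_mat_mult[OF assms(1,2)] inj_mat_det[of "P * A" c] assms by auto

lemma det_nonzero_inverse:
  assumes A: "(A :: complex mat) \<in> carrier_mat n n" and d: "det A \<noteq> 0"
  obtains B where "B \<in> carrier_mat n n" "A * B = 1\<^sub>m n" "B * A = 1\<^sub>m n" "det B \<noteq> 0"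
proof -
  obtain B where B: "B \<in> carrier_mat n n" "A * B = 1\<^sub>m n" "B * A = 1\<^sub>m n"
    using det_non_zero_imp_unit[OF A d, of undefined] unfolding Units_def ring_mat_def by auto
  have "det A * det B = 1" using det_mult[OF A B(1)] B(2) by simp
  then show ?thesis using that B by force
qed

lemma det_one_imp_nonzero:
  assumes "(A :: complex mat) \<in> carrier_mat n n" "B \<in> carrier_mat n n" "A * B = 1\<^sub>m n"
  shows "det A \<noteq> 0" "det B \<noteq> 0"
  using det_mult[OF assms(1,2)] assms(3) by auto

lemma invertible_mat_iff_det:
  assumes A: "(A :: complex mat) \<in> carrier_mat n n"
  shows "invertible_mat A \<longleftrightarrow> det A \<noteq> 0"
proof
  assume "invertible_mat A"
  then obtain B where B: "A * B = 1\<^sub>m n" "B * A = 1\<^sub>m (dim_row B)"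
    using A unfolding invertible_mat_def inverts_mat_def by auto
  have "dim_col B = n" using arg_cong[OF B(1), of dim_col] by simp
  moreover have "dim_row B = n" using arg_cong[OF B(2), of dim_col] A by simp
  ultimately have "B \<in> carrier_mat n n" by auto
  then show "det A \<noteq> 0" using det_one_imp_nonzero[OF A] B by blast
next
  assume "det A \<noteq> 0"
  then obtain B where "B \<in> carrier_mat n n" "A * B = 1\<^sub>m n" "B * A = 1\<^sub>m n"
    using det_nonzero_inverse[OF A] by blast
  then show "invertible_mat A" using A unfolding invertible_mat_def inverts_mat_def by auto
qed

lemma col_span_subset_factor:
  assumes A: "A \<in> carrier_mat n c" and A': "A' \<in> carrier_mat n d"
    and sub: "\<And>j. j < d \<Longrightarrow> col A' j \<in> col_span n A"
  obtains X where "X \<in> carrier_mat c d" "A' = A * X"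
proof -
  have "\<exists>x. x \<in> carrier_vec c \<and> A *\<^sub>v x = col A' j" if "j < d" for j
    using sub[OF that] unfolding col_span_eq[OF A] by auto
  then obtain f where f: "\<And>j. j < d \<Longrightarrow> f j \<in> carrier_vec c \<and> A *\<^sub>v f j = col A' j" by metis
  define X where "X = mat c d (\<lambda>(i, j). f j $ i)"
  have X: "X \<in> carrier_mat c d" unfolding X_def by simp
  have "col X j = f j" if "j < d" for j using f[OF that] that unfolding X_def by (intro eq_vecI) auto
  then have "col A' j = col (A * X) j" if "j < d" for j
    using f[OF that] that col_mult2[OF A X that] by simp
  then have "A' = A * X" using A A' X by (intro mat_col_eqI) auto
  then show ?thesis using X that by blast
qed

lemma col_in_col_span: "A \<in> carrier_mat n c \<Longrightarrow> j < c \<Longrightarrow> col A j \<in> col_span n A"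
  using mult_unit_vec_col[of A n c j] unfolding col_span_eq by (metis imageI unit_vec_carrier)

lemma col_span_mult_subset:
  assumes "A \<in> carrier_mat n c" "X \<in> carrier_mat c d"
  shows "col_span n (A * X) \<subseteq> col_span n A"
  using assms by (auto simp: col_span_eq[of A n c] col_span_eq[of "A * X" n d])

lemma col_span_mult:
  assumes A: "A \<in> carrier_mat n c" and g: "g \<in> carrier_mat c c" "det g \<noteq> 0"
  shows "col_span n (A * g) = col_span n A"
proof
  show "col_span n (A * g) \<subseteq> col_span n A" by (rule col_span_mult_subset[OF A g(1)])
  obtain h where h: "h \<in> carrier_mat c c" "g * h = 1\<^sub>m c" using det_nonzero_inverse[OF g] by blast
  have "A = A * g * h" using A g h by (simp add: assoc_mult_mat[OF A g(1) h(1)])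
  then show "col_span n A \<subseteq> col_span n (A * g)"
    using col_span_mult_subset[of "A * g" n c h c] A g h by auto
qed

text \<open>The square factor inherits a trivial kernel from \<open>A'\<close> and is therefore
  invertible.\<close>

lemma col_span_eq_factor:
  assumes A: "A \<in> carrier_mat n c" and A': "A' \<in> carrier_mat n c" "inj_mat A'"
    and sub: "\<And>j. j < c \<Longrightarrow> col A' j \<in> col_span n A"
  obtains g where "g \<in> carrier_mat c c" "det g \<noteq> 0" "A' = A * g"
proof -
  obtain g where g: "g \<in> carrier_mat c c" "A' = A * g"
    using col_span_subset_factor[OF A A'(1) sub] by blast
  have "det g \<noteq> 0" using inj_mat_mult[OF A g(1)] A'(2) g inj_mat_det by auto
  then show ?thesis using that g by blast
qed

lemma image_col_span:
  assumes k: "k \<in> carrier_mat n n" and A: "A \<in> carrier_mat n c"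
  shows "(\<lambda>v. k *\<^sub>v v) ` col_span n A = col_span n (k * A)"
  using assms by (auto simp: col_span_eq[of A n c] col_span_eq[of "k * A" n c] image_image)

text \<open>The product has rank at most \<open>card J\<close>. Compressing the inner sum to indices
  from \<open>J\<close> and padding with zeros gives square factors, the first of which has a zero
  column, and the determinant is multiplicative.\<close>

lemma det_mult_few_cols:
  assumes U: "(U :: complex mat) \<in> carrier_mat s r" and V: "V \<in> carrier_mat r s"
    and J: "J \<subseteq> {..<r}" "card J < s" "\<And>i j. i < s \<Longrightarrow> j < r \<Longrightarrow> j \<notin> J \<Longrightarrow> U $$ (i, j) = 0"
  shows "det (U * V) = 0"
proof -
  have fJ: "finite J" using J(1) finite_subset by auto
  obtain h where h: "bij_betw h {..<card J} J" using ex_bij_betw_nat_finite[OF fJ] by (auto simp: atLeast0LessThan)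
  define U' where "U' = mat s s (\<lambda>(i, k). if k < card J then U $$ (i, h k) else 0)"
  define V' where "V' = mat s s (\<lambda>(k, j). if k < card J then V $$ (h k, j) else 0)"
  have U': "U' \<in> carrier_mat s s" and V': "V' \<in> carrier_mat s s" unfolding U'_def V'_def by auto
  have "U * V = U' * V'"
  proof (rule eq_matI)
    fix i j assume "i < dim_row (U' * V')" "j < dim_col (U' * V')"
    then have ij: "i < s" "j < s" using U' V' by auto
    have "(U * V) $$ (i, j) = (\<Sum>k<r. U $$ (i, k) * V $$ (k, j))" by (rule mult_mat_index_sum[OF U V ij])
    also have "\<dots> = (\<Sum>k\<in>J. U $$ (i, k) * V $$ (k, j))"
      using J(1) J(3)[OF ij(1)] by (intro sum.mono_neutral_right) auto
    also have "\<dots> = (\<Sum>k<card J. U $$ (i, h k) * V $$ (h k, j))"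
      by (rule sum.reindex_bij_betw[OF h, symmetric])
    also have "\<dots> = (\<Sum>k<s. U' $$ (i, k) * V' $$ (k, j))"
      using ij J(2) unfolding U'_def V'_def by (intro sum.mono_neutral_cong_left) auto
    also have "\<dots> = (U' * V') $$ (i, j)" by (rule mult_mat_index_sum[OF U' V' ij, symmetric])
    finally show "(U * V) $$ (i, j) = (U' * V') $$ (i, j)" .
  qed (use U V U' V' in auto)
  moreover have "det U' = 0"
  proof -
    have "U' *\<^sub>v unit_vec s (card J) = col U' (card J)" by (rule mult_unit_vec_col[OF U' J(2)])
    also have "\<dots> = 0\<^sub>v s" using J(2) unfolding U'_def by (intro eq_vecI) auto
    finally show ?thesis using det_0_iff_vec_prod_zero[OF U'] J(2)
      by (metis unit_vec_carrier unit_vec_nonzero)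
  qed
  ultimately show ?thesis using det_mult[OF U' V'] by simp
qed

text \<open>Otherwise column \<open>j\<close> of the inverse has a lowest nonzero entry in some row
  \<open>m > j\<close>. Entry \<open>(m, j)\<close> of the product then reduces to one term with a
  nonzero diagonal factor, but it is an off-diagonal entry of the identity.\<close>

lemma upper_triangular_inverse:
  assumes b: "(b :: complex mat) \<in> carrier_mat n n" "\<And>i j. i < n \<Longrightarrow> j < i \<Longrightarrow> b $$ (i, j) = 0"
    and c: "c \<in> carrier_mat n n" "b * c = 1\<^sub>m n" and ij: "i < n" "j < i"
  shows "c $$ (i, j) = 0"
proof (rule ccontr)
  assume nz: "c $$ (i, j) \<noteq> 0"
  have dg: "b $$ (i, i) \<noteq> 0" if "i < n" for i
  proof -
    have "upper_triangular b" using b by auto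
    then have "det b = prod_list (diag_mat b)" using det_upper_triangular b(1) by blast
    then have "0 \<notin> set (diag_mat b)" using det_one_imp_nonzero(1)[OF b(1) c] by (auto simp: prod_list_zero_iff)
    then show ?thesis using that b(1) unfolding diag_mat_def by force
  qed
  define I where "I = {i. i < n \<and> c $$ (i, j) \<noteq> 0}"
  define m where "m = Max I"
  have fI: "finite I" unfolding I_def by auto
  have "i \<in> I" unfolding I_def using nz ij by auto
  then have mI: "m \<in> I" and im: "i \<le> m" unfolding m_def using Max_in[OF fI] Max_ge[OF fI] by auto
  have m: "m < n" "c $$ (m, j) \<noteq> 0" using mI unfolding I_def by auto
  have above: "c $$ (k, j) = 0" if "m < k" "k < n" for k
  proof (rule ccontr)
    assume "c $$ (k, j) \<noteq> 0"
    then have "k \<le> m" using Max_ge[OF fI, of k] that(2) unfolding m_def[symmetric] by (auto simp: I_def)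
    then show False using that(1) by simp
  qed
  have "0 = (b * c) $$ (m, j)" using c(2) m im ij by auto
  also have "\<dots> = (\<Sum>k<n. b $$ (m, k) * c $$ (k, j))" using mult_mat_index_sum[OF b(1) c(1)] m im ij by auto
  also have "\<dots> = (\<Sum>k\<in>{m}. b $$ (m, k) * c $$ (k, j))"
    using m b(2)[of m] above by (intro sum.mono_neutral_right) (auto, metis linorder_neqE_nat)
  finally show False using dg[OF m(1)] m by simp
qed

section \<open>The group K and the Zariski topology on frames\<close>

lemma det_four_block_diag:
  assumes "(g :: complex mat) \<in> carrier_mat p p" "h \<in> carrier_mat q q"
  shows "det (four_block_mat g (0\<^sub>m p q) (0\<^sub>m q p) h) = det g * det h"
  using det_four_block_mat_lower_left_zero[OF assms(1) zero_carrier_mat refl assms(2)] by simp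

text \<open>The block shape becomes a vanishing of entries, which is the form that fits polynomial
  functions and lines of matrices.\<close>

lemma K_group_iff:
  "k \<in> K_group p q \<longleftrightarrow> k \<in> carrier_mat (p + q) (p + q) \<and>
     (\<forall>i<p + q. \<forall>j<p + q. (i < p) \<noteq> (j < p) \<longrightarrow> k $$ (i, j) = 0) \<and> det k \<noteq> 0"
proof
  assume "k \<in> K_group p q"
  then obtain g h where gh: "k = four_block_mat g (0\<^sub>m p q) (0\<^sub>m q p) h"
    "g \<in> carrier_mat p p" "invertible_mat g" "h \<in> carrier_mat q q" "invertible_mat h"
    unfolding K_group_def by blast
  have "det k \<noteq> 0"
    using gh invertible_mat_iff_det[OF gh(2)] invertible_mat_iff_det[OF gh(4)] by (simp add: det_four_block_diag)
  then show "k \<in> carrier_mat (p + q) (p + q) \<and>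
     (\<forall>i<p + q. \<forall>j<p + q. (i < p) \<noteq> (j < p) \<longrightarrow> k $$ (i, j) = 0) \<and> det k \<noteq> 0"
    using gh by auto
next
  assume k: "k \<in> carrier_mat (p + q) (p + q) \<and>
     (\<forall>i<p + q. \<forall>j<p + q. (i < p) \<noteq> (j < p) \<longrightarrow> k $$ (i, j) = 0) \<and> det k \<noteq> 0"
  define g where "g = mat p p (\<lambda>(i, j). k $$ (i, j))"
  define h where "h = mat q q (\<lambda>(i, j). k $$ (p + i, p + j))"
  have gh: "g \<in> carrier_mat p p" "h \<in> carrier_mat q q" unfolding g_def h_def by auto
  have e: "k = four_block_mat g (0\<^sub>m p q) (0\<^sub>m q p) h"
    using k unfolding g_def h_def by (intro eq_matI) auto
  have "det g \<noteq> 0" "det h \<noteq> 0" using k det_four_block_diag[OF gh] e by auto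
  then show "k \<in> K_group p q"
    unfolding K_group_def using e gh invertible_mat_iff_det by blast
qed

lemma K_group_carrier: "k \<in> K_group p q \<Longrightarrow> k \<in> carrier_mat (p + q) (p + q)"
  by (simp add: K_group_iff)

lemma K_group_block: "k \<in> K_group p q \<Longrightarrow> i < p + q \<Longrightarrow> j < p + q \<Longrightarrow> (i < p) \<noteq> (j < p) \<Longrightarrow> k $$ (i, j) = 0"
  by (simp add: K_group_iff)

lemma K_group_mult:
  assumes a: "a \<in> K_group p q" and b: "b \<in> K_group p q"
  shows "a * b \<in> K_group p q"
proof -
  note ac = K_group_carrier[OF a] and bc = K_group_carrier[OF b]
  have "(a * b) $$ (i, j) = 0" if ij: "i < p + q" "j < p + q" "(i < p) \<noteq> (j < p)" for i j
    unfolding mult_mat_index_sum[OF ac bc ij(1,2)]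
  proof (intro sum.neutral ballI)
    fix k assume "k \<in> {..<p + q}"
    then show "a $$ (i, k) * b $$ (k, j) = 0"
      using K_group_block[OF a ij(1), of k] K_group_block[OF b _ ij(2), of k] ij(3) by auto
  qed
  then show ?thesis using ac bc det_mult[OF ac bc] a b by (auto simp: K_group_iff)
qed

lemma K_group_one: "1\<^sub>m (p + q) \<in> K_group p q"
  by (auto simp: K_group_iff)

lemma K_group_inverse:
  assumes "k \<in> K_group p q"
  obtains k' where "k' \<in> K_group p q" "k * k' = 1\<^sub>m (p + q)" "k' * k = 1\<^sub>m (p + q)"
proof -
  obtain g h where gh: "k = four_block_mat g (0\<^sub>m p q) (0\<^sub>m q p) h"
    "g \<in> carrier_mat p p" "invertible_mat g" "h \<in> carrier_mat q q" "invertible_mat h"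
    using assms unfolding K_group_def by blast
  obtain g' where g': "g' \<in> carrier_mat p p" "g * g' = 1\<^sub>m p" "g' * g = 1\<^sub>m p" "det g' \<noteq> 0"
    using det_nonzero_inverse[OF gh(2)] gh(3) invertible_mat_iff_det[OF gh(2)] by metis
  obtain h' where h': "h' \<in> carrier_mat q q" "h * h' = 1\<^sub>m q" "h' * h = 1\<^sub>m q" "det h' \<noteq> 0"
    using det_nonzero_inverse[OF gh(4)] gh(5) invertible_mat_iff_det[OF gh(4)] by metis
  define k' where "k' = four_block_mat g' (0\<^sub>m p q) (0\<^sub>m q p) h'"
  have "k' \<in> K_group p q"
    unfolding K_group_def k'_def using g' h' invertible_mat_iff_det by blast
  moreover have "four_block_mat (1\<^sub>m p) (0\<^sub>m p q) (0\<^sub>m q p) (1\<^sub>m q) = (1\<^sub>m (p + q) :: complex mat)"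
    by (intro eq_matI) auto
  then have "k * k' = 1\<^sub>m (p + q)" "k' * k = 1\<^sub>m (p + q)"
    unfolding gh(1) k'_def
    using mult_four_block_mat[OF gh(2) zero_carrier_mat zero_carrier_mat gh(4) g'(1) zero_carrier_mat zero_carrier_mat h'(1)]
      mult_four_block_mat[OF g'(1) zero_carrier_mat zero_carrier_mat h'(1) gh(2) zero_carrier_mat zero_carrier_mat gh(4)]
      g' h' gh(2,4) by auto
  ultimately show ?thesis by (rule that)
qed

lemma frames_iff:
  "(A, k) \<in> frames p q r \<longleftrightarrow> A \<in> carrier_mat (p + q) r \<and> inj_mat A \<and> k \<in> K_group p q"
  unfolding frames_def using inj_mat_iff_rank[of A "p + q" r] by auto

text \<open>Only values on frames count, so formulas valid for matrices of the right size, such as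
  the Leibniz expansion of a determinant, may be used.\<close>

definition regular :: "nat \<Rightarrow> nat \<Rightarrow> nat \<Rightarrow> (complex mat \<times> complex mat \<Rightarrow> complex) \<Rightarrow> bool" where
  "regular p q r f \<longleftrightarrow> (\<exists>g\<in>poly_functions p q r. \<forall>x\<in>frames p q r. f x = g x)"

lemma regular_const: "regular p q r (\<lambda>x. c)"
  unfolding regular_def by (auto intro: poly_functions.const)

lemma regular_fst: "i < p + q \<Longrightarrow> j < r \<Longrightarrow> regular p q r (\<lambda>x. fst x $$ (i, j))"
  unfolding regular_def by (rule bexI[OF _ poly_functions.entry1[where i = i and j = j]]) auto

lemma regular_snd: "i < p + q \<Longrightarrow> j < p + q \<Longrightarrow> regular p q r (\<lambda>x. snd x $$ (i, j))"
  unfolding regular_def by (rule bexI[OF _ poly_functions.entry2[where i = i and j = j]]) auto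

lemma regular_add: "regular p q r f \<Longrightarrow> regular p q r g \<Longrightarrow> regular p q r (\<lambda>x. f x + g x)"
  unfolding regular_def using poly_functions.add by (metis (no_types, lifting))

lemma regular_mult: "regular p q r f \<Longrightarrow> regular p q r g \<Longrightarrow> regular p q r (\<lambda>x. f x * g x)"
  unfolding regular_def using poly_functions.mult by (metis (no_types, lifting))

lemma regular_cong: "(\<And>x. x \<in> frames p q r \<Longrightarrow> f x = g x) \<Longrightarrow> regular p q r g \<Longrightarrow> regular p q r f"
  unfolding regular_def by auto

interpretation regular: function_ring "{f. regular p q r f}" for p q r
  by unfold_locales (auto intro: regular_const regular_add regular_mult)

lemmas regular_sum = regular.sum[unfolded mem_Collect_eq]
lemmas regular_prod = regular.prod[unfolded mem_Collect_eq]

definition regular_mat :: "nat \<Rightarrow> nat \<Rightarrow> nat \<Rightarrow> nat \<Rightarrow> nat \<Rightarrow> (complex mat \<times> complex mat \<Rightarrow> complex mat) \<Rightarrow> bool" where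
  "regular_mat p q r s t M \<longleftrightarrow> (\<forall>x\<in>frames p q r. M x \<in> carrier_mat s t) \<and>
     (\<forall>i<s. \<forall>j<t. regular p q r (\<lambda>x. M x $$ (i, j)))"

lemma regular_mat_const: "C \<in> carrier_mat s t \<Longrightarrow> regular_mat p q r s t (\<lambda>x. C)"
  unfolding regular_mat_def by (auto intro: regular_const)

lemma regular_mat_fst: "regular_mat p q r (p + q) r fst"
  unfolding regular_mat_def by (auto simp: frames_iff intro: regular_fst)

lemma regular_mat_snd: "regular_mat p q r (p + q) (p + q) snd"
  unfolding regular_mat_def by (auto simp: frames_iff K_group_carrier intro: regular_snd)

lemma regular_mat_mult:
  assumes "regular_mat p q r s t M" "regular_mat p q r t u N"
  shows "regular_mat p q r s u (\<lambda>x. M x * N x)"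
  unfolding regular_mat_def
proof (intro conjI ballI allI impI)
  fix x assume "x \<in> frames p q r"
  then show "M x * N x \<in> carrier_mat s u" using assms unfolding regular_mat_def by auto
next
  fix i j assume ij: "i < s" "j < u"
  have "regular p q r (\<lambda>x. \<Sum>k<t. M x $$ (i, k) * N x $$ (k, j))"
    by (intro regular_sum regular_mult) (use assms ij in \<open>auto simp: regular_mat_def\<close>)
  then show "regular p q r (\<lambda>x. (M x * N x) $$ (i, j))"
    by (rule regular_cong[rotated]) (use assms ij in \<open>auto simp: regular_mat_def intro!: mult_mat_index_sum\<close>)
qed

lemma regular_det:
  assumes "regular_mat p q r s s M"
  shows "regular p q r (\<lambda>x. det (M x))"
proof -
  have "regular p q r (\<lambda>x. \<Sum>\<pi>\<in>{\<pi>. \<pi> permutes {0..<s}}. signof \<pi> * (\<Prod>i = 0..<s. M x $$ (i, \<pi> i)))"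
  proof (intro regular_sum regular_mult regular_const regular_prod)
    fix \<pi> i assume "\<pi> \<in> {\<pi>. \<pi> permutes {0..<s}}" "i \<in> {0..<s}"
    then have "i < s" "\<pi> i < s" using permutes_in_image[of \<pi> "{0..<s}" i] by auto
    then show "regular p q r (\<lambda>x. M x $$ (i, \<pi> i))" using assms unfolding regular_mat_def by auto
  qed
  then show ?thesis
    by (rule regular_cong[rotated]) (use assms in \<open>auto simp: regular_mat_def intro!: det_def'\<close>)
qed

text \<open>The adjugate replaces the inverse of \<open>k\<close>: its entries are polynomials, and
  it differs from the inverse by the factor \<open>det k\<close>, which is nonzero on
  \<open>K\<close>.\<close>

lemma regular_mat_adj: "regular_mat p q r (p + q) (p + q) (\<lambda>x. adj_mat (snd x))"
  unfolding regular_mat_def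
proof (intro conjI ballI allI impI)
  fix x assume "x \<in> frames p q r"
  then have "snd x \<in> carrier_mat (p + q) (p + q)" by (auto simp: frames_def K_group_carrier)
  then show "adj_mat (snd x) \<in> carrier_mat (p + q) (p + q)" by (rule adj_mat(1))
next
  fix i j assume ij: "i < p + q" "j < p + q"
  let ?n = "p + q"
  let ?D = "\<lambda>x. mat (?n - 1) (?n - 1) (\<lambda>(a, b). snd x $$ (if a < j then a else Suc a, if b < i then b else Suc b))"
  have "regular_mat p q r (?n - 1) (?n - 1) ?D"
    unfolding regular_mat_def using ij by (auto intro!: regular_snd)
  then have "regular p q r (\<lambda>x. (-1) ^ (j + i) * det (?D x))"
    by (intro regular_mult regular_const regular_det)
  then show "regular p q r (\<lambda>x. adj_mat (snd x) $$ (i, j))"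
  proof (rule regular_cong[rotated])
    fix x assume "x \<in> frames p q r"
    then have "snd x \<in> carrier_mat ?n ?n" by (auto simp: frames_def K_group_carrier)
    then show "adj_mat (snd x) $$ (i, j) = (-1) ^ (j + i) * det (?D x)"
      using ij by (simp add: adj_mat_def cofactor_def mat_delete_def)
  qed
qed

text \<open>Products of functions turn finite intersections into principal open sets, so the
  generating sets form a base.\<close>

lemma openin_zariski_frames:
  "openin (zariski_frames p q r) U \<longleftrightarrow> U \<subseteq> frames p q r \<and>
     (\<forall>x\<in>U. \<exists>f. regular p q r f \<and> f x \<noteq> 0 \<and> {y \<in> frames p q r. f y \<noteq> 0} \<subseteq> U)" (is "_ \<longleftrightarrow> ?R U")
proof
  let ?B = "{{x \<in> frames p q r. f x \<noteq> 0} | f. f \<in> poly_functions p q r}"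
  {
    assume "openin (zariski_frames p q r) U"
    then have "generate_topology_on ?B U"
      unfolding zariski_frames_def openin_topology_generated_by_iff .
    then show "?R U"
    proof (induction rule: generate_topology_on.induct)
      case (Int U V)
      show ?case
      proof (intro conjI ballI)
        fix x assume x: "x \<in> U \<inter> V"
        obtain f where f: "regular p q r f" "f x \<noteq> 0" "{y \<in> frames p q r. f y \<noteq> 0} \<subseteq> U" using Int x by blast
        obtain g where g: "regular p q r g" "g x \<noteq> 0" "{y \<in> frames p q r. g y \<noteq> 0} \<subseteq> V" using Int x by blast
        show "\<exists>f. regular p q r f \<and> f x \<noteq> 0 \<and> {y \<in> frames p q r. f y \<noteq> 0} \<subseteq> U \<inter> V"
          using f g by (intro exI[of _ "\<lambda>x. f x * g x"]) (auto intro: regular_mult)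
      qed (use Int in auto)
    next
      case (UN K)
      show ?case
      proof (intro conjI ballI)
        fix x assume "x \<in> \<Union>K"
        then obtain k where k: "k \<in> K" "x \<in> k" by auto
        then obtain f where "regular p q r f" "f x \<noteq> 0" "{y \<in> frames p q r. f y \<noteq> 0} \<subseteq> k"
          using UN[OF k(1)] by blast
        then show "\<exists>f. regular p q r f \<and> f x \<noteq> 0 \<and> {y \<in> frames p q r. f y \<noteq> 0} \<subseteq> \<Union>K"
          using k(1) by (intro exI[of _ f]) auto
      qed (use UN in auto)
    next
      case (Basis s)
      then obtain f where f: "f \<in> poly_functions p q r" "s = {x \<in> frames p q r. f x \<noteq> 0}" by auto
      then have "regular p q r f" unfolding regular_def by auto
      then show ?case using f(2) by auto
    qed auto
  }
  assume R: "?R U"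
  have "openin (zariski_frames p q r) {y \<in> frames p q r. f y \<noteq> 0}" if f: "regular p q r f" for f
  proof -
    obtain g where g: "g \<in> poly_functions p q r" "\<forall>x\<in>frames p q r. f x = g x"
      using f unfolding regular_def by auto
    then have "{y \<in> frames p q r. f y \<noteq> 0} \<in> ?B" by auto
    then show ?thesis unfolding zariski_frames_def by (rule topology_generated_by_Basis)
  qed
  then show "openin (zariski_frames p q r) U"
    using R by (subst openin_subopen) blast
qed

lemma openin_nonzero: "regular p q r f \<Longrightarrow> openin (zariski_frames p q r) {y \<in> frames p q r. f y \<noteq> 0}"
  unfolding openin_zariski_frames by blast

lemma closedin_zero_set:
  assumes "\<And>f. f \<in> \<Phi> \<Longrightarrow> regular p q r f"
  shows "closedin (zariski_frames p q r) {x \<in> frames p q r. \<forall>f\<in>\<Phi>. f x = 0}"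
proof -
  have e: "frames p q r - {x \<in> frames p q r. \<forall>f\<in>\<Phi>. f x = 0} = (\<Union>f\<in>\<Phi>. {y \<in> frames p q r. f y \<noteq> 0})" by auto
  show ?thesis unfolding closedin_def topspace_zariski_frames e
    using assms openin_nonzero by (auto intro!: openin_Union)
qed

lemma closedin_zariski_framesE:
  assumes "closedin (zariski_frames p q r) C" "x \<in> frames p q r" "x \<notin> C"
  obtains f where "regular p q r f" "f x \<noteq> 0" "\<forall>y\<in>C. f y = 0"
proof -
  have "openin (zariski_frames p q r) (frames p q r - C)" "C \<subseteq> frames p q r"
    using assms(1) by (auto simp: closedin_def topspace_zariski_frames)
  then obtain f where "regular p q r f" "f x \<noteq> 0" "{y \<in> frames p q r. f y \<noteq> 0} \<subseteq> frames p q r - C"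
    unfolding openin_zariski_frames using assms(2,3) by blast
  then show ?thesis using that \<open>C \<subseteq> frames p q r\<close> by blast
qed

section \<open>Lines of matrices and irreducibility\<close>

definition frame_line :: "nat \<Rightarrow> nat \<Rightarrow> nat \<Rightarrow> complex mat \<times> complex mat \<Rightarrow> complex mat \<times> complex mat \<Rightarrow>
    complex \<Rightarrow> complex mat \<times> complex mat" where
  "frame_line p q r x y t =
     (mat (p + q) r (\<lambda>ij. (1 - t) * fst x $$ ij + t * fst y $$ ij),
      mat (p + q) (p + q) (\<lambda>ij. (1 - t) * snd x $$ ij + t * snd y $$ ij))"

lemma frame_line_ends:
  assumes "x \<in> frames p q r" "y \<in> frames p q r"
  shows "frame_line p q r x y 0 = x" "frame_line p q r x y 1 = y"
  using assms K_group_carrier[of "snd x" p q] K_group_carrier[of "snd y" p q]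
  unfolding frame_line_def frames_def by (auto intro!: prod_eqI eq_matI)

lemma regular_on_line:
  assumes "regular p q r f"
  obtains P where "\<And>t. frame_line p q r x y t \<in> frames p q r \<Longrightarrow> f (frame_line p q r x y t) = poly P t"
proof -
  have "\<exists>P. \<forall>t. g (frame_line p q r x y t) = poly P t" if "g \<in> poly_functions p q r" for g
    using that
  proof induction
    case (const c)
    show ?case by (intro exI[of _ "[:c:]"]) auto
  next
    case (entry1 i j)
    then show ?case
      by (intro exI[of _ "[:fst x $$ (i, j), fst y $$ (i, j) - fst x $$ (i, j):]"])
         (auto simp: frame_line_def algebra_simps)
  next
    case (entry2 i j)
    then show ?case
      by (intro exI[of _ "[:snd x $$ (i, j), snd y $$ (i, j) - snd x $$ (i, j):]"])
         (auto simp: frame_line_def algebra_simps)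
  next
    case (add f g)
    then obtain P Q where "\<forall>t. f (frame_line p q r x y t) = poly P t" "\<forall>t. g (frame_line p q r x y t) = poly Q t" by blast
    then show ?case by (intro exI[of _ "P + Q"]) auto
  next
    case (mult f g)
    then obtain P Q where "\<forall>t. f (frame_line p q r x y t) = poly P t" "\<forall>t. g (frame_line p q r x y t) = poly Q t" by blast
    then show ?case by (intro exI[of _ "P * Q"]) auto
  qed
  then show ?thesis using assms that unfolding regular_def by metis
qed

lemma det_mat_poly:
  assumes "\<And>i j. i < s \<Longrightarrow> j < s \<Longrightarrow> \<exists>P. \<forall>t. F t i j = poly P t"
  shows "\<exists>P. \<forall>t. det (mat s s (\<lambda>(i, j). F t i j)) = poly P (t :: complex)"
proof -
  have "\<exists>P. \<forall>i<s. \<forall>j<s. \<forall>t. F t i j = poly (P i j) t" using assms by metis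
  then obtain P where P: "\<And>i j t. i < s \<Longrightarrow> j < s \<Longrightarrow> F t i j = poly (P i j) t" by blast
  have "det (mat s s (\<lambda>(i, j). F t i j)) =
      poly (\<Sum>\<pi>\<in>{\<pi>. \<pi> permutes {0..<s}}. signof \<pi> * (\<Prod>i = 0..<s. P i (\<pi> i))) t" for t
  proof -
    have "signof \<pi> * (\<Prod>i = 0..<s. mat s s (\<lambda>(i, j). F t i j) $$ (i, \<pi> i)) =
        poly (signof \<pi> * (\<Prod>i = 0..<s. P i (\<pi> i))) t" if "\<pi> permutes {0..<s}" for \<pi>
    proof -
      have "\<pi> i < s" if "i < s" for i using permutes_in_image[OF \<open>\<pi> permutes {0..<s}\<close>, of i] that by simp
      then show ?thesis using P by (auto simp: poly_prod sign_def intro!: prod.cong)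
    qed
    then show ?thesis by (subst det_def'[of _ s]) (auto simp: poly_sum intro!: sum.cong)
  qed
  then show ?thesis by blast
qed

lemma finite_roots_nonzero: "poly P (a :: complex) \<noteq> 0 \<Longrightarrow> finite {t. poly P t = 0}"
  by (rule poly_roots_finite) auto

text \<open>Full rank and invertibility at \<open>x\<close> are witnessed by two determinants that
  are polynomial in \<open>t\<close> and nonzero at \<open>t = 0\<close>. Wherever both are nonzero,
  the point of the line is a frame.\<close>

lemma finite_line_not_frames:
  assumes x: "x \<in> frames p q r" and y: "y \<in> frames p q r"
  shows "finite {t. frame_line p q r x y t \<notin> frames p q r}"
proof -
  let ?n = "p + q" and ?l = "frame_line p q r x y"
  obtain A k A' k' where xy: "x = (A, k)" "y = (A', k')" by (metis surj_pair)
  have A: "A \<in> carrier_mat ?n r" "inj_mat A" and k: "k \<in> K_group p q" "k' \<in> K_group p q"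
    using x y unfolding xy frames_iff by auto
  obtain Q where Q: "Q \<in> carrier_mat r ?n" "det (Q * A) \<noteq> 0" using inj_mat_minor[OF A] .
  have lc: "fst (?l t) \<in> carrier_mat ?n r" "snd (?l t) \<in> carrier_mat ?n ?n" for t
    unfolding frame_line_def by auto
  have l0: "?l 0 = x" using frame_line_ends[OF x y] by simp
  have "\<exists>P. \<forall>t. det (mat r r (\<lambda>(i, j). \<Sum>m<?n. Q $$ (i, m) * ((1 - t) * A $$ (m, j) + t * A' $$ (m, j)))) = poly P t"
  proof (rule det_mat_poly)
    fix i j
    show "\<exists>P. \<forall>t. (\<Sum>m<?n. Q $$ (i, m) * ((1 - t) * A $$ (m, j) + t * A' $$ (m, j))) = poly P t"
      by (intro exI[of _ "\<Sum>m<?n. [:Q $$ (i, m) * A $$ (m, j), Q $$ (i, m) * (A' $$ (m, j) - A $$ (m, j)):]"])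
         (auto simp: poly_sum algebra_simps intro!: sum.cong)
  qed
  then obtain P1 where P1: "\<And>t. det (mat r r (\<lambda>(i, j). \<Sum>m<?n. Q $$ (i, m) * ((1 - t) * A $$ (m, j) + t * A' $$ (m, j)))) = poly P1 t" by blast
  have e1: "det (Q * fst (?l t)) = poly P1 t" for t
    unfolding P1[symmetric]
    by (rule arg_cong[of _ _ det], intro eq_matI)
       (use Q lc[of t] in \<open>auto simp: xy frame_line_def scalar_prod_def atLeast0LessThan intro!: sum.cong\<close>)
  have "\<exists>P. \<forall>t. det (mat ?n ?n (\<lambda>(i, j). (1 - t) * k $$ (i, j) + t * k' $$ (i, j))) = poly P t"
  proof (rule det_mat_poly)
    fix i j
    show "\<exists>P. \<forall>t. (1 - t) * k $$ (i, j) + t * k' $$ (i, j) = poly P t"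
      by (intro exI[of _ "[:k $$ (i, j), k' $$ (i, j) - k $$ (i, j):]"]) (auto simp: algebra_simps)
  qed
  then obtain P2 where P2: "\<And>t. det (mat ?n ?n (\<lambda>(i, j). (1 - t) * k $$ (i, j) + t * k' $$ (i, j))) = poly P2 t" by blast
  have e2: "det (snd (?l t)) = poly P2 t" for t
    unfolding P2[symmetric] by (rule arg_cong[of _ _ det], intro eq_matI) (auto simp: xy frame_line_def)
  have "poly P1 0 \<noteq> 0" using e1[of 0] l0 Q(2) xy by simp
  moreover have "poly P2 0 \<noteq> 0" using e2[of 0] l0 k(1) xy by (simp add: K_group_iff)
  ultimately have fin: "finite ({t. poly P1 t = 0} \<union> {t. poly P2 t = 0})" using finite_roots_nonzero by auto
  have "?l t \<in> frames p q r" if "poly P1 t \<noteq> 0" "poly P2 t \<noteq> 0" for t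
  proof -
    have "inj_mat (fst (?l t))" using det_nonzero_imp_inj_mat[OF Q(1) lc(1)] e1 that(1) by simp
    moreover have "snd (?l t) \<in> K_group p q"
      using e2 that(2) lc(2)[of t] K_group_block[OF k(1)] K_group_block[OF k(2)]
      unfolding K_group_iff xy by (auto simp: frame_line_def)
    ultimately show ?thesis using lc(1) frames_iff by (metis prod.collapse)
  qed
  then have "{t. ?l t \<notin> frames p q r} \<subseteq> {t. poly P1 t = 0} \<union> {t. poly P2 t = 0}" by auto
  then show ?thesis using fin finite_subset by blast
qed

text \<open>Two open sets meeting \<open>M\<close> contain principal open sets of functions nonzero
  at points \<open>x\<close> and \<open>y\<close> of \<open>M\<close>. On the line through
  \<open>x\<close> and \<open>y\<close> both functions are nonzero polynomials, so a general point
  of the line lies in both sets and in \<open>M\<close>.\<close>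

lemma irreducible_in_framesI:
  assumes M: "M \<subseteq> frames p q r" "M \<noteq> {}"
    and line: "\<And>x y. x \<in> M \<Longrightarrow> y \<in> M \<Longrightarrow> finite {t. frame_line p q r x y t \<notin> M}"
  shows "irreducible_in (zariski_frames p q r) M"
  unfolding irreducible_in_def topspace_zariski_frames
proof (intro conjI M allI impI)
  fix U V assume UV: "openin (zariski_frames p q r) U \<and> openin (zariski_frames p q r) V \<and> U \<inter> M \<noteq> {} \<and> V \<inter> M \<noteq> {}"
  then obtain x y where xy: "x \<in> U" "x \<in> M" "y \<in> V" "y \<in> M" by auto
  obtain f where f: "regular p q r f" "f x \<noteq> 0" "{y \<in> frames p q r. f y \<noteq> 0} \<subseteq> U"
    using UV xy(1) unfolding openin_zariski_frames by meson
  obtain g where g: "regular p q r g" "g y \<noteq> 0" "{y \<in> frames p q r. g y \<noteq> 0} \<subseteq> V"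
    using UV xy(3) unfolding openin_zariski_frames by meson
  have fr: "x \<in> frames p q r" "y \<in> frames p q r" using xy M by auto
  let ?l = "frame_line p q r x y"
  obtain P where P: "\<And>t. ?l t \<in> frames p q r \<Longrightarrow> f (?l t) = poly P t" using regular_on_line[OF f(1)] by metis
  obtain Q where Q: "\<And>t. ?l t \<in> frames p q r \<Longrightarrow> g (?l t) = poly Q t" using regular_on_line[OF g(1)] by metis
  have "poly P 0 \<noteq> 0" "poly Q 1 \<noteq> 0"
    using P[of 0] Q[of 1] f(2) g(2) fr frame_line_ends[OF fr] by auto
  then have "finite ({t. ?l t \<notin> M} \<union> {t. poly P t = 0} \<union> {t. poly Q t = 0})"
    using line[OF xy(2,4)] finite_roots_nonzero by auto
  from ex_new_if_finite[OF infinite_UNIV_char_0 this] obtain t where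
    "t \<notin> {t. ?l t \<notin> M} \<union> {t. poly P t = 0} \<union> {t. poly Q t = 0}" ..
  then have t: "?l t \<in> M" "poly P t \<noteq> 0" "poly Q t \<noteq> 0" by auto
  then have "?l t \<in> frames p q r" using M by auto
  then have "?l t \<in> U \<inter> V \<inter> M" using t P Q f(3) g(3) by auto
  then show "U \<inter> V \<inter> M \<noteq> {}" by blast
qed

definition block_positions :: "nat \<Rightarrow> nat \<Rightarrow> (nat \<times> nat) set" where
  "block_positions p q = {(i, j). i < p + q \<and> j < p + q \<and> (i < p \<longleftrightarrow> j < p)}"

lemma finite_block_positions: "finite (block_positions p q)"
  by (rule finite_subset[of _ "{..<p + q} \<times> {..<p + q}"]) (auto simp: block_positions_def)

text \<open>The coordinates are the entries of the first matrix and the diagonal-block entries of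
  the second. Off-block entries are zero on \<open>K\<close> and contribute polynomials of degree
  \<open>0\<close>, which keeps the bound sharp.\<close>

lemma chain_in_frames_bound:
  assumes "chain_in (zariski_frames p q r) (frames p q r) m"
  shows "m \<le> (p + q) * r + card (block_positions p q)"
proof -
  let ?n = "p + q" and ?T = "zariski_frames p q r"
  define I where "I = ({..<?n} \<times> {..<r}) <+> block_positions p q"
  define co where "co = (\<lambda>i (x :: complex mat \<times> complex mat). case i of Inl ij \<Rightarrow> fst x $$ ij | Inr ij \<Rightarrow> snd x $$ ij)"
  have fI: "finite I" and cI: "card I = ?n * r + card (block_positions p q)"
    unfolding I_def using finite_block_positions[of p q] by (auto simp: card_Plus)
  obtain h where h: "bij_betw h {..<card I} I" using ex_bij_betw_nat_finite[OF fI] by (auto simp: atLeast0LessThan)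
  define \<xi> where "\<xi> = (\<lambda>k. co (h k))"
  have coord: "poly_on (frames p q r) \<xi> (card I) 1 (co i)" if "i \<in> I" for i
  proof -
    have "i \<in> h ` {..<card I}" using h that by (simp add: bij_betw_def)
    then obtain k where "k < card I" "h k = i" by auto
    then show ?thesis using poly_on_coord[of k "card I" "frames p q r" \<xi>] unfolding \<xi>_def by auto
  qed
  have po: "\<exists>d. poly_on (frames p q r) \<xi> (card I) d g" if "g \<in> poly_functions p q r" for g
    using that
  proof induction
    case (const c)
    then show ?case using poly_on_const by blast
  next
    case (entry1 i j)
    then have "poly_on (frames p q r) \<xi> (card I) 1 (co (Inl (i, j)))" by (intro coord) (auto simp: I_def)
    then show ?case unfolding co_def by auto
  next
    case (entry2 i j)
    show ?case
    proof (cases "(i < p) = (j < p)")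
      case True
      then have "poly_on (frames p q r) \<xi> (card I) 1 (co (Inr (i, j)))"
        using entry2 by (intro coord) (auto simp: I_def block_positions_def)
      then show ?thesis unfolding co_def by auto
    next
      case False
      have "poly_on (frames p q r) \<xi> (card I) 0 (\<lambda>x. snd x $$ (i, j)) \<longleftrightarrow> poly_on (frames p q r) \<xi> (card I) 0 (\<lambda>x. 0)"
        unfolding poly_on_def using False entry2 by (auto simp: frames_def K_group_block)
      then show ?thesis using poly_on_const by blast
    qed
  next
    case (add f g)
    then obtain d e where "poly_on (frames p q r) \<xi> (card I) d f" "poly_on (frames p q r) \<xi> (card I) e g" by blast
    then have "poly_on (frames p q r) \<xi> (card I) (max d e) f" "poly_on (frames p q r) \<xi> (card I) (max d e) g"
      by (auto elim: poly_on_mono)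
    then show ?case using poly_on_add by blast
  next
    case (mult f g)
    then show ?case using poly_on_mult by blast
  qed
  obtain Z where Z: "\<And>i. i \<le> m \<Longrightarrow> closedin ?T (Z i)" "\<And>i. i \<le> m \<Longrightarrow> irreducible_in ?T (Z i)"
      "\<And>i. i < m \<Longrightarrow> Z i \<subset> Z (Suc i)"
    using assms unfolding chain_in_def topspace_zariski_frames[symmetric] by auto
  have "m \<le> card I"
  proof (rule regular.chain_length_bound[where p = p and q = q and r = r and Z = Z and \<xi> = \<xi> and X = "frames p q r"])
    fix f assume "f \<in> {f. regular p q r f}"
    then obtain g where g: "g \<in> poly_functions p q r" "\<forall>x\<in>frames p q r. f x = g x" unfolding regular_def by auto
    then show "\<exists>d. poly_on (frames p q r) \<xi> (card I) d f" using po[OF g(1)] unfolding poly_on_def by simp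
  next
    \<comment> \<open>Irreducibility of \<open>Z i\<close> is used as primeness of its vanishing
      ideal.\<close>
    fix i g h assume i: "i \<le> m" and gh: "g \<in> {f. regular p q r f}" "h \<in> {f. regular p q r f}" "\<forall>x\<in>Z i. g x * h x = 0"
    have Zf: "Z i \<subseteq> frames p q r" using Z(1)[OF i] closedin_subset topspace_zariski_frames by metis
    show "(\<forall>x\<in>Z i. g x = 0) \<or> (\<forall>x\<in>Z i. h x = 0)"
    proof (rule ccontr)
      let ?U = "{y \<in> frames p q r. g y \<noteq> 0}" and ?V = "{y \<in> frames p q r. h y \<noteq> 0}"
      assume "\<not> ?thesis"
      then have "?U \<inter> Z i \<noteq> {}" "?V \<inter> Z i \<noteq> {}" using Zf by auto
      moreover have "openin ?T ?U" "openin ?T ?V" using gh openin_nonzero by auto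
      ultimately have "?U \<inter> ?V \<inter> Z i \<noteq> {}" using Z(2)[OF i] unfolding irreducible_in_def by meson
      then show False using gh(3) by auto
    qed
  next
    show "Z 0 \<noteq> {}" using Z(2)[of 0] unfolding irreducible_in_def by auto
    show "Z m \<subseteq> frames p q r" using Z(1)[of m] closedin_subset topspace_zariski_frames by blast
    show "Z i \<subseteq> Z (Suc i)" if "i < m" for i using Z(3)[OF that] by auto
  next
    fix i assume i: "i < m"
    then obtain x where x: "x \<in> Z (Suc i)" "x \<notin> Z i" using Z(3) by blast
    then have "x \<in> frames p q r" using Z(1)[of "Suc i"] i closedin_subset topspace_zariski_frames by fastforce
    then obtain f where "regular p q r f" "f x \<noteq> 0" "\<forall>y\<in>Z i. f y = 0"
      using closedin_zariski_framesE[OF Z(1)[of i] _ x(2)] i by auto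
    then show "\<exists>g\<in>{f. regular p q r f}. (\<forall>x\<in>Z i. g x = 0) \<and> (\<exists>x\<in>Z (Suc i). g x \<noteq> 0)" using x(1) by auto
  qed
  then show ?thesis using cI by simp
qed

section \<open>Frames of points of the double flag variety\<close>

definition coord_space :: "nat \<Rightarrow> nat set \<Rightarrow> complex vec set" where
  "coord_space n I = {x \<in> carrier_vec n. \<forall>m<n. m \<notin> I \<longrightarrow> x $ m = 0}"

lemma V_plus_coord: "V_plus p q = coord_space (p + q) {..<p}"
proof
  show "V_plus p q \<subseteq> coord_space (p + q) {..<p}" unfolding V_plus_def coord_space_def by auto
  show "coord_space (p + q) {..<p} \<subseteq> V_plus p q"
  proof
    fix x assume x: "x \<in> coord_space (p + q) {..<p}"
    then have "x = vec p (\<lambda>i. x $ i) @\<^sub>v 0\<^sub>v q" unfolding coord_space_def by (intro eq_vecI) auto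
    then show "x \<in> V_plus p q" unfolding V_plus_def by (metis (mono_tags, lifting) mem_Collect_eq vec_carrier)
  qed
qed

lemma V_minus_coord: "V_minus p q = coord_space (p + q) {p..<p + q}"
proof
  show "V_minus p q \<subseteq> coord_space (p + q) {p..<p + q}" unfolding V_minus_def coord_space_def by auto
  show "coord_space (p + q) {p..<p + q} \<subseteq> V_minus p q"
  proof
    fix x assume x: "x \<in> coord_space (p + q) {p..<p + q}"
    then have "x = 0\<^sub>v p @\<^sub>v vec q (\<lambda>i. x $ (p + i))" unfolding coord_space_def by (intro eq_vecI) auto
    then show "x \<in> V_minus p q" unfolding V_minus_def by (metis (mono_tags, lifting) mem_Collect_eq vec_carrier)
  qed
qed

lemma std_flag_plus_coord: "std_flag_plus p q = map (\<lambda>i. coord_space (p + q) {..<i}) [0..<p + 1]"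
  unfolding std_flag_plus_def
proof (rule map_cong[OF refl])
  fix i assume "i \<in> set [0..<p + 1]"
  then have i: "i \<le> p" by auto
  show "{v @\<^sub>v 0\<^sub>v (p - i) @\<^sub>v 0\<^sub>v q | v. v \<in> carrier_vec i} = coord_space (p + q) {..<i}" (is "?L = ?R")
  proof
    show "?L \<subseteq> ?R" using i unfolding coord_space_def by (auto intro!: carrier_vecI)
    show "?R \<subseteq> ?L"
    proof
      fix x assume x: "x \<in> ?R"
      have "x = vec i (\<lambda>i. x $ i) @\<^sub>v 0\<^sub>v (p - i) @\<^sub>v 0\<^sub>v q"
        using x i unfolding coord_space_def by (intro eq_vecI) auto
      then show "x \<in> ?L" by (metis (mono_tags, lifting) mem_Collect_eq vec_carrier)
    qed
  qed
qed

lemma std_flag_minus_coord: "std_flag_minus p q = map (\<lambda>j. coord_space (p + q) {p..<p + j}) [0..<q + 1]"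
  unfolding std_flag_minus_def
proof (rule map_cong[OF refl])
  fix i assume "i \<in> set [0..<q + 1]"
  then have i: "i \<le> q" by auto
  show "{0\<^sub>v p @\<^sub>v v @\<^sub>v 0\<^sub>v (q - i) | v. v \<in> carrier_vec i} = coord_space (p + q) {p..<p + i}" (is "?L = ?R")
  proof
    show "?L \<subseteq> ?R" using i unfolding coord_space_def by (auto intro!: carrier_vecI)
    show "?R \<subseteq> ?L"
    proof
      fix x assume x: "x \<in> ?R"
      have "x = 0\<^sub>v p @\<^sub>v vec i (\<lambda>i. x $ (p + i)) @\<^sub>v 0\<^sub>v (q - i)"
        using x i unfolding coord_space_def by (intro eq_vecI) auto
      then show "x \<in> ?L" by (metis (mono_tags, lifting) mem_Collect_eq vec_carrier)
    qed
  qed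
qed

definition sub_cols :: "complex mat \<Rightarrow> nat \<Rightarrow> nat \<Rightarrow> complex mat" where
  "sub_cols k s c = mat (dim_row k) c (\<lambda>(i, j). k $$ (i, s + j))"

lemma sub_cols_carrier: "k \<in> carrier_mat n m \<Longrightarrow> sub_cols k s c \<in> carrier_mat n c"
  unfolding sub_cols_def by auto

lemma mult_sub_cols:
  assumes k: "k \<in> carrier_mat n m" and s: "s + c \<le> m" and x: "x \<in> carrier_vec m" "\<forall>i<m. i \<notin> {s..<s + c} \<longrightarrow> x $ i = 0"
  shows "k *\<^sub>v x = sub_cols k s c *\<^sub>v vec c (\<lambda>j. x $ (s + j))"
proof (rule eq_vecI)
  fix i assume "i < dim_vec (sub_cols k s c *\<^sub>v vec c (\<lambda>j. x $ (s + j)))"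
  then have i: "i < n" using k by (auto simp: sub_cols_def)
  have "(k *\<^sub>v x) $ i = (\<Sum>j<m. k $$ (i, j) * x $ j)" by (rule mult_mat_vec_index_sum[OF k x(1) i])
  also have "\<dots> = (\<Sum>j\<in>{s..<s + c}. k $$ (i, j) * x $ j)"
    using s x(2) by (intro sum.mono_neutral_right) auto
  also have "\<dots> = (\<Sum>j<c. k $$ (i, s + j) * x $ (s + j))"
    using sum.shift_bounds_nat_ivl[of "\<lambda>j. k $$ (i, j) * x $ j" 0 s c] by (simp add: atLeast0LessThan add.commute)
  also have "\<dots> = (sub_cols k s c *\<^sub>v vec c (\<lambda>j. x $ (s + j))) $ i"
    using i k by (subst mult_mat_vec_index_sum[OF sub_cols_carrier[OF k]]) (auto simp: sub_cols_def)
  finally show "(k *\<^sub>v x) $ i = (sub_cols k s c *\<^sub>v vec c (\<lambda>j. x $ (s + j))) $ i" .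
qed (use k in \<open>auto simp: sub_cols_def\<close>)

lemma pad_vec:
  assumes "y \<in> carrier_vec c" "s + c \<le> m"
  obtains x where "x \<in> carrier_vec m" "\<forall>i<m. i \<notin> {s..<s + c} \<longrightarrow> x $ i = 0"
    "vec c (\<lambda>j. x $ (s + j)) = y"
proof -
  define x where "x = vec m (\<lambda>i. if i \<in> {s..<s + c} then y $ (i - s) else 0)"
  have "vec c (\<lambda>j. x $ (s + j)) = y" unfolding x_def using assms by (intro eq_vecI) auto
  then show ?thesis by (intro that[of x]) (auto simp: x_def)
qed

lemma image_coord_space:
  assumes k: "k \<in> carrier_mat n n" and s: "s + c \<le> n"
  shows "(\<lambda>v. k *\<^sub>v v) ` coord_space n {s..<s + c} = col_span n (sub_cols k s c)"
  unfolding col_span_eq[OF sub_cols_carrier[OF k]]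
proof
  show "(\<lambda>v. k *\<^sub>v v) ` coord_space n {s..<s + c} \<subseteq> (\<lambda>x. sub_cols k s c *\<^sub>v x) ` carrier_vec c"
    using mult_sub_cols[OF k s] unfolding coord_space_def by fastforce
  show "(\<lambda>x. sub_cols k s c *\<^sub>v x) ` carrier_vec c \<subseteq> (\<lambda>v. k *\<^sub>v v) ` coord_space n {s..<s + c}"
  proof
    fix z assume "z \<in> (\<lambda>x. sub_cols k s c *\<^sub>v x) ` carrier_vec c"
    then obtain y where y: "y \<in> carrier_vec c" "z = sub_cols k s c *\<^sub>v y" by auto
    obtain x where x: "x \<in> carrier_vec n" "\<forall>i<n. i \<notin> {s..<s + c} \<longrightarrow> x $ i = 0"
      "vec c (\<lambda>j. x $ (s + j)) = y" by (rule pad_vec[OF y(1) s])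
    have "z = k *\<^sub>v x" using mult_sub_cols[OF k s x(1,2)] x(3) y(2) by simp
    then show "z \<in> (\<lambda>v. k *\<^sub>v v) ` coord_space n {s..<s + c}" using x(1,2) unfolding coord_space_def by auto
  qed
qed

lemma inj_sub_cols:
  assumes k: "k \<in> carrier_mat n m" and s: "s + c \<le> m" and i: "inj_mat k"
  shows "inj_mat (sub_cols k s c)"
  unfolding inj_mat_def
proof (intro ballI impI)
  fix y assume "y \<in> carrier_vec (dim_col (sub_cols k s c))" "sub_cols k s c *\<^sub>v y = 0\<^sub>v (dim_row (sub_cols k s c))"
  then have y: "y \<in> carrier_vec c" "sub_cols k s c *\<^sub>v y = 0\<^sub>v n" using k by (auto simp: sub_cols_def)
  obtain x where x: "x \<in> carrier_vec m" "\<forall>i<m. i \<notin> {s..<s + c} \<longrightarrow> x $ i = 0"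
    "vec c (\<lambda>j. x $ (s + j)) = y" by (rule pad_vec[OF y(1) s])
  have "k *\<^sub>v x = 0\<^sub>v n" using mult_sub_cols[OF k s x(1,2)] x(3) y(2) by simp
  then have "x = 0\<^sub>v m" using i x(1) k unfolding inj_mat_def by auto
  then show "y = 0\<^sub>v (dim_col (sub_cols k s c))" using x(3)[symmetric] s by (auto simp: sub_cols_def)
qed

lemma mult_one_vec_image: "(\<lambda>v. 1\<^sub>m n *\<^sub>v v) ` coord_space n I = coord_space n I"
  by (auto simp: coord_space_def image_iff)

lemma coord_space_subspace:
  assumes k: "k \<in> carrier_mat n n" "det k \<noteq> 0" and s: "s + c \<le> n"
  shows "lin_subspace n ((\<lambda>v. k *\<^sub>v v) ` coord_space n {s..<s + c})"
    "lin_dim n ((\<lambda>v. k *\<^sub>v v) ` coord_space n {s..<s + c}) = c"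
proof -
  note e = image_coord_space[OF k(1) s] and cc = sub_cols_carrier[OF k(1)]
  show "lin_subspace n ((\<lambda>v. k *\<^sub>v v) ` coord_space n {s..<s + c})"
    unfolding e by (rule col_span_subspace(1)[OF cc])
  have "inj_mat k" using inj_mat_det[OF k(1)] k(2) by simp
  then have "inj_mat (sub_cols k s c)" by (rule inj_sub_cols[OF k(1) s])
  then show "lin_dim n ((\<lambda>v. k *\<^sub>v v) ` coord_space n {s..<s + c}) = c"
    unfolding e col_span_subspace(2)[OF cc] using inj_mat_iff_rank[OF cc] by simp
qed

lemma lin_dim_coord_space: "s + c \<le> n \<Longrightarrow> lin_dim n (coord_space n {s..<s + c}) = c"
  using coord_space_subspace(2)[of "1\<^sub>m n" n s c] by (simp add: mult_one_vec_image)

lemma K_group_inj: "k \<in> K_group p q \<Longrightarrow> inj_mat k"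
  using inj_mat_det[of k "p + q"] by (simp add: K_group_iff)

lemma K_group_image_block:
  assumes k: "k \<in> K_group p q" and b: "I = {0..<0 + p} \<or> I = {p..<p + q}"
  shows "(\<lambda>v. k *\<^sub>v v) ` coord_space (p + q) I \<subseteq> coord_space (p + q) I"
proof
  fix y assume "y \<in> (\<lambda>v. k *\<^sub>v v) ` coord_space (p + q) I"
  then obtain x where x: "x \<in> carrier_vec (p + q)" "\<And>m. m < p + q \<Longrightarrow> m \<notin> I \<Longrightarrow> x $ m = 0" "y = k *\<^sub>v x"
    unfolding coord_space_def by auto
  note kc = K_group_carrier[OF k]
  have "y $ i = 0" if i: "i < p + q" "i \<notin> I" for i
    unfolding x(3) mult_mat_vec_index_sum[OF kc x(1) i(1)]
  proof (intro sum.neutral ballI)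
    fix j assume "j \<in> {..<p + q}"
    then show "k $$ (i, j) * x $ j = 0"
      using x(2)[of j] K_group_block[OF k i(1), of j] i b by (cases "j \<in> I") auto
  qed
  then show "y \<in> coord_space (p + q) I" unfolding coord_space_def x(3) using kc x(1) by auto
qed

lemma coord_space_mono: "I \<subseteq> J \<Longrightarrow> coord_space n I \<subseteq> coord_space n J"
  unfolding coord_space_def by auto

text \<open>Writing \<open>{0..<0 + i}\<close> gives both flags the shape
  \<open>{s..<s + i}\<close>, with \<open>s = 0\<close> or \<open>s = p\<close>, so that later
  statements can cover both at once.\<close>

lemma frame_map_alt:
  "frame_map p q (A, k) = (col_span (p + q) A,
     map (\<lambda>i. (\<lambda>v. k *\<^sub>v v) ` coord_space (p + q) {0..<0 + i}) [0..<p + 1],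
     map (\<lambda>j. (\<lambda>v. k *\<^sub>v v) ` coord_space (p + q) {p..<p + j}) [0..<q + 1])"
  unfolding frame_map_def std_flag_plus_coord std_flag_minus_coord by (simp add: comp_def atLeast0LessThan)

lemma flag_in_Fl:
  assumes k: "k \<in> K_group p q" and s: "(s = 0 \<and> d = p) \<or> (s = p \<and> d = q)"
  shows "map (\<lambda>i. (\<lambda>v. k *\<^sub>v v) ` coord_space (p + q) {s..<s + i}) [0..<d + 1] \<in> Fl (p + q) (coord_space (p + q) {s..<s + d})"
proof -
  let ?n = "p + q"
  have kc: "k \<in> carrier_mat ?n ?n" "det k \<noteq> 0" using k by (auto simp: K_group_iff)
  have sd: "s + d \<le> ?n" using s by auto
  have dim: "lin_dim ?n (coord_space ?n {s..<s + d}) = d" by (rule lin_dim_coord_space[OF sd])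
  have sub: "(\<lambda>v. k *\<^sub>v v) ` coord_space ?n {s..<s + i} \<subseteq> coord_space ?n {s..<s + d}" if "i \<le> d" for i
  proof -
    have "(\<lambda>v. k *\<^sub>v v) ` coord_space ?n {s..<s + i} \<subseteq> (\<lambda>v. k *\<^sub>v v) ` coord_space ?n {s..<s + d}"
      using that by (intro image_mono coord_space_mono) auto
    also have "\<dots> \<subseteq> coord_space ?n {s..<s + d}"
      using s by (intro K_group_image_block[OF k]) auto
    finally show ?thesis .
  qed
  have mono: "(\<lambda>v. k *\<^sub>v v) ` coord_space ?n {s..<s + i} \<subseteq> (\<lambda>v. k *\<^sub>v v) ` coord_space ?n {s..<s + Suc i}" for i
    by (intro image_mono coord_space_mono) auto
  show ?thesis unfolding Fl_def dim
    using sub mono coord_space_subspace[OF kc, of s] sd by (auto simp: nth_append simp del: upt_Suc)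
qed

lemma frame_map_in_variety:
  assumes x: "(A, k) \<in> frames p q r"
  shows "frame_map p q (A, k) \<in> dflag_variety p q r"
proof -
  have A: "A \<in> carrier_mat (p + q) r" "inj_mat A" and k: "k \<in> K_group p q" using x by (auto simp: frames_iff)
  have "col_span (p + q) A \<in> Gr (p + q) r"
    unfolding Gr_def using col_span_subspace[OF A(1)] inj_mat_iff_rank[OF A(1)] A(2) by simp
  moreover note flag_in_Fl[OF k, of 0 p] flag_in_Fl[OF k, of p q]
  ultimately show ?thesis
    unfolding dflag_variety_def frame_map_alt V_plus_coord V_minus_coord by (simp add: atLeast0LessThan)
qed

section \<open>Matrices adapted to flags\<close>

lemma sub_cols_Suc:
  assumes M: "M \<in> carrier_mat n d" and i: "i < d" and inj: "inj_mat (sub_cols M 0 i)"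
    and notin: "col M i \<notin> col_span n (sub_cols M 0 i)"
  shows "inj_mat (sub_cols M 0 (Suc i))"
  unfolding inj_mat_def
proof (intro ballI impI)
  let ?S = "sub_cols M 0 (Suc i)"
  fix x assume "x \<in> carrier_vec (dim_col ?S)" "?S *\<^sub>v x = 0\<^sub>v (dim_row ?S)"
  then have x: "x \<in> carrier_vec (Suc i)" "?S *\<^sub>v x = 0\<^sub>v n" using M by (auto simp: sub_cols_def)
  note Sc = sub_cols_carrier[OF M, of 0 i] and Sc' = sub_cols_carrier[OF M, of 0 "Suc i"]
  define y where "y = vec i (\<lambda>j. x $ j)"
  have y: "y \<in> carrier_vec i" unfolding y_def by simp
  have e: "(sub_cols M 0 i *\<^sub>v y) $ a + M $$ (a, i) * x $ i = 0" if a: "a < n" for a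
  proof -
    have "(?S *\<^sub>v x) $ a = (\<Sum>j<Suc i. ?S $$ (a, j) * x $ j)" by (rule mult_mat_vec_index_sum[OF Sc' x(1) a])
    also have "\<dots> = (\<Sum>j<i. sub_cols M 0 i $$ (a, j) * y $ j) + M $$ (a, i) * x $ i"
      using a M by (auto simp: sub_cols_def y_def)
    also have "(\<Sum>j<i. sub_cols M 0 i $$ (a, j) * y $ j) = (sub_cols M 0 i *\<^sub>v y) $ a"
      by (rule mult_mat_vec_index_sum[OF Sc y a, symmetric])
    finally show ?thesis using x(2) a by simp
  qed
  have xi: "x $ i = 0"
  proof (rule ccontr)
    assume nz: "x $ i \<noteq> 0"
    have "col M i = sub_cols M 0 i *\<^sub>v (- inverse (x $ i) \<cdot>\<^sub>v y)"
    proof (rule eq_vecI)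
      fix a assume "a < dim_vec (sub_cols M 0 i *\<^sub>v (- inverse (x $ i) \<cdot>\<^sub>v y))"
      then have a: "a < n" using Sc by auto
      have "(sub_cols M 0 i *\<^sub>v (- inverse (x $ i) \<cdot>\<^sub>v y)) $ a = - inverse (x $ i) * (sub_cols M 0 i *\<^sub>v y) $ a"
        using mult_mat_vec[OF Sc y] a Sc by simp
      also have "(sub_cols M 0 i *\<^sub>v y) $ a = - (M $$ (a, i) * x $ i)" using e[OF a] by (simp add: eq_neg_iff_add_eq_0)
      finally show "col M i $ a = (sub_cols M 0 i *\<^sub>v (- inverse (x $ i) \<cdot>\<^sub>v y)) $ a" using nz a M i by simp
    qed (use M in \<open>auto simp: sub_cols_def\<close>)
    then show False using notin y unfolding col_span_eq[OF Sc] by auto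
  qed
  have "sub_cols M 0 i *\<^sub>v y = 0\<^sub>v n" using e xi Sc by (intro eq_vecI) auto
  then have "y = 0\<^sub>v i" using inj y Sc unfolding inj_mat_def by auto
  then have "x $ j = 0" if "j < i" for j using that unfolding y_def by (metis index_vec index_zero_vec(1))
  then show "x = 0\<^sub>v (dim_col ?S)" using x(1) xi by (intro eq_vecI) (auto simp: sub_cols_def less_Suc_eq)
qed

text \<open>One vector is chosen from each step of the flag. The first \<open>i\<close> of them are
  independent in a space of dimension \<open>i\<close>, hence a basis of it.\<close>

lemma flag_adapted_matrix:
  assumes F: "F \<in> Fl n U" and U: "lin_dim n U = d"
  obtains M where "M \<in> carrier_mat n d" "inj_mat M" "\<And>j. j < d \<Longrightarrow> col M j \<in> U"
    "\<And>i. i \<le> d \<Longrightarrow> F ! i = col_span n (sub_cols M 0 i)" "length F = d + 1"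
proof -
  have len: "length F = d + 1" and sp: "\<And>i. i \<le> d \<Longrightarrow> lin_subspace n (F ! i) \<and> F ! i \<subseteq> U \<and> lin_dim n (F ! i) = i"
    and mono: "\<And>i. i < d \<Longrightarrow> F ! i \<subseteq> F ! Suc i"
    using F unfolding Fl_def U by auto
  have "\<exists>v. v \<in> F ! Suc i \<and> v \<notin> F ! i" if "i < d" for i
  proof (rule ccontr)
    assume "\<not> ?thesis"
    then have "F ! Suc i = F ! i" using mono[OF that] by auto
    then show False using sp[of i] sp[of "Suc i"] that by auto
  qed
  then obtain v where v: "\<And>i. i < d \<Longrightarrow> v i \<in> F ! Suc i \<and> v i \<notin> F ! i" by metis
  have Fc: "F ! i \<subseteq> carrier_vec n" if i: "i \<le> d" for i
  proof -
    obtain A where "A \<in> carrier_mat n i" "F ! i = col_span n A" using subspace_col_span[of "F ! i" n i] sp[OF i] by metis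
    then show ?thesis using col_span_eq by auto
  qed
  define M where "M = mat n d (\<lambda>(a, j). v j $ a)"
  have M: "M \<in> carrier_mat n d" unfolding M_def by simp
  have cM: "col M j = v j" if "j < d" for j
    using v[OF that] Fc[of "Suc j"] that unfolding M_def by (intro eq_vecI) auto
  have Fmono: "F ! i \<subseteq> F ! j" if "i \<le> j" "j \<le> d" for i j
    using that by (induction j rule: dec_induct) (use mono in \<open>auto, meson Suc_le_lessD in_mono less_imp_le_nat\<close>)
  have main: "F ! i = col_span n (sub_cols M 0 i) \<and> inj_mat (sub_cols M 0 i)" if "i \<le> d" for i
    using that
  proof (induction i)
    case 0
    have "lin_subspace n (F ! 0)" "lin_dim n (F ! 0) = 0" using sp[of 0] by auto
    then obtain A where A: "A \<in> carrier_mat n 0" "F ! 0 = col_span n A" by (rule subspace_col_span)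
    have "A = sub_cols M 0 0" using A M by (intro eq_matI) (auto simp: sub_cols_def)
    then show ?case using A by (auto simp: inj_mat_def sub_cols_def)
  next
    case (Suc i)
    then have IH: "F ! i = col_span n (sub_cols M 0 i)" "inj_mat (sub_cols M 0 i)" and i: "i < d" by auto
    have inj: "inj_mat (sub_cols M 0 (Suc i))"
      using IH v[OF i] cM[OF i] by (intro sub_cols_Suc[OF M i]) auto
    obtain B where B: "B \<in> carrier_mat n (Suc i)" "F ! Suc i = col_span n B"
      using subspace_col_span[of "F ! Suc i" n "Suc i"] sp[OF Suc.prems] by metis
    have "col (sub_cols M 0 (Suc i)) j \<in> col_span n B" if j: "j < Suc i" for j
    proof -
      have "col (sub_cols M 0 (Suc i)) j = v j"
      proof -
        have "col (sub_cols M 0 (Suc i)) j = col M j"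
          using j i M by (intro eq_vecI) (auto simp: sub_cols_def)
        then show ?thesis using cM[of j] j i by simp
      qed
      moreover have "F ! Suc j \<subseteq> F ! Suc i" using j i by (intro Fmono) auto
      ultimately show ?thesis using v[of j] j i B by auto
    qed
    then obtain g where "g \<in> carrier_mat (Suc i) (Suc i)" "det g \<noteq> 0" "sub_cols M 0 (Suc i) = B * g"
      using col_span_eq_factor[OF B(1) sub_cols_carrier[OF M] inj] by metis
    then show ?case using col_span_mult[OF B(1)] B(2) inj by simp
  qed
  have "sub_cols M 0 d = M" using M by (intro eq_matI) (auto simp: sub_cols_def)
  then have "inj_mat M" using main[of d] by simp
  moreover have "col M j \<in> U" if "j < d" for j using cM[OF that] v[OF that] sp[of "Suc j"] that by auto
  ultimately show ?thesis using that M main len by blast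
qed

text \<open>Adapted matrices for the two flags are placed side by side. Their nonzero rows are
  complementary, so the result is block diagonal and invertible.\<close>

lemma variety_has_frame:
  assumes x: "x \<in> dflag_variety p q r"
  obtains A k where "(A, k) \<in> frames p q r" "x = frame_map p q (A, k)"
proof -
  let ?n = "p + q"
  obtain W F F' where xe: "x = (W, F, F')" and W: "W \<in> Gr ?n r"
    and F: "F \<in> Fl ?n (coord_space ?n {0..<0 + p})" and F': "F' \<in> Fl ?n (coord_space ?n {p..<p + q})"
    using x unfolding dflag_variety_def V_plus_coord V_minus_coord by (auto simp: atLeast0LessThan)
  obtain A where A: "A \<in> carrier_mat ?n r" "inj_mat A" "W = col_span ?n A"
    using W subspace_col_span[of W ?n r] unfolding Gr_def by blast
  have d: "lin_dim ?n (coord_space ?n {0..<0 + p}) = p" "lin_dim ?n (coord_space ?n {p..<p + q}) = q"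
    by (rule lin_dim_coord_space, simp)+
  obtain M where M: "M \<in> carrier_mat ?n p" "inj_mat M" "\<And>j. j < p \<Longrightarrow> col M j \<in> coord_space ?n {0..<0 + p}"
    "\<And>i. i \<le> p \<Longrightarrow> F ! i = col_span ?n (sub_cols M 0 i)" "length F = p + 1"
    using flag_adapted_matrix[OF F d(1)] by metis
  obtain N where N: "N \<in> carrier_mat ?n q" "inj_mat N" "\<And>j. j < q \<Longrightarrow> col N j \<in> coord_space ?n {p..<p + q}"
    "\<And>i. i \<le> q \<Longrightarrow> F' ! i = col_span ?n (sub_cols N 0 i)" "length F' = q + 1"
    using flag_adapted_matrix[OF F' d(2)] by metis
  have M0: "M $$ (i, j) = 0" if "p \<le> i" "i < ?n" "j < p" for i j
    using M(3)[OF that(3)] that M(1) unfolding coord_space_def by auto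
  have N0: "N $$ (i, j) = 0" if "i < p" "j < q" for i j
    using N(3)[OF that(2)] that N(1) unfolding coord_space_def by auto
  define k where "k = mat ?n ?n (\<lambda>(i, j). if j < p then M $$ (i, j) else N $$ (i, j - p))"
  have kc: "k \<in> carrier_mat ?n ?n" unfolding k_def by simp
  have sM: "sub_cols k 0 i = sub_cols M 0 i" if "i \<le> p" for i
    unfolding sub_cols_def k_def using M(1) that by (intro eq_matI) auto
  have sN: "sub_cols k p i = sub_cols N 0 i" if "i \<le> q" for i
    unfolding sub_cols_def k_def using N(1) that by (intro eq_matI) auto
  have "inj_mat k" unfolding inj_mat_def
  proof (intro ballI impI)
    fix z assume "z \<in> carrier_vec (dim_col k)" "k *\<^sub>v z = 0\<^sub>v (dim_row k)"
    then have z: "z \<in> carrier_vec ?n" "k *\<^sub>v z = 0\<^sub>v ?n" using kc by auto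
    define z1 where "z1 = vec p (\<lambda>i. z $ i)"
    define z2 where "z2 = vec q (\<lambda>i. z $ (p + i))"
    have zc: "z1 \<in> carrier_vec p" "z2 \<in> carrier_vec q" unfolding z1_def z2_def by auto
    have s: "(M *\<^sub>v z1) $ i + (N *\<^sub>v z2) $ i = 0" if i: "i < ?n" for i
    proof -
      have "(k *\<^sub>v z) $ i = (\<Sum>j<p + q. k $$ (i, j) * z $ j)" by (rule mult_mat_vec_index_sum[OF kc z(1) i])
      also have "\<dots> = (\<Sum>j<p. k $$ (i, j) * z $ j) + (\<Sum>j<q. k $$ (i, p + j) * z $ (p + j))"
        by (induction q) (auto simp: add.assoc)
      also have "(\<Sum>j<p. k $$ (i, j) * z $ j) = (M *\<^sub>v z1) $ i"
        unfolding mult_mat_vec_index_sum[OF M(1) zc(1) i] using i by (intro sum.cong) (auto simp: k_def z1_def)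
      also have "(\<Sum>j<q. k $$ (i, p + j) * z $ (p + j)) = (N *\<^sub>v z2) $ i"
        unfolding mult_mat_vec_index_sum[OF N(1) zc(2) i] using i by (intro sum.cong) (auto simp: k_def z2_def)
      finally show ?thesis using z(2) i by simp
    qed
    \<comment> \<open>Each half of the product vanishes on the rows of the other block, so a zero
      sum forces both halves to vanish.\<close>
    have Mz: "(M *\<^sub>v z1) $ i = 0" if "p \<le> i" "i < ?n" for i
      unfolding mult_mat_vec_index_sum[OF M(1) zc(1) that(2)] using M0 that by (intro sum.neutral) auto
    have Nz: "(N *\<^sub>v z2) $ i = 0" if "i < p" for i
      by (subst mult_mat_vec_index_sum[OF N(1) zc(2)]) (use N0 that in \<open>auto intro!: sum.neutral\<close>)
    have "M *\<^sub>v z1 = 0\<^sub>v ?n"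
    proof (rule eq_vecI)
      fix i assume "i < dim_vec (0\<^sub>v ?n)"
      then show "(M *\<^sub>v z1) $ i = 0\<^sub>v ?n $ i" using s[of i] Mz[of i] Nz[of i] by (cases "i < p") auto
    qed (use M(1) in auto)
    then have 1: "z1 = 0\<^sub>v p" using M(1,2) zc(1) unfolding inj_mat_def by auto
    have "N *\<^sub>v z2 = 0\<^sub>v ?n"
    proof (rule eq_vecI)
      fix i assume "i < dim_vec (0\<^sub>v ?n)"
      then show "(N *\<^sub>v z2) $ i = 0\<^sub>v ?n $ i" using s[of i] Mz[of i] Nz[of i] by (cases "i < p") auto
    qed (use N(1) in auto)
    then have 2: "z2 = 0\<^sub>v q" using N(1,2) zc(2) unfolding inj_mat_def by auto
    have "z $ i = 0" if "i < ?n" for i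
    proof (cases "i < p")
      case True
      then show ?thesis using arg_cong[OF 1, of "\<lambda>v. v $ i"] unfolding z1_def by simp
    next
      case False
      then have "i - p < q" "p + (i - p) = i" using that by auto
      then show ?thesis using arg_cong[OF 2, of "\<lambda>v. v $ (i - p)"] unfolding z2_def by simp
    qed
    then show "z = 0\<^sub>v (dim_col k)" using z kc by (intro eq_vecI) auto
  qed
  then have "det k \<noteq> 0" using inj_mat_det[OF kc] by simp
  then have kK: "k \<in> K_group p q"
    unfolding K_group_iff using kc M0 N0 by (auto simp: k_def)
  have "F = map (\<lambda>i. (\<lambda>v. k *\<^sub>v v) ` coord_space ?n {0..<0 + i}) [0..<p + 1]"
  proof (rule nth_equalityI)
    fix i assume "i < length F"
    then have i: "i \<le> p" using M(5) by simp
    have "(\<lambda>v. k *\<^sub>v v) ` coord_space ?n {0..<0 + i} = col_span ?n (sub_cols k 0 i)"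
      using i by (intro image_coord_space[OF kc]) auto
    then show "F ! i = map (\<lambda>i. (\<lambda>v. k *\<^sub>v v) ` coord_space ?n {0..<0 + i}) [0..<p + 1] ! i"
      using M(4)[OF i] sM[OF i] i by (simp del: upt_Suc)
  qed (use M(5) in simp)
  moreover have "F' = map (\<lambda>i. (\<lambda>v. k *\<^sub>v v) ` coord_space ?n {p..<p + i}) [0..<q + 1]"
  proof (rule nth_equalityI)
    fix i assume "i < length F'"
    then have i: "i \<le> q" using N(5) by simp
    have "(\<lambda>v. k *\<^sub>v v) ` coord_space ?n {p..<p + i} = col_span ?n (sub_cols k p i)"
      using i by (intro image_coord_space[OF kc]) auto
    then show "F' ! i = map (\<lambda>i. (\<lambda>v. k *\<^sub>v v) ` coord_space ?n {p..<p + i}) [0..<q + 1] ! i"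
      using N(4)[OF i] sN[OF i] i by (simp del: upt_Suc)
  qed (use N(5) in simp)
  ultimately have "x = frame_map p q (A, k)" unfolding xe frame_map_alt A(3) by simp
  moreover have "(A, k) \<in> frames p q r" using A kK by (simp add: frames_iff)
  ultimately show ?thesis using that by blast
qed

text \<open>Among block matrices, upper triangularity describes the common stabilizer in
  \<open>K\<close> of the two standard flags.\<close>

definition borel_group :: "nat \<Rightarrow> nat \<Rightarrow> complex mat set" where
  "borel_group p q = {b \<in> K_group p q. \<forall>i<p + q. \<forall>j<i. b $$ (i, j) = 0}"

lemma borel_K: "b \<in> borel_group p q \<Longrightarrow> b \<in> K_group p q"
  unfolding borel_group_def by auto

lemma borel_inverse:
  assumes b: "b \<in> borel_group p q"
  obtains c where "c \<in> borel_group p q" "b * c = 1\<^sub>m (p + q)" "c * b = 1\<^sub>m (p + q)"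
proof -
  obtain c where c: "c \<in> K_group p q" "b * c = 1\<^sub>m (p + q)" "c * b = 1\<^sub>m (p + q)"
    using K_group_inverse[OF borel_K[OF b]] .
  have "c \<in> borel_group p q"
    unfolding borel_group_def using c(1) upper_triangular_inverse[of b "p + q" c] b c(2)
    by (auto simp: borel_group_def K_group_carrier)
  then show ?thesis using that c by blast
qed

text \<open>One inclusion is triangularity, the other is the same inclusion for the inverse.\<close>

lemma borel_image:
  assumes b: "b \<in> borel_group p q" and s: "(s = 0 \<and> i \<le> p) \<or> (s = p \<and> i \<le> q)"
  shows "(\<lambda>v. b *\<^sub>v v) ` coord_space (p + q) {s..<s + i} = coord_space (p + q) {s..<s + i}"
proof -
  have sub: "b *\<^sub>v x \<in> coord_space (p + q) {s..<s + i}"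
    if b: "b \<in> borel_group p q" and xc: "x \<in> coord_space (p + q) {s..<s + i}" for b x
  proof -
    have bc: "b \<in> carrier_mat (p + q) (p + q)" using b K_group_carrier borel_K by blast
    have x: "x \<in> carrier_vec (p + q)" "\<And>m. m < p + q \<Longrightarrow> m \<notin> {s..<s + i} \<Longrightarrow> x $ m = 0"
      using xc unfolding coord_space_def by auto
    have "(b *\<^sub>v x) $ m = 0" if m: "m < p + q" "m \<notin> {s..<s + i}" for m
      unfolding mult_mat_vec_index_sum[OF bc x(1) m(1)]
    proof (intro sum.neutral ballI)
      fix j assume j: "j \<in> {..<p + q}"
      show "b $$ (m, j) * x $ j = 0"
      proof (cases "j \<in> {s..<s + i}")
        case True
        then have "j < m \<or> (m < p) \<noteq> (j < p)" using m s by auto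
        then have "b $$ (m, j) = 0" using b K_group_block[OF borel_K[OF b] m(1), of j] m j unfolding borel_group_def by auto
        then show ?thesis by simp
      qed (use x(2) j in auto)
    qed
    then show ?thesis unfolding coord_space_def using bc x(1) by auto
  qed
  obtain c where c: "c \<in> borel_group p q" "b * c = 1\<^sub>m (p + q)" using borel_inverse[OF b] by metis
  have bc: "b \<in> carrier_mat (p + q) (p + q)" "c \<in> carrier_mat (p + q) (p + q)" using b c K_group_carrier borel_K by blast+
  have "x \<in> (\<lambda>v. b *\<^sub>v v) ` coord_space (p + q) {s..<s + i}" if x: "x \<in> coord_space (p + q) {s..<s + i}" for x
  proof -
    have xc: "x \<in> carrier_vec (p + q)" using x unfolding coord_space_def by auto
    have "b *\<^sub>v (c *\<^sub>v x) = x" using assoc_mult_mat_vec[OF bc xc] c(2) xc by simp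
    then show ?thesis using sub[OF c(1) x] by (metis image_eqI)
  qed
  then show ?thesis using sub[OF b] by auto
qed

lemma K_act_frame_map:
  assumes k: "k \<in> K_group p q" and x: "(A, k') \<in> frames p q r"
  shows "K_act k (frame_map p q (A, k')) = frame_map p q (k * A, k * k')" "(k * A, k * k') \<in> frames p q r"
proof -
  have A: "A \<in> carrier_mat (p + q) r" "inj_mat A" and k': "k' \<in> K_group p q" using x by (auto simp: frames_iff)
  note kc = K_group_carrier[OF k] K_group_carrier[OF k']
  have im: "(\<lambda>v. k *\<^sub>v v) ` (\<lambda>v. k' *\<^sub>v v) ` coord_space (p + q) I = (\<lambda>v. (k * k') *\<^sub>v v) ` coord_space (p + q) I" for I
    unfolding image_image using assoc_mult_mat_vec[OF kc] by (intro image_cong) (auto simp: coord_space_def)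
  show "K_act k (frame_map p q (A, k')) = frame_map p q (k * A, k * k')"
    unfolding frame_map_alt K_act.simps using image_col_span[OF kc(1) A(1)] im by (simp add: comp_def del: upt_Suc)
  show "(k * A, k * k') \<in> frames p q r"
    using A kc K_group_mult[OF k k'] inj_mat_multI[OF kc(1) A(1) K_group_inj[OF k] A(2)] by (auto simp: frames_iff)
qed

lemma frame_map_borel:
  assumes x: "(A, k) \<in> frames p q r" and g: "g \<in> carrier_mat r r" "det g \<noteq> 0" and b: "b \<in> borel_group p q"
  shows "frame_map p q (A * g, k * b) = frame_map p q (A, k)" "(A * g, k * b) \<in> frames p q r"
proof -
  have A: "A \<in> carrier_mat (p + q) r" "inj_mat A" and k: "k \<in> K_group p q" using x by (auto simp: frames_iff)
  note kc = K_group_carrier[OF k] K_group_carrier[OF borel_K[OF b]]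
  have im: "(\<lambda>v. (k * b) *\<^sub>v v) ` coord_space (p + q) {s..<s + i} = (\<lambda>v. k *\<^sub>v v) ` coord_space (p + q) {s..<s + i}"
    if "(s = 0 \<and> i \<le> p) \<or> (s = p \<and> i \<le> q)" for s i
  proof -
    have "(\<lambda>v. (k * b) *\<^sub>v v) ` coord_space (p + q) {s..<s + i} = (\<lambda>v. k *\<^sub>v v) ` (\<lambda>v. b *\<^sub>v v) ` coord_space (p + q) {s..<s + i}"
      unfolding image_image using assoc_mult_mat_vec[OF kc] by (intro image_cong) (auto simp: coord_space_def)
    then show ?thesis unfolding borel_image[OF b that] .
  qed
  show "frame_map p q (A * g, k * b) = frame_map p q (A, k)"
    unfolding frame_map_alt using col_span_mult[OF A(1) g] im[of 0] im[of p] by simp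
  show "(A * g, k * b) \<in> frames p q r"
    using A g K_group_mult[OF k borel_K[OF b]] inj_mat_multI[OF A(1) g(1) A(2)] inj_mat_det[OF g(1)]
    by (auto simp: frames_iff)
qed

text \<open>The converse of \<open>frame_map_borel\<close>: fibres of the frame map are orbits of
  \<open>GL_r\<close> times the Borel group. The factor \<open>b = k^-1 k'\<close> is upper
  triangular because it preserves every standard flag member.\<close>

lemma frame_map_eqD:
  assumes x: "(A, k) \<in> frames p q r" and x': "(A', k') \<in> frames p q r" and e: "frame_map p q (A, k) = frame_map p q (A', k')"
  obtains g b where "g \<in> carrier_mat r r" "det g \<noteq> 0" "b \<in> borel_group p q" "A' = A * g" "k' = k * b"
proof -
  let ?n = "p + q"
  have A: "A \<in> carrier_mat ?n r" "inj_mat A" and k: "k \<in> K_group p q" using x by (auto simp: frames_iff)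
  have A': "A' \<in> carrier_mat ?n r" "inj_mat A'" and k': "k' \<in> K_group p q" using x' by (auto simp: frames_iff)
  note kc = K_group_carrier[OF k] and kc' = K_group_carrier[OF k']
  have cs: "col_span ?n A = col_span ?n A'" using e unfolding frame_map_alt by auto
  obtain g where g: "g \<in> carrier_mat r r" "det g \<noteq> 0" "A' = A * g"
    using col_span_eq_factor[OF A(1) A'] cs col_in_col_span[OF A'(1)] by metis
  obtain kinv where ki: "kinv \<in> K_group p q" "k * kinv = 1\<^sub>m ?n" "kinv * k = 1\<^sub>m ?n" using K_group_inverse[OF k] .
  note kic = K_group_carrier[OF ki(1)]
  define b where "b = kinv * k'"
  have bK: "b \<in> K_group p q" unfolding b_def by (rule K_group_mult[OF ki(1) k'])
  note bc = K_group_carrier[OF bK]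
  have kb: "k' = k * b" unfolding b_def using assoc_mult_mat[OF kc kic kc'] ki(2) kc' by simp
  have fp: "(\<lambda>v. k *\<^sub>v v) ` coord_space ?n {0..<0 + i} = (\<lambda>v. k' *\<^sub>v v) ` coord_space ?n {0..<0 + i}" if "i \<le> p" for i
    using e that unfolding frame_map_alt by (auto simp: list_eq_iff_nth_eq simp del: upt_Suc)
  have fm: "(\<lambda>v. k *\<^sub>v v) ` coord_space ?n {p..<p + i} = (\<lambda>v. k' *\<^sub>v v) ` coord_space ?n {p..<p + i}" if "i \<le> q" for i
    using e that unfolding frame_map_alt by (auto simp: list_eq_iff_nth_eq simp del: upt_Suc)
  have "b $$ (i, j) = 0" if ij: "i < ?n" "j < i" for i j
  proof -
    \<comment> \<open>\<open>s\<close> and \<open>c\<close> select the flag member whose last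
      coordinate is \<open>j\<close>, that is, \<open>s + c = Suc j\<close>.\<close>
    define s where "s = (if j < p then 0 else p)"
    define c where "c = (if j < p then Suc j else Suc j - p)"
    have sc: "(\<lambda>v. k *\<^sub>v v) ` coord_space ?n {s..<s + c} = (\<lambda>v. k' *\<^sub>v v) ` coord_space ?n {s..<s + c}"
      using fp[of c] fm[of c] ij by (cases "j < p") (simp_all add: s_def c_def)
    have js: "s \<le> j" "s + c = Suc j" unfolding s_def c_def by auto
    have jn: "j < ?n" using ij by simp
    have "unit_vec ?n j \<in> coord_space ?n {s..<s + c}" using js jn unfolding coord_space_def by auto
    then have "k' *\<^sub>v unit_vec ?n j \<in> (\<lambda>v. k *\<^sub>v v) ` coord_space ?n {s..<s + c}" unfolding sc by blast
    then obtain y where y: "y \<in> coord_space ?n {s..<s + c}" "k' *\<^sub>v unit_vec ?n j = k *\<^sub>v y" by auto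
    have yc: "y \<in> carrier_vec ?n" using y(1) unfolding coord_space_def by auto
    have "b *\<^sub>v unit_vec ?n j = kinv *\<^sub>v (k' *\<^sub>v unit_vec ?n j)" unfolding b_def using assoc_mult_mat_vec[OF kic kc'] by simp
    also have "\<dots> = (kinv * k) *\<^sub>v y" unfolding y(2) using assoc_mult_mat_vec[OF kic kc yc] by simp
    also have "\<dots> = y" using ki(3) yc by simp
    finally have "col b j = y" using mult_unit_vec_col[OF bc jn] by simp
    then have "b $$ (i, j) = y $ i" using ij bc jn by auto
    also have "\<dots> = 0" using y(1) ij js unfolding coord_space_def by auto
    finally show ?thesis .
  qed
  then have "b \<in> borel_group p q" unfolding borel_group_def using bK by auto
  then show ?thesis using that g kb by blast
qed

section \<open>The quotient topology\<close>

lemma frame_map_image: "frame_map p q ` frames p q r = dflag_variety p q r"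
  using frame_map_in_variety variety_has_frame by (auto simp: image_iff) (metis surj_pair)+

lemma frame_mapI: "x \<in> frames p q r \<Longrightarrow> frame_map p q x \<in> dflag_variety p q r"
  using frame_map_image by blast

lemma topspace_zariski: "topspace (zariski p q r) = dflag_variety p q r"
proof
  show "topspace (zariski p q r) \<subseteq> dflag_variety p q r"
    using openin_topspace[of "zariski p q r"] unfolding openin_zariski by auto
  have "{x \<in> frames p q r. frame_map p q x \<in> dflag_variety p q r} = frames p q r" using frame_mapI by blast
  then have "openin (zariski p q r) (dflag_variety p q r)"
    unfolding openin_zariski using openin_topspace[of "zariski_frames p q r"] by (simp add: topspace_zariski_frames)
  then show "dflag_variety p q r \<subseteq> topspace (zariski p q r)" by (rule openin_subset)
qed

lemma continuous_frame_map: "continuous_map (zariski_frames p q r) (zariski p q r) (frame_map p q)"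
  unfolding continuous_map_def topspace_zariski topspace_zariski_frames
  using frame_mapI[of _ p q r] by (simp add: openin_zariski Pi_iff)

lemma closedin_zariski:
  "closedin (zariski p q r) C \<longleftrightarrow> C \<subseteq> dflag_variety p q r \<and>
     closedin (zariski_frames p q r) {x \<in> frames p q r. frame_map p q x \<in> C}"
proof -
  have "{x \<in> frames p q r. frame_map p q x \<in> dflag_variety p q r - C} = frames p q r - {x \<in> frames p q r. frame_map p q x \<in> C}"
    using frame_mapI by blast
  then show ?thesis unfolding closedin_def openin_zariski topspace_zariski topspace_zariski_frames by auto
qed

lemma regular_compose:
  assumes \<rho>: "\<And>x. x \<in> frames p q r \<Longrightarrow> \<rho> x \<in> frames p q r"
    and r1: "regular_mat p q r (p + q) r (\<lambda>x. fst (\<rho> x))" and r2: "regular_mat p q r (p + q) (p + q) (\<lambda>x. snd (\<rho> x))"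
    and f: "regular p q r f"
  shows "regular p q r (\<lambda>x. f (\<rho> x))"
proof -
  have pr: "regular p q r (\<lambda>x. g (\<rho> x))" if "g \<in> poly_functions p q r" for g
    using that
    by induction (use r1 r2 in \<open>auto simp: regular_mat_def intro: regular_const regular_add regular_mult\<close>)
  obtain g where g: "g \<in> poly_functions p q r" "\<forall>x\<in>frames p q r. f x = g x" using f unfolding regular_def by auto
  show ?thesis by (rule regular_cong[OF _ pr[OF g(1)]]) (use g \<rho> in blast)
qed

text \<open>The saturation of an open set is the union of its translates under \<open>GL_r\<close>
  and the Borel group, and each translation is polynomial in the entries.\<close>

lemma open_frame_map: "open_map (zariski_frames p q r) (zariski p q r) (frame_map p q)"
  unfolding open_map_def
proof (intro allI impI)
  fix U assume U: "openin (zariski_frames p q r) U"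
  then have Uf: "U \<subseteq> frames p q r" by (simp add: openin_zariski_frames)
  show "openin (zariski p q r) (frame_map p q ` U)"
    unfolding openin_zariski
  proof
    show "frame_map p q ` U \<subseteq> dflag_variety p q r" using Uf frame_map_image by blast
    let ?P = "{x \<in> frames p q r. frame_map p q x \<in> frame_map p q ` U}"
    show "openin (zariski_frames p q r) ?P"
      unfolding openin_zariski_frames
    proof (intro conjI ballI)
      fix x assume "x \<in> ?P"
      then obtain u where u: "u \<in> U" "frame_map p q x = frame_map p q u" "x \<in> frames p q r" by auto
      obtain A k A' k' where xu: "x = (A, k)" "u = (A', k')" by (metis surj_pair)
      obtain g b where gb: "g \<in> carrier_mat r r" "det g \<noteq> 0" "b \<in> borel_group p q" "A' = A * g" "k' = k * b"
        using frame_map_eqD[of A k p q r A' k'] u Uf unfolding xu by blast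
      define \<rho> where "\<rho> = (\<lambda>x :: complex mat \<times> complex mat. (fst x * g, snd x * b))"
      have rf: "\<rho> y \<in> frames p q r \<and> frame_map p q (\<rho> y) = frame_map p q y" if "y \<in> frames p q r" for y
        using frame_map_borel[of "fst y" "snd y" p q r, OF _ gb(1-3)] that unfolding \<rho>_def by simp
      obtain f where f: "regular p q r f" "f u \<noteq> 0" "{y \<in> frames p q r. f y \<noteq> 0} \<subseteq> U"
        using U u(1) unfolding openin_zariski_frames by blast
      have bc: "b \<in> carrier_mat (p + q) (p + q)" using gb(3) K_group_carrier borel_K by blast
      have "regular p q r (\<lambda>x. f (\<rho> x))"
        by (rule regular_compose[OF _ _ _ f(1)])
           (use rf regular_mat_mult[OF regular_mat_fst regular_mat_const[OF gb(1)]]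
             regular_mat_mult[OF regular_mat_snd regular_mat_const[OF bc]] in \<open>auto simp: \<rho>_def\<close>)
      moreover have "f (\<rho> x) \<noteq> 0" using f(2) unfolding \<rho>_def xu gb by simp
      moreover have "{y \<in> frames p q r. f (\<rho> y) \<noteq> 0} \<subseteq> ?P"
      proof
        fix y assume "y \<in> {y \<in> frames p q r. f (\<rho> y) \<noteq> 0}"
        then have "y \<in> frames p q r" "f (\<rho> y) \<noteq> 0" by auto
        moreover from this have "\<rho> y \<in> U" using f(3) rf by blast
        ultimately have "y \<in> frames p q r" "\<rho> y \<in> U" by auto
        then show "y \<in> ?P" using rf[of y] by (metis (mono_tags, lifting) imageI mem_Collect_eq)
      qed
      ultimately show "\<exists>f. regular p q r f \<and> f x \<noteq> 0 \<and> {y \<in> frames p q r. f y \<noteq> 0} \<subseteq> ?P"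
        by (intro exI[of _ "\<lambda>x. f (\<rho> x)"] conjI)
    qed auto
  qed
qed

text \<open>A common zero set of such functions contains the line through any two of its members, as
  far as this line consists of frames; this is what makes it irreducible.\<close>

definition affine_fun :: "nat \<Rightarrow> nat \<Rightarrow> nat \<Rightarrow> (complex mat \<times> complex mat \<Rightarrow> complex) \<Rightarrow> bool" where
  "affine_fun p q r f \<longleftrightarrow> regular p q r f \<and> (\<forall>x\<in>frames p q r. \<forall>y\<in>frames p q r. \<forall>t.
     f (frame_line p q r x y t) = (1 - t) * f x + t * f y)"

lemma affine_fun_line:
  "affine_fun p q r f \<Longrightarrow> x \<in> frames p q r \<Longrightarrow> y \<in> frames p q r \<Longrightarrow>
     f (frame_line p q r x y t) = (1 - t) * f x + t * f y"
  unfolding affine_fun_def by blast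

lemma affine_fun_const: "affine_fun p q r (\<lambda>x. c)"
  unfolding affine_fun_def by (auto intro: regular_const simp: algebra_simps)

lemma affine_fun_fst: "i < p + q \<Longrightarrow> j < r \<Longrightarrow> affine_fun p q r (\<lambda>x. fst x $$ (i, j))"
  unfolding affine_fun_def by (auto intro: regular_fst simp: frame_line_def)

lemma affine_fun_snd: "i < p + q \<Longrightarrow> j < p + q \<Longrightarrow> affine_fun p q r (\<lambda>x. snd x $$ (i, j))"
  unfolding affine_fun_def by (auto intro: regular_snd simp: frame_line_def)

lemma affine_fun_add: "affine_fun p q r f \<Longrightarrow> affine_fun p q r g \<Longrightarrow> affine_fun p q r (\<lambda>x. f x + g x)"
  unfolding affine_fun_def by (auto intro: regular_add simp: algebra_simps)

lemma affine_fun_scale: "affine_fun p q r f \<Longrightarrow> affine_fun p q r (\<lambda>x. c * f x)"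
  unfolding affine_fun_def by (auto intro: regular_mult regular_const simp: distrib_left mult.left_commute)

lemma affine_fun_diff: "affine_fun p q r f \<Longrightarrow> affine_fun p q r g \<Longrightarrow> affine_fun p q r (\<lambda>x. f x - g x)"
  using affine_fun_add[OF _ affine_fun_scale[of p q r g "-1"], of f] by simp

lemma affine_fun_sum: "(\<And>i. i \<in> I \<Longrightarrow> affine_fun p q r (f i)) \<Longrightarrow> affine_fun p q r (\<lambda>x. \<Sum>i\<in>I. f i x)"
  by (induction I rule: infinite_finite_induct) (auto intro: affine_fun_const affine_fun_add)

lemma affine_fun_mult_fst:
  assumes "i < s" "j < r"
  shows "affine_fun p q r (\<lambda>x. \<Sum>k<p + q. P $$ (i, k) * fst x $$ (k, j))"
  using assms by (intro affine_fun_sum affine_fun_scale affine_fun_fst) auto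

lemma affine_fun_mult_snd:
  assumes "j < p + q"
  shows "affine_fun p q r (\<lambda>x. \<Sum>k<p + q. P $$ (i, k) * snd x $$ (k, j))"
  using assms by (intro affine_fun_sum affine_fun_scale affine_fun_snd) auto

lemma closedin_affine_zeros:
  assumes "\<And>f. f \<in> \<Phi> \<Longrightarrow> affine_fun p q r f"
  shows "closedin (zariski_frames p q r) {x \<in> frames p q r. \<forall>f\<in>\<Phi>. f x = 0}"
  using assms by (intro closedin_zero_set) (auto simp: affine_fun_def)

lemma irreducible_affine_zeros:
  assumes "\<And>f. f \<in> \<Phi> \<Longrightarrow> affine_fun p q r f" and ne: "x0 \<in> frames p q r" "\<forall>f\<in>\<Phi>. f x0 = 0"
  shows "irreducible_in (zariski_frames p q r) {x \<in> frames p q r. \<forall>f\<in>\<Phi>. f x = 0}"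
proof (rule irreducible_in_framesI)
  fix x y assume xy: "x \<in> {x \<in> frames p q r. \<forall>f\<in>\<Phi>. f x = 0}" "y \<in> {x \<in> frames p q r. \<forall>f\<in>\<Phi>. f x = 0}"
  have "f (frame_line p q r x y t) = 0" if "f \<in> \<Phi>" for f t
  proof -
    have "f x = 0" "f y = 0" using xy that by auto
    then show ?thesis using affine_fun_line[OF assms(1)[OF that], of x y t] xy by simp
  qed
  then have "{t. frame_line p q r x y t \<notin> {x \<in> frames p q r. \<forall>f\<in>\<Phi>. f x = 0}} \<subseteq> {t. frame_line p q r x y t \<notin> frames p q r}"
    by blast
  then show "finite {t. frame_line p q r x y t \<notin> {x \<in> frames p q r. \<forall>f\<in>\<Phi>. f x = 0}}"
    using finite_line_not_frames[of x p q r y] xy finite_subset by auto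
qed (use ne in blast)+

lemma irreducible_in_open_subset:
  assumes "irreducible_in T M" "openin T U" "U \<inter> M \<noteq> {}"
  shows "irreducible_in T (U \<inter> M)"
  unfolding irreducible_in_def
proof (intro conjI allI impI)
  show "U \<inter> M \<subseteq> topspace T" "U \<inter> M \<noteq> {}" using assms unfolding irreducible_in_def by auto
  fix V W assume VW: "openin T V \<and> openin T W \<and> V \<inter> (U \<inter> M) \<noteq> {} \<and> W \<inter> (U \<inter> M) \<noteq> {}"
  then have "openin T (V \<inter> U)" "openin T (W \<inter> U)" "(V \<inter> U) \<inter> M \<noteq> {}" "(W \<inter> U) \<inter> M \<noteq> {}" using assms(2) by auto
  then have "(V \<inter> U) \<inter> (W \<inter> U) \<inter> M \<noteq> {}" using assms(1) unfolding irreducible_in_def by meson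
  then show "V \<inter> W \<inter> (U \<inter> M) \<noteq> {}" by blast
qed

text \<open>One position for each coordinate of \<open>GL_r\<close> times the Borel group, so that
  the cardinality is the dimension of a fibre of the frame map.\<close>

definition fibre_positions :: "nat \<Rightarrow> nat \<Rightarrow> nat \<Rightarrow> (nat \<times> nat + nat \<times> nat) set" where
  "fibre_positions p q r = ({..<r} \<times> {..<r}) <+> {(i, j) \<in> block_positions p q. i \<le> j}"

lemma finite_fibre_positions: "finite (fibre_positions p q r)"
proof -
  have "finite {(i, j) \<in> block_positions p q. i \<le> j}"
    by (rule finite_subset[OF _ finite_block_positions[of p q]]) auto
  then show ?thesis unfolding fibre_positions_def by auto
qed

lemma fibre_positions_iff:
  "Inl (i, j) \<in> fibre_positions p q r \<longleftrightarrow> i < r \<and> j < r"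
  "Inr (i, j) \<in> fibre_positions p q r \<longleftrightarrow> (i, j) \<in> block_positions p q \<and> i \<le> j"
  unfolding fibre_positions_def by (auto elim!: PlusE)

lemma inj_mat_left_inverse:
  assumes A: "A \<in> carrier_mat n c" and i: "inj_mat A"
  obtains P where "P \<in> carrier_mat c n" "P * A = 1\<^sub>m c"
proof -
  obtain Q where Q: "Q \<in> carrier_mat c n" "det (Q * A) \<noteq> 0" using inj_mat_minor[OF A i] .
  have QA: "Q * A \<in> carrier_mat c c" using Q A by auto
  obtain B where B: "B \<in> carrier_mat c c" "B * (Q * A) = 1\<^sub>m c" using det_nonzero_inverse[OF QA Q(2)] by metis
  show ?thesis
    by (rule that[of "B * Q"]) (use B Q A assoc_mult_mat[OF B(1) Q(1) A] in auto)
qed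

text \<open>A witness that one coordinate can vary alone while the matrix stays invertible; it
  proves the strictness of inclusions between slices. A diagonal entry becomes \<open>2\<close>, any
  other one \<open>1\<close>.\<close>

lemma elementary_mat:
  assumes ij: "i < n" "j < n"
  obtains g :: "complex mat" where "g \<in> carrier_mat n n" "det g \<noteq> 0" "g $$ (i, j) \<noteq> of_bool (i = j)"
    "\<And>a b. a < n \<Longrightarrow> b < n \<Longrightarrow> (a, b) \<noteq> (i, j) \<Longrightarrow> g $$ (a, b) = of_bool (a = b)"
proof (cases "i = j")
  case True
  show ?thesis
    by (rule that[of "multrow_mat n i 2"])
       (use True ij det_multrow_mat[of i n "2 :: complex"] in auto)
next
  case False
  show ?thesis
    by (rule that[of "addrow_mat n 1 i j"])
       (use False ij det_addrow_mat[of i j n "1 :: complex"] in auto)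
qed

(* Only positions in S are allowed to differ from the identity; in the fibre through (A0, k0)
   this gives affine slices, which are irreducible. *)
lemma fibre_chain:
  assumes x0: "x0 \<in> frames p q r"
  defines "F \<equiv> {x \<in> frames p q r. frame_map p q x = frame_map p q x0}"
  shows "irreducible_in (zariski_frames p q r) F"
    and "\<exists>W. (\<forall>i\<le>card (fibre_positions p q r). closedin (zariski_frames p q r) (W i) \<and> irreducible_in (zariski_frames p q r) (W i)) \<and>
      (\<forall>i<card (fibre_positions p q r). W i \<subset> W (Suc i)) \<and> W (card (fibre_positions p q r)) = F"
proof -
  let ?n = "p + q" and ?T = "zariski_frames p q r" and ?I = "fibre_positions p q r"
  obtain A0 k0 where x0e: "x0 = (A0, k0)" by (cases x0)
  have A0: "A0 \<in> carrier_mat ?n r" "inj_mat A0" and k0: "k0 \<in> K_group p q" using x0 by (auto simp: x0e frames_iff)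
  note kc = K_group_carrier[OF k0]
  obtain P where P: "P \<in> carrier_mat r ?n" "P * A0 = 1\<^sub>m r" using inj_mat_left_inverse[OF A0] .
  obtain ki where ki: "ki \<in> K_group p q" "k0 * ki = 1\<^sub>m ?n" "ki * k0 = 1\<^sub>m ?n" using K_group_inverse[OF k0] .
  note kic = K_group_carrier[OF ki(1)]
  \<comment> \<open>For \<open>A = A0 * g\<close> and \<open>k = k0 * b\<close> these are the
    entries of \<open>g\<close> and \<open>b\<close>, linear in the frame.\<close>
  define PA where "PA = (\<lambda>i j (x :: complex mat \<times> complex mat). \<Sum>k<?n. P $$ (i, k) * fst x $$ (k, j))"
  define KK where "KK = (\<lambda>i j (x :: complex mat \<times> complex mat). \<Sum>k<?n. ki $$ (i, k) * snd x $$ (k, j))"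
  \<comment> \<open>\<open>\<Phi>1\<close> says \<open>A = A0 * (P * A)\<close>, so that the columns
    of \<open>A\<close> lie in the span of those of \<open>A0\<close>. The other two families fix
    the entries of \<open>g\<close> and \<open>b\<close> outside \<open>S\<close> to those of the
    identity.\<close>
  define \<Phi>1 where "\<Phi>1 = (\<lambda>(i, j) x. fst x $$ (i, j) - (\<Sum>l<r. A0 $$ (i, l) * PA l j x)) ` ({..<?n} \<times> {..<r})"
  define \<Phi>2 where "\<Phi>2 = (\<lambda>S :: (nat \<times> nat + nat \<times> nat) set. (\<lambda>(i, j) x. PA i j x - of_bool (i = j)) ` {(i, j). i < r \<and> j < r \<and> Inl (i, j) \<notin> S})"
  define \<Phi>3 where "\<Phi>3 = (\<lambda>S :: (nat \<times> nat + nat \<times> nat) set. (\<lambda>(i, j) x. KK i j x - of_bool (i = j)) ` {(i, j). i < ?n \<and> j < ?n \<and> Inr (i, j) \<notin> S})"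
  define \<Phi> where "\<Phi> = (\<lambda>S. \<Phi>1 \<union> \<Phi>2 S \<union> \<Phi>3 S)"
  define G where "G = (\<lambda>S. {x \<in> frames p q r. \<forall>f\<in>\<Phi> S. f x = 0})"
  have affP: "affine_fun p q r (PA i j)" if "j < r" for i j
    unfolding PA_def by (rule affine_fun_mult_fst[of i "Suc i"]) (use that in auto)
  have affK: "affine_fun p q r (KK i j)" if "j < ?n" for i j
    unfolding KK_def by (rule affine_fun_mult_snd) (use that in auto)
  have aff: "affine_fun p q r f" if "f \<in> \<Phi> S" for f S
    using that unfolding \<Phi>_def \<Phi>1_def \<Phi>2_def \<Phi>3_def
    by (auto intro!: affine_fun_diff affine_fun_const affine_fun_fst affine_fun_sum affine_fun_scale affP affK)
  have G_iff: "(A, k) \<in> G S \<longleftrightarrow> (A, k) \<in> frames p q r \<and> A = A0 * (P * A) \<and>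
      (\<forall>i<r. \<forall>j<r. Inl (i, j) \<notin> S \<longrightarrow> (P * A) $$ (i, j) = of_bool (i = j)) \<and>
      (\<forall>i<?n. \<forall>j<?n. Inr (i, j) \<notin> S \<longrightarrow> (ki * k) $$ (i, j) = of_bool (i = j))" for A k S
  proof (cases "(A, k) \<in> frames p q r")
    case True
    then have Ac: "A \<in> carrier_mat ?n r" and kc': "k \<in> carrier_mat ?n ?n" by (auto simp: frames_iff K_group_carrier)
    have PAe: "PA i j (A, k) = (P * A) $$ (i, j)" if "i < r" "j < r" for i j
      unfolding PA_def using mult_mat_index_sum[OF P(1) Ac that] by simp
    have KKe: "KK i j (A, k) = (ki * k) $$ (i, j)" if "i < ?n" "j < ?n" for i j
      unfolding KK_def using mult_mat_index_sum[OF kic kc' that] by simp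
    have PAc: "P * A \<in> carrier_mat r r" using P Ac by auto
    have "(\<forall>f\<in>\<Phi>1. f (A, k) = 0) \<longleftrightarrow> (\<forall>i<?n. \<forall>j<r. A $$ (i, j) = (A0 * (P * A)) $$ (i, j))"
    proof -
      have "(A0 * (P * A)) $$ (i, j) = (\<Sum>l<r. A0 $$ (i, l) * PA l j (A, k))" if "i < ?n" "j < r" for i j
        unfolding mult_mat_index_sum[OF A0(1) PAc that] using PAe that by (intro sum.cong) auto
      then show ?thesis unfolding \<Phi>1_def by auto
    qed
    also have "\<dots> \<longleftrightarrow> A = A0 * (P * A)"
    proof
      assume "\<forall>i<?n. \<forall>j<r. A $$ (i, j) = (A0 * (P * A)) $$ (i, j)"
      then show "A = A0 * (P * A)" using Ac A0 by (intro eq_matI) auto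
    next
      assume "A = A0 * (P * A)"
      then show "\<forall>i<?n. \<forall>j<r. A $$ (i, j) = (A0 * (P * A)) $$ (i, j)" by metis
    qed
    finally have 1: "(\<forall>f\<in>\<Phi>1. f (A, k) = 0) \<longleftrightarrow> A = A0 * (P * A)" .
    have 2: "(\<forall>f\<in>\<Phi>2 S. f (A, k) = 0) \<longleftrightarrow> (\<forall>i<r. \<forall>j<r. Inl (i, j) \<notin> S \<longrightarrow> (P * A) $$ (i, j) = of_bool (i = j))"
      unfolding \<Phi>2_def using PAe by auto
    have 3: "(\<forall>f\<in>\<Phi>3 S. f (A, k) = 0) \<longleftrightarrow> (\<forall>i<?n. \<forall>j<?n. Inr (i, j) \<notin> S \<longrightarrow> (ki * k) $$ (i, j) = of_bool (i = j))"
      unfolding \<Phi>3_def using KKe by auto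
    show ?thesis unfolding G_def \<Phi>_def using True 1 2 3 by (simp add: ball_Un)
  qed (simp add: G_def)
  have x0G: "(A0, k0) \<in> G S" for S
    unfolding G_iff using x0 P ki A0 by (auto simp: x0e)
  have closed: "closedin ?T (G S)" for S unfolding G_def by (rule closedin_affine_zeros) (rule aff)
  have irr: "irreducible_in ?T (G S)" for S
    unfolding G_def by (rule irreducible_affine_zeros[of _ _ _ _ "(A0, k0)"]) (use aff x0G[of S] in \<open>auto simp: G_def\<close>)
  have GI: "G ?I = F"
  proof (rule Set.set_eqI)
    fix x :: "complex mat \<times> complex mat"
    obtain A k where x: "x = (A, k)" by (cases x)
    show "x \<in> G ?I \<longleftrightarrow> x \<in> F"
    proof
      assume "x \<in> G ?I"
      then have h: "(A, k) \<in> frames p q r" "A = A0 * (P * A)"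
        "\<And>i j. i < ?n \<Longrightarrow> j < ?n \<Longrightarrow> Inr (i, j) \<notin> ?I \<Longrightarrow> (ki * k) $$ (i, j) = of_bool (i = j)"
        unfolding x G_iff by auto
      have Ac: "A \<in> carrier_mat ?n r" "inj_mat A" and kK: "k \<in> K_group p q" using h(1) by (auto simp: frames_iff)
      have g: "P * A \<in> carrier_mat r r" using P Ac by auto
      have "inj_mat (P * A)" using inj_mat_mult[OF A0(1) g] h(2) Ac(2) by simp
      then have dg: "det (P * A) \<noteq> 0" using inj_mat_det[OF g] by simp
      have bK: "ki * k \<in> K_group p q" by (rule K_group_mult[OF ki(1) kK])
      have "(ki * k) $$ (i, j) = 0" if "i < ?n" "j < i" for i j
        using h(3)[of i j] that by (auto simp: fibre_positions_iff)
      then have bB: "ki * k \<in> borel_group p q" using bK unfolding borel_group_def by auto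
      have kk: "k0 * (ki * k) = k" using assoc_mult_mat[OF kc kic K_group_carrier[OF kK]] ki(2) K_group_carrier[OF kK] by simp
      have "frame_map p q (A0 * (P * A), k0 * (ki * k)) = frame_map p q (A0, k0)"
        by (rule frame_map_borel(1)[OF _ g dg bB]) (use x0 x0e in simp)
      then show "x \<in> F" unfolding F_def x using h(1) h(2)[symmetric] kk x0e by simp
    next
      assume "x \<in> F"
      then have h: "(A, k) \<in> frames p q r" "frame_map p q (A0, k0) = frame_map p q (A, k)" unfolding F_def x x0e by auto
      obtain g b where gb: "g \<in> carrier_mat r r" "det g \<noteq> 0" "b \<in> borel_group p q" "A = A0 * g" "k = k0 * b"
        using frame_map_eqD[OF _ h(1,2)] x0 x0e by blast
      have bc: "b \<in> carrier_mat ?n ?n" using gb(3) K_group_carrier borel_K by blast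
      have PA: "P * A = g" unfolding gb(4) using assoc_mult_mat[OF P(1) A0(1) gb(1)] P(2) gb(1) by simp
      have kk: "ki * k = b" unfolding gb(5) using assoc_mult_mat[OF kic kc bc] ki(3) bc by simp
      have "b $$ (i, j) = of_bool (i = j)" if "i < ?n" "j < ?n" "Inr (i, j) \<notin> ?I" for i j
      proof -
        have "j < i \<or> (i < p) \<noteq> (j < p)" using that by (auto simp: fibre_positions_iff block_positions_def)
        then show ?thesis
          using gb(3) K_group_block[OF borel_K[OF gb(3)] that(1,2)] that(1) unfolding borel_group_def by auto
      qed
      then show "x \<in> G ?I" unfolding x G_iff PA kk using h(1) gb(4) by (auto simp: fibre_positions_iff)
    qed
  qed
  show "irreducible_in ?T F" using irr[of ?I] GI by simp
  have mono: "G S \<subseteq> G S'" if "S \<subseteq> S'" for S S'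
    using that unfolding G_def \<Phi>_def \<Phi>2_def \<Phi>3_def by blast
  have strict: "G (S - {y}) \<subset> G S" if S: "S \<subseteq> ?I" "y \<in> S" for S y
  proof (rule psubsetI)
    show "G (S - {y}) \<subseteq> G S" by (rule mono) auto
    have yI: "y \<in> ?I" using S by auto
    show "G (S - {y}) \<noteq> G S"
    proof (cases y)
      case (Inl a)
      obtain i j where "a = (i, j)" by (cases a)
      then have y: "y = Inl (i, j)" "i < r" "j < r" using yI Inl by (auto simp: fibre_positions_iff)
      obtain g :: "complex mat" where g: "g \<in> carrier_mat r r" "det g \<noteq> 0" "g $$ (i, j) \<noteq> of_bool (i = j)"
        "\<And>a b. a < r \<Longrightarrow> b < r \<Longrightarrow> (a, b) \<noteq> (i, j) \<Longrightarrow> g $$ (a, b) = of_bool (a = b)"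
        using elementary_mat[OF y(2,3)] by blast
      have PA: "P * (A0 * g) = g" using assoc_mult_mat[OF P(1) A0(1) g(1)] P(2) g(1) by simp
      have "(A0 * g, k0) \<in> frames p q r"
        using A0 g k0 inj_mat_multI[OF A0(1) g(1) A0(2)] inj_mat_det[OF g(1)] by (auto simp: frames_iff)
      moreover have "g $$ (a, b) = of_bool (a = b)" if "a < r" "b < r" "Inl (a, b) \<notin> S" for a b
        by (rule g(4)) (use that S(2) y in auto)
      ultimately have "(A0 * g, k0) \<in> G S" unfolding G_iff PA ki(3) by auto
      moreover have "Inl (i, j) \<notin> S - {y}" using y by simp
      then have "(A0 * g, k0) \<notin> G (S - {y})" unfolding G_iff PA ki(3) using g(3) y(2,3) by blast
      ultimately show ?thesis by blast
    next
      case (Inr a)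
      obtain i j where "a = (i, j)" by (cases a)
      then have y: "y = Inr (i, j)" "i < ?n" "j < ?n" "i \<le> j" "(i < p) = (j < p)"
        using yI Inr by (auto simp: fibre_positions_iff block_positions_def)
      obtain g :: "complex mat" where g: "g \<in> carrier_mat ?n ?n" "det g \<noteq> 0" "g $$ (i, j) \<noteq> of_bool (i = j)"
        "\<And>a b. a < ?n \<Longrightarrow> b < ?n \<Longrightarrow> (a, b) \<noteq> (i, j) \<Longrightarrow> g $$ (a, b) = of_bool (a = b)"
        using elementary_mat[OF y(2,3)] by blast
      have gK: "g \<in> K_group p q" unfolding K_group_iff
      proof (intro conjI allI impI g(1,2))
        fix a b assume ab: "a < ?n" "b < ?n" "(a < p) \<noteq> (b < p)"
        then have "(a, b) \<noteq> (i, j)" "a \<noteq> b" using y by auto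
        then show "g $$ (a, b) = 0" using g(4) ab by simp
      qed
      have kk: "ki * (k0 * g) = g" using assoc_mult_mat[OF kic kc g(1)] ki(3) g(1) by simp
      have "(A0, k0 * g) \<in> frames p q r" using A0 K_group_mult[OF k0 gK] by (auto simp: frames_iff)
      moreover have "g $$ (a, b) = of_bool (a = b)" if "a < ?n" "b < ?n" "Inr (a, b) \<notin> S" for a b
        by (rule g(4)) (use that S(2) y in auto)
      ultimately have "(A0, k0 * g) \<in> G S" unfolding G_iff P(2) kk using A0(1) by auto
      moreover have "Inr (i, j) \<notin> S - {y}" using y by simp
      then have "(A0, k0 * g) \<notin> G (S - {y})" unfolding G_iff P(2) kk using g(3) y(2,3) by blast
      ultimately show ?thesis by blast
    qed
  qed
  have "\<exists>Z. (\<forall>i\<le>card ?I. closedin ?T (Z i) \<and> irreducible_in ?T (Z i)) \<and> (\<forall>i<card ?I. Z i \<subset> Z (Suc i)) \<and>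
      Z (card ?I) = G ?I \<and> Z 0 = G {}"
  proof (rule chain_of_good_subsets[where good = "\<lambda>_. True" and F = G])
    show "\<exists>x\<in>S. True \<and> G (S - {x}) \<subset> G S" if S: "S \<subseteq> ?I" "S \<noteq> {}" for S
    proof -
      obtain x where "x \<in> S" using S(2) by auto
      then show ?thesis using strict[OF S(1)] by (intro bexI[of _ x]) simp_all
    qed
  qed (use finite_fibre_positions closed irr in auto)
  then show "\<exists>W. (\<forall>i\<le>card ?I. closedin ?T (W i) \<and> irreducible_in ?T (W i)) \<and>
      (\<forall>i<card ?I. W i \<subset> W (Suc i)) \<and> W (card ?I) = F"
    unfolding GI by blast
qed

text \<open>A chain downstairs gains the dimension of a fibre when it is lifted, and chains of
  frames are bounded by the number of coordinates.\<close>

lemma chain_in_variety_bound: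
  assumes "chain_in (zariski p q r) (dflag_variety p q r) m"
  shows "card (fibre_positions p q r) + m \<le> (p + q) * r + card (block_positions p q)"
proof -
  let ?T = "zariski_frames p q r"
  have "chain_in ?T (topspace ?T) (card (fibre_positions p q r) + m)"
  proof (rule chain_in_lift[OF continuous_frame_map open_frame_map])
    show "frame_map p q ` topspace ?T = topspace (zariski p q r)"
      unfolding topspace_zariski topspace_zariski_frames by (rule frame_map_image)
    show "chain_in (zariski p q r) (topspace (zariski p q r)) m" using assms by (simp add: topspace_zariski)
  next
    fix y assume "y \<in> topspace (zariski p q r)"
    then obtain x0 where x0: "x0 \<in> frames p q r" "y = frame_map p q x0"
      unfolding topspace_zariski frame_map_image[symmetric] by auto
    show "irreducible_in ?T {x \<in> topspace ?T. frame_map p q x = y}"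
      unfolding topspace_zariski_frames x0(2) by (rule fibre_chain(1)[OF x0(1)])
    show "\<exists>W. (\<forall>i\<le>card (fibre_positions p q r). closedin ?T (W i) \<and> irreducible_in ?T (W i)) \<and>
        (\<forall>i<card (fibre_positions p q r). W i \<subset> W (Suc i)) \<and>
        W (card (fibre_positions p q r)) = {x \<in> topspace ?T. frame_map p q x = y}"
      unfolding topspace_zariski_frames x0(2) by (rule fibre_chain(2)[OF x0(1)])
  qed
  then show ?thesis unfolding topspace_zariski_frames by (rule chain_in_frames_bound)
qed

section \<open>Configurations of points and swaps\<close>

text \<open>
  A graph is encoded by points of the grid \<open>{0..p + 1} \<times> {0..q + 1}\<close>: an edge \<open>(i\<^sup>+, j\<^sup>-)\<close> is the
  point \<open>(i, j)\<close>, marks are the points \<open>(i, 0)\<close> and \<open>(0, j)\<close>, and free vertices are the points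
  \<open>(i, q + 1)\<close> and \<open>(p + 1, j)\<close>. If one allows any number of additional points at
  \<open>(0, q + 1)\<close> and \<open>(p + 1, 0)\<close>, then all elementary moves become the same operation, which
  replaces \<open>(a, d), (b, c)\<close> with \<open>a < b\<close> and \<open>c < d\<close> by \<open>(a, c), (b, d)\<close>, and the closure order
  is a Bruhat order.
\<close>

definition config :: "nat \<Rightarrow> nat \<Rightarrow> nat \<Rightarrow> (nat \<times> nat) set \<Rightarrow> bool" where
  "config p q r C \<longleftrightarrow> C \<subseteq> {0..Suc p} \<times> {0..Suc q} \<and>
     (\<forall>i\<in>{1..p}. \<exists>!x. x \<in> C \<and> fst x = i) \<and> (\<forall>j\<in>{1..q}. \<exists>!x. x \<in> C \<and> snd x = j) \<and>
     (\<forall>x\<in>C. fst x \<in> {1..p} \<or> snd x \<in> {1..q}) \<and> card {x \<in> C. fst x \<le> p \<and> snd x \<le> q} = r"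

text \<open>A set cannot record an arbitrary multiplicity at these two corners, so they stay outside
  every configuration and are supplied or discarded at each swap.\<close>

definition phantoms :: "nat \<Rightarrow> nat \<Rightarrow> (nat \<times> nat) set" where
  "phantoms p q = {(0, Suc q), (Suc p, 0)}"

definition cnt :: "(nat \<times> nat) set \<Rightarrow> nat \<Rightarrow> nat \<Rightarrow> nat" where
  "cnt C i j = card {x \<in> C. fst x \<le> i \<and> snd x \<le> j}"

definition ll :: "nat \<times> nat \<Rightarrow> nat \<times> nat \<Rightarrow> bool" where
  "ll x y \<longleftrightarrow> fst x < fst y \<and> snd x < snd y"

definition ll_pairs :: "(nat \<times> nat) set \<Rightarrow> nat" where
  "ll_pairs C = card {(x, y). x \<in> C \<and> y \<in> C \<and> ll x y}"

text \<open>\<open>C'\<close> is the configuration before the swap and belongs to the larger orbit.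
  Phantoms that serve as swap partners are subtracted from it, and the new points must avoid the
  corners that no configuration contains.\<close>

definition swap :: "nat \<Rightarrow> nat \<Rightarrow> (nat \<times> nat) set \<Rightarrow> (nat \<times> nat) set \<Rightarrow> nat \<Rightarrow> nat \<Rightarrow> nat \<Rightarrow> nat \<Rightarrow> bool" where
  "swap p q C' C a b c d \<longleftrightarrow> a < b \<and> b \<le> Suc p \<and> c < d \<and> d \<le> Suc q \<and> (a, c) \<noteq> (0, 0) \<and>
     (b, d) \<noteq> (Suc p, Suc q) \<and>
     (\<exists>T. (a, c) \<notin> T \<and> (b, d) \<notin> T \<and> (a, d) \<notin> T \<and> (b, c) \<notin> T \<and>
        C = T \<union> {(a, c), (b, d)} \<and> C' = T \<union> ({(a, d), (b, c)} - phantoms p q))"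

lemma config_finite: "config p q r C \<Longrightarrow> finite C"
  unfolding config_def by (meson finite_SigmaI finite_atLeastAtMost finite_subset)

lemma config_ex1_row: "config p q r C \<Longrightarrow> i \<in> {1..p} \<Longrightarrow> \<exists>!x. x \<in> C \<and> fst x = i"
  unfolding config_def by (elim conjE) (erule (1) bspec)

lemma config_ex1_col: "config p q r C \<Longrightarrow> j \<in> {1..q} \<Longrightarrow> \<exists>!x. x \<in> C \<and> snd x = j"
  unfolding config_def by (elim conjE) (erule (1) bspec)

lemma config_range: "config p q r C \<Longrightarrow> (i, j) \<in> C \<Longrightarrow> i \<le> Suc p \<and> j \<le> Suc q"
  unfolding config_def by auto

lemma config_row:
  assumes "config p q r C" "i \<in> {1..p}"
  obtains j where "(i, j) \<in> C" "j \<le> Suc q"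
proof -
  obtain x where "x \<in> C" "fst x = i" using config_ex1_row[OF assms] by auto
  then show ?thesis using that[of "snd x"] config_range[OF assms(1), of "fst x" "snd x"] by auto
qed

lemma config_col:
  assumes "config p q r C" "j \<in> {1..q}"
  obtains i where "(i, j) \<in> C" "i \<le> Suc p"
proof -
  obtain x where "x \<in> C" "snd x = j" using config_ex1_col[OF assms] by auto
  then show ?thesis using that[of "fst x"] config_range[OF assms(1), of "fst x" "snd x"] by auto
qed

lemma config_row_unique:
  assumes "config p q r C" "(i, j) \<in> C" "(i, j') \<in> C" "1 \<le> i" "i \<le> p"
  shows "j = j'"
proof -
  have "\<exists>!x. x \<in> C \<and> fst x = i" using config_ex1_row assms by simp
  then have "(i, j) = (i, j')" using assms by (metis fst_conv)
  then show ?thesis by simp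
qed

lemma config_col_unique:
  assumes "config p q r C" "(i, j) \<in> C" "(i', j) \<in> C" "1 \<le> j" "j \<le> q"
  shows "i = i'"
proof -
  have "\<exists>!x. x \<in> C \<and> snd x = j" using config_ex1_col assms by simp
  then have "(i, j) = (i', j)" using assms by (metis snd_conv)
  then show ?thesis by simp
qed

lemma config_interior: "config p q r C \<Longrightarrow> (i, j) \<in> C \<Longrightarrow> 1 \<le> i \<and> i \<le> p \<or> 1 \<le> j \<and> j \<le> q"
  unfolding config_def by fastforce

lemma config_cnt: "config p q r C \<Longrightarrow> cnt C p q = r"
  unfolding config_def cnt_def by simp

lemma config_corner:
  assumes "config p q r C"
  shows "(0, 0) \<notin> C" "(Suc p, Suc q) \<notin> C" "C \<inter> phantoms p q = {}"
  using config_interior[OF assms] unfolding phantoms_def by fastforce+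

lemma cnt_insert: "finite T \<Longrightarrow> z \<notin> T \<Longrightarrow> cnt (insert z T) i j = cnt T i j + of_bool (fst z \<le> i \<and> snd z \<le> j)"
proof -
  assume T: "finite T" "z \<notin> T"
  have "{x \<in> insert z T. fst x \<le> i \<and> snd x \<le> j} =
    (if fst z \<le> i \<and> snd z \<le> j then insert z {x \<in> T. fst x \<le> i \<and> snd x \<le> j} else {x \<in> T. fst x \<le> i \<and> snd x \<le> j})" by auto
  then show ?thesis using T unfolding cnt_def by auto
qed

lemma ll_pairs_insert:
  assumes T: "finite T" "z \<notin> T"
  shows "ll_pairs (insert z T) = ll_pairs T + (\<Sum>t\<in>T. of_bool (ll t z) + of_bool (ll z t))"
proof -
  have e: "{(x, y). x \<in> insert z T \<and> y \<in> insert z T \<and> ll x y} =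
     {(x, y). x \<in> T \<and> y \<in> T \<and> ll x y} \<union> ((\<lambda>t. (t, z)) ` {t \<in> T. ll t z} \<union> (\<lambda>t. (z, t)) ` {t \<in> T. ll z t})"
    by (auto simp: ll_def)
  have f: "finite {(x, y). x \<in> T \<and> y \<in> T \<and> ll x y}"
    by (rule finite_subset[of _ "T \<times> T"]) (use T in auto)
  have "card ((\<lambda>t. (t, z)) ` {t \<in> T. ll t z} \<union> (\<lambda>t. (z, t)) ` {t \<in> T. ll z t}) =
      card {t \<in> T. ll t z} + card {t \<in> T. ll z t}"
    by (subst card_Un_disjoint) (use T in \<open>auto simp: card_image inj_on_def\<close>)
  also have "\<dots> = (\<Sum>t\<in>T. of_bool (ll t z) + of_bool (ll z t))"
    using T by (simp add: sum.distrib sum_of_bool_eq Int_def)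
  finally show ?thesis unfolding ll_pairs_def e
    by (subst card_Un_disjoint) (use T f in auto)
qed

lemma ex1_iff_card: "(\<exists>!x. P x) \<longleftrightarrow> card {x. P x} = 1"
proof -
  have "card {x. P x} = 1 \<longleftrightarrow> (\<exists>x. {x. P x} = {x})" by (simp add: card_1_singleton_iff)
  also have "\<dots> \<longleftrightarrow> (\<exists>!x. P x)" by (auto simp: set_eq_iff)
  finally show ?thesis by simp
qed

text \<open>Apart from the range conditions on single points, everything in \<open>config\<close> is
  a count, hence additive over the disjoint union with \<open>T\<close>.\<close>

lemma config_exchange:
  assumes c: "config p q r (T \<union> X)" and T: "T \<inter> X = {}" "T \<inter> Y = {}" and f: "finite Y"
    and row: "\<And>i. i \<in> {1..p} \<Longrightarrow> card {x \<in> Y. fst x = i} = card {x \<in> X. fst x = i}"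
    and col: "\<And>j. j \<in> {1..q} \<Longrightarrow> card {x \<in> Y. snd x = j} = card {x \<in> X. snd x = j}"
    and nf: "card {x \<in> Y. fst x \<le> p \<and> snd x \<le> q} = card {x \<in> X. fst x \<le> p \<and> snd x \<le> q}"
    and rng: "Y \<subseteq> {0..Suc p} \<times> {0..Suc q}" and int: "\<And>x. x \<in> Y \<Longrightarrow> fst x \<in> {1..p} \<or> snd x \<in> {1..q}"
  shows "config p q r (T \<union> Y)"
proof -
  have fT: "finite T" "finite X" using config_finite[OF c] by auto
  have split: "card {x. x \<in> T \<union> S \<and> P x} = card {x \<in> T. P x} + card {x \<in> S. P x}" if "finite S" "T \<inter> S = {}" for P S
  proof -
    have "{x. x \<in> T \<union> S \<and> P x} = {x \<in> T. P x} \<union> {x \<in> S. P x}" by auto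
    then show ?thesis using that fT(1) by (simp add: card_Un_disjoint disjoint_iff)
  qed
  have "card {x. x \<in> T \<union> Y \<and> fst x = i} = card {x. x \<in> T \<union> X \<and> fst x = i}" if "i \<in> {1..p}" for i
    unfolding split[OF f T(2)] split[OF fT(2) T(1)] using row[OF that] by simp
  moreover have "card {x. x \<in> T \<union> Y \<and> snd x = j} = card {x. x \<in> T \<union> X \<and> snd x = j}" if "j \<in> {1..q}" for j
    unfolding split[OF f T(2)] split[OF fT(2) T(1)] using col[OF that] by simp
  moreover have "card {x. x \<in> T \<union> Y \<and> fst x \<le> p \<and> snd x \<le> q} = card {x. x \<in> T \<union> X \<and> fst x \<le> p \<and> snd x \<le> q}"
    unfolding split[OF f T(2)] split[OF fT(2) T(1)] using nf by simp
  moreover have "\<forall>x\<in>T \<union> Y. fst x \<in> {1..p} \<or> snd x \<in> {1..q}" using c int unfolding config_def by blast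
  ultimately show ?thesis using c rng unfolding config_def ex1_iff_card by simp
qed

lemma swap_config_iff:
  assumes X: "X = {(a, c), (b, d)}" and Y: "Y = {(a, d), (b, c)} - phantoms p q"
    and T: "(a, c) \<notin> T" "(b, d) \<notin> T" "(a, d) \<notin> T" "(b, c) \<notin> T"
    and s: "a < b" "b \<le> Suc p" "c < d" "d \<le> Suc q" "(a, c) \<noteq> (0, 0)" "(b, d) \<noteq> (Suc p, Suc q)"
  shows "config p q r (T \<union> X) \<longleftrightarrow> config p q r (T \<union> Y)"
proof -
  have TX: "T \<inter> X = {}" "T \<inter> Y = {}" using T unfolding X Y by auto
  have f: "finite X" "finite Y" unfolding X Y by auto
  have row: "card {x \<in> X. fst x = i} = card {x \<in> Y. fst x = i}" if "i \<in> {1..p}" for i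
  proof -
    have "{x \<in> X. fst x = i} = (if i = a then {(a, c)} else if i = b then {(b, d)} else {})" using s by (auto simp: X)
    moreover have "{x \<in> Y. fst x = i} = (if i = a then {(a, d)} else if i = b then {(b, c)} else {})"
      using s that by (auto simp: Y phantoms_def)
    ultimately show ?thesis by simp
  qed
  have col: "card {x \<in> X. snd x = j} = card {x \<in> Y. snd x = j}" if "j \<in> {1..q}" for j
  proof -
    have "{x \<in> X. snd x = j} = (if j = c then {(a, c)} else if j = d then {(b, d)} else {})" using s by (auto simp: X)
    moreover have "{x \<in> Y. snd x = j} = (if j = c then {(b, c)} else if j = d then {(a, d)} else {})"
      using s that by (auto simp: Y phantoms_def)
    ultimately show ?thesis by simp
  qed
  have nf: "card {x \<in> X. fst x \<le> p \<and> snd x \<le> q} = card {x \<in> Y. fst x \<le> p \<and> snd x \<le> q}"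
  proof -
    have "{x \<in> X. fst x \<le> p \<and> snd x \<le> q} = (if b \<le> p \<and> d \<le> q then {(a, c), (b, d)} else {(a, c)})"
      using s by (auto simp: X)
    moreover have "{x \<in> Y. fst x \<le> p \<and> snd x \<le> q} =
        (if d \<le> q then {(a, d)} else {}) \<union> (if b \<le> p then {(b, c)} else {})"
      using s by (auto simp: Y phantoms_def)
    ultimately show ?thesis using s by auto
  qed
  have rng: "X \<subseteq> {0..Suc p} \<times> {0..Suc q}" "Y \<subseteq> {0..Suc p} \<times> {0..Suc q}" using s unfolding X Y by auto
  have int: "x \<in> X \<Longrightarrow> fst x \<in> {1..p} \<or> snd x \<in> {1..q}" "x \<in> Y \<Longrightarrow> fst x \<in> {1..p} \<or> snd x \<in> {1..q}" for x
    using s unfolding X Y phantoms_def by auto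
  show ?thesis
    using config_exchange[OF _ TX f(2) row[symmetric] col[symmetric] nf[symmetric] rng(2) int(2)]
      config_exchange[OF _ TX(2,1) f(1) row col nf rng(1) int(1)] by blast
qed

lemma swap_config:
  assumes s: "swap p q C' C a b c d"
  shows "config p q r C' \<longleftrightarrow> config p q r C"
proof -
  obtain T where T: "(a, c) \<notin> T" "(b, d) \<notin> T" "(a, d) \<notin> T" "(b, c) \<notin> T"
    "C = T \<union> {(a, c), (b, d)}" "C' = T \<union> ({(a, d), (b, c)} - phantoms p q)"
    using s unfolding swap_def by blast
  show ?thesis unfolding T(5,6)
    by (rule swap_config_iff[OF refl refl T(1-4), symmetric]) (use s in \<open>auto simp: swap_def\<close>)
qed

lemma cnt_swap:
  assumes s: "swap p q C' C a b c d" and f: "finite C" and ij: "i \<le> p" "j \<le> q"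
  shows "cnt C i j = cnt C' i j + of_bool (a \<le> i \<and> i < b \<and> c \<le> j \<and> j < d)"
proof -
  obtain T where T: "(a, c) \<notin> T" "(b, d) \<notin> T" "(a, d) \<notin> T" "(b, c) \<notin> T"
    "C = T \<union> {(a, c), (b, d)}" "C' = T \<union> ({(a, d), (b, c)} - phantoms p q)"
    using s unfolding swap_def by blast
  have ab: "a < b" "b \<le> Suc p" "c < d" "d \<le> Suc q" using s unfolding swap_def by auto
  have fT: "finite T" using f T by simp
  have "C = insert (a, c) (insert (b, d) T)" using T by auto
  then have 1: "cnt C i j = cnt T i j + of_bool (b \<le> i \<and> d \<le> j) + of_bool (a \<le> i \<and> c \<le> j)"
    using T fT ab by (simp add: cnt_insert)
  have "cnt C' i j = cnt (insert (a, d) (insert (b, c) T)) i j"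
    unfolding cnt_def T(6) using ij by (intro arg_cong[of _ _ card]) (auto simp: phantoms_def)
  also have "\<dots> = cnt T i j + of_bool (b \<le> i \<and> c \<le> j) + of_bool (a \<le> i \<and> d \<le> j)"
    using T fT ab by (simp add: cnt_insert)
  finally show ?thesis using 1 ab by auto
qed

text \<open>A third point is comparable with the old pair as often as with the new one; what remains
  is the pair \<open>(a, c)\<close>, \<open>(b, d)\<close> itself. The first rectangle matters for a
  third point that lies below corners of the swap, the second for one that lies above them.\<close>

lemma ll_pairs_swap:
  assumes s: "swap p q C' C a b c d" and C: "config p q r C"
    and box1: "\<And>i j. (i, j) \<in> C \<Longrightarrow> (i, j) \<noteq> (a, c) \<Longrightarrow> (i, j) \<noteq> (b, d) \<Longrightarrow> \<not> (a \<le> i \<and> i < b \<and> c \<le> j \<and> j < d)"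
    and box2: "\<And>i j. (i, j) \<in> C \<Longrightarrow> (i, j) \<noteq> (a, c) \<Longrightarrow> (i, j) \<noteq> (b, d) \<Longrightarrow> \<not> (a < i \<and> i \<le> b \<and> c < j \<and> j \<le> d)"
  shows "ll_pairs C = ll_pairs C' + 1"
proof -
  obtain T where T: "(a, c) \<notin> T" "(b, d) \<notin> T" "(a, d) \<notin> T" "(b, c) \<notin> T"
    "C = T \<union> {(a, c), (b, d)}" "C' = T \<union> ({(a, d), (b, c)} - phantoms p q)"
    using s unfolding swap_def by blast
  have ab: "a < b" "b \<le> Suc p" "c < d" "d \<le> Suc q" using s unfolding swap_def by auto
  have fT: "finite T" using config_finite[OF C] T by simp
  define u where "u z = (\<Sum>t\<in>T. of_bool (ll t z) + of_bool (ll z t) :: nat)" for z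
  \<comment> \<open>A phantom lies on opposite borders of the grid, so no point is strictly
    comparable with it, and counting it or not makes no difference.\<close>
  have ph0: "u z = 0" if "z \<in> phantoms p q" for z
    unfolding u_def using that config_range[OF C] T(5) by (intro sum.neutral) (fastforce simp: ll_def phantoms_def)
  have "C = insert (a, c) (insert (b, d) T)" using T by auto
  moreover have "ll_pairs (insert (a, c) (insert (b, d) T)) =
      ll_pairs (insert (b, d) T) + (\<Sum>t\<in>insert (b, d) T. of_bool (ll t (a, c)) + of_bool (ll (a, c) t))"
    by (rule ll_pairs_insert) (use T fT ab in auto)
  ultimately have "ll_pairs C = ll_pairs (insert (b, d) T) + (\<Sum>t\<in>insert (b, d) T. of_bool (ll t (a, c)) + of_bool (ll (a, c) t))"
    by simp
  also have "\<dots> = ll_pairs T + u (b, d) + u (a, c) + 1"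
    using T fT ab by (simp add: ll_pairs_insert u_def) (simp add: ll_def)
  finally have 1: "ll_pairs C = ll_pairs T + u (b, d) + u (a, c) + 1" .
  have 2: "ll_pairs C' = ll_pairs T + u (a, d) + u (b, c)"
  proof -
    have P: "ll_pairs (insert (b, c) T) = ll_pairs T + u (b, c)" "ll_pairs (insert (a, d) T) = ll_pairs T + u (a, d)"
      using T fT by (simp_all add: ll_pairs_insert u_def)
    have "ll_pairs (insert (a, d) (insert (b, c) T)) = ll_pairs T + u (b, c) + u (a, d)"
      using T fT ab P(1) by (subst ll_pairs_insert) (simp_all add: u_def ll_def)
    moreover have "C' = (if (a, d) \<in> phantoms p q then if (b, c) \<in> phantoms p q then T else insert (b, c) T
        else if (b, c) \<in> phantoms p q then insert (a, d) T else insert (a, d) (insert (b, c) T))"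
      unfolding T(6) by auto
    ultimately show ?thesis using P ph0[of "(a, d)"] ph0[of "(b, c)"] by simp
  qed
  have "u (b, d) + u (a, c) = u (a, d) + u (b, c)"
    unfolding u_def sum.distrib[symmetric]
  proof (rule sum.cong[OF refl])
    fix t assume t: "t \<in> T"
    obtain i j where ij: "t = (i, j)" by (cases t)
    have "(i, j) \<in> C" "(i, j) \<noteq> (a, c)" "(i, j) \<noteq> (b, d)" using t T unfolding ij by auto
    then have b: "\<not> (a \<le> i \<and> i < b \<and> c \<le> j \<and> j < d)" "\<not> (a < i \<and> i \<le> b \<and> c < j \<and> j \<le> d)"
      using box1 box2 by auto
    have x: "of_bool (i < b \<and> j < d) + of_bool (i < a \<and> j < c) = (of_bool (i < a \<and> j < d) + of_bool (i < b \<and> j < c) :: nat)"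
      using b(1) ab(1,3) by (auto simp: of_bool_def)
    have y: "of_bool (b < i \<and> d < j) + of_bool (a < i \<and> c < j) = (of_bool (a < i \<and> d < j) + of_bool (b < i \<and> c < j) :: nat)"
      using b(2) ab(1,3) by (auto simp: of_bool_def)
    show "of_bool (ll t (b, d)) + of_bool (ll (b, d) t) + (of_bool (ll t (a, c)) + of_bool (ll (a, c) t)) =
       of_bool (ll t (a, d)) + of_bool (ll (a, d) t) + (of_bool (ll t (b, c)) + of_bool (ll (b, c) t) :: nat)"
      unfolding ij ll_def fst_conv snd_conv using x y by linarith
  qed
  then show ?thesis using 1 2 by simp
qed

text \<open>An interior row or column holds exactly one point, so a vertex that is free in one
  configuration cannot carry a point inside the grid in the other.\<close>

lemma config_agree_subset:
  assumes u: "config p q r u" and v: "config p q r v"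
    and agree: "\<And>i j. i \<le> p \<Longrightarrow> j \<le> q \<Longrightarrow> (i, j) \<in> u \<longleftrightarrow> (i, j) \<in> v"
  shows "u \<subseteq> v"
proof
  fix x assume x: "x \<in> u"
  obtain i j where ij: "x = (i, j)" by (cases x)
  have rng: "i \<le> Suc p" "j \<le> Suc q" using config_range[OF u] x ij by auto
  have int: "1 \<le> i \<and> i \<le> p \<or> 1 \<le> j \<and> j \<le> q" using config_interior[OF u] x ij by auto
  consider "i \<le> p" "j \<le> q" | "j = Suc q" "1 \<le> i" "i \<le> p" | "i = Suc p" "1 \<le> j" "j \<le> q"
    using rng int by linarith
  then show "x \<in> v"
  proof cases
    case 1
    then show ?thesis using agree x ij by simp
  next
    case 2
    then obtain j' where j': "j' \<le> Suc q" "(i, j') \<in> v" using config_row[OF v, of i] by force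
    have "j' = Suc q"
    proof (rule ccontr)
      assume "j' \<noteq> Suc q"
      then have "(i, j') \<in> u" using agree[of i j'] j' 2 by auto
      then show False using config_row_unique[OF u, of i j' j] x ij 2 \<open>j' \<noteq> Suc q\<close> by auto
    qed
    then show ?thesis using j' ij 2 by simp
  next
    case 3
    then obtain i' where i': "i' \<le> Suc p" "(i', j) \<in> v" using config_col[OF v, of j] by force
    have "i' = Suc p"
    proof (rule ccontr)
      assume "i' \<noteq> Suc p"
      then have "(i', j) \<in> u" using agree[of i' j] i' 3 by auto
      then show False using config_col_unique[OF u, of i' j i] x ij 3 \<open>i' \<noteq> Suc p\<close> by auto
    qed
    then show ?thesis using i' ij 3 by simp
  qed
qed

text \<open>The chain property of a Bruhat order, with the number of comparable pairs growing by one
  only. The rectangle is found from the first place where \<open>u\<close> and \<open>v\<close>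
  differ, and its sides are chosen so short that no further point of \<open>v\<close> lies inside.
  In row or column \<open>0\<close>, which may be empty, a phantom supplies the missing
  point.\<close>

lemma exists_swap_below:
  assumes u: "config p q r u" and v: "config p q r v" and uv: "u \<noteq> v"
    and le: "\<And>i j. i \<le> p \<Longrightarrow> j \<le> q \<Longrightarrow> cnt v i j \<le> cnt u i j"
  obtains w a b c d where "swap p q v w a b c d" "config p q r w" "ll_pairs w = ll_pairs v + 1"
    "\<And>i j. i \<le> p \<Longrightarrow> j \<le> q \<Longrightarrow> cnt w i j \<le> cnt u i j"
proof -
  let ?V = "v \<union> phantoms p q"
  define ag where "ag i \<longleftrightarrow> (\<forall>j\<le>q. (i, j) \<in> u \<longleftrightarrow> (i, j) \<in> v)" for i
  have "\<exists>a. a \<le> p \<and> \<not> ag a"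
  proof (rule ccontr)
    assume "\<not> ?thesis"
    then have g: "(i, j) \<in> u \<longleftrightarrow> (i, j) \<in> v" if "i \<le> p" "j \<le> q" for i j using that unfolding ag_def by auto
    then show False using config_agree_subset[OF u v] config_agree_subset[OF v u] uv by auto
  qed
  define a where "a = (LEAST a. a \<le> p \<and> \<not> ag a)"
  have a: "a \<le> p" "\<not> ag a" unfolding a_def using LeastI_ex[OF \<open>\<exists>a. a \<le> p \<and> \<not> ag a\<close>] by auto
  have ag: "(i, j) \<in> u \<longleftrightarrow> (i, j) \<in> v" if "i < a" "j \<le> q" for i j
  proof -
    have "\<not> (i \<le> p \<and> \<not> ag i)" using not_less_Least[of i "\<lambda>a. a \<le> p \<and> \<not> ag a"] that(1) unfolding a_def by blast
    then show ?thesis using that a(1) unfolding ag_def by auto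
  qed
  let ?D = "\<lambda>c. c \<le> q \<and> ((a, c) \<in> u) \<noteq> ((a, c) \<in> v)"
  have "\<exists>c. ?D c" using a(2) unfolding ag_def by auto
  define c0 where "c0 = (LEAST c. ?D c)"
  have c0: "c0 \<le> q" "((a, c0) \<in> u) \<noteq> ((a, c0) \<in> v)" unfolding c0_def using LeastI_ex[OF \<open>\<exists>c. ?D c\<close>] by auto
  have agc: "(a, j) \<in> u \<longleftrightarrow> (a, j) \<in> v" if "j < c0" for j
    using not_less_Least[of j ?D] that c0(1) unfolding c0_def[symmetric] by auto
  \<comment> \<open>At the first difference a point of \<open>v\<close> alone would make
    \<open>cnt v\<close> exceed \<open>cnt u\<close>.\<close>
  have ac0: "(a, c0) \<in> u" "(a, c0) \<notin> v"
  proof -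
    have "(a, c0) \<in> u"
    proof (rule ccontr)
      assume n: "(a, c0) \<notin> u"
      have eq: "(i, j) \<in> u \<longleftrightarrow> (i, j) \<in> v" if "i \<le> a" "j \<le> c0" "(i, j) \<noteq> (a, c0)" for i j
      proof (cases "i = a")
        case True
        then have "j < c0" using that by auto
        then show ?thesis using agc True by simp
      next
        case False
        then show ?thesis using ag that c0(1) by auto
      qed
      have "{x \<in> u. fst x \<le> a \<and> snd x \<le> c0} \<subset> {x \<in> v. fst x \<le> a \<and> snd x \<le> c0}"
      proof (rule psubsetI)
        show "{x \<in> u. fst x \<le> a \<and> snd x \<le> c0} \<subseteq> {x \<in> v. fst x \<le> a \<and> snd x \<le> c0}"
        proof
          fix x assume x: "x \<in> {x \<in> u. fst x \<le> a \<and> snd x \<le> c0}"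
          then have "(fst x, snd x) \<noteq> (a, c0)" using n by auto
          then show "x \<in> {x \<in> v. fst x \<le> a \<and> snd x \<le> c0}" using eq[of "fst x" "snd x"] x by simp
        qed
        have "(a, c0) \<in> {x \<in> v. fst x \<le> a \<and> snd x \<le> c0}" using n c0(2) by auto
        moreover have "(a, c0) \<notin> {x \<in> u. fst x \<le> a \<and> snd x \<le> c0}" using n by simp
        ultimately show "{x \<in> u. fst x \<le> a \<and> snd x \<le> c0} \<noteq> {x \<in> v. fst x \<le> a \<and> snd x \<le> c0}" by metis
      qed
      then have "cnt u a c0 < cnt v a c0"
        unfolding cnt_def using config_finite[OF v] by (intro psubset_card_mono) auto
      then show False using le[OF a(1) c0(1)] by simp
    qed
    then show "(a, c0) \<in> u" "(a, c0) \<notin> v" using c0(2) by auto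
  qed
  let ?E = "\<lambda>d. c0 < d \<and> (a, d) \<in> ?V"
  have "\<exists>d. ?E d"
  proof (cases "a = 0")
    case True
    then show ?thesis using c0(1) by (intro exI[of _ "Suc q"]) (auto simp: phantoms_def)
  next
    case False
    then obtain j where j: "(a, j) \<in> v" using config_row[OF v, of a] a(1) by force
    have "j \<noteq> c0" using j ac0 by auto
    moreover have "\<not> j < c0"
    proof
      assume "j < c0"
      then have "(a, j) \<in> u" using agc j by simp
      then show False using config_row_unique[OF u, of a j c0] ac0 a(1) False \<open>j < c0\<close> by auto
    qed
    ultimately show ?thesis using j by (intro exI[of _ j]) auto
  qed
  \<comment> \<open>The next point of \<open>v\<close> to the right in row \<open>a\<close>,
    possibly the phantom if \<open>a = 0\<close>.\<close>
  define d where "d = (LEAST d. ?E d)"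
  have d: "c0 < d" "(a, d) \<in> ?V" unfolding d_def using LeastI_ex[OF \<open>\<exists>d. ?E d\<close>] by auto
  have dq: "d \<le> Suc q" using d(2) config_range[OF v] by (auto simp: phantoms_def)
  have rowa: "(a, j) \<notin> v" if "c0 \<le> j" "j < d" for j
    using not_less_Least[of j ?E] that ac0(2) unfolding d_def[symmetric] by (cases "j = c0") auto
  let ?F = "\<lambda>b. a < b \<and> (\<exists>c. c0 \<le> c \<and> c < d \<and> (b, c) \<in> ?V)"
  have "\<exists>b. ?F b"
  proof (cases "c0 = 0")
    case True
    then show ?thesis using a(1) d(1) by (intro exI[of _ "Suc p"] conjI exI[of _ 0]) (auto simp: phantoms_def)
  next
    case False
    then obtain i where i: "(i, c0) \<in> v" using config_col[OF v, of c0] c0(1) by force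
    have "i \<noteq> a" using i ac0 by auto
    moreover have "\<not> i < a"
    proof
      assume "i < a"
      then have "(i, c0) \<in> u" using ag i c0(1) by simp
      then show False using config_col_unique[OF u, of i c0 a] ac0 c0(1) False \<open>i < a\<close> by auto
    qed
    ultimately show ?thesis using i d(1) by (intro exI[of _ i] conjI exI[of _ c0]) auto
  qed
  \<comment> \<open>The first later row with a point in the columns from \<open>c0\<close> up to,
    but excluding, \<open>d\<close>. Strictly between the rows \<open>a\<close> and \<open>b\<close>
    these columns are empty.\<close>
  define b where "b = (LEAST b. ?F b)"
  have b: "a < b" "\<exists>c. c0 \<le> c \<and> c < d \<and> (b, c) \<in> ?V" unfolding b_def using LeastI_ex[OF \<open>\<exists>b. ?F b\<close>] by blast+
  have bp: "b \<le> Suc p" using b(2) config_range[OF v] by (auto simp: phantoms_def)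
  have rowi: "(i, j) \<notin> ?V" if "a < i" "i < b" "c0 \<le> j" "j < d" for i j
    using not_less_Least[of i ?F] that unfolding b_def[symmetric] by auto
  \<comment> \<open>Row \<open>b\<close> can hold several points only for \<open>b = Suc p\<close>;
    the maximum keeps the others out of the rectangle.\<close>
  define c where "c = Max {c. c0 \<le> c \<and> c < d \<and> (b, c) \<in> ?V}"
  have fc: "finite {c. c0 \<le> c \<and> c < d \<and> (b, c) \<in> ?V}" by (rule finite_subset[of _ "{..<d}"]) auto
  have c: "c0 \<le> c" "c < d" "(b, c) \<in> ?V" using Max_in[OF fc] b(2) unfolding c_def[symmetric] by blast+
  have cmax: "(b, j) \<notin> ?V" if "c < j" "j < d" for j
    using Max_ge[OF fc, of j] that c(1) unfolding c_def[symmetric] by auto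
  \<comment> \<open>Likewise column \<open>d\<close> can hold several points only for
    \<open>d = Suc q\<close>, and the last one before row \<open>b\<close> is taken.\<close>
  define a' where "a' = Max {i. a \<le> i \<and> i < b \<and> (i, d) \<in> ?V}"
  have fa: "finite {i. a \<le> i \<and> i < b \<and> (i, d) \<in> ?V}" by (rule finite_subset[of _ "{..<b}"]) auto
  have a': "a \<le> a'" "a' < b" "(a', d) \<in> ?V" using Max_in[OF fa] b(1) d(2) unfolding a'_def[symmetric] by blast+
  have amax: "(i, d) \<notin> ?V" if "a' < i" "i < b" for i
    using Max_ge[OF fa, of i] that a'(1) unfolding a'_def[symmetric] by auto
  \<comment> \<open>Left of column \<open>c0\<close> the hypothesis applies. From \<open>c0\<close>
    on, the points of \<open>v\<close> lie in rows before \<open>a\<close>, where \<open>u\<close>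
    agrees with \<open>v\<close>, and \<open>u\<close> has \<open>(a, c0)\<close> in
    addition.\<close>
  have strict: "cnt v i j < cnt u i j" if ij: "a \<le> i" "i < b" "i \<le> p" "c0 \<le> j" "j < d" "j \<le> q" for i j
  proof -
    have sp: "cnt C i j = card {x \<in> C. fst x \<le> i \<and> snd x < c0} + card {x \<in> C. fst x \<le> i \<and> c0 \<le> snd x \<and> snd x \<le> j}"
      if "finite C" for C
      unfolding cnt_def using that ij(4)
      by (subst card_Un_disjoint[symmetric]) (auto intro!: arg_cong[of _ _ card])
    have "card {x \<in> v. fst x \<le> i \<and> snd x < c0} \<le> card {x \<in> u. fst x \<le> i \<and> snd x < c0}"
    proof (cases c0)
      case (Suc k)
      then have "cnt v i k \<le> cnt u i k" using le ij c0(1) by auto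
      then show ?thesis unfolding cnt_def Suc less_Suc_eq_le .
    qed simp
    moreover have "card {x \<in> v. fst x \<le> i \<and> c0 \<le> snd x \<and> snd x \<le> j} < card {x \<in> u. fst x \<le> i \<and> c0 \<le> snd x \<and> snd x \<le> j}"
    proof (rule psubset_card_mono)
      show "finite {x \<in> u. fst x \<le> i \<and> c0 \<le> snd x \<and> snd x \<le> j}" using config_finite[OF u] by auto
      have "x \<in> u" if x: "x \<in> v" "fst x \<le> i" "c0 \<le> snd x" "snd x \<le> j" for x
      proof -
        obtain k l where kl: "x = (k, l)" by (cases x)
        have "l < d" using x kl ij by auto
        then have "k \<noteq> a" using rowa x kl by auto
        moreover have "\<not> a < k" using rowi[of k l] x kl ij \<open>l < d\<close> by auto
        ultimately show ?thesis using ag[of k l] x kl ij by auto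
      qed
      moreover have "(a, c0) \<in> {x \<in> u. fst x \<le> i \<and> c0 \<le> snd x \<and> snd x \<le> j}" using ac0 ij by auto
      moreover have "(a, c0) \<notin> {x \<in> v. fst x \<le> i \<and> c0 \<le> snd x \<and> snd x \<le> j}" using ac0 by auto
      ultimately show "{x \<in> v. fst x \<le> i \<and> c0 \<le> snd x \<and> snd x \<le> j} \<subset> {x \<in> u. fst x \<le> i \<and> c0 \<le> snd x \<and> snd x \<le> j}"
        by blast
    qed
    ultimately show ?thesis using sp[OF config_finite[OF u]] sp[OF config_finite[OF v]] by linarith
  qed
  \<comment> \<open>For this corner the strict inequality would reach \<open>(p, q)\<close>, where
    both counts equal \<open>r\<close>.\<close>
  have bd: "(b, d) \<noteq> (Suc p, Suc q)"
  proof
    assume "(b, d) = (Suc p, Suc q)"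
    then have "cnt v p q < cnt u p q" using a(1) c0(1) by (intro strict) auto
    then show False using config_cnt[OF u] config_cnt[OF v] by simp
  qed
  have ac: "(a', c) \<noteq> (0, 0)"
  proof
    assume "(a', c) = (0, 0)"
    then have "(a, c0) = (0, 0)" using a'(1) c(1) by auto
    then show False using config_corner(1)[OF u] ac0 by auto
  qed
  have nac: "(a', c) \<notin> v" using rowa[of c] rowi[of a' c] a' c by (cases "a' = a") auto
  have nbd: "(b, d) \<notin> v"
  proof
    assume m: "(b, d) \<in> v"
    show False
    proof (cases "d \<le> q")
      case True
      then have "(a', d) \<in> v" using a' c c0 d bp by (auto simp: phantoms_def)
      then show False using config_col_unique[OF v m, of a'] True d a'(2) by auto
    next
      case False
      then have "b \<le> p" using bd bp dq by auto
      then have "(b, c) \<in> v" using c(3) b(1) by (auto simp: phantoms_def)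
      then show False using config_row_unique[OF v m, of c] \<open>b \<le> p\<close> b(1) c(2) by auto
    qed
  qed
  define T where "T = v - {(a', d), (b, c)}"
  define w where "w = T \<union> {(a', c), (b, d)}"
  have vT: "v = T \<union> ({(a', d), (b, c)} - phantoms p q)"
    unfolding T_def using a'(3) c(3) config_corner(3)[OF v] by blast
  have sw: "swap p q v w a' b c d"
    unfolding swap_def
  proof (intro conjI exI[of _ T])
    show "w = T \<union> {(a', c), (b, d)}" by (rule w_def)
    show "v = T \<union> ({(a', d), (b, c)} - phantoms p q)" by (rule vT)
    show "(a', d) \<notin> T" "(b, c) \<notin> T" "(a', c) \<notin> T" "(b, d) \<notin> T" using nac nbd by (simp_all add: T_def)
  qed (use a'(2) bp c(2) dq ac bd in simp_all)
  have cw: "config p q r w" using v swap_config[OF sw] by simp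
  have inT: "(i, j) \<in> v" if "(i, j) \<in> w" "(i, j) \<noteq> (a', c)" "(i, j) \<noteq> (b, d)" for i j
    using that unfolding w_def T_def by auto
  have pairs: "ll_pairs w = ll_pairs v + 1"
  proof (rule ll_pairs_swap[OF sw cw])
    fix i j assume w: "(i, j) \<in> w" "(i, j) \<noteq> (a', c)" "(i, j) \<noteq> (b, d)"
    note m = inT[OF w]
    show "\<not> (a' \<le> i \<and> i < b \<and> c \<le> j \<and> j < d)"
      using rowa[of j] rowi[of i j] m a'(1) c(1) by (cases "i = a") auto
    show "\<not> (a' < i \<and> i \<le> b \<and> c < j \<and> j \<le> d)"
    proof
      assume h: "a' < i \<and> i \<le> b \<and> c < j \<and> j \<le> d"
      consider "i < b" "j < d" | "i < b" "j = d" | "i = b" "j < d" | "i = b" "j = d" using h by linarith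
      then show False
        using rowi[of i j] amax[of i] cmax[of j] nbd m h a'(1) c(1) by cases auto
    qed
  qed
  have "cnt w i j \<le> cnt u i j" if ij: "i \<le> p" "j \<le> q" for i j
  proof -
    have "cnt w i j = cnt v i j + of_bool (a' \<le> i \<and> i < b \<and> c \<le> j \<and> j < d)"
      by (rule cnt_swap[OF sw config_finite[OF cw] ij])
    then show ?thesis using strict[of i j] le[OF ij] ij a'(1) c(1) by (auto simp: of_bool_def)
  qed
  then show ?thesis using that sw cw pairs by blast
qed

text \<open>A comparable pair of smallest half-perimeter has no further point in its rectangles,
  because such a point would form a closer pair with one of the two ends.\<close>

lemma exists_swap_above:
  assumes C: "config p q r C" and pos: "ll_pairs C > 0"
  obtains C' a b c d where "swap p q C' C a b c d" "config p q r C'" "ll_pairs C = ll_pairs C' + 1"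
proof -
  let ?P = "\<lambda>(x, y). x \<in> C \<and> y \<in> C \<and> ll x y"
  let ?m = "\<lambda>(x, y). (fst y - fst x) + (snd y - snd x)"
  have "{(x, y). x \<in> C \<and> y \<in> C \<and> ll x y} \<noteq> {}" using pos unfolding ll_pairs_def by (metis card.empty less_irrefl)
  then obtain z where "?P z" by blast
  then obtain xy where xy: "?P xy" "\<And>z. ?P z \<Longrightarrow> ?m xy \<le> ?m z" using ex_has_least_nat[of ?P z ?m] by blast
  obtain a c b d where e: "xy = ((a, c), (b, d))" by (metis surj_pair)
  have m: "(a, c) \<in> C" "(b, d) \<in> C" "a < b" "c < d" using xy(1) unfolding e ll_def by auto
  have min: "(b - a) + (d - c) \<le> (k - i) + (l - j)" if "(i, j) \<in> C" "(k, l) \<in> C" "i < k" "j < l" for i j k l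
    using xy(2)[of "((i, j), (k, l))"] that unfolding e ll_def by simp
  define T where "T = C - {(a, c), (b, d)}"
  define C' where "C' = T \<union> ({(a, d), (b, c)} - phantoms p q)"
  note rng = config_range[OF C m(1)] config_range[OF C m(2)]
  have nad: "(a, d) \<notin> C"
  proof
    assume x: "(a, d) \<in> C"
    from config_interior[OF C x] consider "1 \<le> a" "a \<le> p" | "1 \<le> d" "d \<le> q" by blast
    then show False
    proof cases
      case 1
      then show ?thesis using config_row_unique[OF C x m(1)] m(4) by simp
    next
      case 2
      then show ?thesis using config_col_unique[OF C x m(2)] m(3) by simp
    qed
  qed
  have nbc: "(b, c) \<notin> C"
  proof
    assume x: "(b, c) \<in> C"
    from config_interior[OF C x] consider "1 \<le> b" "b \<le> p" | "1 \<le> c" "c \<le> q" by blast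
    then show False
    proof cases
      case 1
      then show ?thesis using config_row_unique[OF C x m(2)] m(4) by simp
    next
      case 2
      then show ?thesis using config_col_unique[OF C x m(1)] m(3) by simp
    qed
  qed
  have CT: "C = T \<union> {(a, c), (b, d)}" unfolding T_def using m by auto
  have sw: "swap p q C' C a b c d"
    unfolding swap_def
  proof (intro conjI exI[of _ T])
    show "(a, c) \<noteq> (0, 0)" "(b, d) \<noteq> (Suc p, Suc q)" using m(1,2) config_corner(1,2)[OF C] by metis+
    show "C = T \<union> {(a, c), (b, d)}" by (rule CT)
    show "C' = T \<union> ({(a, d), (b, c)} - phantoms p q)" by (rule C'_def)
    show "(a, d) \<notin> T" "(b, c) \<notin> T" "(a, c) \<notin> T" "(b, d) \<notin> T" using nad nbc by (simp_all add: T_def)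
  qed (use m rng in simp_all)
  have "ll_pairs C = ll_pairs C' + 1"
  proof (rule ll_pairs_swap[OF sw C])
    fix i j assume t: "(i, j) \<in> C" "(i, j) \<noteq> (a, c)" "(i, j) \<noteq> (b, d)"
    show "\<not> (a \<le> i \<and> i < b \<and> c \<le> j \<and> j < d)"
    proof
      assume h: "a \<le> i \<and> i < b \<and> c \<le> j \<and> j < d"
      then have "(b - a) + (d - c) \<le> (b - i) + (d - j)" using min[OF t(1) m(2)] by auto
      then show False using h t(2) by auto
    qed
    show "\<not> (a < i \<and> i \<le> b \<and> c < j \<and> j \<le> d)"
    proof
      assume h: "a < i \<and> i \<le> b \<and> c < j \<and> j \<le> d"
      then have "(b - a) + (d - c) \<le> (i - a) + (j - c)" using min[OF m(1) t(1)] by auto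
      then show False using h t(3) by auto
    qed
  qed
  then show ?thesis using that sw swap_config[OF sw] C by blast
qed

lemma swap_cnt_le:
  assumes "swap p q C' C a b c d" "config p q r C" "i \<le> p" "j \<le> q"
  shows "cnt C' i j \<le> cnt C i j"
  using cnt_swap[OF assms(1) config_finite[OF assms(2)] assms(3,4)] by simp

text \<open>If the configurations differed, a swap of \<open>v\<close> below \<open>u\<close> would
  exist, but it raises the count at its corner \<open>(a, c)\<close> above that of
  \<open>u\<close>.\<close>

lemma config_eq_if_cnt_eq:
  assumes u: "config p q r u" and v: "config p q r v"
    and eq: "\<And>i j. i \<le> p \<Longrightarrow> j \<le> q \<Longrightarrow> cnt u i j = cnt v i j"
  shows "u = v"
proof (rule ccontr)
  assume "u \<noteq> v"
  then obtain w a b c d where w: "swap p q v w a b c d" "config p q r w"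
    "\<And>i j. i \<le> p \<Longrightarrow> j \<le> q \<Longrightarrow> cnt w i j \<le> cnt u i j"
    using exists_swap_below[OF u v] eq by (metis order_refl)
  have s: "a < b" "b \<le> Suc p" "c < d" "d \<le> Suc q" using w(1) unfolding swap_def by auto
  then have "cnt w a c = cnt v a c + 1" using cnt_swap[OF w(1) config_finite[OF w(2)], of a c] by simp
  then show False using w(3)[of a c] eq[of a c] s by simp
qed

section \<open>Leading positions\<close>

(* A point (i, j) stands for the coordinates 0, ..., i - 1 of V^+ and 0, ..., j - 1 of V^-. *)
definition box :: "nat \<Rightarrow> nat \<times> nat \<Rightarrow> nat set" where
  "box p x = {..<fst x} \<union> {p..<p + snd x}"

text \<open>Coordinates of points are counted from \<open>1\<close>, rows from \<open>0\<close>; the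
  coordinate \<open>0\<close> means that the column is zero in that block.\<close>

definition lead_rows :: "nat \<Rightarrow> nat \<times> nat \<Rightarrow> nat set" where
  "lead_rows p x = (if fst x = 0 then {} else {fst x - 1}) \<union> (if snd x = 0 then {} else {p + snd x - 1})"

text \<open>\<open>ld m\<close> is the point contributed by column \<open>m\<close>, and disjoint
  lead rows mean that no vertex is used by two columns.\<close>

definition lead_fun :: "nat \<Rightarrow> nat \<Rightarrow> nat \<Rightarrow> (nat \<Rightarrow> nat \<times> nat) \<Rightarrow> bool" where
  "lead_fun p q r ld \<longleftrightarrow> (\<forall>m<r. ld m \<noteq> (0, 0) \<and> fst (ld m) \<le> p \<and> snd (ld m) \<le> q) \<and>
     (\<forall>m<r. \<forall>m'<r. m \<noteq> m' \<longrightarrow> lead_rows p (ld m) \<inter> lead_rows p (ld m') = {})"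

definition has_leads :: "nat \<Rightarrow> nat \<Rightarrow> nat \<Rightarrow> (nat \<Rightarrow> nat \<times> nat) \<Rightarrow> complex mat \<Rightarrow> bool" where
  "has_leads p q r ld A \<longleftrightarrow> A \<in> carrier_mat (p + q) r \<and>
     (\<forall>m<r. (\<forall>i<p + q. i \<notin> box p (ld m) \<longrightarrow> A $$ (i, m) = 0) \<and> (\<forall>i\<in>lead_rows p (ld m). A $$ (i, m) \<noteq> 0))"

definition lead_mat :: "nat \<Rightarrow> nat \<Rightarrow> nat \<Rightarrow> (nat \<Rightarrow> nat \<times> nat) \<Rightarrow> complex mat" where
  "lead_mat p q r ld = mat (p + q) r (\<lambda>(i, m). of_bool (i \<in> lead_rows p (ld m)))"

lemma lead_rows_less: "fst x \<le> p \<Longrightarrow> snd x \<le> q \<Longrightarrow> i \<in> lead_rows p x \<Longrightarrow> i < p + q"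
  unfolding lead_rows_def by (auto split: if_splits)

lemma lead_rows_box: "lead_rows p x \<subseteq> box p x"
  unfolding lead_rows_def box_def by auto

lemma box_mono: "fst x \<le> fst y \<Longrightarrow> snd x \<le> snd y \<Longrightarrow> box p x \<subseteq> box p y"
  unfolding box_def by auto

lemma has_leads_lead_mat:
  assumes "lead_fun p q r ld"
  shows "has_leads p q r ld (lead_mat p q r ld)"
  unfolding has_leads_def
proof (intro conjI allI impI ballI)
  fix m assume m: "m < r"
  then have rng: "fst (ld m) \<le> p" "snd (ld m) \<le> q" using assms unfolding lead_fun_def by auto
  {
    fix i assume "i < p + q" "i \<notin> box p (ld m)"
    then show "lead_mat p q r ld $$ (i, m) = 0"
      using m lead_rows_box[of p "ld m"] unfolding lead_mat_def by auto
  next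
    fix i assume "i \<in> lead_rows p (ld m)"
    then show "lead_mat p q r ld $$ (i, m) \<noteq> 0"
      using m lead_rows_less[OF rng] unfolding lead_mat_def by simp
  }
qed (simp add: lead_mat_def)

text \<open>For a point that is not dominated by \<open>(i0, j0)\<close> this is a lead row outside
  the box of \<open>(i0, j0)\<close>, taken in \<open>V^+\<close> whenever possible.\<close>

definition pivot_row :: "nat \<Rightarrow> nat \<Rightarrow> nat \<times> nat \<Rightarrow> nat" where
  "pivot_row p i0 x = (if i0 < fst x then fst x - 1 else p + snd x - 1)"

lemma pivot_row_lead:
  assumes "\<not> (fst x \<le> i0 \<and> snd x \<le> j0)" "fst x \<le> p"
  shows "pivot_row p i0 x \<in> lead_rows p x" "i0 \<le> p \<Longrightarrow> pivot_row p i0 x \<notin> box p (i0, j0)"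
  using assms unfolding pivot_row_def lead_rows_def box_def by auto

(* Triangularity: columns with lead beyond i0 in V^+ are eliminated by decreasing lead in V^+,
   and then the remaining ones by decreasing lead in V^-. *)
lemma pivots_vanish:
  assumes ld: "lead_fun p q r ld" and A: "has_leads p q r ld A"
    and eq: "\<And>m. m < r \<Longrightarrow> w m \<noteq> 0 \<Longrightarrow> \<not> (fst (ld m) \<le> i0 \<and> snd (ld m) \<le> j0) \<Longrightarrow>
      (\<Sum>m'<r. A $$ (pivot_row p i0 (ld m), m') * w m') = 0"
    and m: "m < r" "\<not> (fst (ld m) \<le> i0 \<and> snd (ld m) \<le> j0)"
  shows "w m = 0"
proof (rule ccontr)
  assume wm: "w m \<noteq> 0"
  have rng: "fst (ld m) \<le> p \<and> snd (ld m) \<le> q" if "m < r" for m using ld that unfolding lead_fun_def by auto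
  have zero: "A $$ (i, m) = 0" if "m < r" "i < p + q" "i \<notin> box p (ld m)" for i m
    using A that unfolding has_leads_def by auto
  have lead: "A $$ (i, m) \<noteq> 0" if "m < r" "i \<in> lead_rows p (ld m)" for i m
    using A that unfolding has_leads_def by auto
  have disj: "lead_rows p (ld m) \<inter> lead_rows p (ld m') = {}" if "m < r" "m' < r" "m \<noteq> m'" for m m'
    using ld that unfolding lead_fun_def by auto
  define J where "J = {m. m < r \<and> w m \<noteq> 0 \<and> \<not> (fst (ld m) \<le> i0 \<and> snd (ld m) \<le> j0)}"
  have contra: False if k: "k \<in> J" and other: "\<And>m'. m' < r \<Longrightarrow> m' \<noteq> k \<Longrightarrow> w m' \<noteq> 0 \<Longrightarrow> A $$ (pivot_row p i0 (ld k), m') = 0" for k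
  proof -
    have kr: "k < r" "w k \<noteq> 0" "\<not> (fst (ld k) \<le> i0 \<and> snd (ld k) \<le> j0)" using k unfolding J_def by auto
    have "0 = (\<Sum>m'<r. A $$ (pivot_row p i0 (ld k), m') * w m')" using eq[OF kr] by simp
    also have "\<dots> = (\<Sum>m'\<in>{k}. A $$ (pivot_row p i0 (ld k), m') * w m')"
      using kr(1) other by (intro sum.mono_neutral_right) auto
    finally have "A $$ (pivot_row p i0 (ld k), k) * w k = 0" by simp
    then show False using lead[OF kr(1)] pivot_row_lead(1)[OF kr(3)] rng[OF kr(1)] kr(2) by auto
  qed
  have fJ: "finite J" unfolding J_def by auto
  show False
  proof (cases "\<exists>k\<in>J. i0 < fst (ld k)")
    case True
    let ?J1 = "{k \<in> J. i0 < fst (ld k)}"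
    have "finite ?J1" "?J1 \<noteq> {}" using True fJ by auto
    then obtain k where k: "k \<in> ?J1" "\<And>m. m \<in> ?J1 \<Longrightarrow> fst (ld m) \<le> fst (ld k)"
      using Max_in[of "(\<lambda>k. fst (ld k)) ` ?J1"] Max_ge[of "(\<lambda>k. fst (ld k)) ` ?J1"] by fastforce
    have kr: "k < r" "i0 < fst (ld k)" using k(1) unfolding J_def by auto
    have pr: "pivot_row p i0 (ld k) = fst (ld k) - 1" using kr unfolding pivot_row_def by simp
    show False
    proof (rule contra)
      show "k \<in> J" using k(1) by simp
      fix m' assume m': "m' < r" "m' \<noteq> k" "w m' \<noteq> 0"
      have "fst (ld m') \<le> fst (ld k)"
      proof (cases "i0 < fst (ld m')")
        case True
        then show ?thesis using k(2)[of m'] m' unfolding J_def by auto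
      qed (use kr in auto)
      moreover have "fst (ld m') \<noteq> fst (ld k)" using disj[OF m'(1) kr(1) m'(2)] kr(2) unfolding lead_rows_def by auto
      ultimately have "fst (ld k) - 1 \<notin> box p (ld m')" using rng[OF kr(1)] kr(2) unfolding box_def by auto
      moreover have "fst (ld k) - 1 < p + q" using rng[OF kr(1)] kr(2) by auto
      ultimately show "A $$ (pivot_row p i0 (ld k), m') = 0" unfolding pr using zero[OF m'(1)] by auto
    qed
  next
    case False
    have "J \<noteq> {}" using m wm unfolding J_def by auto
    then obtain k where k: "k \<in> J" "\<And>m. m \<in> J \<Longrightarrow> snd (ld m) \<le> snd (ld k)"
      using Max_in[of "(\<lambda>k. snd (ld k)) ` J"] Max_ge[of "(\<lambda>k. snd (ld k)) ` J"] fJ by fastforce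
    have kr: "k < r" "\<not> i0 < fst (ld k)" "j0 < snd (ld k)" using k(1) False unfolding J_def by auto
    have pr: "pivot_row p i0 (ld k) = p + snd (ld k) - 1" using kr unfolding pivot_row_def by simp
    show False
    proof (rule contra)
      show "k \<in> J" using k(1) by simp
      fix m' assume m': "m' < r" "m' \<noteq> k" "w m' \<noteq> 0"
      have "snd (ld m') \<le> snd (ld k)"
      proof (cases "m' \<in> J")
        case True
        then show ?thesis using k(2) by auto
      next
        case False
        then show ?thesis using m' kr unfolding J_def by auto
      qed
      moreover have "snd (ld m') \<noteq> snd (ld k)" using disj[OF m'(1) kr(1) m'(2)] kr(3) unfolding lead_rows_def by auto
      ultimately have "p + snd (ld k) - 1 \<notin> box p (ld m')" using rng[OF m'(1)] kr(3) unfolding box_def by auto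
      moreover have "p + snd (ld k) - 1 < p + q" using rng[OF kr(1)] kr(3) by auto
      ultimately show "A $$ (pivot_row p i0 (ld k), m') = 0" unfolding pr using zero[OF m'(1)] by auto
    qed
  qed
qed

text \<open>With the empty box of \<open>(0, 0)\<close> every column counts as outside, so all
  coefficients of a relation vanish.\<close>

lemma has_leads_inj:
  assumes ld: "lead_fun p q r ld" and A: "has_leads p q r ld A"
  shows "inj_mat A"
  unfolding inj_mat_def
proof (intro ballI impI)
  have Ac: "A \<in> carrier_mat (p + q) r" using A unfolding has_leads_def by simp
  fix v assume "v \<in> carrier_vec (dim_col A)" "A *\<^sub>v v = 0\<^sub>v (dim_row A)"
  then have v: "v \<in> carrier_vec r" "A *\<^sub>v v = 0\<^sub>v (p + q)" using Ac by auto
  have "v $ m = 0" if m: "m < r" for m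
  proof (rule pivots_vanish[OF ld A, of "\<lambda>m. v $ m" 0 0])
    show "m < r" "\<not> (fst (ld m) \<le> 0 \<and> snd (ld m) \<le> 0)"
      using m ld unfolding lead_fun_def by (auto simp: prod_eq_iff)
    fix m assume m: "m < r" "\<not> (fst (ld m) \<le> 0 \<and> snd (ld m) \<le> 0)"
    have "fst (ld m) \<le> p" "snd (ld m) \<le> q" using ld m unfolding lead_fun_def by auto
    then have "pivot_row p 0 (ld m) < p + q" using pivot_row_lead(1)[OF m(2)] lead_rows_less by blast
    then show "(\<Sum>m'<r. A $$ (pivot_row p 0 (ld m), m') * v $ m') = 0"
      using mult_mat_vec_index_sum[OF Ac v(1)] v(2) by (metis index_zero_vec(1))
  qed
  then show "v = 0\<^sub>v (dim_col A)" using v Ac by (intro eq_vecI) auto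
qed

lemma lead_mat_frames: "lead_fun p q r ld \<Longrightarrow> k \<in> K_group p q \<Longrightarrow> has_leads p q r ld A \<Longrightarrow> (k * A, k) \<in> frames p q r"
  using has_leads_inj[of p q r ld A] inj_mat_multI[of k "p + q" "p + q" A r] K_group_inj[of k p q] K_group_carrier[of k p q]
  by (auto simp: frames_iff has_leads_def)

text \<open>An upper triangular block matrix moves entries only upward within a block and multiplies
  leading entries by its nonzero diagonal.\<close>

lemma borel_has_leads:
  assumes ld: "lead_fun p q r ld" and b: "b \<in> borel_group p q" and A: "has_leads p q r ld A"
  shows "has_leads p q r ld (b * A)"
  unfolding has_leads_def
proof (intro conjI allI impI ballI)
  have bK: "b \<in> K_group p q" by (rule borel_K[OF b])
  have bc: "b \<in> carrier_mat (p + q) (p + q)" using bK K_group_carrier by auto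
  have Ac: "A \<in> carrier_mat (p + q) r" using A unfolding has_leads_def by simp
  show "b * A \<in> carrier_mat (p + q) r" using bc Ac by auto
  fix m assume m: "m < r"
  have rng: "fst (ld m) \<le> p" "snd (ld m) \<le> q" using ld m unfolding lead_fun_def by auto
  have zero: "A $$ (i, m) = 0" if "i < p + q" "i \<notin> box p (ld m)" for i using A m that unfolding has_leads_def by auto
  have bz: "b $$ (i, c) = 0" if "i < p + q" "c < p + q" "c < i \<or> (i < p) \<noteq> (c < p)" for i c
    using b K_group_block[OF bK that(1,2)] that unfolding borel_group_def by auto
  have bdiag: "b $$ (i, i) \<noteq> 0" if "i < p + q" for i
  proof -
    have "upper_triangular b" using b bc unfolding borel_group_def by auto
    then have "det b = prod_list (diag_mat b)" using det_upper_triangular bc by blast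
    moreover have "det b \<noteq> 0" using bK by (simp add: K_group_iff)
    ultimately have "0 \<notin> set (diag_mat b)" by (auto simp: prod_list_zero_iff)
    then show ?thesis using that bc unfolding diag_mat_def by force
  qed
  {
    fix i assume i: "i < p + q" "i \<notin> box p (ld m)"
    show "(b * A) $$ (i, m) = 0"
      unfolding mult_mat_index_sum[OF bc Ac i(1) m]
    proof (intro sum.neutral ballI)
      fix c assume c: "c \<in> {..<p + q}"
      show "b $$ (i, c) * A $$ (c, m) = 0"
      proof (cases "c \<in> box p (ld m)")
        case True
        then have "c < i \<or> (i < p) \<noteq> (c < p)" using i rng unfolding box_def by auto
        then show ?thesis using bz[OF i(1)] c by auto
      qed (use zero c in auto)
    qed
  }
  fix i assume i: "i \<in> lead_rows p (ld m)"
  then have ip: "i < p + q" using lead_rows_less[OF rng] by auto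
  have "(b * A) $$ (i, m) = (\<Sum>c<p + q. b $$ (i, c) * A $$ (c, m))" by (rule mult_mat_index_sum[OF bc Ac ip m])
  also have "\<dots> = (\<Sum>c\<in>{i}. b $$ (i, c) * A $$ (c, m))"
  proof (rule sum.mono_neutral_right)
    show "\<forall>c\<in>{..<p + q} - {i}. b $$ (i, c) * A $$ (c, m) = 0"
    proof
      fix c assume c: "c \<in> {..<p + q} - {i}"
      show "b $$ (i, c) * A $$ (c, m) = 0"
      proof (cases "c \<in> box p (ld m)")
        case True
        then have "c < i \<or> (i < p) \<noteq> (c < p)" using i c rng unfolding box_def lead_rows_def by (auto split: if_splits)
        then show ?thesis using bz[OF ip] c by auto
      qed (use zero c in auto)
    qed
  qed (use ip in auto)
  finally have "(b * A) $$ (i, m) = b $$ (i, i) * A $$ (i, m)" by simp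
  moreover have "A $$ (i, m) \<noteq> 0" using A m i unfolding has_leads_def by auto
  ultimately show "(b * A) $$ (i, m) \<noteq> 0" using bdiag[OF ip] by simp
qed

text \<open>The matrices with given leads form a single orbit of the Borel group. A column of
  \<open>b\<close> at a lead row is the part, in that block, of the column of \<open>A\<close>
  owning the row; the remaining columns are those of the identity. Triangularity is the vanishing
  beyond the lead.\<close>

lemma has_leads_borel_factor:
  assumes ld: "lead_fun p q r ld" and A: "has_leads p q r ld A"
  obtains b where "b \<in> borel_group p q" "A = b * lead_mat p q r ld"
proof -
  let ?n = "p + q"
  have Ac: "A \<in> carrier_mat ?n r" using A unfolding has_leads_def by simp
  have rng: "fst (ld m) \<le> p \<and> snd (ld m) \<le> q" if "m < r" for m using ld that unfolding lead_fun_def by auto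
  have zero: "A $$ (i, m) = 0" if "m < r" "i < p + q" "i \<notin> box p (ld m)" for i m
    using A that unfolding has_leads_def by auto
  \<comment> \<open>Lead rows of different columns are disjoint, so the owner of a lead row is
    unique.\<close>
  define own where "own c = (SOME m. m < r \<and> c \<in> lead_rows p (ld m))" for c
  have own: "own c = m" if "m < r" "c \<in> lead_rows p (ld m)" for c m
  proof -
    have "own c < r \<and> c \<in> lead_rows p (ld (own c))" unfolding own_def by (rule someI[of _ m]) (use that in auto)
    then show ?thesis using ld that unfolding lead_fun_def by blast
  qed
  define b where "b = mat ?n ?n (\<lambda>(i, c). if (i < p) \<noteq> (c < p) then 0
     else if \<exists>m<r. c \<in> lead_rows p (ld m) then A $$ (i, own c) else of_bool (i = c))"
  have bc: "b \<in> carrier_mat ?n ?n" unfolding b_def by simp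
  have upper: "b $$ (i, c) = 0" if ic: "i < ?n" "c < i" for i c
  proof (cases "(i < p) \<noteq> (c < p)")
    case False
    show ?thesis
    proof (cases "\<exists>m<r. c \<in> lead_rows p (ld m)")
      case True
      then obtain m where m: "m < r" "c \<in> lead_rows p (ld m)" by auto
      have "i \<notin> box p (ld m)" using m ic False rng[OF m(1)] unfolding lead_rows_def box_def by (auto split: if_splits)
      then show ?thesis using zero[OF m(1) ic(1)] own[OF m] m ic False unfolding b_def by auto
    qed (use ic False in \<open>auto simp: b_def\<close>)
  qed (use ic in \<open>auto simp: b_def\<close>)
  have diag: "b $$ (c, c) \<noteq> 0" if "c < ?n" for c
  proof (cases "\<exists>m<r. c \<in> lead_rows p (ld m)")
    case True
    then obtain m where m: "m < r" "c \<in> lead_rows p (ld m)" by auto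
    then have "A $$ (c, m) \<noteq> 0" using A unfolding has_leads_def by auto
    then show ?thesis using own[OF m] m that unfolding b_def by auto
  qed (use that in \<open>auto simp: b_def\<close>)
  have "upper_triangular b" using upper bc by auto
  then have "det b = prod_list (diag_mat b)" using det_upper_triangular bc by blast
  moreover have "0 \<notin> set (diag_mat b)" using diag bc unfolding diag_mat_def by auto
  ultimately have "det b \<noteq> 0" by (auto simp: prod_list_zero_iff)
  then have bB: "b \<in> borel_group p q"
    unfolding borel_group_def K_group_iff using bc upper by (auto simp: b_def)
  have Mc: "lead_mat p q r ld \<in> carrier_mat ?n r" unfolding lead_mat_def by simp
  have "A = b * lead_mat p q r ld"
  proof (rule eq_matI)
    fix i m assume "i < dim_row (b * lead_mat p q r ld)" "m < dim_col (b * lead_mat p q r ld)"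
    then have i: "i < ?n" and m: "m < r" using bc Mc by auto
    have "(b * lead_mat p q r ld) $$ (i, m) = (\<Sum>c<?n. b $$ (i, c) * lead_mat p q r ld $$ (c, m))"
      by (rule mult_mat_index_sum[OF bc Mc i m])
    also have "\<dots> = (\<Sum>c\<in>lead_rows p (ld m). b $$ (i, c))"
      using m lead_rows_less[of "ld m" p q] rng[OF m] by (intro sum.mono_neutral_cong_right) (auto simp: lead_mat_def)
    also have "\<dots> = (\<Sum>c\<in>lead_rows p (ld m). if (i < p) \<noteq> (c < p) then 0 else A $$ (i, m))"
      using own[OF m] m i lead_rows_less[of "ld m" p q] rng[OF m] by (intro sum.cong) (auto simp: b_def)
    also have "\<dots> = A $$ (i, m)"
    proof (cases "i < p")
      case True
      have "A $$ (i, m) = 0" if "fst (ld m) = 0" by (rule zero[OF m i]) (use that True in \<open>auto simp: box_def\<close>)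
      then show ?thesis using True rng[OF m] unfolding lead_rows_def
        by (cases "fst (ld m) = 0"; cases "snd (ld m) = 0") auto
    next
      case False
      have "A $$ (i, m) = 0" if "snd (ld m) = 0" by (rule zero[OF m i]) (use that False rng[OF m] in \<open>auto simp: box_def\<close>)
      then show ?thesis using False rng[OF m] unfolding lead_rows_def
        by (cases "fst (ld m) = 0"; cases "snd (ld m) = 0") auto
    qed
    finally show "A $$ (i, m) = (b * lead_mat p q r ld) $$ (i, m)" by simp
  qed (use bc Mc Ac in auto)
  then show ?thesis using that bB by blast
qed

text \<open>The position of the last nonzero entry in a block of \<open>d\<close> rows starting at
  \<open>s\<close>, counted from \<open>1\<close>; it is \<open>0\<close> if the block of the column
  vanishes.\<close>

definition lead :: "nat \<Rightarrow> nat \<Rightarrow> complex mat \<Rightarrow> nat \<Rightarrow> nat" where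
  "lead s d B m = (LEAST i. \<forall>i'<d. i \<le> i' \<longrightarrow> B $$ (s + i', m) = 0)"

lemma lead_zero: "i < d \<Longrightarrow> lead s d B m \<le> i \<Longrightarrow> B $$ (s + i, m) = 0"
proof -
  assume i: "i < d" "lead s d B m \<le> i"
  have "\<forall>i'<d. lead s d B m \<le> i' \<longrightarrow> B $$ (s + i', m) = 0"
    unfolding lead_def by (rule LeastI[of _ d]) auto
  then show ?thesis using i by auto
qed

lemma lead_le: "(\<And>i'. i' < d \<Longrightarrow> i \<le> i' \<Longrightarrow> B $$ (s + i', m) = 0) \<Longrightarrow> lead s d B m \<le> i"
  unfolding lead_def by (rule Least_le) auto

lemma lead_bound: "lead s d B m \<le> d"
  by (rule lead_le) auto

lemma lead_nonzero:
  assumes "lead s d B m \<noteq> 0"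
  shows "B $$ (s + (lead s d B m - 1), m) \<noteq> 0"
proof
  assume z: "B $$ (s + (lead s d B m - 1), m) = 0"
  have "lead s d B m \<le> lead s d B m - 1"
  proof (rule lead_le)
    fix i' assume i': "i' < d" "lead s d B m - 1 \<le> i'"
    show "B $$ (s + i', m) = 0"
      using z lead_zero[OF i'(1), of s B m] i'(2) by (cases "i' = lead s d B m - 1") auto
  qed
  then show False using assms by simp
qed

lemma lead_addcol_le:
  assumes B: "B \<in> carrier_mat n r" and m: "m < r" "m' < r" and s: "s + d \<le> n" and le: "lead s d B m \<le> lead s d B m'"
  shows "lead s d (addcol a m' m B) m' \<le> lead s d B m'"
proof (rule lead_le)
  fix i' assume i': "i' < d" "lead s d B m' \<le> i'"
  then show "addcol a m' m B $$ (s + i', m') = 0"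
    using lead_zero[of i' d s B m] lead_zero[of i' d s B m'] B m s le by auto
qed

lemma lead_addcol_less:
  assumes B: "B \<in> carrier_mat n r" and m: "m < r" "m' < r" and s: "s + d \<le> n"
    and eq: "lead s d B m = l" "lead s d B m' = l" "l \<noteq> 0"
  defines "a \<equiv> - (B $$ (s + (l - 1), m') / B $$ (s + (l - 1), m))"
  shows "lead s d (addcol a m' m B) m' < l"
proof -
  have ld: "l \<le> d" using lead_bound eq(1) by blast
  have nz: "B $$ (s + (l - 1), m) \<noteq> 0" using lead_nonzero[of s d B m] eq by simp
  have "lead s d (addcol a m' m B) m' \<le> l - 1"
  proof (rule lead_le)
    fix i' assume i': "i' < d" "l - 1 \<le> i'"
    show "addcol a m' m B $$ (s + i', m') = 0"
    proof (cases "i' = l - 1")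
      case True
      then show ?thesis using nz B m s i' unfolding a_def by auto
    next
      case False
      then show ?thesis using lead_zero[of i' d s B m] lead_zero[of i' d s B m'] B m s eq i' by auto
    qed
  qed
  then show ?thesis using eq(3) by simp
qed

(* Column reduction: a matrix A g for which the sum of all leads is minimal has distinct leads. *)
lemma exists_leads:
  assumes A: "A \<in> carrier_mat (p + q) r" "inj_mat A"
  obtains g ld where "g \<in> carrier_mat r r" "det g \<noteq> 0" "lead_fun p q r ld" "has_leads p q r ld (A * g)"
proof -
  define \<mu> where "\<mu> B = (\<Sum>m<r. lead 0 p B m + lead p q B m)" for B
  define \<mu>' where "\<mu>' g = \<mu> (A * g)" for g
  let ?G = "\<lambda>g. g \<in> carrier_mat r r \<and> det g \<noteq> 0"
  have "?G (1\<^sub>m r)" by auto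
  then obtain g where g: "?G g" "\<And>h. ?G h \<Longrightarrow> \<mu>' g \<le> \<mu>' h" using ex_has_least_nat[of ?G "1\<^sub>m r" \<mu>'] by blast
  define B where "B = A * g"
  have B: "B \<in> carrier_mat (p + q) r" unfolding B_def using A g by auto
  have injB: "inj_mat B" unfolding B_def using inj_mat_multI[OF A(1) _ A(2)] g(1) inj_mat_det by blast
  have min: "\<mu> B \<le> \<mu> (addcol a m' m B)" if m: "m < r" "m' < r" "m \<noteq> m'" for a m m'
  proof -
    have e: "addcol a m' m B = A * (g * addrow_mat r a m m')"
      using addcol_mat[OF B m(1), of a m'] assoc_mult_mat[OF A(1), of g r "addrow_mat r a m m'" r] g(1) unfolding B_def by auto
    have "?G (g * addrow_mat r a m m')"
      using g(1) det_mult[of g r "addrow_mat r a m m'"] det_addrow_mat[OF m(3), of r a] by auto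
    then show ?thesis using g(2) e unfolding \<mu>'_def B_def by metis
  qed
  have dec: "\<mu> (addcol a m' m B) < \<mu> B" if m: "m < r" "m' < r" "m \<noteq> m'"
    and l: "lead 0 p (addcol a m' m B) m' + lead p q (addcol a m' m B) m' < lead 0 p B m' + lead p q B m'" for a m m'
  proof -
    have same: "lead s d (addcol a m' m B) k = lead s d B k" if "k < r" "k \<noteq> m'" "s + d \<le> p + q" for s d k
      unfolding lead_def using B that by (intro arg_cong[of _ _ Least]) (auto simp: fun_eq_iff)
    have "\<mu> C = (\<Sum>k\<in>{..<r} - {m'}. lead 0 p C k + lead p q C k) + (lead 0 p C m' + lead p q C m')" for C
      unfolding \<mu>_def using m(2) by (subst sum.remove[of _ m']) auto
    moreover have "(\<Sum>k\<in>{..<r} - {m'}. lead 0 p (addcol a m' m B) k + lead p q (addcol a m' m B) k) =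
        (\<Sum>k\<in>{..<r} - {m'}. lead 0 p B k + lead p q B k)"
      using same by (intro sum.cong) auto
    ultimately show ?thesis using l by simp
  qed
  define ld where "ld m = (lead 0 p B m, lead p q B m)" for m
  have nz: "ld m \<noteq> (0, 0)" if m: "m < r" for m
  proof
    assume z: "ld m = (0, 0)"
    have "B $$ (i, m) = 0" if "i < p + q" for i
      using lead_zero[of i p 0 B m] lead_zero[of "i - p" q p B m] z that unfolding ld_def by (cases "i < p") auto
    then have "B *\<^sub>v unit_vec r m = 0\<^sub>v (p + q)" unfolding mult_unit_vec_col[OF B m] using B m by (intro eq_vecI) auto
    then have "unit_vec r m = (0\<^sub>v r :: complex vec)" using injB B unfolding inj_mat_def by auto
    then show False using m by (metis unit_vec_nonzero)
  qed
  \<comment> \<open>Of two columns sharing a nonzero lead in \<open>V^+\<close>, a multiple of the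
    one with the smaller lead in \<open>V^-\<close> is added to the other. The lead in
    \<open>V^+\<close> drops, and the one in \<open>V^-\<close> does not grow.\<close>
  have np: "lead 0 p B m \<noteq> lead 0 p B m' \<or> lead 0 p B m = 0" if m: "m < r" "m' < r" "m \<noteq> m'" "lead p q B m \<le> lead p q B m'" for m m'
  proof (rule ccontr)
    assume n: "\<not> ?thesis"
    define a where "a = - (B $$ (0 + (lead 0 p B m - 1), m') / B $$ (0 + (lead 0 p B m - 1), m))"
    have "lead 0 p (addcol a m' m B) m' < lead 0 p B m"
      unfolding a_def by (rule lead_addcol_less[OF B m(1,2)]) (use n in auto)
    moreover have "lead p q (addcol a m' m B) m' \<le> lead p q B m'"
      by (rule lead_addcol_le[OF B m(1,2)]) (use m in auto)
    ultimately have "\<mu> (addcol a m' m B) < \<mu> B" using n by (intro dec[OF m(1-3)]) auto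
    then show False using min[OF m(1-3), of a] by simp
  qed
  have nm: "lead p q B m \<noteq> lead p q B m' \<or> lead p q B m = 0" if m: "m < r" "m' < r" "m \<noteq> m'" "lead 0 p B m \<le> lead 0 p B m'" for m m'
  proof (rule ccontr)
    assume n: "\<not> ?thesis"
    define a where "a = - (B $$ (p + (lead p q B m - 1), m') / B $$ (p + (lead p q B m - 1), m))"
    have "lead p q (addcol a m' m B) m' < lead p q B m"
      unfolding a_def by (rule lead_addcol_less[OF B m(1,2)]) (use n in auto)
    moreover have "lead 0 p (addcol a m' m B) m' \<le> lead 0 p B m'"
      by (rule lead_addcol_le[OF B m(1,2)]) (use m in auto)
    ultimately have "\<mu> (addcol a m' m B) < \<mu> B" using n by (intro dec[OF m(1-3)]) auto
    then show False using min[OF m(1-3), of a] by simp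
  qed
  have disj: "lead_rows p (ld m) \<inter> lead_rows p (ld m') = {}" if m: "m < r" "m' < r" "m \<noteq> m'" for m m'
  proof -
    have 1: "lead 0 p B m \<noteq> lead 0 p B m' \<or> lead 0 p B m = 0"
      using np[of m m'] np[of m' m] m by (metis nat_le_linear)
    have 2: "lead p q B m \<noteq> lead p q B m' \<or> lead p q B m = 0"
      using nm[of m m'] nm[of m' m] m by (metis nat_le_linear)
    show ?thesis using 1 2 lead_bound[of 0 p B m] lead_bound[of 0 p B m'] unfolding lead_rows_def ld_def by (auto split: if_splits)
  qed
  have lf: "lead_fun p q r ld" unfolding lead_fun_def
    using nz disj lead_bound[of 0 p B] lead_bound[of p q B] by (auto simp: ld_def)
  have "has_leads p q r ld B" unfolding has_leads_def
  proof (intro conjI allI impI ballI B)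
    fix m i assume m: "m < r"
    {
      assume i: "i < p + q" "i \<notin> box p (ld m)"
      show "B $$ (i, m) = 0"
        using lead_zero[of i p 0 B m] lead_zero[of "i - p" q p B m] i unfolding ld_def box_def by (cases "i < p") auto
    next
      assume "i \<in> lead_rows p (ld m)"
      then show "B $$ (i, m) \<noteq> 0"
        using lead_nonzero[of 0 p B m] lead_nonzero[of p q B m] unfolding lead_rows_def ld_def by (auto split: if_splits)
    }
  qed
  then show ?thesis using that g(1) lf unfolding B_def by blast
qed

section \<open>Orbits and configurations\<close>

lemma lead_rows_iff: "i \<in> lead_rows p x \<longleftrightarrow> fst x \<noteq> 0 \<and> Suc i = fst x \<or> snd x \<noteq> 0 \<and> Suc i = p + snd x"
  unfolding lead_rows_def by auto

lemma lead_fun_range: "lead_fun p q r ld \<Longrightarrow> m < r \<Longrightarrow> fst (ld m) \<le> p \<and> snd (ld m) \<le> q \<and> ld m \<noteq> (0, 0)"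
  unfolding lead_fun_def by auto

lemma lead_fun_fst_eq:
  assumes "lead_fun p q r ld" "m < r" "m' < r" "fst (ld m) = fst (ld m')" "fst (ld m) \<noteq> 0"
  shows "m = m'"
proof (rule ccontr)
  assume "m \<noteq> m'"
  then have "lead_rows p (ld m) \<inter> lead_rows p (ld m') = {}" using assms unfolding lead_fun_def by auto
  then show False using assms(4,5) unfolding lead_rows_def by auto
qed

lemma lead_fun_snd_eq:
  assumes "lead_fun p q r ld" "m < r" "m' < r" "snd (ld m) = snd (ld m')" "snd (ld m) \<noteq> 0"
  shows "m = m'"
proof (rule ccontr)
  assume "m \<noteq> m'"
  then have "lead_rows p (ld m) \<inter> lead_rows p (ld m') = {}" using assms unfolding lead_fun_def by auto
  then show False using assms(4,5) unfolding lead_rows_def by auto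
qed

lemma lead_fun_inj: "lead_fun p q r ld \<Longrightarrow> inj_on ld {..<r}"
proof (rule inj_onI)
  fix m m' assume ld: "lead_fun p q r ld" and m: "m \<in> {..<r}" "m' \<in> {..<r}" "ld m = ld m'"
  have "fst (ld m) \<noteq> 0 \<or> snd (ld m) \<noteq> 0" using lead_fun_range[OF ld, of m] m by (auto simp: prod_eq_iff)
  then show "m = m'" using lead_fun_fst_eq[OF ld, of m m'] lead_fun_snd_eq[OF ld, of m m'] m by auto
qed

lemma lead_funI:
  assumes "\<And>m. m < r \<Longrightarrow> fst (ld m) \<le> p \<and> snd (ld m) \<le> q \<and> ld m \<noteq> (0, 0)"
    and "\<And>m m'. m < r \<Longrightarrow> m' < r \<Longrightarrow> m \<noteq> m' \<Longrightarrow> fst (ld m) = fst (ld m') \<Longrightarrow> fst (ld m) = 0"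
    and "\<And>m m'. m < r \<Longrightarrow> m' < r \<Longrightarrow> m \<noteq> m' \<Longrightarrow> snd (ld m) = snd (ld m') \<Longrightarrow> snd (ld m) = 0"
  shows "lead_fun p q r ld"
  unfolding lead_fun_def
proof (intro conjI allI impI)
  fix m m' assume m: "m < r" "m' < r" "m \<noteq> m'"
  show "lead_rows p (ld m) \<inter> lead_rows p (ld m') = {}"
  proof (rule ccontr)
    assume "\<not> ?thesis"
    then obtain i where i: "i \<in> lead_rows p (ld m)" "i \<in> lead_rows p (ld m')" by auto
    have "fst (ld m) \<noteq> 0 \<and> fst (ld m) = fst (ld m') \<or> snd (ld m) \<noteq> 0 \<and> snd (ld m) = snd (ld m')"
      using i assms(1)[OF m(1)] assms(1)[OF m(2)] unfolding lead_rows_iff by linarith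
    then show False using assms(2)[OF m] assms(3)[OF m] by metis
  qed
qed (use assms(1) in auto)

text \<open>Equal images of size \<open>r\<close> force injectivity, so the new function only
  renumbers the columns.\<close>

lemma lead_fun_image:
  assumes ld: "lead_fun p q r ld" and e: "ld' ` {..<r} = ld ` {..<r}"
  shows "lead_fun p q r ld'"
proof -
  have "card (ld' ` {..<r}) = r" unfolding e using card_image[OF lead_fun_inj[OF ld]] by simp
  then have inj: "inj_on ld' {..<r}" by (intro eq_card_imp_inj_on) auto
  have ex: "\<exists>k<r. ld' m = ld k" if "m < r" for m
  proof -
    have "ld' m \<in> ld ` {..<r}" using that e by blast
    then show ?thesis by auto
  qed
  show ?thesis
  proof (rule lead_funI)
    fix m assume "m < r"
    then show "fst (ld' m) \<le> p \<and> snd (ld' m) \<le> q \<and> ld' m \<noteq> (0, 0)" using ex lead_fun_range[OF ld] by metis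
  next
    fix m m' assume m: "m < r" "m' < r" "m \<noteq> m'"
    obtain k k' where k: "k < r" "ld' m = ld k" "k' < r" "ld' m' = ld k'" using ex m by meson
    have "k \<noteq> k'" using k m inj by (metis inj_onD lessThan_iff)
    then show "fst (ld' m) = fst (ld' m') \<Longrightarrow> fst (ld' m) = 0" "snd (ld' m) = snd (ld' m') \<Longrightarrow> snd (ld' m) = 0"
      using lead_fun_fst_eq[OF ld, of k k'] lead_fun_snd_eq[OF ld, of k k'] k by auto
  qed
qed

definition nonfree :: "nat \<Rightarrow> nat \<Rightarrow> (nat \<times> nat) set \<Rightarrow> (nat \<times> nat) set" where
  "nonfree p q C = {x \<in> C. fst x \<le> p \<and> snd x \<le> q}"

definition points :: "nat \<Rightarrow> nat \<Rightarrow> nat \<Rightarrow> (nat \<Rightarrow> nat \<times> nat) \<Rightarrow> (nat \<times> nat) set" where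
  "points p q r ld = ld ` {..<r} \<union> {(i, Suc q) |i. i \<in> {1..p} \<and> (\<forall>m<r. fst (ld m) \<noteq> i)} \<union>
     {(Suc p, j) |j. j \<in> {1..q} \<and> (\<forall>m<r. snd (ld m) \<noteq> j)}"

lemma nonfree_points:
  assumes "lead_fun p q r ld"
  shows "nonfree p q (points p q r ld) = ld ` {..<r}"
  unfolding nonfree_def points_def using lead_fun_range[OF assms] by auto

lemma points_config:
  assumes ld: "lead_fun p q r ld"
  shows "config p q r (points p q r ld)"
  unfolding config_def
proof (intro conjI ballI)
  show "points p q r ld \<subseteq> {0..Suc p} \<times> {0..Suc q}"
  proof
    fix x assume x: "x \<in> points p q r ld"
    show "x \<in> {0..Suc p} \<times> {0..Suc q}"
    proof (cases "x \<in> ld ` {..<r}")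
      case True
      then obtain m where "m < r" "x = ld m" by auto
      then show ?thesis using lead_fun_range[OF ld, of m] by (simp add: mem_Times_iff le_SucI)
    qed (use x in \<open>auto simp: points_def\<close>)
  qed
  show "card {x \<in> points p q r ld. fst x \<le> p \<and> snd x \<le> q} = r"
    using nonfree_points[OF ld] card_image[OF lead_fun_inj[OF ld]] unfolding nonfree_def by simp
  fix i assume i: "i \<in> {1..p}"
  show "\<exists>!x. x \<in> points p q r ld \<and> fst x = i"
  proof (cases "\<exists>m<r. fst (ld m) = i")
    case True
    then obtain m where m: "m < r" "fst (ld m) = i" by auto
    show ?thesis
    proof (rule ex1I[of _ "ld m"])
      fix x assume x: "x \<in> points p q r ld \<and> fst x = i"
      then obtain m' where "m' < r" "x = ld m'" using m i unfolding points_def by auto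
      then show "x = ld m" using lead_fun_fst_eq[OF ld, of m m'] m i x by auto
    qed (use m in \<open>auto simp: points_def\<close>)
  next
    case False
    show ?thesis
      by (rule ex1I[of _ "(i, Suc q)"]) (use False i in \<open>auto simp: points_def\<close>)
  qed
next
  fix j assume j: "j \<in> {1..q}"
  show "\<exists>!x. x \<in> points p q r ld \<and> snd x = j"
  proof (cases "\<exists>m<r. snd (ld m) = j")
    case True
    then obtain m where m: "m < r" "snd (ld m) = j" by auto
    show ?thesis
    proof (rule ex1I[of _ "ld m"])
      fix x assume x: "x \<in> points p q r ld \<and> snd x = j"
      then obtain m' where "m' < r" "x = ld m'" using m j unfolding points_def by auto
      then show "x = ld m" using lead_fun_snd_eq[OF ld, of m m'] m j x by auto
    qed (use m in \<open>auto simp: points_def\<close>)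
  next
    case False
    show ?thesis
      by (rule ex1I[of _ "(Suc p, j)"]) (use False j in \<open>auto simp: points_def\<close>)
  qed
next
  fix x assume x: "x \<in> points p q r ld"
  show "fst x \<in> {1..p} \<or> snd x \<in> {1..q}"
  proof (cases "x \<in> ld ` {..<r}")
    case True
    then obtain m where "m < r" "x = ld m" by auto
    then show ?thesis using lead_fun_range[OF ld, of m] by (cases "ld m") auto
  qed (use x in \<open>auto simp: points_def\<close>)
qed

lemma config_eq_if_nonfree_eq:
  assumes "config p q r u" "config p q r v" "nonfree p q u = nonfree p q v"
  shows "u = v"
proof -
  have "(i, j) \<in> u \<longleftrightarrow> (i, j) \<in> v" if "i \<le> p" "j \<le> q" for i j
  proof -
    have "(i, j) \<in> nonfree p q u \<longleftrightarrow> (i, j) \<in> nonfree p q v" using assms(3) by simp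
    then show ?thesis using that by (simp add: nonfree_def)
  qed
  then show ?thesis using config_agree_subset[OF assms(1,2)] config_agree_subset[OF assms(2,1)] by auto
qed

text \<open>Any enumeration of the points that are not free serves, since the free vertices are
  determined by them.\<close>

lemma config_lead_fun:
  assumes C: "config p q r C"
  obtains ld where "lead_fun p q r ld" "points p q r ld = C"
proof -
  have "finite (nonfree p q C)" "card (nonfree p q C) = r"
    using config_finite[OF C] C unfolding nonfree_def config_def by auto
  then obtain ld where b: "bij_betw ld {..<r} (nonfree p q C)"
    using ex_bij_betw_nat_finite by (metis atLeast0LessThan)
  then have im: "ld ` {..<r} = nonfree p q C" and inj: "inj_on ld {..<r}" by (auto simp: bij_betw_def)
  have mem: "(fst (ld m), snd (ld m)) \<in> C" "fst (ld m) \<le> p" "snd (ld m) \<le> q" if "m < r" for m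
  proof -
    have "ld m \<in> nonfree p q C" using im that by auto
    then show "(fst (ld m), snd (ld m)) \<in> C" "fst (ld m) \<le> p" "snd (ld m) \<le> q" unfolding nonfree_def by auto
  qed
  have lf: "lead_fun p q r ld"
  proof (rule lead_funI)
    fix m assume m: "m < r"
    have "ld m \<noteq> (0, 0)" using mem(1)[OF m] config_corner(1)[OF C] by auto
    then show "fst (ld m) \<le> p \<and> snd (ld m) \<le> q \<and> ld m \<noteq> (0, 0)" using mem[OF m] by simp
  next
    fix m m' assume m: "m < r" "m' < r" "m \<noteq> m'"
    then have n: "ld m \<noteq> ld m'" using inj by (auto dest: inj_onD)
    show "fst (ld m) = 0" if "fst (ld m) = fst (ld m')"
      using config_row_unique[OF C, of "fst (ld m)" "snd (ld m)" "snd (ld m')"] mem[OF m(1)] mem[OF m(2)] that n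
      by (cases "fst (ld m) = 0") (auto simp: prod_eq_iff)
    show "snd (ld m) = 0" if "snd (ld m) = snd (ld m')"
      using config_col_unique[OF C, of "fst (ld m)" "snd (ld m)" "fst (ld m')"] mem[OF m(1)] mem[OF m(2)] that n
      by (cases "snd (ld m) = 0") (auto simp: prod_eq_iff)
  qed
  have "points p q r ld = C"
    by (rule config_eq_if_nonfree_eq[OF points_config[OF lf] C]) (simp add: nonfree_points[OF lf] im)
  then show ?thesis using that lf by blast
qed

lemma cnt_points:
  assumes ld: "lead_fun p q r ld" and ij: "i \<le> p" "j \<le> q"
  shows "cnt (points p q r ld) i j = card {m. m < r \<and> fst (ld m) \<le> i \<and> snd (ld m) \<le> j}"
proof -
  have "{x \<in> points p q r ld. fst x \<le> i \<and> snd x \<le> j} = {x \<in> nonfree p q (points p q r ld). fst x \<le> i \<and> snd x \<le> j}"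
    using ij unfolding nonfree_def by auto
  also have "\<dots> = ld ` {m. m < r \<and> fst (ld m) \<le> i \<and> snd (ld m) \<le> j}"
    unfolding nonfree_points[OF ld] by auto
  finally have "cnt (points p q r ld) i j = card (ld ` {m. m < r \<and> fst (ld m) \<le> i \<and> snd (ld m) \<le> j})"
    unfolding cnt_def by simp
  also have "\<dots> = card {m. m < r \<and> fst (ld m) \<le> i \<and> snd (ld m) \<le> j}"
    by (intro card_image inj_on_subset[OF lead_fun_inj[OF ld]]) auto
  finally show ?thesis .
qed

section \<open>Orbits as images of frames \<open>(k M, k)\<close>\<close>

definition orb :: "nat \<Rightarrow> nat \<Rightarrow> nat \<Rightarrow> (nat \<Rightarrow> nat \<times> nat) \<Rightarrow> dflag set" where
  "orb p q r ld = {frame_map p q (k * lead_mat p q r ld, k) |k. k \<in> K_group p q}"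

lemma lead_mat_carrier: "lead_mat p q r ld \<in> carrier_mat (p + q) r"
  unfolding lead_mat_def by simp

lemma frame_map_one: "frame_map p q (A, 1\<^sub>m (p + q)) = (col_span (p + q) A, std_flag_plus p q, std_flag_minus p q)"
proof -
  have "(\<lambda>v. 1\<^sub>m (p + q) *\<^sub>v v) ` U = U" if "U \<in> set (std_flag_plus p q) \<union> set (std_flag_minus p q)" for U
    using that mult_one_vec_image unfolding std_flag_plus_coord std_flag_minus_coord by auto
  then show ?thesis unfolding frame_map_def by (auto intro!: map_idI)
qed

lemma orb_alt:
  assumes ld: "lead_fun p q r ld"
  shows "orb p q r ld = K_orbit p q (col_span (p + q) (lead_mat p q r ld), std_flag_plus p q, std_flag_minus p q)"
proof -
  have fr: "(lead_mat p q r ld, 1\<^sub>m (p + q)) \<in> frames p q r"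
    using has_leads_inj[OF ld has_leads_lead_mat[OF ld]] K_group_one lead_mat_carrier by (auto simp: frames_iff)
  have "K_act k (frame_map p q (lead_mat p q r ld, 1\<^sub>m (p + q))) = frame_map p q (k * lead_mat p q r ld, k)"
    if k: "k \<in> K_group p q" for k
    using K_act_frame_map(1)[OF k fr] K_group_carrier[OF k] by simp
  then show ?thesis unfolding orb_def K_orbit_def frame_map_one[symmetric] setcompr_eq_image
    by (intro image_cong) auto
qed

text \<open>The column space depends only on the set of columns, so renumbering them leaves the
  orbit unchanged.\<close>

lemma orb_cong:
  assumes ld: "lead_fun p q r ld" and e: "ld' ` {..<r} = ld ` {..<r}"
  shows "orb p q r ld' = orb p q r ld"
proof -
  have "set (cols (lead_mat p q r ld)) = (\<lambda>x. vec (p + q) (\<lambda>i. of_bool (i \<in> lead_rows p x))) ` ld ` {..<r}" for ld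
    unfolding cols_def lead_mat_def image_image by (auto simp: image_iff)
  then have "col_span (p + q) (lead_mat p q r ld) = col_span (p + q) (lead_mat p q r ld')"
    unfolding vec_space.col_space_def using e by simp
  then show ?thesis using orb_alt[OF ld] orb_alt[OF lead_fun_image[OF ld e]] by simp
qed

lemma orb_cong_points:
  assumes "lead_fun p q r ld" "lead_fun p q r ld'" "points p q r ld = points p q r ld'"
  shows "orb p q r ld = orb p q r ld'"
  by (rule orb_cong[OF assms(2)]) (use nonfree_points[OF assms(1)] nonfree_points[OF assms(2)] assms(3) in simp)

text \<open>Leads are required only after a column operation \<open>g\<close>: a frame may absorb
  \<open>g\<close>, and the Borel factor of \<open>A * g\<close> is moved into
  \<open>k\<close>.\<close>

lemma orb_memI:
  assumes ld: "lead_fun p q r ld" and k: "k \<in> K_group p q" and A: "A \<in> carrier_mat (p + q) r"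
    and g: "g \<in> carrier_mat r r" "det g \<noteq> 0" "has_leads p q r ld (A * g)"
  shows "frame_map p q (k * A, k) \<in> orb p q r ld" "(k * A, k) \<in> frames p q r"
proof -
  let ?M = "lead_mat p q r ld"
  obtain b where b: "b \<in> borel_group p q" "A * g = b * ?M" using has_leads_borel_factor[OF ld g(3)] .
  note kc = K_group_carrier[OF k] and bc = K_group_carrier[OF borel_K[OF b(1)]]
  have "inj_mat (A * g)" using has_leads_inj[OF ld g(3)] .
  obtain h where h: "h \<in> carrier_mat r r" "g * h = 1\<^sub>m r" "det h \<noteq> 0" using det_nonzero_inverse[OF g(1,2)] by metis
  have "A * g * h = A" using assoc_mult_mat[OF A g(1) h(1)] h(2) A by simp
  then have "inj_mat A" using inj_mat_multI[OF _ h(1) \<open>inj_mat (A * g)\<close>, of "p + q"] inj_mat_det[OF h(1)] h(3) A g(1) by auto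
  then show fr: "(k * A, k) \<in> frames p q r"
    using inj_mat_multI[OF kc A K_group_inj[OF k]] k kc A by (auto simp: frames_iff)
  have "frame_map p q (k * A, k) = frame_map p q (k * A * g, k * b)"
    using frame_map_borel(1)[OF fr g(1,2) b(1)] by simp
  also have "k * A * g = (k * b) * ?M"
    using assoc_mult_mat[OF kc A g(1)] b(2) assoc_mult_mat[OF kc bc lead_mat_carrier] by simp
  finally show "frame_map p q (k * A, k) \<in> orb p q r ld"
    unfolding orb_def using K_group_mult[OF k borel_K[OF b(1)]] by auto
qed

lemma orb_has_leads:
  assumes ld: "lead_fun p q r ld" and k: "k \<in> K_group p q" and A: "has_leads p q r ld A"
  shows "frame_map p q (k * A, k) \<in> orb p q r ld"
proof -
  have "A \<in> carrier_mat (p + q) r" using A unfolding has_leads_def by simp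
  then show ?thesis using orb_memI(1)[OF ld k, of A "1\<^sub>m r"] A by simp
qed

lemma orb_framesE:
  assumes ld: "lead_fun p q r ld" and x: "(A, h) \<in> frames p q r" and y: "frame_map p q (A, h) \<in> orb p q r ld"
  obtains k g b where "k \<in> K_group p q" "g \<in> carrier_mat r r" "det g \<noteq> 0" "b \<in> borel_group p q"
    "A = k * lead_mat p q r ld * g" "h = k * b"
proof -
  obtain k where k: "k \<in> K_group p q" "frame_map p q (A, h) = frame_map p q (k * lead_mat p q r ld, k)"
    using y unfolding orb_def by auto
  have "(k * lead_mat p q r ld, k) \<in> frames p q r" by (rule lead_mat_frames[OF ld k(1) has_leads_lead_mat[OF ld]])
  then show ?thesis using frame_map_eqD[OF _ x k(2)[symmetric]] that k(1) by metis
qed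

lemma orb_subset: "lead_fun p q r ld \<Longrightarrow> orb p q r ld \<subseteq> dflag_variety p q r"
  unfolding orb_def using frame_map_in_variety[OF lead_mat_frames[OF _ _ has_leads_lead_mat]] by auto

text \<open>A frame \<open>(A, k)\<close> is moved to the standard flags by the inverse of
  \<open>k\<close>. Column reduction then produces leads, and the remaining Borel factor stabilizes
  the flags.\<close>

lemma K_orbit_is_orb:
  assumes y: "y \<in> dflag_variety p q r"
  obtains ld where "lead_fun p q r ld" "K_orbit p q y = orb p q r ld"
proof -
  obtain A k where x: "(A, k) \<in> frames p q r" "y = frame_map p q (A, k)" using variety_has_frame[OF y] .
  have A: "A \<in> carrier_mat (p + q) r" "inj_mat A" and k: "k \<in> K_group p q" using x(1) by (auto simp: frames_iff)
  note kc = K_group_carrier[OF k]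
  obtain ki where ki: "ki \<in> K_group p q" "k * ki = 1\<^sub>m (p + q)" "ki * k = 1\<^sub>m (p + q)" using K_group_inverse[OF k] .
  note kic = K_group_carrier[OF ki(1)]
  have A1: "ki * A \<in> carrier_mat (p + q) r" "inj_mat (ki * A)"
    using kic A inj_mat_multI[OF kic A(1) K_group_inj[OF ki(1)] A(2)] by auto
  obtain g ld where g: "g \<in> carrier_mat r r" "det g \<noteq> 0" "lead_fun p q r ld" "has_leads p q r ld (ki * A * g)"
    using exists_leads[OF A1] .
  have kA: "k * (ki * A) = A" using assoc_mult_mat[OF kc kic A(1)] ki(2) A(1) by simp
  let ?M = "lead_mat p q r ld"
  have act: "K_act h y = frame_map p q (h * A, h * k)" if "h \<in> K_group p q" for h
    unfolding x(2) by (rule K_act_frame_map(1)[OF that x(1)])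
  have "K_orbit p q y \<subseteq> orb p q r ld"
  proof
    fix z assume "z \<in> K_orbit p q y"
    then obtain h where h: "h \<in> K_group p q" "z = frame_map p q (h * A, h * k)" unfolding K_orbit_def using act by auto
    have "h * A = (h * k) * (ki * A)"
      using assoc_mult_mat[OF K_group_carrier[OF h(1)] kc A1(1)] kA by simp
    then show "z \<in> orb p q r ld"
      unfolding h(2) using orb_memI(1)[OF g(3) K_group_mult[OF h(1) k] A1(1) g(1,2,4)] by simp
  qed
  moreover have "orb p q r ld \<subseteq> K_orbit p q y"
  proof
    fix z assume "z \<in> orb p q r ld"
    then obtain h where h: "h \<in> K_group p q" "z = frame_map p q (h * ?M, h)" unfolding orb_def by auto
    obtain b where b: "b \<in> borel_group p q" "ki * A * g = b * ?M" using has_leads_borel_factor[OF g(3,4)] .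
    obtain c where c: "c \<in> borel_group p q" "b * c = 1\<^sub>m (p + q)" "c * b = 1\<^sub>m (p + q)" using borel_inverse[OF b(1)] .
    note hc = K_group_carrier[OF h(1)] and bc = K_group_carrier[OF borel_K[OF b(1)]] and cc = K_group_carrier[OF borel_K[OF c(1)]]
    define h' where "h' = h * c * ki"
    have h'K: "h' \<in> K_group p q" unfolding h'_def using K_group_mult h(1) borel_K[OF c(1)] ki(1) by blast
    have hcc: "h * c \<in> carrier_mat (p + q) (p + q)" using hc cc by auto
    have 1: "h' * k * b = h"
    proof -
      have "h' * k = h * c" unfolding h'_def using assoc_mult_mat[OF hcc kic kc] ki(3) right_mult_one_mat[OF hcc] by simp
      then show ?thesis using assoc_mult_mat[OF hc cc bc] c(3) hc by simp
    qed
    have 2: "h' * A * g = h * ?M"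
    proof -
      have "h' * A * g = (h * c) * (ki * A) * g" unfolding h'_def using assoc_mult_mat[OF hcc kic A(1)] by simp
      also have "\<dots> = (h * c) * (b * ?M)" using assoc_mult_mat[OF hcc A1(1) g(1)] b(2) by simp
      also have "\<dots> = h * (c * (b * ?M))" by (rule assoc_mult_mat[OF hc cc]) (use bc lead_mat_carrier in auto)
      also have "c * (b * ?M) = ?M" using assoc_mult_mat[OF cc bc lead_mat_carrier] c(3) left_mult_one_mat[OF lead_mat_carrier] by simp
      finally show ?thesis .
    qed
    have "frame_map p q (h' * A * g, h' * k * b) = frame_map p q (h' * A, h' * k)"
      by (rule frame_map_borel(1)[OF K_act_frame_map(2)[OF h'K x(1)] g(1,2) b(1)])
    then have "z = K_act h' y" unfolding 1 2 act[OF h'K] h(2) .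
    then show "z \<in> K_orbit p q y" unfolding K_orbit_def using h'K by auto
  qed
  ultimately show ?thesis using that g(3) by blast
qed

lemma frame_line_mult:
  assumes k: "k \<in> carrier_mat (p + q) (p + q)" and A: "A \<in> carrier_mat (p + q) r" and B: "B \<in> carrier_mat (p + q) r"
  shows "frame_line p q r (k * A, k) (k * B, k) t =
    (k * mat (p + q) r (\<lambda>ij. (1 - t) * A $$ ij + t * B $$ ij), k)"
proof (rule prod_eqI)
  let ?C = "mat (p + q) r (\<lambda>ij. (1 - t) * A $$ ij + t * B $$ ij)"
  have C: "?C \<in> carrier_mat (p + q) r" by simp
  show "fst (frame_line p q r (k * A, k) (k * B, k) t) = fst (k * ?C, k)"
    unfolding frame_line_def fst_conv
  proof (rule eq_matI)
    fix i j assume "i < dim_row (k * ?C)" "j < dim_col (k * ?C)"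
    then have ij: "i < p + q" "j < r" using k by auto
    show "mat (p + q) r (\<lambda>ij. (1 - t) * (k * A) $$ ij + t * (k * B) $$ ij) $$ (i, j) = (k * ?C) $$ (i, j)"
      unfolding mult_mat_index_sum[OF k C ij]
      using ij mult_mat_index_sum[OF k A ij] mult_mat_index_sum[OF k B ij]
      by (simp add: sum_distrib_left distrib_left sum.distrib mult_ac)
  qed (use k in auto)
  show "snd (frame_line p q r (k * A, k) (k * B, k) t) = snd (k * ?C, k)"
    unfolding frame_line_def using k by (auto intro!: eq_matI simp: algebra_simps)
qed

section \<open>The closure order\<close>

text \<open>A neighbourhood of the limit contains the images of all but finitely many points of the
  line, so it meets \<open>S\<close> at some \<open>t \<noteq> 0\<close>.\<close>

lemma line_limit_in_closure:
  assumes x: "x0 \<in> frames p q r" "x1 \<in> frames p q r" and S: "S \<subseteq> dflag_variety p q r"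
    and line: "\<And>t. t \<noteq> 0 \<Longrightarrow> frame_line p q r x0 x1 t \<in> frames p q r \<Longrightarrow> frame_map p q (frame_line p q r x0 x1 t) \<in> S"
  shows "frame_map p q x0 \<in> zariski p q r closure_of S"
  unfolding in_closure_of
proof (intro conjI allI impI)
  show "frame_map p q x0 \<in> topspace (zariski p q r)" unfolding topspace_zariski by (rule frame_mapI[OF x(1)])
  fix V assume V: "frame_map p q x0 \<in> V \<and> openin (zariski p q r) V"
  let ?U = "{x \<in> frames p q r. frame_map p q x \<in> V}" and ?l = "frame_line p q r x0 x1"
  have "openin (zariski_frames p q r) ?U" "x0 \<in> ?U" using V x(1) unfolding openin_zariski by auto
  then obtain f where f: "regular p q r f" "f x0 \<noteq> 0" "{y \<in> frames p q r. f y \<noteq> 0} \<subseteq> ?U"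
    unfolding openin_zariski_frames by meson
  obtain P where P: "\<And>t. ?l t \<in> frames p q r \<Longrightarrow> f (?l t) = poly P t" using regular_on_line[OF f(1)] by metis
  have "poly P 0 \<noteq> 0" using P[of 0] f(2) x frame_line_ends[OF x] by auto
  then have "finite ({t. ?l t \<notin> frames p q r} \<union> {t. poly P t = 0} \<union> {0})"
    using finite_line_not_frames[OF x] finite_roots_nonzero by auto
  from ex_new_if_finite[OF infinite_UNIV_char_0 this] obtain t where
    "t \<notin> {t. ?l t \<notin> frames p q r} \<union> {t. poly P t = 0} \<union> {0}" ..
  then have t: "?l t \<in> frames p q r" "poly P t \<noteq> 0" "t \<noteq> 0" by auto
  then have "?l t \<in> {y \<in> frames p q r. f y \<noteq> 0}" using P by simp
  then have "frame_map p q (?l t) \<in> V" using f(3) by blast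
  then show "\<exists>y. y \<in> S \<and> y \<in> V" using line[OF t(3,1)] by blast
qed

text \<open>This is the openness of the frame map: for \<open>x\<close> outside \<open>D\<close>,
  the image of the complement of \<open>D\<close> would be a neighbourhood that misses
  \<open>S\<close>.\<close>

lemma closed_preimage_of_closure:
  assumes D: "closedin (zariski_frames p q r) D" and S: "{x \<in> frames p q r. frame_map p q x \<in> S} \<subseteq> D"
    and x: "x \<in> frames p q r" "frame_map p q x \<in> zariski p q r closure_of S"
  shows "x \<in> D"
proof (rule ccontr)
  assume n: "x \<notin> D"
  let ?U = "frames p q r - D"
  have "openin (zariski_frames p q r) ?U" using D by (simp add: closedin_def topspace_zariski_frames)
  then have "openin (zariski p q r) (frame_map p q ` ?U)" using open_frame_map unfolding open_map_def by blast
  moreover have "frame_map p q x \<in> frame_map p q ` ?U" using x(1) n by blast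
  moreover from x(2) have "\<forall>V. frame_map p q x \<in> V \<and> openin (zariski p q r) V \<longrightarrow> (\<exists>y. y \<in> S \<and> y \<in> V)"
    by (simp add: in_closure_of)
  ultimately have "\<exists>y. y \<in> S \<and> y \<in> frame_map p q ` ?U" by simp
  then obtain y where y: "y \<in> S" "y \<in> frame_map p q ` ?U" by auto
  then obtain u where "u \<in> frames p q r" "u \<notin> D" "frame_map p q u \<in> S" by auto
  then show False using S by blast
qed

(* Row a of P is the functional rho (h a), and the columns of Q select T. *)
lemma exists_minor:
  assumes A: "A \<in> carrier_mat n r" and T: "T \<subseteq> {..<r}" "card T = s"
    and vanish: "\<And>w m. (\<And>m. m \<notin> T \<Longrightarrow> w m = 0) \<Longrightarrow>
      (\<And>m. m \<in> T \<Longrightarrow> (\<Sum>m'<r. (\<Sum>c<n. \<rho> m c * A $$ (c, m')) * w m') = 0) \<Longrightarrow> m \<in> T \<Longrightarrow> w m = (0 :: complex)"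
  obtains P Q where "P \<in> carrier_mat s n" "Q \<in> carrier_mat r s" "det (P * A * Q) \<noteq> 0"
    "\<And>a. a < s \<Longrightarrow> \<exists>m\<in>T. \<forall>c<n. P $$ (a, c) = \<rho> m c"
proof -
  have "finite T" using T(1) finite_subset by auto
  then obtain h where h: "bij_betw h {..<s} T" using ex_bij_betw_nat_finite[of T] T(2) by (auto simp: atLeast0LessThan)
  have hT: "h a \<in> T" "h a < r" if "a < s" for a
    using h that T(1) unfolding bij_betw_def by auto
  define P where "P = mat s n (\<lambda>(a, c). \<rho> (h a) c)"
  define Q where "Q = mat r s (\<lambda>(m, a). of_bool (m = h a) :: complex)"
  have P: "P \<in> carrier_mat s n" and Q: "Q \<in> carrier_mat r s" unfolding P_def Q_def by auto
  have PA: "P * A \<in> carrier_mat s r" using P A by auto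
  have PAQ: "P * A * Q \<in> carrier_mat s s" using PA Q by auto
  have "inj_mat (P * A * Q)" unfolding inj_mat_def
  proof (intro ballI impI)
    fix v assume "v \<in> carrier_vec (dim_col (P * A * Q))" "P * A * Q *\<^sub>v v = 0\<^sub>v (dim_row (P * A * Q))"
    then have v: "v \<in> carrier_vec s" "P * A * Q *\<^sub>v v = 0\<^sub>v s" using PAQ by auto
    define u where "u = Q *\<^sub>v v"
    have u: "u \<in> carrier_vec r" unfolding u_def using Q v by auto
    have PAu: "(P * A) *\<^sub>v u = 0\<^sub>v s" unfolding u_def using assoc_mult_mat_vec[OF PA Q v(1)] v(2) by simp
    have uh: "u $ h a = v $ a" if a: "a < s" for a
    proof -
      have "u $ h a = (\<Sum>b<s. Q $$ (h a, b) * v $ b)" unfolding u_def by (rule mult_mat_vec_index_sum[OF Q v(1) hT(2)[OF a]])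
      also have "\<dots> = (\<Sum>b\<in>{a}. Q $$ (h a, b) * v $ b)"
        using h a hT by (intro sum.mono_neutral_right) (auto simp: Q_def bij_betw_def dest: inj_onD)
      also have "\<dots> = v $ a" using a hT by (simp add: Q_def)
      finally show ?thesis .
    qed
    have u0: "u $ m = 0" if m: "m < r" "m \<notin> T" for m
      unfolding u_def mult_mat_vec_index_sum[OF Q v(1) m(1)] using m hT by (intro sum.neutral) (auto simp: Q_def)
    define w where "w m = (if m < r then u $ m else 0)" for m
    have wT: "w m = 0" if "m \<in> T" for m
    proof (rule vanish)
      show "w m = 0" if "m \<notin> T" for m using u0 that unfolding w_def by auto
      show "m \<in> T" by fact
      fix m assume "m \<in> T"
      then obtain a where a: "a < s" "m = h a" using h unfolding bij_betw_def by auto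
      have "0 = ((P * A) *\<^sub>v u) $ a" using PAu a by simp
      also have "\<dots> = (\<Sum>m'<r. (P * A) $$ (a, m') * u $ m')" by (rule mult_mat_vec_index_sum[OF PA u a(1)])
      also have "\<dots> = (\<Sum>m'<r. (\<Sum>c<n. \<rho> m c * A $$ (c, m')) * w m')"
        using a mult_mat_index_sum[OF P A a(1)] by (intro sum.cong refl) (simp add: P_def w_def)
      finally show "(\<Sum>m'<r. (\<Sum>c<n. \<rho> m c * A $$ (c, m')) * w m') = 0" by simp
    qed
    have "v $ a = 0" if "a < s" for a using wT[OF hT(1)[OF that]] uh[OF that] hT(2)[OF that] unfolding w_def by simp
    then show "v = 0\<^sub>v (dim_col (P * A * Q))" using v PAQ by (intro eq_vecI) auto
  qed
  then have "det (P * A * Q) \<noteq> 0" using inj_mat_det[OF PAQ] by simp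
  moreover have "\<exists>m\<in>T. \<forall>c<n. P $$ (a, c) = \<rho> m c" if "a < s" for a using hT[OF that] that unfolding P_def by auto
  ultimately show ?thesis using that P Q by blast
qed

lemma sum_of_bool_row: "i < (n :: nat) \<Longrightarrow> (\<Sum>c<n. of_bool (c = i) * F c) = (F i :: complex)"
proof -
  assume "i < n"
  then have "(\<Sum>c<n. of_bool (c = i) * F c) = (\<Sum>c\<in>{i}. of_bool (c = i) * F c)"
    by (intro sum.mono_neutral_right) auto
  then show ?thesis by simp
qed

text \<open>The count at \<open>(i, j)\<close> is the dimension of the intersection with a sum of
  flag members, so \<open>k^-1 A\<close> modulo the coordinates of the box has rank \<open>r\<close>
  minus the count. An upper bound on this rank is a vanishing of minors, which the adjugate makes
  polynomial in the frame.\<close>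

lemma closure_imp_cnt_le:
  assumes ld: "lead_fun p q r ld" and ld': "lead_fun p q r ld'" and y: "y \<in> orb p q r ld" "y \<in> zariski p q r closure_of orb p q r ld'"
    and ij: "i \<le> p" "j \<le> q"
  shows "cnt (points p q r ld') i j \<le> cnt (points p q r ld) i j"
proof (rule ccontr)
  let ?n = "p + q"
  let ?in = "\<lambda>ld m. fst (ld m) \<le> i \<and> snd (ld m) \<le> j"
  assume less: "\<not> ?thesis"
  \<comment> \<open>One more than the rank that \<open>ld'\<close> allows modulo the box.\<close>
  define s where "s = Suc (r - card {m. m < r \<and> ?in ld' m})"
  have cr: "card {m. m < r \<and> ?in ld m} + card {m. m < r \<and> \<not> ?in ld m} = r" for ld
  proof -
    have "card {m. m < r \<and> ?in ld m} + card {m. m < r \<and> \<not> ?in ld m} = card ({m. m < r \<and> ?in ld m} \<union> {m. m < r \<and> \<not> ?in ld m})"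
      by (rule card_Un_disjoint[symmetric]) auto
    also have "{m. m < r \<and> ?in ld m} \<union> {m. m < r \<and> \<not> ?in ld m} = {..<r}" by auto
    finally show ?thesis by simp
  qed
  \<comment> \<open>The rows of \<open>P\<close> are functionals that factor through the quotient by
    the box.\<close>
  define kills where "kills P \<longleftrightarrow> (\<forall>a<s. \<forall>c\<in>box p (i, j). P $$ (a, c) = 0)" for P :: "complex mat"
  define \<Phi> where "\<Phi> = (\<lambda>(P, Q) x. det (P * (adj_mat (snd x) * fst x) * Q)) `
    {(P, Q). P \<in> carrier_mat s ?n \<and> Q \<in> carrier_mat r s \<and> kills P}"
  define D where "D = {x \<in> frames p q r. \<forall>f\<in>\<Phi>. f x = 0}"
  have closed: "closedin (zariski_frames p q r) D"
    unfolding D_def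
  proof (rule closedin_zero_set)
    fix f assume "f \<in> \<Phi>"
    then obtain P Q where PQ: "P \<in> carrier_mat s ?n" "Q \<in> carrier_mat r s"
      "f = (\<lambda>x. det (P * (adj_mat (snd x) * fst x) * Q))" unfolding \<Phi>_def by auto
    show "regular p q r f" unfolding PQ(3)
      by (rule regular_det, rule regular_mat_mult[OF regular_mat_mult[OF regular_mat_const[OF PQ(1)]
            regular_mat_mult[OF regular_mat_adj regular_mat_fst]] regular_mat_const[OF PQ(2)]])
  qed
  have adjm: "P * (adj_mat h * (h * A)) * Q = det h \<cdot>\<^sub>m (P * A * Q)"
    if "h \<in> carrier_mat ?n ?n" "A \<in> carrier_mat ?n r" "P \<in> carrier_mat s ?n" "Q \<in> carrier_mat r s" for h A P Q
  proof -
    have "adj_mat h * (h * A) = det h \<cdot>\<^sub>m A"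
      using assoc_mult_mat[OF adj_mat(1)[OF that(1)] that(1,2)] adj_mat(3)[OF that(1)]
        mult_smult_assoc_mat[OF one_carrier_mat that(2), of "det h"] left_mult_one_mat[OF that(2)] by simp
    then show ?thesis using that by (simp add: mult_smult_distrib[of P s ?n A r] mult_smult_assoc_mat[of "P * A" s r Q s])
  qed
  have sub: "{x \<in> frames p q r. frame_map p q x \<in> orb p q r ld'} \<subseteq> D"
  proof
    fix x assume x: "x \<in> {x \<in> frames p q r. frame_map p q x \<in> orb p q r ld'}"
    obtain A h where xe: "x = (A, h)" by (cases x)
    let ?M = "lead_mat p q r ld'"
    obtain k g b where kgb: "k \<in> K_group p q" "g \<in> carrier_mat r r" "det g \<noteq> 0" "b \<in> borel_group p q"
      "A = k * ?M * g" "h = k * b" using orb_framesE[OF ld'] x unfolding xe by blast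
    obtain c where c: "c \<in> borel_group p q" "b * c = 1\<^sub>m ?n" using borel_inverse[OF kgb(4)] by metis
    note kc = K_group_carrier[OF kgb(1)] and bc = K_group_carrier[OF borel_K[OF kgb(4)]] and cc = K_group_carrier[OF borel_K[OF c(1)]]
    define N where "N = c * ?M"
    have N: "has_leads p q r ld' N" unfolding N_def by (rule borel_has_leads[OF ld' c(1) has_leads_lead_mat[OF ld']])
    then have Nc: "N \<in> carrier_mat ?n r" unfolding has_leads_def by simp
    have hc: "h \<in> carrier_mat ?n ?n" using kgb(6) kc bc by auto
    have "b * N = ?M" unfolding N_def using assoc_mult_mat[OF bc cc lead_mat_carrier] c(2) left_mult_one_mat[OF lead_mat_carrier] by simp
    then have "k * ?M = h * N" unfolding kgb(6) using assoc_mult_mat[OF kc bc Nc] by simp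
    then have Ah: "A = h * (N * g)" unfolding kgb(5) using assoc_mult_mat[OF hc Nc kgb(2)] by simp
    have "det (P * (adj_mat h * A) * Q) = 0" if PQ: "P \<in> carrier_mat s ?n" "Q \<in> carrier_mat r s" "kills P" for P Q
    proof -
      have PN: "P * N \<in> carrier_mat s r" using PQ Nc by auto
      have e: "P * (N * g) * Q = (P * N) * (g * Q)"
        using assoc_mult_mat[OF PQ(1) Nc kgb(2)] assoc_mult_mat[OF PN kgb(2) PQ(2)] by simp
      have "det ((P * N) * (g * Q)) = 0"
      proof (rule det_mult_few_cols[OF PN, where J = "{m. m < r \<and> \<not> ?in ld' m}"])
        show "g * Q \<in> carrier_mat r s" using kgb(2) PQ(2) by auto
        show "card {m. m < r \<and> \<not> ?in ld' m} < s" using cr[of ld'] unfolding s_def by simp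
        fix a m assume am: "a < s" "m < r" "m \<notin> {m. m < r \<and> \<not> ?in ld' m}"
        then have bx: "box p (ld' m) \<subseteq> box p (i, j)" using box_mono[of "ld' m" "(i, j)"] by auto
        show "(P * N) $$ (a, m) = 0"
          unfolding mult_mat_index_sum[OF PQ(1) Nc am(1,2)]
        proof (intro sum.neutral ballI)
          fix c assume c: "c \<in> {..<?n}"
          show "P $$ (a, c) * N $$ (c, m) = 0"
          proof (cases "c \<in> box p (ld' m)")
            case True
            then show ?thesis using PQ(3) bx am(1) unfolding kills_def by auto
          next
            case False
            then show ?thesis using N c am(2) unfolding has_leads_def by auto
          qed
        qed
      qed auto
      then show ?thesis unfolding Ah using adjm[OF hc _ PQ(1,2), of "N * g"] Nc kgb(2) e by simp
    qed
    then show "x \<in> D" using x unfolding D_def \<Phi>_def xe by auto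
  qed
  let ?M = "lead_mat p q r ld"
  obtain k where k: "k \<in> K_group p q" "y = frame_map p q (k * ?M, k)" using y(1) unfolding orb_def by auto
  note kc = K_group_carrier[OF k(1)]
  have xf: "(k * ?M, k) \<in> frames p q r" by (rule lead_mat_frames[OF ld k(1) has_leads_lead_mat[OF ld]])
  have xD: "(k * ?M, k) \<in> D" by (rule closed_preimage_of_closure[OF closed sub xf]) (use y(2) k(2) in simp)
  have dk: "det k \<noteq> 0" using k(1) by (simp add: K_group_iff)
  have zero: "det (P * ?M * Q) = 0" if PQ: "P \<in> carrier_mat s ?n" "Q \<in> carrier_mat r s" "kills P" for P Q
  proof -
    have "det (P * (adj_mat k * (k * ?M)) * Q) = 0" using xD PQ unfolding D_def \<Phi>_def by auto
    then have "det k ^ s * det (P * ?M * Q) = 0"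
      unfolding adjm[OF kc lead_mat_carrier PQ(1,2)] using PQ by simp
    then show ?thesis using dk by simp
  qed
  have "s \<le> card {m. m < r \<and> \<not> ?in ld m}"
    using less cr[of ld] cr[of ld'] unfolding s_def cnt_points[OF ld ij] cnt_points[OF ld' ij] by linarith
  then obtain T where T: "T \<subseteq> {m. m < r \<and> \<not> ?in ld m}" "card T = s" by (rule obtain_subset_with_card_n)
  \<comment> \<open>Coordinate functionals at pivots outside the box separate the chosen columns of
    \<open>ld\<close>, none of which lies in the box.\<close>
  define \<rho> where "\<rho> m c = (of_bool (c = pivot_row p i (ld m)) :: complex)" for m c
  have pr: "pivot_row p i (ld m) < ?n" "pivot_row p i (ld m) \<notin> box p (i, j)" if "m \<in> T" for m
  proof -
    have m: "m < r" "\<not> ?in ld m" using T(1) that by auto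
    have rg: "fst (ld m) \<le> p" "snd (ld m) \<le> q" using lead_fun_range[OF ld m(1)] by auto
    show "pivot_row p i (ld m) < ?n" using pivot_row_lead(1)[OF m(2) rg(1)] lead_rows_less[OF rg] by auto
    show "pivot_row p i (ld m) \<notin> box p (i, j)" using pivot_row_lead(2)[OF m(2) rg(1) ij(1)] .
  qed
  obtain P Q where PQ: "P \<in> carrier_mat s ?n" "Q \<in> carrier_mat r s" "det (P * ?M * Q) \<noteq> 0"
    "\<And>a. a < s \<Longrightarrow> \<exists>m\<in>T. \<forall>c<?n. P $$ (a, c) = \<rho> m c"
  proof (rule exists_minor[OF lead_mat_carrier[of p q r ld] _ T(2), of \<rho>])
    show "T \<subseteq> {..<r}" using T(1) by auto
    fix w m assume w0: "\<And>m. m \<notin> T \<Longrightarrow> w m = 0" and m: "m \<in> T"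
      and eq: "\<And>m. m \<in> T \<Longrightarrow> (\<Sum>m'<r. (\<Sum>c<?n. \<rho> m c * ?M $$ (c, m')) * w m') = 0"
    show "w m = 0"
    proof (rule pivots_vanish[OF ld has_leads_lead_mat[OF ld], of w i j])
      show "m < r" "\<not> ?in ld m" using m T(1) by auto
      fix m assume "m < r" "w m \<noteq> 0"
      then have "m \<in> T" using w0 by blast
      then show "(\<Sum>m'<r. ?M $$ (pivot_row p i (ld m), m') * w m') = 0"
        using eq[of m] pr(1)[of m] unfolding \<rho>_def by (simp add: sum_of_bool_row)
    qed
  next
    fix P Q assume "P \<in> carrier_mat s ?n" "Q \<in> carrier_mat r s" "det (P * ?M * Q) \<noteq> 0"
      "\<And>a. a < s \<Longrightarrow> \<exists>m\<in>T. \<forall>c<?n. P $$ (a, c) = \<rho> m c"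
    then show thesis by (rule that)
  qed
  have "kills P" unfolding kills_def
  proof (intro allI impI ballI)
    fix a c assume a: "a < s" and c: "c \<in> box p (i, j)"
    then have "c < ?n" using ij unfolding box_def by auto
    moreover obtain m where "m \<in> T" "\<forall>c<?n. P $$ (a, c) = \<rho> m c" using PQ(4)[OF a] by auto
    ultimately show "P $$ (a, c) = 0" using pr(2)[of m] c unfolding \<rho>_def by auto
  qed
  then show False using zero[OF PQ(1,2)] PQ(3) by simp
qed

text \<open>Column \<open>m0\<close>, at the point \<open>(a, c)\<close>, receives the entry
  \<open>t\<close> in a row that extends its lead. If \<open>b \<le> p\<close> and
  \<open>d \<le> q\<close>, the column of \<open>(b, d)\<close> is cleared of row \<open>b\<close>
  by subtracting \<open>1 / t\<close> times column \<open>m0\<close>, which leaves the leads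
  \<open>(b, c)\<close> and \<open>(a, d)\<close>. At \<open>t = 0\<close> the matrix is that of
  \<open>ld\<close>.\<close>

lemma swap_orb_closure:
  assumes ld: "lead_fun p q r ld" and ld': "lead_fun p q r ld'"
    and sw: "swap p q (points p q r ld') (points p q r ld) a b c d"
  shows "orb p q r ld \<subseteq> zariski p q r closure_of orb p q r ld'"
proof
  fix y assume "y \<in> orb p q r ld"
  let ?n = "p + q" and ?M = "lead_mat p q r ld"
  obtain k where k: "k \<in> K_group p q" "y = frame_map p q (k * ?M, k)" using \<open>y \<in> orb p q r ld\<close> unfolding orb_def by auto
  obtain T where T: "(a, c) \<notin> T" "(b, d) \<notin> T" "(a, d) \<notin> T" "(b, c) \<notin> T"
    "points p q r ld = T \<union> {(a, c), (b, d)}" "points p q r ld' = T \<union> ({(a, d), (b, c)} - phantoms p q)"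
    using sw unfolding swap_def by blast
  have ab: "a < b" "b \<le> Suc p" "c < d" "d \<le> Suc q" "\<not> (b = Suc p \<and> d = Suc q)" using sw unfolding swap_def by auto
  have nf: "ld ` {..<r} = nonfree p q T \<union> {(a, c)} \<union> (if b \<le> p \<and> d \<le> q then {(b, d)} else {})"
  proof -
    have "nonfree p q (T \<union> {(a, c), (b, d)}) = nonfree p q T \<union> {(a, c)} \<union> (if b \<le> p \<and> d \<le> q then {(b, d)} else {})"
      using ab(1-4) unfolding nonfree_def by (auto split: if_splits)
    then show ?thesis using nonfree_points[OF ld] T(5) by simp
  qed
  have nf': "ld' ` {..<r} = nonfree p q T \<union> (if d \<le> q then {(a, d)} else {}) \<union> (if b \<le> p then {(b, c)} else {})"
  proof -
    have "nonfree p q (T \<union> ({(a, d), (b, c)} - phantoms p q)) =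
        nonfree p q T \<union> (if d \<le> q then {(a, d)} else {}) \<union> (if b \<le> p then {(b, c)} else {})"
      using ab(1-4) unfolding nonfree_def phantoms_def by (auto split: if_splits)
    then show ?thesis using nonfree_points[OF ld'] T(6) by simp
  qed
  have nT: "(a, c) \<notin> nonfree p q T" "(b, d) \<notin> nonfree p q T" using T(1,2) unfolding nonfree_def by auto
  note inj = lead_fun_inj[OF ld]
  obtain m0 where m0: "m0 < r" "ld m0 = (a, c)"
  proof -
    have "(a, c) \<in> ld ` {..<r}" unfolding nf by simp
    then show ?thesis using that by (auto simp: image_iff)
  qed
  have upd: "(ld(m0 := z)) ` {..<r} = (ld ` {..<r} - {(a, c)}) \<union> {z}" for z
    using m0 inj by (auto simp: inj_on_def image_iff)
  \<comment> \<open>The lead row of \<open>b\<close>, or that of \<open>d\<close> if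
    \<open>b\<close> is the border row \<open>Suc p\<close>.\<close>
  define e where "e = (if b \<le> p then b - 1 else p + d - 1)"
  define At where "At t = mat ?n r (\<lambda>(i, m). of_bool (i \<in> lead_rows p (ld m)) + (if m = m0 \<and> i = e then t else 0 :: complex))" for t
  have Atc: "At t \<in> carrier_mat ?n r" for t unfolding At_def by simp
  have other: "m < r \<Longrightarrow> (i < ?n \<longrightarrow> i \<notin> box p (ld m) \<longrightarrow> of_bool (i \<in> lead_rows p (ld m)) = (0 :: complex))" for i m
    using lead_rows_box[of p "ld m"] by auto
  have less_n: "i \<in> lead_rows p (ld m) \<Longrightarrow> m < r \<Longrightarrow> i < ?n" for i m
    using lead_rows_less[of "ld m" p q i] lead_fun_range[OF ld, of m] by auto
  have deg: "\<exists>g ld''. g \<in> carrier_mat r r \<and> det g \<noteq> 0 \<and> has_leads p q r ld'' (At t * g) \<and> ld'' ` {..<r} = ld' ` {..<r}"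
    if t: "t \<noteq> 0" for t
  proof -
    \<comment> \<open>If \<open>(b, d)\<close> is a free vertex, it has no column, and only column
      \<open>m0\<close> changes its lead.\<close>
    consider (A) "b \<le> p" "d \<le> q" | (B) "b \<le> p" "d = Suc q" | (C) "b = Suc p" "d \<le> q" using ab by linarith
    then show ?thesis
    proof cases
      case B
      define ld'' where "ld'' = ld(m0 := (b, c))"
      have im: "ld'' ` {..<r} = ld' ` {..<r}" unfolding ld''_def upd nf nf' using B nT by auto
      have "has_leads p q r ld'' (At t)" unfolding has_leads_def
      proof (intro conjI allI impI ballI Atc)
        fix m i assume m: "m < r"
        {
          assume i: "i < ?n" "i \<notin> box p (ld'' m)"
          show "At t $$ (i, m) = 0"
            using i m m0 B ab other[OF m, of i] unfolding At_def ld''_def e_def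
            by (auto simp: box_def lead_rows_iff split: if_splits)
        next
          assume i: "i \<in> lead_rows p (ld'' m)"
          have "i < ?n" using i m m0 B ab less_n[of i m] lead_fun_range[OF ld m0(1)] unfolding ld''_def
            by (auto simp: lead_rows_iff split: if_splits)
          then show "At t $$ (i, m) \<noteq> 0"
            using i m m0 B ab t unfolding At_def ld''_def e_def
            by (auto simp: lead_rows_iff split: if_splits)
        }
      qed
      then show ?thesis using im Atc[of t] by (intro exI[of _ "1\<^sub>m r"] exI[of _ ld'']) auto
    next
      case C
      define ld'' where "ld'' = ld(m0 := (a, d))"
      have im: "ld'' ` {..<r} = ld' ` {..<r}" unfolding ld''_def upd nf nf' using C nT by auto
      have "has_leads p q r ld'' (At t)" unfolding has_leads_def
      proof (intro conjI allI impI ballI Atc)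
        fix m i assume m: "m < r"
        {
          assume i: "i < ?n" "i \<notin> box p (ld'' m)"
          show "At t $$ (i, m) = 0"
            using i m m0 C ab other[OF m, of i] unfolding At_def ld''_def e_def
            by (auto simp: box_def lead_rows_iff split: if_splits)
        next
          assume i: "i \<in> lead_rows p (ld'' m)"
          have "i < ?n" using i m m0 C ab less_n[of i m] lead_fun_range[OF ld m0(1)] unfolding ld''_def
            by (auto simp: lead_rows_iff split: if_splits)
          then show "At t $$ (i, m) \<noteq> 0"
            using i m m0 C ab t unfolding At_def ld''_def e_def
            by (auto simp: lead_rows_iff split: if_splits)
        }
      qed
      then show ?thesis using im Atc[of t] by (intro exI[of _ "1\<^sub>m r"] exI[of _ ld'']) auto
    next
      case A
      obtain m1 where m1: "m1 < r" "ld m1 = (b, d)"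
      proof -
        have "(b, d) \<in> ld ` {..<r}" unfolding nf using A by simp
        then show ?thesis using that by (auto simp: image_iff)
      qed
      have mm: "m0 \<noteq> m1" using m0 m1 ab by auto
      define ld'' where "ld'' = ld(m0 := (b, c), m1 := (a, d))"
      have "ld'' ` {..<r} = (ld ` {..<r} - {(a, c), (b, d)}) \<union> {(b, c), (a, d)}"
        unfolding ld''_def using m0 m1 mm inj by (auto simp: inj_on_def image_iff)
      then have im: "ld'' ` {..<r} = ld' ` {..<r}" unfolding nf nf' using A nT by auto
      let ?C = "addcol (- (1 / t)) m1 m0 (At t)"
      have Cc: "?C \<in> carrier_mat ?n r" using Atc[of t] by auto
      have C0: "?C $$ (i, m) = of_bool (i \<in> lead_rows p (ld m)) + (if m = m0 \<and> i = e then t else 0) +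
          (if m = m1 then - (1 / t) * (of_bool (i \<in> lead_rows p (a, c)) + (if i = e then t else 0)) else 0)"
        if "i < ?n" "m < r" for i m
        using that m0 m1 mm Atc[of t] unfolding At_def by auto
      \<comment> \<open>Row \<open>b\<close> cancels: the entry \<open>1\<close> of column
        \<open>m1\<close> meets \<open>- (1 / t) * t\<close>.\<close>
      have C1: "?C $$ (i, m1) = of_bool (i = p + d - 1) - (1 / t) * of_bool (i \<in> lead_rows p (a, c))" if "i < ?n" for i
        unfolding C0[OF that m1(1)] using t mm m1(2) A ab by (auto simp: e_def lead_rows_iff field_simps)
      have "has_leads p q r ld'' ?C" unfolding has_leads_def
      proof (intro conjI allI impI ballI Cc)
        fix m i assume m: "m < r"
        {
          assume i: "i < ?n" "i \<notin> box p (ld'' m)"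
          show "?C $$ (i, m) = 0"
          proof (cases "m = m1")
            case True
            then show ?thesis using i C1[OF i(1)] A ab by (auto simp: box_def lead_rows_iff ld''_def)
          next
            case False
            then show ?thesis unfolding C0[OF i(1) m]
              using i m m0 A ab other[OF m, of i] unfolding ld''_def e_def
              by (auto simp: box_def lead_rows_iff split: if_splits)
          qed
        next
          assume i: "i \<in> lead_rows p (ld'' m)"
          have inn: "i < ?n" using i m m0 A ab less_n[of i m] lead_fun_range[OF ld m0(1)] unfolding ld''_def
            by (auto simp: lead_rows_iff split: if_splits)
          show "?C $$ (i, m) \<noteq> 0"
          proof (cases "m = m1")
            case True
            then show ?thesis using i C1[OF inn] A ab t lead_fun_range[OF ld m0(1)] m0(2)
              by (auto simp: lead_rows_iff ld''_def)
          next
            case False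
            then show ?thesis unfolding C0[OF inn m]
              using i m m0 A ab t unfolding ld''_def e_def
              by (auto simp: lead_rows_iff split: if_splits)
          qed
        }
      qed
      moreover have "?C = At t * addrow_mat r (- (1 / t)) m0 m1" by (rule addcol_mat[OF Atc m0(1)])
      moreover have "det (addrow_mat r (- (1 / t)) m0 m1) \<noteq> 0" using det_addrow_mat[OF mm, of r "- (1 / t)"] by simp
      ultimately show ?thesis using im addrow_mat_carrier by metis
    qed
  qed
  have inorb: "frame_map p q (k * At t, k) \<in> orb p q r ld' \<and> (k * At t, k) \<in> frames p q r" if t: "t \<noteq> 0" for t
  proof -
    obtain g ld'' where g: "g \<in> carrier_mat r r" "det g \<noteq> 0" "has_leads p q r ld'' (At t * g)" "ld'' ` {..<r} = ld' ` {..<r}"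
      using deg[OF t] by auto
    show ?thesis
      using orb_memI[OF lead_fun_image[OF ld' g(4)] k(1) Atc g(1-3)] orb_cong[OF ld' g(4)] by simp
  qed
  have xf: "(k * ?M, k) \<in> frames p q r" by (rule lead_mat_frames[OF ld k(1) has_leads_lead_mat[OF ld]])
  have line: "frame_line p q r (k * ?M, k) (k * At 1, k) t = (k * At t, k)" for t
  proof -
    have "mat ?n r (\<lambda>ij. (1 - t) * ?M $$ ij + t * At 1 $$ ij) = At t"
      unfolding At_def lead_mat_def by (intro eq_matI) (auto simp: algebra_simps)
    then show ?thesis by (simp only: frame_line_mult[OF K_group_carrier[OF k(1)] lead_mat_carrier Atc])
  qed
  show "y \<in> zariski p q r closure_of orb p q r ld'"
    unfolding k(2)
    by (rule line_limit_in_closure[OF xf, of "(k * At 1, k)"]) (use inorb line orb_subset[OF ld'] in auto)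
qed

text \<open>A crude bound, which makes the induction over successive swaps terminate: each swap
  raises the number of comparable pairs by one.\<close>

lemma ll_pairs_bound:
  assumes C: "config p q r C"
  shows "ll_pairs C \<le> ((p + 2) * (q + 2)) ^ 2"
proof -
  have "C \<subseteq> {0..Suc p} \<times> {0..Suc q}" using C unfolding config_def by blast
  then have c: "card C \<le> (p + 2) * (q + 2)" using card_mono[of "{0..Suc p} \<times> {0..Suc q}" C] by simp
  have "ll_pairs C \<le> card (C \<times> C)"
    unfolding ll_pairs_def using config_finite[OF C] by (intro card_mono) auto
  also have "\<dots> = card C ^ 2" by (simp add: card_cartesian_product power2_eq_square)
  also have "\<dots> \<le> ((p + 2) * (q + 2)) ^ 2" by (rule power_mono[OF c]) simp
  finally show ?thesis .
qed

lemma orb_closure_if_cnt_le: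
  assumes ld: "lead_fun p q r ld" and ld': "lead_fun p q r ld'"
    and le: "\<And>i j. i \<le> p \<Longrightarrow> j \<le> q \<Longrightarrow> cnt (points p q r ld') i j \<le> cnt (points p q r ld) i j"
  shows "orb p q r ld \<subseteq> zariski p q r closure_of orb p q r ld'"
  using ld' le
proof (induction "((p + 2) * (q + 2)) ^ 2 - ll_pairs (points p q r ld')" arbitrary: ld' rule: less_induct)
  case less
  note ld' = less.prems(1)
  have self: "orb p q r ld' \<subseteq> zariski p q r closure_of orb p q r ld'"
    using closure_of_subset orb_subset[OF ld'] by (metis topspace_zariski)
  show ?case
  proof (cases "points p q r ld = points p q r ld'")
    case True
    then show ?thesis using orb_cong_points[OF ld ld'] self by simp
  next
    case False
    obtain w a b c d where w: "swap p q (points p q r ld') w a b c d" "config p q r w"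
      "ll_pairs w = ll_pairs (points p q r ld') + 1"
      "\<And>i j. i \<le> p \<Longrightarrow> j \<le> q \<Longrightarrow> cnt w i j \<le> cnt (points p q r ld) i j"
      using exists_swap_below[OF points_config[OF ld] points_config[OF ld'] False less.prems(2)] by blast
    obtain ld2 where ld2: "lead_fun p q r ld2" "points p q r ld2 = w" using config_lead_fun[OF w(2)] .
    have "orb p q r ld \<subseteq> zariski p q r closure_of orb p q r ld2"
      using less.hyps[OF _ ld2(1)] ld2(2) w(3,4) ll_pairs_bound[OF w(2)] by simp
    also have "\<dots> \<subseteq> zariski p q r closure_of orb p q r ld'"
      by (intro closure_of_minimal closedin_closure_of swap_orb_closure[OF ld2(1) ld']) (use w(1) ld2(2) in simp)
    finally show ?thesis .
  qed
qed

lemma orb_closure_subset_iff: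
  assumes ld: "lead_fun p q r ld" and ld': "lead_fun p q r ld'"
  shows "zariski p q r closure_of orb p q r ld \<subseteq> zariski p q r closure_of orb p q r ld' \<longleftrightarrow>
     (\<forall>i\<le>p. \<forall>j\<le>q. cnt (points p q r ld') i j \<le> cnt (points p q r ld) i j)"
proof
  obtain y where y: "y \<in> orb p q r ld" unfolding orb_def using K_group_one by blast
  have self: "orb p q r ld \<subseteq> zariski p q r closure_of orb p q r ld"
    using closure_of_subset orb_subset[OF ld] by (metis topspace_zariski)
  {
    assume "zariski p q r closure_of orb p q r ld \<subseteq> zariski p q r closure_of orb p q r ld'"
    then show "\<forall>i\<le>p. \<forall>j\<le>q. cnt (points p q r ld') i j \<le> cnt (points p q r ld) i j"
      using closure_imp_cnt_le[OF ld ld' y] y self by blast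
  next
    assume "\<forall>i\<le>p. \<forall>j\<le>q. cnt (points p q r ld') i j \<le> cnt (points p q r ld) i j"
    then show "zariski p q r closure_of orb p q r ld \<subseteq> zariski p q r closure_of orb p q r ld'"
      by (intro closure_of_minimal closedin_closure_of orb_closure_if_cnt_le[OF ld ld']) auto
  }
qed

lemma orb_closure_eq_iff:
  assumes ld: "lead_fun p q r ld" and ld': "lead_fun p q r ld'"
  shows "zariski p q r closure_of orb p q r ld = zariski p q r closure_of orb p q r ld' \<longleftrightarrow> points p q r ld = points p q r ld'"
proof
  assume "zariski p q r closure_of orb p q r ld = zariski p q r closure_of orb p q r ld'"
  then have "cnt (points p q r ld) i j = cnt (points p q r ld') i j" if "i \<le> p" "j \<le> q" for i j
    using orb_closure_subset_iff[OF ld ld'] orb_closure_subset_iff[OF ld' ld] that by (simp add: antisym)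
  then show "points p q r ld = points p q r ld'"
    by (rule config_eq_if_cnt_eq[OF points_config[OF ld] points_config[OF ld']])
next
  assume "points p q r ld = points p q r ld'"
  then show "zariski p q r closure_of orb p q r ld = zariski p q r closure_of orb p q r ld'"
    using orb_cong_points[OF ld ld'] by simp
qed

section \<open>The dimension of an orbit\<close>

lemma closedin_saturated_image:
  assumes D: "closedin (zariski_frames p q r) D"
    and sat: "\<And>x x'. x \<in> D \<Longrightarrow> x' \<in> frames p q r \<Longrightarrow> frame_map p q x' = frame_map p q x \<Longrightarrow> x' \<in> D"
  shows "closedin (zariski p q r) (frame_map p q ` D)"
proof -
  have Df: "D \<subseteq> frames p q r" using D closedin_subset topspace_zariski_frames by metis
  have "{x \<in> frames p q r. frame_map p q x \<in> frame_map p q ` D} = D" using Df sat by blast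
  then show ?thesis unfolding closedin_zariski using D Df frame_mapI by auto
qed

section \<open>Closed slices of an orbit in the flag directions\<close>

definition lower_positions :: "nat \<Rightarrow> nat \<Rightarrow> (nat \<times> nat) set" where
  "lower_positions p q = {(i, j) \<in> block_positions p q. j < i}"

lemma finite_lower_positions: "finite (lower_positions p q)"
  unfolding lower_positions_def by (rule finite_subset[OF _ finite_block_positions[of p q]]) auto

definition lower_zero :: "nat \<Rightarrow> nat \<Rightarrow> nat \<Rightarrow> (nat \<times> nat) set \<Rightarrow> (complex mat \<times> complex mat) set" where
  "lower_zero p q r S = {x \<in> frames p q r. \<forall>f\<in>(\<lambda>(i, j) x. snd x $$ (i, j)) ` (lower_positions p q - S). f x = 0}"

lemma lower_zero_iff:
  "(A, k) \<in> lower_zero p q r S \<longleftrightarrow> (A, k) \<in> frames p q r \<and> (\<forall>(i, j)\<in>lower_positions p q - S. k $$ (i, j) = 0)"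
  unfolding lower_zero_def by auto

lemma closedin_lower_zero: "closedin (zariski_frames p q r) (lower_zero p q r S)"
  unfolding lower_zero_def
  by (rule closedin_zero_set) (auto simp: lower_positions_def block_positions_def intro: regular_snd)

text \<open>Right multiplication by the Borel group adds columns of \<open>k\<close> to later ones.
  Vanishing outside \<open>S\<close> survives this if \<open>S\<close> contains, with a position,
  all lower positions to its right in the same row.\<close>

definition right_closed :: "nat \<Rightarrow> nat \<Rightarrow> (nat \<times> nat) set \<Rightarrow> bool" where
  "right_closed p q S \<longleftrightarrow> (\<forall>i j j'. (i, j) \<in> S \<longrightarrow> j < j' \<longrightarrow> (i, j') \<in> lower_positions p q \<longrightarrow> (i, j') \<in> S)"

lemma lower_zero_saturated:
  assumes S: "right_closed p q S" and x: "x \<in> lower_zero p q r S" and x': "x' \<in> frames p q r"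
    and e: "frame_map p q x' = frame_map p q x"
  shows "x' \<in> lower_zero p q r S"
proof -
  obtain A k A' k' where xe: "x = (A, k)" "x' = (A', k')" by (metis surj_pair)
  have fr: "(A, k) \<in> frames p q r" and z: "\<And>i j. (i, j) \<in> lower_positions p q \<Longrightarrow> (i, j) \<notin> S \<Longrightarrow> k $$ (i, j) = 0"
    using x unfolding xe lower_zero_iff by auto
  obtain g b where gb: "b \<in> borel_group p q" "k' = k * b"
    using frame_map_eqD[OF fr x'[unfolded xe] e[unfolded xe, symmetric]] by metis
  have k: "k \<in> K_group p q" using fr by (simp add: frames_iff)
  note kc = K_group_carrier[OF k] and bc = K_group_carrier[OF borel_K[OF gb(1)]]
  have "k' $$ (i, j) = 0" if ij: "(i, j) \<in> lower_positions p q" "(i, j) \<notin> S" for i j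
  proof -
    have n: "i < p + q" "j < p + q" "j < i" "(i < p) = (j < p)" using ij unfolding lower_positions_def block_positions_def by auto
    show ?thesis unfolding gb(2) mult_mat_index_sum[OF kc bc n(1,2)]
    proof (intro sum.neutral ballI)
      fix c assume c: "c \<in> {..<p + q}"
      consider "j < c" | "c \<le> j" "(i < p) \<noteq> (c < p)" | "c \<le> j" "(i < p) = (c < p)" by linarith
      then show "k $$ (i, c) * b $$ (c, j) = 0"
      proof cases
        case 1
        then show ?thesis using gb(1) c unfolding borel_group_def by auto
      next
        case 2
        then show ?thesis using K_group_block[OF k n(1), of c] c by simp
      next
        case 3
        then have l: "(i, c) \<in> lower_positions p q" using n c unfolding lower_positions_def block_positions_def by auto
        have "(i, c) \<notin> S"
        proof
          assume "(i, c) \<in> S"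
          then show False using S ij 3 unfolding right_closed_def by (cases "c = j") auto
        qed
        then show ?thesis using z[OF l] by simp
      qed
    qed
  qed
  then show ?thesis unfolding xe lower_zero_iff using x'[unfolded xe] by auto
qed

text \<open>For empty \<open>S\<close> the matrices \<open>k\<close> form the Borel group and the
  flags are standard; for the full set of lower positions the slice is the whole orbit.\<close>

definition flag_slice :: "nat \<Rightarrow> nat \<Rightarrow> nat \<Rightarrow> (nat \<Rightarrow> nat \<times> nat) \<Rightarrow> (nat \<times> nat) set \<Rightarrow> dflag set" where
  "flag_slice p q r ld S = {frame_map p q (k * lead_mat p q r ld, k) |k.
     k \<in> K_group p q \<and> (\<forall>(i, j)\<in>lower_positions p q - S. k $$ (i, j) = 0)}"

lemma flag_slice_alt:
  assumes ld: "lead_fun p q r ld" and S: "right_closed p q S"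
  shows "flag_slice p q r ld S = frame_map p q ` lower_zero p q r S \<inter> orb p q r ld"
proof -
  have fr: "(k * lead_mat p q r ld, k) \<in> frames p q r" if "k \<in> K_group p q" for k
    by (rule lead_mat_frames[OF ld that has_leads_lead_mat[OF ld]])
  show ?thesis
  proof
    show "flag_slice p q r ld S \<subseteq> frame_map p q ` lower_zero p q r S \<inter> orb p q r ld"
    proof
      fix y assume "y \<in> flag_slice p q r ld S"
      then obtain k where k: "k \<in> K_group p q" "\<forall>(i, j)\<in>lower_positions p q - S. k $$ (i, j) = 0"
        "y = frame_map p q (k * lead_mat p q r ld, k)" unfolding flag_slice_def by auto
      then have "(k * lead_mat p q r ld, k) \<in> lower_zero p q r S" unfolding lower_zero_iff using fr by auto
      then show "y \<in> frame_map p q ` lower_zero p q r S \<inter> orb p q r ld" using k unfolding orb_def by auto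
    qed
    show "frame_map p q ` lower_zero p q r S \<inter> orb p q r ld \<subseteq> flag_slice p q r ld S"
    proof
      fix y assume "y \<in> frame_map p q ` lower_zero p q r S \<inter> orb p q r ld"
      then obtain x k where x: "x \<in> lower_zero p q r S" "y = frame_map p q x" and k: "k \<in> K_group p q"
        "y = frame_map p q (k * lead_mat p q r ld, k)" unfolding orb_def by auto
      have "(k * lead_mat p q r ld, k) \<in> lower_zero p q r S"
        using lower_zero_saturated[OF S x(1) fr[OF k(1)]] x(2) k(2) by simp
      then show "y \<in> flag_slice p q r ld S" unfolding flag_slice_def lower_zero_iff using k by auto
    qed
  qed
qed

lemma flag_slice_closed:
  assumes "lead_fun p q r ld" "right_closed p q S"
  shows "closedin (subtopology (zariski p q r) (orb p q r ld)) (flag_slice p q r ld S)"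
  unfolding flag_slice_alt[OF assms] closedin_subtopology
  by (rule exI[of _ "frame_map p q ` lower_zero p q r S"])
     (simp add: closedin_saturated_image[OF closedin_lower_zero lower_zero_saturated[OF assms(2)]])

text \<open>In terms of frames the conditions are \<open>A = k * M\<close> and vanishing entries of
  \<open>k\<close>. All of them are linear in the pair, so the affine criterion applies, and
  irreducibility passes to the image.\<close>

lemma flag_slice_irreducible:
  assumes ld: "lead_fun p q r ld"
  shows "irreducible_in (zariski p q r) (flag_slice p q r ld S)"
proof -
  let ?M = "lead_mat p q r ld" and ?n = "p + q"
  define \<Phi> where "\<Phi> = (\<lambda>(i, m) x. fst x $$ (i, m) - (\<Sum>c<?n. ?M $$ (c, m) * snd x $$ (i, c))) ` ({..<?n} \<times> {..<r}) \<union>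
     (\<lambda>(i, j) x. snd x $$ (i, j)) ` (lower_positions p q - S)"
  have aff: "affine_fun p q r f" if "f \<in> \<Phi>" for f
    using that unfolding \<Phi>_def lower_positions_def block_positions_def
    by (auto intro!: affine_fun_diff affine_fun_fst affine_fun_sum affine_fun_scale affine_fun_snd)
  have iff: "(\<forall>f\<in>\<Phi>. f (A, k) = 0) \<longleftrightarrow> A = k * ?M \<and> (\<forall>(i, j)\<in>lower_positions p q - S. k $$ (i, j) = 0)"
    if fr: "(A, k) \<in> frames p q r" for A k
  proof -
    have A: "A \<in> carrier_mat ?n r" and k: "k \<in> carrier_mat ?n ?n" using fr K_group_carrier by (auto simp: frames_iff)
    have "(\<forall>i<?n. \<forall>m<r. A $$ (i, m) = (k * ?M) $$ (i, m)) \<longleftrightarrow> A = k * ?M"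
    proof
      assume "\<forall>i<?n. \<forall>m<r. A $$ (i, m) = (k * ?M) $$ (i, m)"
      then show "A = k * ?M" using A k lead_mat_carrier[of p q r ld] by (intro eq_matI) auto
    qed auto
    moreover have "(k * ?M) $$ (i, m) = (\<Sum>c<?n. ?M $$ (c, m) * k $$ (i, c))" if "i < ?n" "m < r" for i m
      unfolding mult_mat_index_sum[OF k lead_mat_carrier that] by (simp add: mult.commute)
    ultimately show ?thesis unfolding \<Phi>_def by (auto simp: ball_Un)
  qed
  have one: "(?M, 1\<^sub>m ?n) \<in> frames p q r"
    using lead_mat_frames[OF ld K_group_one has_leads_lead_mat[OF ld]] left_mult_one_mat[OF lead_mat_carrier] by metis
  have "irreducible_in (zariski_frames p q r) {x \<in> frames p q r. \<forall>f\<in>\<Phi>. f x = 0}"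
  proof (rule irreducible_affine_zeros[OF aff one])
    show "\<forall>f\<in>\<Phi>. f (?M, 1\<^sub>m ?n) = 0"
      unfolding iff[OF one] using left_mult_one_mat[OF lead_mat_carrier[of p q r ld]]
      by (auto simp: lower_positions_def block_positions_def)
  qed
  then have "irreducible_in (zariski p q r) (frame_map p q ` {x \<in> frames p q r. \<forall>f\<in>\<Phi>. f x = 0})"
    by (rule irreducible_in_image[OF _ continuous_frame_map])
  also have "frame_map p q ` {x \<in> frames p q r. \<forall>f\<in>\<Phi>. f x = 0} = flag_slice p q r ld S"
  proof
    show "frame_map p q ` {x \<in> frames p q r. \<forall>f\<in>\<Phi>. f x = 0} \<subseteq> flag_slice p q r ld S"
    proof
      fix y assume "y \<in> frame_map p q ` {x \<in> frames p q r. \<forall>f\<in>\<Phi>. f x = 0}"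
      then obtain A k where "(A, k) \<in> frames p q r" "\<forall>f\<in>\<Phi>. f (A, k) = 0" "y = frame_map p q (A, k)" by auto
      then show "y \<in> flag_slice p q r ld S" using iff unfolding flag_slice_def by (auto simp: frames_iff)
    qed
    show "flag_slice p q r ld S \<subseteq> frame_map p q ` {x \<in> frames p q r. \<forall>f\<in>\<Phi>. f x = 0}"
    proof
      fix y assume "y \<in> flag_slice p q r ld S"
      then obtain k where k: "k \<in> K_group p q" "\<forall>(i, j)\<in>lower_positions p q - S. k $$ (i, j) = 0"
        "y = frame_map p q (k * ?M, k)" unfolding flag_slice_def by auto
      have "(k * ?M, k) \<in> frames p q r" by (rule lead_mat_frames[OF ld k(1) has_leads_lead_mat[OF ld]])
      then show "y \<in> frame_map p q ` {x \<in> frames p q r. \<forall>f\<in>\<Phi>. f x = 0}" using iff k by blast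
    qed
  qed
  finally show ?thesis .
qed

lemma orb_irreducible: "lead_fun p q r ld \<Longrightarrow> irreducible_in (zariski p q r) (orb p q r ld)"
  using flag_slice_irreducible[of p q r ld "lower_positions p q"] by (simp add: flag_slice_def orb_def)

lemma flag_slice_chain:
  assumes ld: "lead_fun p q r ld"
  shows "\<exists>Z. (\<forall>i\<le>card (lower_positions p q). closedin (subtopology (zariski p q r) (orb p q r ld)) (Z i) \<and>
        irreducible_in (zariski p q r) (Z i)) \<and>
      (\<forall>i<card (lower_positions p q). Z i \<subset> Z (Suc i)) \<and>
      Z (card (lower_positions p q)) = flag_slice p q r ld (lower_positions p q) \<and> Z 0 = flag_slice p q r ld {}"
proof (rule chain_of_good_subsets[OF finite_lower_positions, where good = "right_closed p q" and F = "flag_slice p q r ld"])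
  show "right_closed p q (lower_positions p q)" unfolding right_closed_def by auto
  show "closedin (subtopology (zariski p q r) (orb p q r ld)) (flag_slice p q r ld S) \<and>
      irreducible_in (zariski p q r) (flag_slice p q r ld S)" if "right_closed p q S" for S
    using flag_slice_closed[OF ld that] flag_slice_irreducible[OF ld] by simp
  fix S assume S: "S \<subseteq> lower_positions p q" "right_closed p q S" "S \<noteq> {}"
  \<comment> \<open>A position in the leftmost column of \<open>S\<close> can be removed, because no
    other position of \<open>S\<close> in its row requires it.\<close>
  obtain z where "z \<in> S" "\<And>y. y \<in> S \<Longrightarrow> snd z \<le> snd y" using ex_has_least_nat[of "\<lambda>z. z \<in> S" _ snd] S(3) by blast
  then obtain i j where ij: "(i, j) \<in> S" "\<And>i' j'. (i', j') \<in> S \<Longrightarrow> j \<le> j'" by (metis prod.collapse snd_conv)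
  have rc: "right_closed p q (S - {(i, j)})"
    unfolding right_closed_def
  proof (intro allI impI)
    fix a b b' assume h: "(a, b) \<in> S - {(i, j)}" "b < b'" "(a, b') \<in> lower_positions p q"
    then have "(a, b') \<in> S" using S(2) unfolding right_closed_def by blast
    moreover have "j < b'" using ij(2)[of a b] h by auto
    ultimately show "(a, b') \<in> S - {(i, j)}" by auto
  qed
  have n: "i < p + q" "j < p + q" "j < i" "(i < p) = (j < p)"
    using ij(1) S(1) unfolding lower_positions_def block_positions_def by auto
  \<comment> \<open>The elementary matrix at the removed position yields a point of the larger slice
    only.\<close>
  obtain k :: "complex mat" where k: "k \<in> carrier_mat (p + q) (p + q)" "det k \<noteq> 0" "k $$ (i, j) \<noteq> of_bool (i = j)"
    "\<And>a b. a < p + q \<Longrightarrow> b < p + q \<Longrightarrow> (a, b) \<noteq> (i, j) \<Longrightarrow> k $$ (a, b) = of_bool (a = b)"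
    using elementary_mat[OF n(1,2)] by blast
  have kK: "k \<in> K_group p q" unfolding K_group_iff
  proof (intro conjI allI impI k(1,2))
    fix a b assume ab: "a < p + q" "b < p + q" "(a < p) \<noteq> (b < p)"
    then have "(a, b) \<noteq> (i, j)" "a \<noteq> b" using n by auto
    then show "k $$ (a, b) = 0" using k(4) ab by simp
  qed
  let ?y = "frame_map p q (k * lead_mat p q r ld, k)"
  have "k $$ (a, b) = 0" if "(a, b) \<in> lower_positions p q - S" for a b
  proof -
    have "(a, b) \<noteq> (i, j)" "a < p + q" "b < p + q" "b < a" using that ij(1) unfolding lower_positions_def block_positions_def by auto
    then show ?thesis using k(4) by simp
  qed
  then have y: "?y \<in> flag_slice p q r ld S" unfolding flag_slice_def using kK by blast
  have "?y \<notin> flag_slice p q r ld (S - {(i, j)})"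
  proof
    assume "?y \<in> flag_slice p q r ld (S - {(i, j)})"
    then obtain x where x: "x \<in> lower_zero p q r (S - {(i, j)})" "?y = frame_map p q x"
      unfolding flag_slice_alt[OF ld rc] by blast
    have "(k * lead_mat p q r ld, k) \<in> lower_zero p q r (S - {(i, j)})"
      by (rule lower_zero_saturated[OF rc x(1) lead_mat_frames[OF ld kK has_leads_lead_mat[OF ld]] x(2)])
    then have "k $$ (i, j) = 0" using ij(1) S(1) unfolding lower_zero_iff by auto
    then show False using k(3) n(3) by simp
  qed
  moreover have "flag_slice p q r ld (S - {(i, j)}) \<subseteq> flag_slice p q r ld S" unfolding flag_slice_def by blast
  ultimately have "flag_slice p q r ld (S - {(i, j)}) \<subset> flag_slice p q r ld S" using y by blast
  then show "\<exists>x\<in>S. right_closed p q (S - {x}) \<and> flag_slice p q r ld (S - {x}) \<subset> flag_slice p q r ld S"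
    using ij(1) rc by blast
qed

section \<open>Closed slices in the Grassmannian directions\<close>

definition movable :: "(nat \<times> nat) set \<Rightarrow> (nat \<times> nat) set" where
  "movable C = {x \<in> C. 1 \<le> fst x \<and> 1 \<le> snd x}"

(* The linear forms x_{i^+} - x_{j^-} for edges and the coordinates of free vertices cut out the
   column space of lead_mat. *)
definition form_coeff :: "nat \<Rightarrow> nat \<Rightarrow> nat \<times> nat \<Rightarrow> nat \<Rightarrow> complex" where
  "form_coeff p q \<mu> c = of_bool (fst \<mu> \<le> p \<and> Suc c = fst \<mu>) - of_bool (snd \<mu> \<le> q \<and> Suc c = p + snd \<mu>)"

definition form_col :: "nat \<Rightarrow> nat \<Rightarrow> nat \<times> nat \<Rightarrow> complex mat \<Rightarrow> nat \<Rightarrow> complex" where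
  "form_col p q \<mu> A m = (\<Sum>c<p + q. form_coeff p q \<mu> c * A $$ (c, m))"

lemma form_col_eval:
  assumes "1 \<le> fst \<mu>" "1 \<le> snd \<mu>"
  shows "form_col p q \<mu> A m = (if fst \<mu> \<le> p then A $$ (fst \<mu> - 1, m) else 0) -
     (if snd \<mu> \<le> q then A $$ (p + snd \<mu> - 1, m) else 0)"
proof -
  have "form_col p q \<mu> A m =
     (\<Sum>c<p + q. of_bool (c = fst \<mu> - 1) * (of_bool (fst \<mu> \<le> p) * A $$ (c, m))) -
     (\<Sum>c<p + q. of_bool (c = p + snd \<mu> - 1) * (of_bool (snd \<mu> \<le> q) * A $$ (c, m)))"
    unfolding form_col_def form_coeff_def sum_subtractf[symmetric]
    using assms by (intro sum.cong refl) (auto simp: of_bool_def)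
  moreover have "(\<Sum>c<p + q. of_bool (c = fst \<mu> - 1) * (of_bool (fst \<mu> \<le> p) * A $$ (c, m))) =
      (if fst \<mu> \<le> p then A $$ (fst \<mu> - 1, m) else 0)"
    using assms by (cases "fst \<mu> \<le> p") (simp_all add: sum_of_bool_row)
  moreover have "(\<Sum>c<p + q. of_bool (c = p + snd \<mu> - 1) * (of_bool (snd \<mu> \<le> q) * A $$ (c, m))) =
      (if snd \<mu> \<le> q then A $$ (p + snd \<mu> - 1, m) else 0)"
    using assms by (cases "snd \<mu> \<le> q") (simp_all add: sum_of_bool_row)
  ultimately show ?thesis by simp
qed

text \<open>The coordinates occurring in the form of \<open>\<mu>\<close> lie beyond the box of
  column \<open>m\<close>.\<close>

lemma form_col_ll:
  assumes A: "has_leads p q r ld A" and ld: "lead_fun p q r ld" and m: "m < r" and ll: "ll (ld m) \<mu>"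
  shows "form_col p q \<mu> A m = 0"
proof -
  have rng: "fst (ld m) \<le> p" using lead_fun_range[OF ld m] by auto
  have l: "fst (ld m) < fst \<mu>" "snd (ld m) < snd \<mu>" using ll unfolding ll_def by auto
  have z: "A $$ (i, m) = 0" if "i < p + q" "i \<notin> box p (ld m)" for i using A m that unfolding has_leads_def by auto
  have "A $$ (fst \<mu> - 1, m) = 0" if "fst \<mu> \<le> p" by (rule z) (use that l in \<open>auto simp: box_def\<close>)
  moreover have "A $$ (p + snd \<mu> - 1, m) = 0" if "snd \<mu> \<le> q" by (rule z) (use that l rng in \<open>auto simp: box_def\<close>)
  moreover have "1 \<le> fst \<mu>" "1 \<le> snd \<mu>" using l by auto
  ultimately show ?thesis by (simp add: form_col_eval)
qed

lemma ld_in_points: "m < r \<Longrightarrow> ld m \<in> points p q r ld"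
  unfolding points_def by auto

lemma points_fst_eq:
  assumes ld: "lead_fun p q r ld" and x: "x \<in> points p q r ld" "y \<in> points p q r ld" "fst x = fst y" "1 \<le> fst x" "fst x \<le> p"
  shows "x = y"
proof -
  obtain i j k l where xy: "x = (i, j)" "y = (k, l)" by (metis surj_pair)
  show ?thesis using config_row_unique[OF points_config[OF ld], of i j l] x unfolding xy by simp
qed

lemma points_snd_eq:
  assumes ld: "lead_fun p q r ld" and x: "x \<in> points p q r ld" "y \<in> points p q r ld" "snd x = snd y" "1 \<le> snd x" "snd x \<le> q"
  shows "x = y"
proof -
  obtain i j k l where xy: "x = (i, j)" "y = (k, l)" by (metis surj_pair)
  show ?thesis using config_col_unique[OF points_config[OF ld], of i j k] x unfolding xy by simp
qed

text \<open>In the column of an edge the two terms of its own form cancel. By uniqueness of points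
  in rows and columns, no other column meets the coordinates of that form.\<close>

lemma form_col_lead_mat:
  assumes ld: "lead_fun p q r ld" and m: "m < r" and \<mu>: "\<mu> \<in> movable (points p q r ld)"
  shows "form_col p q \<mu> (lead_mat p q r ld) m = 0"
proof -
  have pos: "1 \<le> fst \<mu>" "1 \<le> snd \<mu>" and mem: "\<mu> \<in> points p q r ld" using \<mu> unfolding movable_def by auto
  have rng: "fst (ld m) \<le> p" "snd (ld m) \<le> q" using lead_fun_range[OF ld m] by auto
  have 1: "lead_mat p q r ld $$ (fst \<mu> - 1, m) = of_bool (ld m = \<mu>)" if h: "fst \<mu> \<le> p"
  proof -
    have "fst \<mu> - 1 \<in> lead_rows p (ld m) \<longleftrightarrow> fst (ld m) = fst \<mu>" using pos h unfolding lead_rows_iff by auto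
    also have "\<dots> \<longleftrightarrow> ld m = \<mu>" using points_fst_eq[OF ld ld_in_points[OF m] mem] pos h by auto
    finally show ?thesis using m pos h unfolding lead_mat_def by simp
  qed
  have 2: "lead_mat p q r ld $$ (p + snd \<mu> - 1, m) = of_bool (ld m = \<mu>)" if h: "snd \<mu> \<le> q"
  proof -
    have "p + snd \<mu> - 1 \<in> lead_rows p (ld m) \<longleftrightarrow> snd (ld m) = snd \<mu>" using pos h rng unfolding lead_rows_iff by auto
    also have "\<dots> \<longleftrightarrow> ld m = \<mu>" using points_snd_eq[OF ld ld_in_points[OF m] mem] pos h by auto
    finally show ?thesis using m pos h unfolding lead_mat_def by simp
  qed
  show ?thesis unfolding form_col_eval[OF pos] using 1 2 rng by auto
qed

text \<open>Pairs of a column and an equation that the leads do not satisfy automatically. They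
  correspond to coordinates on \<open>Hom(W, V/W)\<close>, and the chain below switches them off one
  by one.\<close>

definition slice_index :: "nat \<Rightarrow> nat \<Rightarrow> nat \<Rightarrow> (nat \<Rightarrow> nat \<times> nat) \<Rightarrow> (nat \<times> nat \<times> nat) set" where
  "slice_index p q r ld = {(m, \<mu>). m < r \<and> \<mu> \<in> movable (points p q r ld) \<and> \<not> ll (ld m) \<mu>}"

text \<open>The flags stay standard, and only the subspace moves.\<close>

definition gr_slice :: "nat \<Rightarrow> nat \<Rightarrow> nat \<Rightarrow> (nat \<Rightarrow> nat \<times> nat) \<Rightarrow> (nat \<times> nat \<times> nat) set \<Rightarrow> dflag set" where
  "gr_slice p q r ld S = {frame_map p q (A, 1\<^sub>m (p + q)) |A. has_leads p q r ld A \<and>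
     (\<forall>m<r. \<forall>\<mu>\<in>movable (points p q r ld). (m, \<mu>) \<notin> S \<longrightarrow> form_col p q \<mu> A m = 0)}"

definition below :: "(nat \<Rightarrow> nat \<times> nat) \<Rightarrow> nat \<Rightarrow> nat \<Rightarrow> bool" where
  "below ld m l \<longleftrightarrow> fst (ld m) \<le> fst (ld l) \<and> snd (ld m) \<le> snd (ld l)"

text \<open>Adding column \<open>m\<close> to a column \<open>l\<close> with larger lead respects
  the boxes and carries values of forms from \<open>m\<close> to \<open>l\<close>. A condition on
  \<open>l\<close> is thus independent of the frame only if it is imposed on every column below
  \<open>l\<close> as well.\<close>

definition up_closed :: "nat \<Rightarrow> (nat \<Rightarrow> nat \<times> nat) \<Rightarrow> (nat \<times> nat \<times> nat) set \<Rightarrow> bool" where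
  "up_closed r ld S \<longleftrightarrow> (\<forall>m \<mu> l. (m, \<mu>) \<in> S \<longrightarrow> l < r \<longrightarrow> below ld m l \<longrightarrow> \<not> ll (ld l) \<mu> \<longrightarrow> (l, \<mu>) \<in> S)"

text \<open>The size of the minors that have to vanish: one more than the number of columns that may
  be nonzero modulo the subspace attached to \<open>l\<close>.\<close>

definition slice_size :: "nat \<Rightarrow> (nat \<Rightarrow> nat \<times> nat) \<Rightarrow> nat \<Rightarrow> nat" where
  "slice_size r ld l = Suc (card {m. m < r \<and> \<not> below ld m l})"

text \<open>The rows of \<open>P\<close> annihilate the subspace of vectors that are supported in
  the box of \<open>l\<close> and satisfy the equations prescribed for column \<open>l\<close>.
  Testing all such \<open>P\<close> replaces a choice of coordinates on the quotient.\<close>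

definition kills :: "nat \<Rightarrow> nat \<Rightarrow> nat \<Rightarrow> (nat \<Rightarrow> nat \<times> nat) \<Rightarrow> (nat \<times> nat \<times> nat) set \<Rightarrow> nat \<Rightarrow> complex mat \<Rightarrow> bool" where
  "kills p q r ld S l P \<longleftrightarrow> (\<forall>v. (\<forall>c<p + q. c \<notin> box p (ld l) \<longrightarrow> v c = 0) \<longrightarrow>
     (\<forall>\<mu>\<in>movable (points p q r ld). (l, \<mu>) \<notin> S \<longrightarrow> (\<Sum>c<p + q. form_coeff p q \<mu> c * v c) = 0) \<longrightarrow>
     (\<forall>a<dim_row P. (\<Sum>c<p + q. P $$ (a, c) * v c) = 0))"

definition slice_minors :: "nat \<Rightarrow> nat \<Rightarrow> nat \<Rightarrow> (nat \<Rightarrow> nat \<times> nat) \<Rightarrow> (nat \<times> nat \<times> nat) set \<Rightarrow> (complex mat \<times> complex mat \<Rightarrow> complex) set" where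
  "slice_minors p q r ld S = {\<lambda>x. det (P * fst x * Q) |P Q l. l < r \<and> P \<in> carrier_mat (slice_size r ld l) (p + q) \<and>
     Q \<in> carrier_mat r (slice_size r ld l) \<and> kills p q r ld S l P}"

(* Rank conditions: modulo the subspace of the l-th box on which the forms outside S vanish, the
   rank of A is at most the number of columns whose box is not contained in the l-th one. *)
definition slice_zero :: "nat \<Rightarrow> nat \<Rightarrow> nat \<Rightarrow> (nat \<Rightarrow> nat \<times> nat) \<Rightarrow> (nat \<times> nat \<times> nat) set \<Rightarrow> (complex mat \<times> complex mat) set" where
  "slice_zero p q r ld S = lower_zero p q r {} \<inter> {x \<in> frames p q r. \<forall>f\<in>slice_minors p q r ld S. f x = 0}"

lemma closedin_slice_zero: "closedin (zariski_frames p q r) (slice_zero p q r ld S)"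
  unfolding slice_zero_def
proof (intro closedin_Int closedin_lower_zero closedin_zero_set)
  fix f assume "f \<in> slice_minors p q r ld S"
  then obtain P Q s where "P \<in> carrier_mat s (p + q)" "Q \<in> carrier_mat r s" "f = (\<lambda>x. det (P * fst x * Q))"
    unfolding slice_minors_def by blast
  then show "regular p q r f"
    using regular_det[OF regular_mat_mult[OF regular_mat_mult[OF regular_mat_const regular_mat_fst] regular_mat_const]] by blast
qed

lemma right_closed_empty: "right_closed p q {}"
  unfolding right_closed_def by simp

text \<open>A change of frame multiplies \<open>A\<close> by some \<open>g\<close> on the right,
  which only replaces \<open>Q\<close> by \<open>g * Q\<close> in the minors.\<close>

lemma slice_zero_saturated:
  assumes x: "x \<in> slice_zero p q r ld S" and x': "x' \<in> frames p q r" and e: "frame_map p q x' = frame_map p q x"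
  shows "x' \<in> slice_zero p q r ld S"
proof -
  obtain A k A' k' where xe: "x = (A, k)" "x' = (A', k')" by (metis surj_pair)
  have l: "x \<in> lower_zero p q r {}" and fr: "(A, k) \<in> frames p q r" and z: "\<And>f. f \<in> slice_minors p q r ld S \<Longrightarrow> f (A, k) = 0"
    using x unfolding slice_zero_def xe by auto
  obtain g b where g: "g \<in> carrier_mat r r" "A' = A * g"
    using frame_map_eqD[OF fr x'[unfolded xe] e[unfolded xe, symmetric]] by metis
  have A: "A \<in> carrier_mat (p + q) r" using fr by (simp add: frames_iff)
  have "f (A', k') = 0" if "f \<in> slice_minors p q r ld S" for f
  proof -
    obtain P Q l where PQ: "l < r" "P \<in> carrier_mat (slice_size r ld l) (p + q)" "Q \<in> carrier_mat r (slice_size r ld l)"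
      "kills p q r ld S l P" and f: "f = (\<lambda>x. det (P * fst x * Q))" using \<open>f \<in> slice_minors p q r ld S\<close> unfolding slice_minors_def by blast
    have PA: "P * A \<in> carrier_mat (slice_size r ld l) r" using PQ(2) A by auto
    have "P * A' * Q = P * A * (g * Q)"
      unfolding g(2) using assoc_mult_mat[OF PQ(2) A g(1)] assoc_mult_mat[OF PA g(1) PQ(3)] by simp
    moreover have "(\<lambda>x. det (P * fst x * (g * Q))) \<in> slice_minors p q r ld S"
      unfolding slice_minors_def using PQ g(1) by (intro CollectI exI[of _ P] exI[of _ "g * Q"] exI[of _ l]) auto
    ultimately show ?thesis unfolding f using z by fastforce
  qed
  then show ?thesis
    unfolding slice_zero_def using lower_zero_saturated[OF right_closed_empty l x' e] x' by (auto simp: xe)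
qed

text \<open>If a prescribed form were nonzero on column \<open>l\<close>, then this form and the
  pivots of the columns not below \<open>l\<close> would be enough functionals for a nonzero minor
  of the forbidden size.\<close>

lemma slice_zero_imp:
  assumes ld: "lead_fun p q r ld" and A: "has_leads p q r ld A" and D: "(A, k) \<in> slice_zero p q r ld S"
    and l: "l < r" and \<mu>: "\<mu> \<in> movable (points p q r ld)" "(l, \<mu>) \<notin> S"
  shows "form_col p q \<mu> A l = 0"
proof (rule ccontr)
  assume nz: "form_col p q \<mu> A l \<noteq> 0"
  let ?n = "p + q"
  have Ac: "A \<in> carrier_mat ?n r" using A unfolding has_leads_def by simp
  define J where "J = {m. m < r \<and> \<not> below ld m l}"
  have lJ: "l \<notin> J" unfolding J_def below_def by simp
  have fJ: "finite J" unfolding J_def by simp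
  have cT: "card (insert l J) = slice_size r ld l" using lJ fJ unfolding slice_size_def J_def by simp
  have rl: "fst (ld l) \<le> p" using lead_fun_range[OF ld l] by auto
  have pr: "pivot_row p (fst (ld l)) (ld m) < ?n" "pivot_row p (fst (ld l)) (ld m) \<notin> box p (ld l)" if "m \<in> J" for m
  proof -
    have m: "m < r" "\<not> (fst (ld m) \<le> fst (ld l) \<and> snd (ld m) \<le> snd (ld l))" using that unfolding J_def below_def by auto
    have rg: "fst (ld m) \<le> p" "snd (ld m) \<le> q" using lead_fun_range[OF ld m(1)] by auto
    show "pivot_row p (fst (ld l)) (ld m) < ?n" using pivot_row_lead(1)[OF m(2) rg(1)] lead_rows_less[OF rg] by auto
    show "pivot_row p (fst (ld l)) (ld m) \<notin> box p (ld l)" using pivot_row_lead(2)[OF m(2) rg(1) rl] by simp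
  qed
  define \<rho> where "\<rho> m c = (if m = l then form_coeff p q \<mu> c else of_bool (c = pivot_row p (fst (ld l)) (ld m)))" for m c
  obtain P Q where PQ: "P \<in> carrier_mat (slice_size r ld l) ?n" "Q \<in> carrier_mat r (slice_size r ld l)" "det (P * A * Q) \<noteq> 0"
    "\<And>a. a < slice_size r ld l \<Longrightarrow> \<exists>m\<in>insert l J. \<forall>c<?n. P $$ (a, c) = \<rho> m c"
  proof (rule exists_minor[OF Ac _ cT, of \<rho>])
    show "insert l J \<subseteq> {..<r}" using l unfolding J_def by auto
    fix w m assume w0: "\<And>m. m \<notin> insert l J \<Longrightarrow> w m = 0" and m: "m \<in> insert l J"
      and eq: "\<And>m. m \<in> insert l J \<Longrightarrow> (\<Sum>m'<r. (\<Sum>c<?n. \<rho> m c * A $$ (c, m')) * w m') = 0"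
    have wJ: "w m = 0" if "m \<in> J" for m
    proof (rule pivots_vanish[OF ld A, of w "fst (ld l)" "snd (ld l)"])
      show "m < r" "\<not> (fst (ld m) \<le> fst (ld l) \<and> snd (ld m) \<le> snd (ld l))" using that unfolding J_def below_def by auto
      fix m assume "m < r" "\<not> (fst (ld m) \<le> fst (ld l) \<and> snd (ld m) \<le> snd (ld l))"
      then have mJ: "m \<in> J" unfolding J_def below_def by auto
      then have "m \<noteq> l" using lJ by auto
      then show "(\<Sum>m'<r. A $$ (pivot_row p (fst (ld l)) (ld m), m') * w m') = 0"
        using eq[of m] mJ pr(1)[OF mJ] unfolding \<rho>_def by (simp add: sum_of_bool_row)
    qed
    have "0 = (\<Sum>m'<r. form_col p q \<mu> A m' * w m')" using eq[of l] unfolding \<rho>_def form_col_def by simp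
    also have "\<dots> = (\<Sum>m'\<in>{l}. form_col p q \<mu> A m' * w m')"
      using l w0 wJ by (intro sum.mono_neutral_right) auto
    finally have "w l = 0" using nz by simp
    then show "w m = 0" using m wJ by auto
  next
    fix P Q assume "P \<in> carrier_mat (slice_size r ld l) ?n" "Q \<in> carrier_mat r (slice_size r ld l)" "det (P * A * Q) \<noteq> 0"
      "\<And>a. a < slice_size r ld l \<Longrightarrow> \<exists>m\<in>insert l J. \<forall>c<?n. P $$ (a, c) = \<rho> m c"
    then show thesis by (rule that)
  qed
  have "kills p q r ld S l P" unfolding kills_def
  proof (intro allI impI)
    fix v a assume v: "\<forall>c<?n. c \<notin> box p (ld l) \<longrightarrow> v c = 0"
      "\<forall>\<mu>\<in>movable (points p q r ld). (l, \<mu>) \<notin> S \<longrightarrow> (\<Sum>c<?n. form_coeff p q \<mu> c * v c) = 0" and a: "a < dim_row P"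
    obtain m where m: "m \<in> insert l J" "\<forall>c<?n. P $$ (a, c) = \<rho> m c" using PQ(4)[of a] a PQ(1) by auto
    have "(\<Sum>c<?n. P $$ (a, c) * v c) = (\<Sum>c<?n. \<rho> m c * v c)" using m(2) by (intro sum.cong) auto
    also have "\<dots> = 0"
    proof (cases "m = l")
      case True
      then show ?thesis using v(2) \<mu> unfolding \<rho>_def by simp
    next
      case False
      then have "m \<in> J" using m by simp
      then show ?thesis using pr[of m] v(1) False unfolding \<rho>_def by (simp add: sum_of_bool_row)
    qed
    finally show "(\<Sum>c<?n. P $$ (a, c) * v c) = 0" .
  qed
  then have "(\<lambda>x. det (P * fst x * Q)) \<in> slice_minors p q r ld S"
    unfolding slice_minors_def using PQ(1,2) l by blast
  then have "det (P * A * Q) = 0" using D unfolding slice_zero_def by fastforce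
  then show False using PQ(3) by simp
qed

text \<open>All columns below \<open>l\<close> lie in the subspace attached to \<open>l\<close>, so
  \<open>P\<close> maps them to zero, and the other columns are too few for a nonzero minor.\<close>

lemma slice_zero_mem:
  assumes ld: "lead_fun p q r ld" and A: "has_leads p q r ld A" and S: "S \<subseteq> slice_index p q r ld" "up_closed r ld S"
    and z: "\<And>m \<mu>. m < r \<Longrightarrow> \<mu> \<in> movable (points p q r ld) \<Longrightarrow> (m, \<mu>) \<notin> S \<Longrightarrow> form_col p q \<mu> A m = 0"
  shows "(A, 1\<^sub>m (p + q)) \<in> slice_zero p q r ld S"
proof -
  let ?n = "p + q"
  have Ac: "A \<in> carrier_mat ?n r" using A unfolding has_leads_def by simp
  have fr: "(A, 1\<^sub>m ?n) \<in> frames p q r" using lead_mat_frames[OF ld K_group_one A] left_mult_one_mat[OF Ac] by simp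
  have low: "(A, 1\<^sub>m ?n) \<in> lower_zero p q r {}"
    unfolding lower_zero_iff using fr by (auto simp: lower_positions_def block_positions_def)
  have "f (A, 1\<^sub>m ?n) = 0" if "f \<in> slice_minors p q r ld S" for f
  proof -
    obtain P Q l where PQ: "l < r" "P \<in> carrier_mat (slice_size r ld l) ?n" "Q \<in> carrier_mat r (slice_size r ld l)"
      "kills p q r ld S l P" and f: "f = (\<lambda>x. det (P * fst x * Q))" using \<open>f \<in> slice_minors p q r ld S\<close> unfolding slice_minors_def by blast
    have PA: "P * A \<in> carrier_mat (slice_size r ld l) r" using PQ(2) Ac by auto
    have "det (P * A * Q) = 0"
    proof (rule det_mult_few_cols[OF PA PQ(3), where J = "{m. m < r \<and> \<not> below ld m l}"])
      show "card {m. m < r \<and> \<not> below ld m l} < slice_size r ld l" unfolding slice_size_def by simp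
      fix a m assume am: "a < slice_size r ld l" "m < r" "m \<notin> {m. m < r \<and> \<not> below ld m l}"
      then have b: "below ld m l" by simp
      then have bx: "box p (ld m) \<subseteq> box p (ld l)" unfolding below_def by (intro box_mono) auto
      have 1: "\<forall>c<?n. c \<notin> box p (ld l) \<longrightarrow> A $$ (c, m) = 0" using A am(2) bx unfolding has_leads_def by auto
      \<comment> \<open>A condition imposed on \<open>l\<close> is also imposed on \<open>m\<close>:
        a pair \<open>(m, \<mu>)\<close> in \<open>S\<close> would by up-closedness force
        \<open>ll (ld l) \<mu>\<close>, hence \<open>ll (ld m) \<mu>\<close>, which
        \<open>slice_index\<close> excludes.\<close>
      have 2: "(\<Sum>c<?n. form_coeff p q \<mu> c * A $$ (c, m)) = 0" if mu: "\<mu> \<in> movable (points p q r ld)" "(l, \<mu>) \<notin> S" for \<mu>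
      proof -
        have "(m, \<mu>) \<notin> S"
        proof
          assume mS: "(m, \<mu>) \<in> S"
          then have "ll (ld l) \<mu>" using S(2) PQ(1) b mu(2) unfolding up_closed_def by blast
          then have "ll (ld m) \<mu>" using b unfolding ll_def below_def by auto
          then show False using mS S(1) unfolding slice_index_def by auto
        qed
        then show ?thesis using z[OF am(2) mu(1)] unfolding form_col_def by simp
      qed
      have "(\<Sum>c<?n. P $$ (a, c) * A $$ (c, m)) = 0"
        using PQ(4)[unfolded kills_def, rule_format, of "\<lambda>c. A $$ (c, m)" a] 1 2 am(1) PQ(2) by auto
      then show "(P * A) $$ (a, m) = 0" using mult_mat_index_sum[OF PQ(2) Ac am(1,2)] by simp
    qed auto
    then show ?thesis unfolding f by simp
  qed
  then show ?thesis unfolding slice_zero_def using low fr by blast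
qed

lemma frame_map_one_borel:
  assumes "(A, 1\<^sub>m (p + q)) \<in> frames p q r" "b \<in> borel_group p q"
  shows "frame_map p q (A, b) = frame_map p q (A, 1\<^sub>m (p + q))"
proof -
  have "A \<in> carrier_mat (p + q) r" using assms(1) by (simp add: frames_iff)
  then show ?thesis
    using frame_map_borel(1)[OF assms(1) one_carrier_mat _ assms(2)] K_group_carrier[OF borel_K[OF assms(2)]] by simp
qed

lemma lower_zero_borel:
  assumes "(A, k) \<in> lower_zero p q r {}"
  shows "k \<in> borel_group p q"
proof -
  have fr: "(A, k) \<in> frames p q r" and z: "\<And>i j. (i, j) \<in> lower_positions p q \<Longrightarrow> k $$ (i, j) = 0"
    using assms unfolding lower_zero_iff by auto
  have k: "k \<in> K_group p q" using fr by (simp add: frames_iff)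
  have "k $$ (i, j) = 0" if "i < p + q" "j < i" for i j
    using z[of i j] K_group_block[OF k that(1), of j] that
    by (cases "(i < p) = (j < p)") (auto simp: lower_positions_def block_positions_def)
  then show ?thesis unfolding borel_group_def using k by auto
qed

lemma has_leads_one_frames:
  assumes "lead_fun p q r ld" "has_leads p q r ld A"
  shows "(A, 1\<^sub>m (p + q)) \<in> frames p q r" "frame_map p q (A, 1\<^sub>m (p + q)) \<in> orb p q r ld"
proof -
  have "A \<in> carrier_mat (p + q) r" using assms(2) unfolding has_leads_def by simp
  then show "(A, 1\<^sub>m (p + q)) \<in> frames p q r" "frame_map p q (A, 1\<^sub>m (p + q)) \<in> orb p q r ld"
    using lead_mat_frames[OF assms(1) K_group_one assms(2)] orb_has_leads[OF assms(1) K_group_one assms(2)] by simp_all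
qed

lemma gr_slice_alt:
  assumes ld: "lead_fun p q r ld" and S: "S \<subseteq> slice_index p q r ld" "up_closed r ld S"
  shows "gr_slice p q r ld S = frame_map p q ` slice_zero p q r ld S \<inter> orb p q r ld"
proof
  show "gr_slice p q r ld S \<subseteq> frame_map p q ` slice_zero p q r ld S \<inter> orb p q r ld"
  proof
    fix y assume "y \<in> gr_slice p q r ld S"
    then obtain A where A: "has_leads p q r ld A" "y = frame_map p q (A, 1\<^sub>m (p + q))"
      "\<And>m \<mu>. m < r \<Longrightarrow> \<mu> \<in> movable (points p q r ld) \<Longrightarrow> (m, \<mu>) \<notin> S \<Longrightarrow> form_col p q \<mu> A m = 0"
      unfolding gr_slice_def by auto
    then show "y \<in> frame_map p q ` slice_zero p q r ld S \<inter> orb p q r ld"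
      using slice_zero_mem[OF ld A(1) S A(3)] has_leads_one_frames(2)[OF ld A(1)] by auto
  qed
  show "frame_map p q ` slice_zero p q r ld S \<inter> orb p q r ld \<subseteq> gr_slice p q r ld S"
  proof
    fix y assume "y \<in> frame_map p q ` slice_zero p q r ld S \<inter> orb p q r ld"
    then obtain x k where x: "x \<in> slice_zero p q r ld S" "y = frame_map p q x" and k: "k \<in> K_group p q"
      "y = frame_map p q (k * lead_mat p q r ld, k)" unfolding orb_def by auto
    let ?A = "k * lead_mat p q r ld"
    have D: "(?A, k) \<in> slice_zero p q r ld S"
      by (rule slice_zero_saturated[OF x(1) lead_mat_frames[OF ld k(1) has_leads_lead_mat[OF ld]]]) (use x k in simp)
    then have b: "k \<in> borel_group p q" using lower_zero_borel unfolding slice_zero_def by blast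
    have A: "has_leads p q r ld ?A" by (rule borel_has_leads[OF ld b has_leads_lead_mat[OF ld]])
    have "y = frame_map p q (?A, 1\<^sub>m (p + q))"
      unfolding k(2) by (rule frame_map_one_borel[OF has_leads_one_frames(1)[OF ld A] b])
    then show "y \<in> gr_slice p q r ld S" unfolding gr_slice_def using A slice_zero_imp[OF ld A D] by blast
  qed
qed

lemma gr_slice_closed:
  assumes "lead_fun p q r ld" "S \<subseteq> slice_index p q r ld" "up_closed r ld S"
  shows "closedin (subtopology (zariski p q r) (orb p q r ld)) (gr_slice p q r ld S)"
  unfolding gr_slice_alt[OF assms] closedin_subtopology
  by (rule exI[of _ "frame_map p q ` slice_zero p q r ld S"])
     (simp add: closedin_saturated_image[OF closedin_slice_zero slice_zero_saturated])

text \<open>Vanishing beyond the leads, the prescribed forms and \<open>k = 1\<close> are affine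
  conditions. Nonzero leading entries are the open condition \<open>\<psi>\<close>, so these frames
  form an open part of an irreducible set.\<close>

lemma gr_slice_irreducible:
  assumes ld: "lead_fun p q r ld"
  shows "irreducible_in (zariski p q r) (gr_slice p q r ld S)"
proof -
  let ?M = "lead_mat p q r ld" and ?n = "p + q" and ?mv = "movable (points p q r ld)"
  have rng: "fst (ld m) \<le> p" "snd (ld m) \<le> q" if "m < r" for m using lead_fun_range[OF ld that] by auto
  define \<Phi> where "\<Phi> = (\<lambda>(i, j) x. snd x $$ (i, j) - of_bool (i = j)) ` ({..<?n} \<times> {..<?n}) \<union>
     (\<lambda>(i, m) x. fst x $$ (i, m)) ` {(i, m). i < ?n \<and> m < r \<and> i \<notin> box p (ld m)} \<union>
     (\<lambda>(m, \<mu>) x. form_col p q \<mu> (fst x) m) ` {(m, \<mu>). m < r \<and> \<mu> \<in> ?mv \<and> (m, \<mu>) \<notin> S}"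
  define \<psi> where "\<psi> x = (\<Prod>m<r. \<Prod>i\<in>lead_rows p (ld m). fst x $$ (i, m))" for x :: "complex mat \<times> complex mat"
  have aff: "affine_fun p q r f" if "f \<in> \<Phi>" for f
    using that unfolding \<Phi>_def form_col_def
    by (auto intro!: affine_fun_diff affine_fun_const affine_fun_fst affine_fun_sum affine_fun_scale affine_fun_snd)
  have reg: "regular p q r \<psi>" unfolding \<psi>_def
    using lead_rows_less[OF rng] by (intro regular_prod) (auto intro!: regular_fst)
  have "1\<^sub>m ?n \<in> carrier_mat ?n ?n" by simp
  have iff: "(\<forall>f\<in>\<Phi>. f (A, k) = 0) \<and> \<psi> (A, k) \<noteq> 0 \<longleftrightarrow> k = 1\<^sub>m ?n \<and> has_leads p q r ld A \<and>
      (\<forall>m<r. \<forall>\<mu>\<in>?mv. (m, \<mu>) \<notin> S \<longrightarrow> form_col p q \<mu> A m = 0)" if fr: "(A, k) \<in> frames p q r" for A k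
  proof -
    have A: "A \<in> carrier_mat ?n r" and k: "k \<in> carrier_mat ?n ?n" using fr K_group_carrier by (auto simp: frames_iff)
    have 1: "(\<forall>i<?n. \<forall>j<?n. k $$ (i, j) = of_bool (i = j)) \<longleftrightarrow> k = 1\<^sub>m ?n"
      using k by (auto intro!: eq_matI)
    have fl: "finite (lead_rows p x)" for x unfolding lead_rows_def by auto
    have 2: "\<psi> (A, k) \<noteq> 0 \<longleftrightarrow> (\<forall>m<r. \<forall>i\<in>lead_rows p (ld m). A $$ (i, m) \<noteq> 0)"
      unfolding \<psi>_def by (auto simp: prod_zero_iff fl)
    show ?thesis unfolding \<Phi>_def has_leads_def 1[symmetric] 2 using A by (auto simp: ball_Un)
  qed
  have one: "(?M, 1\<^sub>m ?n) \<in> frames p q r" by (rule has_leads_one_frames(1)[OF ld has_leads_lead_mat[OF ld]])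
  have M: "(\<forall>f\<in>\<Phi>. f (?M, 1\<^sub>m ?n) = 0) \<and> \<psi> (?M, 1\<^sub>m ?n) \<noteq> 0"
    unfolding iff[OF one] using has_leads_lead_mat[OF ld] form_col_lead_mat[OF ld] by auto
  let ?N = "{y \<in> frames p q r. \<psi> y \<noteq> 0} \<inter> {x \<in> frames p q r. \<forall>f\<in>\<Phi>. f x = 0}"
  have "irreducible_in (zariski_frames p q r) {x \<in> frames p q r. \<forall>f\<in>\<Phi>. f x = 0}"
    by (rule irreducible_affine_zeros[OF aff one]) (use conjunct1[OF M] in \<open>simp_all only: ball_simps\<close>)
  then have "irreducible_in (zariski_frames p q r) ?N"
    by (rule irreducible_in_open_subset[OF _ openin_nonzero[OF reg]]) (use M one in blast)
  then have "irreducible_in (zariski p q r) (frame_map p q ` ?N)"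
    by (rule irreducible_in_image[OF _ continuous_frame_map])
  also have "frame_map p q ` ?N = gr_slice p q r ld S"
  proof
    show "frame_map p q ` ?N \<subseteq> gr_slice p q r ld S"
    proof
      fix y assume "y \<in> frame_map p q ` ?N"
      then obtain A k where A: "(A, k) \<in> frames p q r" "(\<forall>f\<in>\<Phi>. f (A, k) = 0) \<and> \<psi> (A, k) \<noteq> 0" "y = frame_map p q (A, k)" by auto
      show "y \<in> gr_slice p q r ld S" using A(2)[unfolded iff[OF A(1)]] A(3) unfolding gr_slice_def by blast
    qed
    show "gr_slice p q r ld S \<subseteq> frame_map p q ` ?N"
    proof
      fix y assume "y \<in> gr_slice p q r ld S"
      then obtain A where A: "has_leads p q r ld A" "\<forall>m<r. \<forall>\<mu>\<in>?mv. (m, \<mu>) \<notin> S \<longrightarrow> form_col p q \<mu> A m = 0"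
        "y = frame_map p q (A, 1\<^sub>m ?n)" unfolding gr_slice_def by blast
      note fr = has_leads_one_frames(1)[OF ld A(1)]
      have "(\<forall>f\<in>\<Phi>. f (A, 1\<^sub>m ?n) = 0) \<and> \<psi> (A, 1\<^sub>m ?n) \<noteq> 0" unfolding iff[OF fr] using A by blast
      then show "y \<in> frame_map p q ` ?N" using fr A(3) by blast
    qed
  qed
  finally show ?thesis .
qed

lemma gr_slice_chain:
  assumes ld: "lead_fun p q r ld"
  shows "\<exists>Z. (\<forall>i\<le>card (slice_index p q r ld). closedin (subtopology (zariski p q r) (orb p q r ld)) (Z i) \<and>
        irreducible_in (zariski p q r) (Z i)) \<and>
      (\<forall>i<card (slice_index p q r ld). Z i \<subset> Z (Suc i)) \<and>
      Z (card (slice_index p q r ld)) = gr_slice p q r ld (slice_index p q r ld) \<and> Z 0 = gr_slice p q r ld {}"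
proof (rule chain_of_good_subsets[where good = "up_closed r ld" and F = "gr_slice p q r ld"])
  let ?I = "slice_index p q r ld" and ?M = "lead_mat p q r ld"
  have "finite (points p q r ld)" by (rule config_finite[OF points_config[OF ld]])
  then show "finite ?I"
    by (intro finite_subset[of ?I "{..<r} \<times> points p q r ld"]) (auto simp: slice_index_def movable_def)
  show "up_closed r ld ?I" unfolding up_closed_def slice_index_def by auto
  show "closedin (subtopology (zariski p q r) (orb p q r ld)) (gr_slice p q r ld S) \<and>
      irreducible_in (zariski p q r) (gr_slice p q r ld S)" if "S \<subseteq> ?I" "up_closed r ld S" for S
    using gr_slice_closed[OF ld that] gr_slice_irreducible[OF ld] by simp
  fix S assume S: "S \<subseteq> ?I" "up_closed r ld S" "S \<noteq> {}"
  \<comment> \<open>The key measures the lead of a column. If it is minimal at \<open>l\<close>, no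
    other column occurring in \<open>S\<close> is below \<open>l\<close>, so a pair of
    \<open>l\<close> can be removed without losing up-closedness.\<close>
  let ?key = "\<lambda>z :: nat \<times> nat \<times> nat. fst (ld (fst z)) + snd (ld (fst z))"
  obtain z0 where z0: "z0 \<in> S" "\<And>y. y \<in> S \<Longrightarrow> ?key z0 \<le> ?key y" using ex_has_least_nat[of "\<lambda>z. z \<in> S" _ ?key] S(3) by blast
  obtain l \<mu> where l\<mu>: "z0 = (l, \<mu>)" by (cases z0)
  have z: "(l, \<mu>) \<in> S" "\<And>m \<nu>. (m, \<nu>) \<in> S \<Longrightarrow> fst (ld l) + snd (ld l) \<le> fst (ld m) + snd (ld m)"
    using z0(1) z0(2)[of "(_, _)"] unfolding l\<mu> by simp_all
  have l: "l < r" and \<mu>: "\<mu> \<in> movable (points p q r ld)" and nll: "\<not> ll (ld l) \<mu>" using z(1) S(1) unfolding slice_index_def by auto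
  let ?S = "S - {(l, \<mu>)}"
  have up: "up_closed r ld ?S" unfolding up_closed_def
  proof (intro allI impI)
    fix m \<nu> k assume h: "(m, \<nu>) \<in> ?S" "k < r" "below ld m k" "\<not> ll (ld k) \<nu>"
    then have "(k, \<nu>) \<in> S" using S(2) unfolding up_closed_def by blast
    moreover have "(k, \<nu>) \<noteq> (l, \<mu>)"
    proof
      assume kl: "(k, \<nu>) = (l, \<mu>)"
      have "fst (ld l) + snd (ld l) \<le> fst (ld m) + snd (ld m)" using z(2)[of m \<nu>] h(1) by simp
      then have "ld m = ld l" using h(3) kl unfolding below_def by (auto simp: prod_eq_iff)
      moreover have "m < r" using h(1) S(1) unfolding slice_index_def by auto
      ultimately have "m = l" using lead_fun_inj[OF ld] l by (auto dest: inj_onD)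
      then show False using h(1) kl by simp
    qed
    ultimately show "(k, \<nu>) \<in> ?S" by auto
  qed
  have subI: "?S \<subseteq> ?I" using S(1) by auto
  have pos: "1 \<le> fst \<mu>" "1 \<le> snd \<mu>" and mem: "\<mu> \<in> points p q r ld" using \<mu> unfolding movable_def by auto
  have rl: "fst (ld l) \<le> p" "snd (ld l) \<le> q" using lead_fun_range[OF ld l] by auto
  \<comment> \<open>A row in the box of \<open>l\<close> that occurs in the form of
    \<open>\<mu>\<close> but in no other form; it exists because \<open>ld l\<close> is not strictly
    below \<open>\<mu>\<close>. Perturbing column \<open>l\<close> there makes just this one form
    nonzero on just this column.\<close>
  define e where "e = (if fst \<mu> \<le> fst (ld l) then fst \<mu> - 1 else p + snd \<mu> - 1)"
  have e: "e < p + q" "e \<in> box p (ld l)"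
    using pos rl nll unfolding e_def box_def ll_def by auto
  have fe: "form_coeff p q \<nu> e = 0" if \<nu>: "\<nu> \<in> movable (points p q r ld)" "\<nu> \<noteq> \<mu>" for \<nu>
  proof -
    have pn: "1 \<le> fst \<nu>" "1 \<le> snd \<nu>" "\<nu> \<in> points p q r ld" using \<nu> unfolding movable_def by auto
    show ?thesis
    proof (cases "fst \<mu> \<le> fst (ld l)")
      case True
      then have "fst \<mu> \<noteq> fst \<nu>" using points_fst_eq[OF ld mem pn(3)] pos rl \<nu>(2) by auto
      then show ?thesis using True pos pn rl unfolding form_coeff_def e_def by (auto simp: of_bool_def)
    next
      case False
      then have "snd \<mu> \<le> snd (ld l)" using nll unfolding ll_def by auto
      then have "snd \<mu> \<noteq> snd \<nu>" "snd \<mu> \<le> q" using points_snd_eq[OF ld mem pn(3)] pos rl \<nu>(2) by auto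
      then show ?thesis using False pos pn rl unfolding form_coeff_def e_def by (auto simp: of_bool_def)
    qed
  qed
  have fm: "form_coeff p q \<mu> e \<noteq> 0"
    using pos rl nll unfolding form_coeff_def e_def ll_def by (auto simp: of_bool_def)
  define A where "A = mat (p + q) r (\<lambda>(i, m). ?M $$ (i, m) + of_bool (m = l \<and> i = e))"
  have lr: "i < p + q" if "m < r" "i \<in> lead_rows p (ld m)" for i m
    using lead_rows_less[of "ld m" p q i] lead_fun_range[OF ld that(1)] that(2) by auto
  have A: "has_leads p q r ld A" unfolding has_leads_def
  proof (intro conjI allI impI ballI)
    show "A \<in> carrier_mat (p + q) r" unfolding A_def by simp
    fix m i assume m: "m < r"
    {
      assume i: "i < p + q" "i \<notin> box p (ld m)"
      then show "A $$ (i, m) = 0" using m e(2) lead_rows_box[of p "ld m"] unfolding A_def lead_mat_def by auto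
    next
      assume i: "i \<in> lead_rows p (ld m)"
      then show "A $$ (i, m) \<noteq> 0" using m lr[OF m i] unfolding A_def lead_mat_def by (auto simp: of_bool_def)
    }
  qed
  have fA: "form_col p q \<nu> A m = (if m = l then form_coeff p q \<nu> e else 0)"
    if "m < r" "\<nu> \<in> movable (points p q r ld)" for \<nu> m
  proof -
    have "form_col p q \<nu> A m = form_col p q \<nu> ?M m + (\<Sum>c<p + q. of_bool (c = e) * (of_bool (m = l) * form_coeff p q \<nu> c))"
      unfolding form_col_def sum.distrib[symmetric] A_def using that(1) by (intro sum.cong refl) (auto simp: of_bool_def algebra_simps)
    then show ?thesis using form_col_lead_mat[OF ld that] e(1) by (simp add: sum_of_bool_row)
  qed
  let ?y = "frame_map p q (A, 1\<^sub>m (p + q))"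
  have "form_col p q \<nu> A m = 0" if "m < r" "\<nu> \<in> movable (points p q r ld)" "(m, \<nu>) \<notin> S" for m \<nu>
    using fA[OF that(1,2)] fe[OF that(2)] that(3) z(1) by (cases "\<nu> = \<mu>") auto
  then have y: "?y \<in> gr_slice p q r ld S" unfolding gr_slice_def using A by blast
  have "?y \<notin> gr_slice p q r ld ?S"
  proof
    assume "?y \<in> gr_slice p q r ld ?S"
    then obtain x where x: "x \<in> slice_zero p q r ld ?S" "?y = frame_map p q x" unfolding gr_slice_alt[OF ld subI up] by blast
    have "(A, 1\<^sub>m (p + q)) \<in> slice_zero p q r ld ?S"
      by (rule slice_zero_saturated[OF x(1) has_leads_one_frames(1)[OF ld A] x(2)])
    then have "form_col p q \<mu> A l = 0" by (rule slice_zero_imp[OF ld A _ l \<mu>]) simp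
    then show False using fA[OF l \<mu>] fm by simp
  qed
  moreover have "gr_slice p q r ld ?S \<subseteq> gr_slice p q r ld S" unfolding gr_slice_def by blast
  ultimately have "gr_slice p q r ld ?S \<subset> gr_slice p q r ld S" using y by blast
  then show "\<exists>x\<in>S. up_closed r ld (S - {x}) \<and> gr_slice p q r ld (S - {x}) \<subset> gr_slice p q r ld S"
    using z(1) up by blast
qed

text \<open>Here the two chains meet: the largest Grassmannian slice and the smallest flag slice are
  both the Borel orbit of the base point. With \<open>k\<close> in the Borel group, moving only the
  subspace or moving everything by \<open>k\<close> gives the same point.\<close>

lemma gr_slice_full:
  assumes ld: "lead_fun p q r ld"
  shows "gr_slice p q r ld (slice_index p q r ld) = flag_slice p q r ld {}"
proof
  show "gr_slice p q r ld (slice_index p q r ld) \<subseteq> flag_slice p q r ld {}"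
  proof
    fix y assume "y \<in> gr_slice p q r ld (slice_index p q r ld)"
    then obtain A where A: "has_leads p q r ld A" "y = frame_map p q (A, 1\<^sub>m (p + q))" unfolding gr_slice_def by auto
    obtain b where b: "b \<in> borel_group p q" "A = b * lead_mat p q r ld" using has_leads_borel_factor[OF ld A(1)] .
    have "y = frame_map p q (b * lead_mat p q r ld, b)"
      using frame_map_one_borel[OF has_leads_one_frames(1)[OF ld A(1)] b(1)] A(2) b(2) by simp
    then show "y \<in> flag_slice p q r ld {}"
      unfolding flag_slice_def using b(1) borel_K[OF b(1)]
      by (auto simp: borel_group_def lower_positions_def block_positions_def)
  qed
  show "flag_slice p q r ld {} \<subseteq> gr_slice p q r ld (slice_index p q r ld)"
  proof
    fix y assume "y \<in> flag_slice p q r ld {}"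
    then obtain k where k: "k \<in> K_group p q" "\<forall>(i, j)\<in>lower_positions p q - {}. k $$ (i, j) = 0"
      "y = frame_map p q (k * lead_mat p q r ld, k)" unfolding flag_slice_def by blast
    have "(k * lead_mat p q r ld, k) \<in> lower_zero p q r {}"
      unfolding lower_zero_iff using k(2) lead_mat_frames[OF ld k(1) has_leads_lead_mat[OF ld]] by simp
    then have b: "k \<in> borel_group p q" by (rule lower_zero_borel)
    have A: "has_leads p q r ld (k * lead_mat p q r ld)" by (rule borel_has_leads[OF ld b has_leads_lead_mat[OF ld]])
    have y: "y = frame_map p q (k * lead_mat p q r ld, 1\<^sub>m (p + q))"
      unfolding k(3) by (rule frame_map_one_borel[OF has_leads_one_frames(1)[OF ld A] b])
    have "form_col p q \<mu> (k * lead_mat p q r ld) m = 0"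
      if "m < r" "\<mu> \<in> movable (points p q r ld)" "(m, \<mu>) \<notin> slice_index p q r ld" for m \<mu>
      by (rule form_col_ll[OF A ld that(1)]) (use that in \<open>auto simp: slice_index_def\<close>)
    then show "y \<in> gr_slice p q r ld (slice_index p q r ld)" unfolding gr_slice_def using A y by blast
  qed
qed

section \<open>The dimension count\<close>

lemma orb_chain:
  assumes ld: "lead_fun p q r ld"
  shows "chain_in (zariski p q r) (orb p q r ld) (card (slice_index p q r ld) + card (lower_positions p q))"
proof -
  let ?P = "\<lambda>Z. closedin (subtopology (zariski p q r) (orb p q r ld)) Z \<and> irreducible_in (zariski p q r) Z"
  obtain Z where Z: "\<forall>i\<le>card (slice_index p q r ld). ?P (Z i)" "\<forall>i<card (slice_index p q r ld). Z i \<subset> Z (Suc i)"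
    "Z (card (slice_index p q r ld)) = gr_slice p q r ld (slice_index p q r ld)"
    using gr_slice_chain[OF ld] by (elim exE conjE)
  obtain Y where Y: "\<forall>i\<le>card (lower_positions p q). ?P (Y i)" "\<forall>i<card (lower_positions p q). Y i \<subset> Y (Suc i)"
    "Y 0 = flag_slice p q r ld {}" using flag_slice_chain[OF ld] by (elim exE conjE)
  show ?thesis unfolding chain_in_def
    by (rule chain_concat[OF Z(1,2) _ Y(1,2)]) (use Z(3) Y(3) gr_slice_full[OF ld] in simp)
qed

text \<open>There are \<open>p + q - e\<close> points, where \<open>e\<close> is the number of
  edges, since exactly the edges occupy both an interior row and an interior column. Edges and marks
  together number \<open>r\<close>, and all points except marks are movable. The result is the
  number of equations of an \<open>r\<close>-dimensional subspace.\<close>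

lemma card_movable:
  assumes ld: "lead_fun p q r ld"
  shows "card (movable (points p q r ld)) + r = p + q"
proof -
  let ?C = "points p q r ld"
  note C = points_config[OF ld]
  have fC: "finite ?C" by (rule config_finite[OF C])
  let ?R = "{x \<in> ?C. 1 \<le> fst x \<and> fst x \<le> p}" and ?L = "{x \<in> ?C. 1 \<le> snd x \<and> snd x \<le> q}"
  let ?mk = "{x \<in> ?C. fst x = 0 \<or> snd x = 0}"
  have "bij_betw fst ?R {1..p}"
  proof (rule bij_betwI')
    fix y assume "y \<in> {1..p}"
    then show "\<exists>x\<in>?R. y = fst x" using config_ex1_row[OF C, of y] by auto
  qed (use points_fst_eq[OF ld] in auto)
  then have 1: "card ?R = p" using bij_betw_same_card by fastforce
  have "bij_betw snd ?L {1..q}"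
  proof (rule bij_betwI')
    fix y assume "y \<in> {1..q}"
    then show "\<exists>x\<in>?L. y = snd x" using config_ex1_col[OF C, of y] by auto
  qed (use points_snd_eq[OF ld] in auto)
  then have 2: "card ?L = q" using bij_betw_same_card by fastforce
  have int: "1 \<le> fst x \<and> fst x \<le> p \<or> 1 \<le> snd x \<and> snd x \<le> q" if "x \<in> ?C" for x
    using config_interior[OF C, of "fst x" "snd x"] that by simp
  have un: "?R \<union> ?L = ?C" using int by auto
  have 3: "card ?R + card ?L = card ?C + card (?R \<inter> ?L)"
    using card_Un_Int[of ?R ?L] fC un by simp
  have 4: "card ?C = card (movable ?C) + card ?mk"
    by (subst card_Un_disjoint[symmetric]) (use fC in \<open>auto simp: movable_def intro!: arg_cong[of _ _ card]\<close>)
  have nf: "nonfree p q ?C = (?R \<inter> ?L) \<union> ?mk"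
  proof
    show "nonfree p q ?C \<subseteq> (?R \<inter> ?L) \<union> ?mk" unfolding nonfree_def by auto
    show "(?R \<inter> ?L) \<union> ?mk \<subseteq> nonfree p q ?C" unfolding nonfree_def using int by fastforce
  qed
  have "card (nonfree p q ?C) = r" using C unfolding config_def nonfree_def by simp
  then have 5: "card (?R \<inter> ?L) + card ?mk = r"
    unfolding nf by (subst (asm) card_Un_disjoint) (use fC in auto)
  show ?thesis using 1 2 3 4 5 by linarith
qed

text \<open>In a comparable pair the lower point comes from a column and the upper one is movable,
  so the comparable pairs are exactly the pairs missing from \<open>slice_index\<close>.\<close>

lemma card_slice_index:
  assumes ld: "lead_fun p q r ld"
  shows "card (slice_index p q r ld) + ll_pairs (points p q r ld) = r * (p + q - r)"
proof -
  let ?C = "points p q r ld"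
  let ?N = "{(m, \<mu>). m < r \<and> \<mu> \<in> movable ?C \<and> ll (ld m) \<mu>}"
  have fm: "finite (movable ?C)" using config_finite[OF points_config[OF ld]] unfolding movable_def by simp
  have "{(x, y). x \<in> ?C \<and> y \<in> ?C \<and> ll x y} = (\<lambda>(m, \<mu>). (ld m, \<mu>)) ` ?N"
  proof
    show "(\<lambda>(m, \<mu>). (ld m, \<mu>)) ` ?N \<subseteq> {(x, y). x \<in> ?C \<and> y \<in> ?C \<and> ll x y}"
      using ld_in_points[of _ r ld p q] unfolding movable_def by auto
    show "{(x, y). x \<in> ?C \<and> y \<in> ?C \<and> ll x y} \<subseteq> (\<lambda>(m, \<mu>). (ld m, \<mu>)) ` ?N"
    proof
      fix z assume "z \<in> {(x, y). x \<in> ?C \<and> y \<in> ?C \<and> ll x y}"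
      then obtain x y where z: "z = (x, y)" "x \<in> ?C" "y \<in> ?C" "ll x y" by auto
      have "fst y \<le> Suc p" "snd y \<le> Suc q" using config_range[OF points_config[OF ld], of "fst y" "snd y"] z(3) by auto
      then have "x \<in> nonfree p q ?C" using z unfolding nonfree_def ll_def by auto
      then obtain m where m: "m < r" "x = ld m" unfolding nonfree_points[OF ld] by auto
      have "y \<in> movable ?C" using z unfolding movable_def ll_def by auto
      then show "z \<in> (\<lambda>(m, \<mu>). (ld m, \<mu>)) ` ?N" using m z by (auto intro!: image_eqI[of _ _ "(m, y)"])
    qed
  qed
  moreover have "inj_on (\<lambda>(m, \<mu>). (ld m, \<mu>)) ?N"
    using lead_fun_inj[OF ld] by (auto simp: inj_on_def)
  ultimately have 1: "ll_pairs ?C = card ?N" unfolding ll_pairs_def by (simp add: card_image)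
  have "slice_index p q r ld \<union> ?N = {..<r} \<times> movable ?C" "slice_index p q r ld \<inter> ?N = {}"
    unfolding slice_index_def by auto
  then have "card (slice_index p q r ld) + card ?N = card ({..<r} \<times> movable ?C)"
    using card_Un_disjoint[of "slice_index p q r ld" ?N] finite_Un[of "slice_index p q r ld" ?N]
      finite_cartesian_product[OF finite_lessThan fm] by simp
  also have "\<dots> = r * (p + q - r)"
  proof -
    have "card (movable ?C) = p + q - r" using card_movable[OF ld] by simp
    then show ?thesis by (simp add: card_cartesian_product)
  qed
  finally show ?thesis using 1 by simp
qed

lemma orb_closure_psubset_imp:
  assumes ld: "lead_fun p q r ld" and C': "config p q r C'" and sw: "swap p q C' (points p q r ld) a b c d"
  obtains ld' where "lead_fun p q r ld'" "points p q r ld' = C'"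
    "zariski p q r closure_of orb p q r ld \<subset> zariski p q r closure_of orb p q r ld'"
proof -
  obtain ld' where ld': "lead_fun p q r ld'" "points p q r ld' = C'" using config_lead_fun[OF C'] .
  have le: "cnt C' i j \<le> cnt (points p q r ld) i j" if "i \<le> p" "j \<le> q" for i j
    by (rule swap_cnt_le[OF sw points_config[OF ld] that])
  have s: "a < b" "b \<le> Suc p" "c < d" "d \<le> Suc q" using sw unfolding swap_def by auto
  have "cnt (points p q r ld) a c = cnt C' a c + 1"
    using cnt_swap[OF sw config_finite[OF points_config[OF ld]], of a c] s by simp
  then have "points p q r ld \<noteq> points p q r ld'" using ld'(2) by auto
  then have "zariski p q r closure_of orb p q r ld \<noteq> zariski p q r closure_of orb p q r ld'"
    using orb_closure_eq_iff[OF ld ld'(1)] by simp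
  moreover have "zariski p q r closure_of orb p q r ld \<subseteq> zariski p q r closure_of orb p q r ld'"
    using orb_closure_subset_iff[OF ld ld'(1)] le ld'(2) by simp
  ultimately show ?thesis using that ld' by blast
qed

text \<open>An inverse swap removes one comparable pair and puts a strictly larger irreducible
  closure on top of the chain.\<close>

lemma chain_in_closure_bound:
  assumes "lead_fun p q r ld" "chain_in (zariski p q r) (zariski p q r closure_of orb p q r ld) m"
  shows "chain_in (zariski p q r) (dflag_variety p q r) (m + ll_pairs (points p q r ld))"
  using assms
proof (induction "ll_pairs (points p q r ld)" arbitrary: ld m)
  case 0
  have "zariski p q r closure_of orb p q r ld \<subseteq> dflag_variety p q r"
    using closure_of_subset_topspace topspace_zariski by metis
  then have "chain_in (zariski p q r) (dflag_variety p q r) m"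
    using chain_in_mono[OF _ _ 0(3)] topspace_zariski by blast
  then show ?case using 0(1) by simp
next
  case (Suc k)
  note ld = Suc.prems(1)
  have "ll_pairs (points p q r ld) > 0" using Suc(2) by simp
  then obtain C' a b c d where C': "swap p q C' (points p q r ld) a b c d" "config p q r C'"
    "ll_pairs (points p q r ld) = ll_pairs C' + 1" using exists_swap_above[OF points_config[OF ld]] by metis
  obtain ld' where ld': "lead_fun p q r ld'" "points p q r ld' = C'"
    "zariski p q r closure_of orb p q r ld \<subset> zariski p q r closure_of orb p q r ld'"
    using orb_closure_psubset_imp[OF ld C'(2,1)] .
  have "chain_in (zariski p q r) (zariski p q r closure_of orb p q r ld') (Suc m)"
    by (rule chain_in_extend[OF closedin_closure_of closedin_closure_of ld'(3)
          irreducible_in_closure[OF orb_irreducible[OF ld'(1)]] Suc.prems(2)])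
  then have "chain_in (zariski p q r) (dflag_variety p q r) (Suc m + ll_pairs (points p q r ld'))"
    using Suc(2) C'(3) ld'(2) by (intro Suc.hyps(1)[OF _ ld'(1)]) auto
  then show ?case using C'(3) ld'(2) by simp
qed

definition orb_dim :: "nat \<Rightarrow> nat \<Rightarrow> nat \<Rightarrow> (nat \<Rightarrow> nat \<times> nat) \<Rightarrow> nat" where
  "orb_dim p q r ld = card (slice_index p q r ld) + card (lower_positions p q)"

text \<open>Of the \<open>(p + q) * r\<close> coordinates of \<open>A\<close> the fibre takes
  \<open>r * r\<close> and leaves \<open>r * (p + q - r)\<close>. Of the block coordinates it takes
  the weakly upper ones and leaves the strictly lower ones. Subtracting the swaps gives the length
  of the explicit chain.\<close>

lemma chain_in_closure_le:
  assumes ld: "lead_fun p q r ld" and ch: "chain_in (zariski p q r) (zariski p q r closure_of orb p q r ld) m"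
  shows "m \<le> orb_dim p q r ld"
proof -
  have "card (fibre_positions p q r) + (m + ll_pairs (points p q r ld)) \<le> (p + q) * r + card (block_positions p q)"
    by (rule chain_in_variety_bound[OF chain_in_closure_bound[OF ld ch]])
  moreover have fb: "finite {(i, j) \<in> block_positions p q. i \<le> j}"
    by (rule finite_subset[OF _ finite_block_positions[of p q]]) auto
  have "card (fibre_positions p q r) = r * r + card {(i, j) \<in> block_positions p q. i \<le> j}"
    unfolding fibre_positions_def using fb by (simp add: card_Plus)
  moreover have "card (block_positions p q) = card {(i, j) \<in> block_positions p q. i \<le> j} + card (lower_positions p q)"
    by (subst card_Un_disjoint[symmetric])
       (use fb finite_lower_positions in \<open>auto simp: lower_positions_def intro!: arg_cong[of _ _ card]\<close>)
  moreover have "r * r + r * (p + q - r) = (p + q) * r"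
  proof -
    have "r \<le> p + q" using card_movable[OF ld] by simp
    then show ?thesis by (metis add_mult_distrib2 le_add_diff_inverse mult.commute)
  qed
  ultimately show ?thesis using card_slice_index[OF ld] unfolding orb_dim_def by linarith
qed

lemma zdim_orb:
  assumes ld: "lead_fun p q r ld"
  shows "zdim p q r (orb p q r ld) = enat (orb_dim p q r ld)"
    and "zdim p q r (zariski p q r closure_of orb p q r ld) = enat (orb_dim p q r ld)"
proof -
  let ?T = "zariski p q r" and ?O = "orb p q r ld"
  have sub: "?O \<subseteq> ?T closure_of ?O" using closure_of_subset orb_subset[OF ld] topspace_zariski by metis
  have top: "?T closure_of ?O \<subseteq> topspace ?T" by (rule closure_of_subset_topspace)
  have ch: "chain_in ?T ?O (orb_dim p q r ld)" unfolding orb_dim_def by (rule orb_chain[OF ld])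
  show "zdim p q r ?O = enat (orb_dim p q r ld)" unfolding zdim_def
    by (rule krull_dim_eqI[OF _ ch]) (use sub top chain_in_closure_le[OF ld] chain_in_mono[OF sub top] in auto)
  show "zdim p q r (?T closure_of ?O) = enat (orb_dim p q r ld)" unfolding zdim_def
    by (rule krull_dim_eqI[OF top chain_in_mono[OF sub top ch]]) (rule chain_in_closure_le[OF ld])
qed

section \<open>Graphs and configurations\<close>

text \<open>The value has at most one element and is empty for marks and free vertices, so that a
  graph is a union over points. The shift by one returns to vertices numbered from
  \<open>0\<close>.\<close>

definition point_edge :: "nat \<Rightarrow> nat \<Rightarrow> nat \<times> nat \<Rightarrow> vertex set set" where
  "point_edge p q x = (if fst x \<in> {1..p} \<and> snd x \<in> {1..q} then {{Pos (fst x - 1), Neg (snd x - 1)}} else {})"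

definition point_mark :: "nat \<Rightarrow> nat \<Rightarrow> nat \<times> nat \<Rightarrow> vertex set" where
  "point_mark p q x = (if fst x \<in> {1..p} \<and> snd x = 0 then {Pos (fst x - 1)}
     else if fst x = 0 \<and> snd x \<in> {1..q} then {Neg (snd x - 1)} else {})"

definition config_graph :: "nat \<Rightarrow> nat \<Rightarrow> (nat \<times> nat) set \<Rightarrow> marked_graph" where
  "config_graph p q C = \<lparr>verts = Pos ` {..<p} \<union> Neg ` {..<q},
     edges = (\<Union>x\<in>C. point_edge p q x), marks = (\<Union>x\<in>C. point_mark p q x)\<rparr>"

lemma edge_config_graph:
  "{Pos i, Neg j} \<in> edges (config_graph p q C) \<longleftrightarrow> i < p \<and> j < q \<and> (Suc i, Suc j) \<in> C"
proof
  assume "{Pos i, Neg j} \<in> edges (config_graph p q C)"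
  then obtain x where x: "x \<in> C" "{Pos i, Neg j} \<in> point_edge p q x" unfolding config_graph_def by auto
  have "fst x \<in> {1..p} \<and> snd x \<in> {1..q} \<and> i = fst x - 1 \<and> j = snd x - 1"
    using x(2) unfolding point_edge_def by (auto simp: doubleton_eq_iff split: if_splits)
  then have "x = (Suc i, Suc j)" "i < p" "j < q" by (auto simp: prod_eq_iff)
  then show "i < p \<and> j < q \<and> (Suc i, Suc j) \<in> C" using x(1) by simp
next
  assume "i < p \<and> j < q \<and> (Suc i, Suc j) \<in> C"
  then show "{Pos i, Neg j} \<in> edges (config_graph p q C)"
    unfolding config_graph_def by (auto simp: point_edge_def intro!: bexI[of _ "(Suc i, Suc j)"])
qed

lemma pos_mark_config_graph: "Pos i \<in> marks (config_graph p q C) \<longleftrightarrow> i < p \<and> (Suc i, 0) \<in> C"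
proof
  assume "Pos i \<in> marks (config_graph p q C)"
  then obtain x where x: "x \<in> C" "Pos i \<in> point_mark p q x" unfolding config_graph_def by auto
  have "fst x \<in> {1..p} \<and> snd x = 0 \<and> i = fst x - 1"
    using x(2) unfolding point_mark_def by (auto split: if_splits)
  then have "x = (Suc i, 0)" "i < p" by (auto simp: prod_eq_iff)
  then show "i < p \<and> (Suc i, 0) \<in> C" using x(1) by simp
next
  assume "i < p \<and> (Suc i, 0) \<in> C"
  then show "Pos i \<in> marks (config_graph p q C)"
    unfolding config_graph_def by (auto simp: point_mark_def intro!: bexI[of _ "(Suc i, 0)"])
qed

lemma neg_mark_config_graph: "Neg j \<in> marks (config_graph p q C) \<longleftrightarrow> j < q \<and> (0, Suc j) \<in> C"
proof
  assume "Neg j \<in> marks (config_graph p q C)"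
  then obtain x where x: "x \<in> C" "Neg j \<in> point_mark p q x" unfolding config_graph_def by auto
  have "fst x = 0 \<and> snd x \<in> {1..q} \<and> j = snd x - 1"
    using x(2) unfolding point_mark_def by (auto split: if_splits)
  then have "x = (0, Suc j)" "j < q" by (auto simp: prod_eq_iff)
  then show "j < q \<and> (0, Suc j) \<in> C" using x(1) by simp
next
  assume "j < q \<and> (0, Suc j) \<in> C"
  then show "Neg j \<in> marks (config_graph p q C)"
    unfolding config_graph_def by (auto simp: point_mark_def intro!: bexI[of _ "(0, Suc j)"])
qed

lemma edges_config_graphE:
  assumes "e \<in> edges (config_graph p q C)"
  obtains i j where "e = {Pos i, Neg j}" "i < p" "j < q" "(Suc i, Suc j) \<in> C"
proof -
  obtain x where x: "x \<in> C" "e \<in> point_edge p q x" using assms unfolding config_graph_def by auto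
  have x': "fst x \<in> {1..p}" "snd x \<in> {1..q}" "e = {Pos (fst x - 1), Neg (snd x - 1)}"
    using x(2) unfolding point_edge_def by (auto split: if_splits)
  have "(Suc (fst x - 1), Suc (snd x - 1)) = x" using x'(1,2) by (auto simp: prod_eq_iff)
  then show ?thesis using that[of "fst x - 1" "snd x - 1"] x x' by auto
qed

text \<open>Row \<open>Suc i\<close> holds exactly one point; if it is neither a mark nor an edge,
  it lies in the border column \<open>Suc q\<close>.\<close>

lemma free_pos_config_graph:
  assumes C: "config p q r C"
  shows "free_vertex (config_graph p q C) (Pos i) \<longleftrightarrow> i < p \<and> (Suc i, Suc q) \<in> C"
proof
  assume f: "free_vertex (config_graph p q C) (Pos i)"
  then have i: "i < p" unfolding free_vertex_def config_graph_def by auto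
  obtain j where j: "(Suc i, j) \<in> C" "j \<le> Suc q" by (rule config_row[OF C, of "Suc i"]) (use i in auto)
  have "j \<noteq> 0" using f j(1) i pos_mark_config_graph[of i p q C] unfolding free_vertex_def by (cases "j = 0") auto
  moreover have "\<not> j \<le> q"
  proof
    assume "j \<le> q"
    then have "{Pos i, Neg (j - 1)} \<in> edges (config_graph p q C)"
      using j(1) i \<open>j \<noteq> 0\<close> unfolding edge_config_graph by auto
    then show False using f unfolding free_vertex_def by auto
  qed
  ultimately show "i < p \<and> (Suc i, Suc q) \<in> C" using i j by (metis le_SucE)
next
  assume i: "i < p \<and> (Suc i, Suc q) \<in> C"
  have u: "(Suc i, j) \<in> C \<Longrightarrow> j = Suc q" for j using config_row_unique[OF C, of "Suc i" j "Suc q"] i by auto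
  show "free_vertex (config_graph p q C) (Pos i)"
    unfolding free_vertex_def
  proof (intro conjI ballI)
    show "Pos i \<in> verts (config_graph p q C)" using i unfolding config_graph_def by simp
    show "Pos i \<notin> marks (config_graph p q C)" unfolding pos_mark_config_graph using u[of 0] by auto
    fix e assume "e \<in> edges (config_graph p q C)"
    then show "Pos i \<notin> e" by (rule edges_config_graphE) (use u in auto)
  qed
qed

lemma free_neg_config_graph:
  assumes C: "config p q r C"
  shows "free_vertex (config_graph p q C) (Neg j) \<longleftrightarrow> j < q \<and> (Suc p, Suc j) \<in> C"
proof
  assume f: "free_vertex (config_graph p q C) (Neg j)"
  then have j: "j < q" unfolding free_vertex_def config_graph_def by auto
  obtain i where i: "(i, Suc j) \<in> C" "i \<le> Suc p" by (rule config_col[OF C, of "Suc j"]) (use j in auto)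
  have "i \<noteq> 0" using f i(1) j neg_mark_config_graph[of j p q C] unfolding free_vertex_def by (cases "i = 0") auto
  moreover have "\<not> i \<le> p"
  proof
    assume "i \<le> p"
    then have "{Pos (i - 1), Neg j} \<in> edges (config_graph p q C)"
      using i(1) j \<open>i \<noteq> 0\<close> unfolding edge_config_graph by auto
    then show False using f unfolding free_vertex_def by auto
  qed
  ultimately show "j < q \<and> (Suc p, Suc j) \<in> C" using i j by (metis le_SucE)
next
  assume j: "j < q \<and> (Suc p, Suc j) \<in> C"
  have u: "(i, Suc j) \<in> C \<Longrightarrow> i = Suc p" for i using config_col_unique[OF C, of i "Suc j" "Suc p"] j by auto
  show "free_vertex (config_graph p q C) (Neg j)"
    unfolding free_vertex_def
  proof (intro conjI ballI)
    show "Neg j \<in> verts (config_graph p q C)" using j unfolding config_graph_def by simp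
    show "Neg j \<notin> marks (config_graph p q C)" unfolding neg_mark_config_graph using u[of 0] by auto
    fix e assume "e \<in> edges (config_graph p q C)"
    then show "Neg j \<notin> e" by (rule edges_config_graphE) (use u in auto)
  qed
qed

lemma config_graph_inj:
  assumes C: "config p q r C" and D: "config p q r D" and e: "config_graph p q C = config_graph p q D"
  shows "C = D"
proof (rule config_eq_if_nonfree_eq[OF C D])
  have "(i, j) \<in> C \<longleftrightarrow> (i, j) \<in> D" if ij: "i \<le> p" "j \<le> q" for i j
  proof -
    have z: "(0, 0) \<notin> C" "(0, 0) \<notin> D" using C D unfolding config_def by force+
    consider "i = 0" "j = 0" | k where "i = Suc k" "j = 0" | l where "i = 0" "j = Suc l" | k l where "i = Suc k" "j = Suc l"
      by (cases i; cases j) auto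
    then show ?thesis
    proof cases
      case 1
      then show ?thesis using z by simp
    next
      case 2
      then show ?thesis using pos_mark_config_graph[of k p q C] pos_mark_config_graph[of k p q D] e ij by simp
    next
      case 3
      then show ?thesis using neg_mark_config_graph[of l p q C] neg_mark_config_graph[of l p q D] e ij by simp
    next
      case 4
      then show ?thesis using edge_config_graph[of k l p q C] edge_config_graph[of k l p q D] e ij by simp
    qed
  qed
  then show "nonfree p q C = nonfree p q D" unfolding nonfree_def by auto
qed

section \<open>Swaps as changes of the graph\<close>

lemma point_edge_disjoint: "x \<noteq> y \<Longrightarrow> point_edge p q x \<inter> point_edge p q y = {}"
proof (rule ccontr)
  assume xy: "x \<noteq> y" "point_edge p q x \<inter> point_edge p q y \<noteq> {}"
  then have "fst x \<in> {1..p}" "snd x \<in> {1..q}" "fst y \<in> {1..p}" "snd y \<in> {1..q}"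
    "fst x - 1 = fst y - 1" "snd x - 1 = snd y - 1"
    unfolding point_edge_def by (auto simp: doubleton_eq_iff split: if_splits)
  then show False using xy(1) by (auto simp: prod_eq_iff)
qed

lemma point_mark_disjoint: "x \<noteq> y \<Longrightarrow> point_mark p q x \<inter> point_mark p q y = {}"
proof (rule ccontr)
  assume xy: "x \<noteq> y" "point_mark p q x \<inter> point_mark p q y \<noteq> {}"
  then have "fst x \<in> {1..p} \<and> fst y \<in> {1..p} \<and> fst x - 1 = fst y - 1 \<and> snd x = 0 \<and> snd y = 0 \<or>
      snd x \<in> {1..q} \<and> snd y \<in> {1..q} \<and> snd x - 1 = snd y - 1 \<and> fst x = 0 \<and> fst y = 0"
    unfolding point_mark_def by (auto split: if_splits)
  then show False using xy(1) by (auto simp: prod_eq_iff)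
qed

lemma UN_Un_replace:
  assumes "\<And>x y. x \<noteq> y \<Longrightarrow> f x \<inter> f y = {}" "T \<inter> Y = {}"
  shows "(\<Union>x\<in>T \<union> X. f x) = ((\<Union>x\<in>T \<union> Y. f x) - (\<Union>x\<in>Y. f x)) \<union> (\<Union>x\<in>X. f x)"
proof -
  have "f x \<inter> f y = {}" if "x \<in> T" "y \<in> Y" for x y using assms that by (metis disjoint_iff)
  then show ?thesis by blast
qed

lemma config_graph_replace:
  assumes "T \<inter> Y = {}"
  shows "config_graph p q (T \<union> X) = replace (config_graph p q (T \<union> Y))
    (\<Union>x\<in>Y. point_edge p q x) (\<Union>x\<in>Y. point_mark p q x) (\<Union>x\<in>X. point_edge p q x) (\<Union>x\<in>X. point_mark p q x)"
proof -
  have E: "(\<Union>x\<in>T \<union> X. point_edge p q x) =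
      ((\<Union>x\<in>T \<union> Y. point_edge p q x) - (\<Union>x\<in>Y. point_edge p q x)) \<union> (\<Union>x\<in>X. point_edge p q x)"
    by (rule UN_Un_replace[OF point_edge_disjoint assms])
  have M: "(\<Union>x\<in>T \<union> X. point_mark p q x) =
      ((\<Union>x\<in>T \<union> Y. point_mark p q x) - (\<Union>x\<in>Y. point_mark p q x)) \<union> (\<Union>x\<in>X. point_mark p q x)"
    by (rule UN_Un_replace[OF point_mark_disjoint assms])
  show ?thesis unfolding config_graph_def replace_def E M by (simp del: UN_Un)
qed

lemma UN_phantoms: 
  "(\<Union>x\<in>Y - phantoms p q. point_edge p q x) = (\<Union>x\<in>Y. point_edge p q x)"
  "(\<Union>x\<in>Y - phantoms p q. point_mark p q x) = (\<Union>x\<in>Y. point_mark p q x)"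
proof -
  have "point_edge p q x = {}" "point_mark p q x = {}" if "x \<in> phantoms p q" for x
    using that unfolding phantoms_def point_edge_def point_mark_def by auto
  then show "(\<Union>x\<in>Y - phantoms p q. point_edge p q x) = (\<Union>x\<in>Y. point_edge p q x)"
    "(\<Union>x\<in>Y - phantoms p q. point_mark p q x) = (\<Union>x\<in>Y. point_mark p q x)" by blast+
qed

text \<open>One formula for all elementary moves: points on the border contribute empty sets to the
  edges or marks that are exchanged.\<close>

lemma swap_graph_replace:
  assumes "(a, d) \<notin> T" "(b, c) \<notin> T"
  shows "config_graph p q (T \<union> {(a, c), (b, d)}) = replace (config_graph p q (T \<union> ({(a, d), (b, c)} - phantoms p q)))
    (point_edge p q (a, d) \<union> point_edge p q (b, c)) (point_mark p q (a, d) \<union> point_mark p q (b, c))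
    (point_edge p q (a, c) \<union> point_edge p q (b, d)) (point_mark p q (a, c) \<union> point_mark p q (b, d))"
  by (subst config_graph_replace[of T "{(a, d), (b, c)} - phantoms p q"])
     (use assms in \<open>auto simp only: UN_phantoms UN_insert UN_empty Un_empty_right\<close>)

text \<open>The kind of move depends on the sides of the rectangle that lie on the border:
  \<open>a = 0\<close>, \<open>c = 0\<close> or neither, combined with \<open>b = Suc p\<close>,
  \<open>d = Suc q\<close> or neither. The nine combinations are the nine rules.\<close>

lemma swap_imp_elementary_move:
  assumes sw: "swap p q C' C a b c d" and C': "config p q r C'"
  shows "elementary_move (config_graph p q C') (config_graph p q C)"
proof -
  let ?G = "config_graph p q C'"
  have s: "a < b" "b \<le> Suc p" "c < d" "d \<le> Suc q" "(a, c) \<noteq> (0, 0)" "(b, d) \<noteq> (Suc p, Suc q)"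
    using sw unfolding swap_def by auto
  obtain T where T: "(a, d) \<notin> T" "(b, c) \<notin> T" "C = T \<union> {(a, c), (b, d)}" "C' = T \<union> ({(a, d), (b, c)} - phantoms p q)"
    using sw unfolding swap_def by blast
  have G: "config_graph p q C = replace ?G
    (point_edge p q (a, d) \<union> point_edge p q (b, c)) (point_mark p q (a, d) \<union> point_mark p q (b, c))
    (point_edge p q (a, c) \<union> point_edge p q (b, d)) (point_mark p q (a, c) \<union> point_mark p q (b, d))"
    unfolding T(3,4) by (rule swap_graph_replace[OF T(1,2)])
  have ad: "(a, d) \<in> C'" if "a \<noteq> 0 \<or> d \<noteq> Suc q" using that s unfolding T(4) phantoms_def by auto
  have bc: "(b, c) \<in> C'" if "c \<noteq> 0 \<or> b \<noteq> Suc p" using that s unfolding T(4) phantoms_def by auto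
  obtain b' d' where bd: "b = Suc b'" "d = Suc d'" using s(1,3) by (cases b; cases d) auto
  show ?thesis
  proof (cases a)
    case a: 0
    then obtain c' where c: "c = Suc c'" using s(5) by (cases c) auto
    consider "b' < p" "d' < q" | "b' < p" "d' = q" | "b' = p" "d' < q" using s bd by fastforce
    then show ?thesis
    proof cases
      case 1
      have "config_graph p q C = replace ?G {{Pos b', Neg c'}} {Neg d'} {{Pos b', Neg d'}} {Neg c'}"
        unfolding G a c bd using 1 s c bd by (simp add: point_edge_def point_mark_def)
      moreover have "elementary_move ?G \<dots>"
        by (rule case2_minus) (use s bd a c 1 ad bc in \<open>simp_all add: edge_config_graph neg_mark_config_graph\<close>)
      ultimately show ?thesis by simp
    next
      case 2
      have "config_graph p q C = replace ?G {{Pos b', Neg c'}} {} {} {Neg c'}"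
        unfolding G a c bd using 2 s c bd by (simp add: point_edge_def point_mark_def)
      moreover have "elementary_move ?G \<dots>"
        by (rule case4_minus) (use s bd a c 2 bc in \<open>simp_all add: edge_config_graph\<close>)
      ultimately show ?thesis by simp
    next
      case 3
      have "config_graph p q C = replace ?G {} {Neg d'} {} {Neg c'}"
        unfolding G a c bd using 3 s c bd by (simp add: point_edge_def point_mark_def)
      moreover have "elementary_move ?G \<dots>"
        by (rule case5_minus)
           (use s bd a c 3 ad bc in \<open>simp_all add: neg_mark_config_graph free_neg_config_graph[OF C']\<close>)
      ultimately show ?thesis by simp
    qed
  next
    case a: (Suc a')
    have ap: "a' < p" using s a by simp
    show ?thesis
    proof (cases c)
      case c: 0
      consider "b' < p" "d' < q" | "b' < p" "d' = q" | "b' = p" "d' < q" using s bd by fastforce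
      then show ?thesis
      proof cases
        case 1
        have "config_graph p q C = replace ?G {{Pos a', Neg d'}} {Pos b'} {{Pos b', Neg d'}} {Pos a'}"
          unfolding G a c bd using 1 s ap c bd by (simp add: point_edge_def point_mark_def)
        moreover have "elementary_move ?G \<dots>"
          by (rule case2_plus) (use s bd a c 1 ap ad bc in \<open>simp_all add: edge_config_graph pos_mark_config_graph\<close>)
        ultimately show ?thesis by simp
      next
        case 2
        have "config_graph p q C = replace ?G {} {Pos b'} {} {Pos a'}"
          unfolding G a c bd using 2 s ap c bd by (simp add: point_edge_def point_mark_def)
        moreover have "elementary_move ?G \<dots>"
          by (rule case5_plus)
             (use s bd a c 2 ap ad bc in \<open>simp_all add: pos_mark_config_graph free_pos_config_graph[OF C']\<close>)
        ultimately show ?thesis by simp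
      next
        case 3
        have "config_graph p q C = replace ?G {{Pos a', Neg d'}} {} {} {Pos a'}"
          unfolding G a c bd using 3 s ap c bd by (simp add: point_edge_def point_mark_def)
        moreover have "elementary_move ?G \<dots>"
          by (rule case4_plus) (use s bd a c 3 ap ad in \<open>simp_all add: edge_config_graph\<close>)
        ultimately show ?thesis by simp
      qed
    next
      case c: (Suc c')
      have cq: "c' < q" using s c by simp
      consider "b' < p" "d' < q" | "b' < p" "d' = q" | "b' = p" "d' < q" using s bd by fastforce
      then show ?thesis
      proof cases
        case 1
        have "config_graph p q C = replace ?G {{Pos a', Neg d'}, {Pos b', Neg c'}} {} {{Pos a', Neg c'}, {Pos b', Neg d'}} {}"
          unfolding G a c bd using 1 s ap cq bd by (simp add: point_edge_def point_mark_def insert_commute)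
        moreover have "elementary_move ?G \<dots>"
          by (rule case1) (use s bd a c 1 ap ad bc in \<open>simp_all add: edge_config_graph\<close>)
        ultimately show ?thesis by simp
      next
        case 2
        have "config_graph p q C = replace ?G {{Pos b', Neg c'}} {} {{Pos a', Neg c'}} {}"
          unfolding G a c bd using 2 s ap cq bd by (simp add: point_edge_def point_mark_def)
        moreover have "elementary_move ?G \<dots>"
          by (rule case3_plus)
             (use s bd a c 2 ap cq ad bc in \<open>simp_all add: edge_config_graph free_pos_config_graph[OF C']\<close>)
        ultimately show ?thesis by simp
      next
        case 3
        have "config_graph p q C = replace ?G {{Pos a', Neg d'}} {} {{Pos a', Neg c'}} {}"
          unfolding G a c bd using 3 s ap cq bd by (simp add: point_edge_def point_mark_def)
        moreover have "elementary_move ?G \<dots>"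
          by (rule case3_minus)
             (use s bd a c 3 ap cq ad bc in \<open>simp_all add: edge_config_graph free_neg_config_graph[OF C']\<close>)
        ultimately show ?thesis by simp
      qed
    qed
  qed
qed

text \<open>A configuration is determined by its graph, so a comparison of graphs suffices. The
  corners \<open>(a, c)\<close> and \<open>(b, d)\<close> are vacant in \<open>C'\<close> by
  uniqueness of points in rows and columns.\<close>

lemma swapI_graph:
  assumes C: "config p q r C" and C': "config p q r C'"
    and s: "a < b" "b \<le> Suc p" "c < d" "d \<le> Suc q" "(a, c) \<noteq> (0, 0)" "(b, d) \<noteq> (Suc p, Suc q)"
    and m: "(a, d) \<in> C' \<union> phantoms p q" "(b, c) \<in> C' \<union> phantoms p q"
    and G: "config_graph p q C = replace (config_graph p q C')
      (point_edge p q (a, d) \<union> point_edge p q (b, c)) (point_mark p q (a, d) \<union> point_mark p q (b, c))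
      (point_edge p q (a, c) \<union> point_edge p q (b, d)) (point_mark p q (a, c) \<union> point_mark p q (b, d))"
  shows "swap p q C' C a b c d"
proof -
  define T where "T = C' - {(a, d), (b, c)}"
  have ad: "a \<noteq> 0 \<or> d \<noteq> Suc q \<Longrightarrow> (a, d) \<in> C'" and bc: "c \<noteq> 0 \<or> b \<noteq> Suc p \<Longrightarrow> (b, c) \<in> C'"
    using m s unfolding phantoms_def by auto
  have ac: "(a, c) \<notin> C'"
  proof
    assume h: "(a, c) \<in> C'"
    show False
    proof (cases "a = 0")
      case True
      then have "c \<noteq> 0" using s by simp
      then show False using config_col_unique[OF C' h bc] s by simp
    next
      case False
      then show False using config_row_unique[OF C' h ad] s by simp
    qed
  qed
  have bd: "(b, d) \<notin> C'"
  proof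
    assume h: "(b, d) \<in> C'"
    show False
    proof (cases "b = Suc p")
      case True
      then have "d \<noteq> Suc q" using s by simp
      then show False using config_col_unique[OF C' h ad] s by simp
    next
      case False
      then show False using config_row_unique[OF C' h bc] s by simp
    qed
  qed
  have T: "(a, c) \<notin> T" "(b, d) \<notin> T" "(a, d) \<notin> T" "(b, c) \<notin> T" using ac bd unfolding T_def by auto
  have C'eq: "C' = T \<union> ({(a, d), (b, c)} - phantoms p q)"
    using m config_corner(3)[OF C'] unfolding T_def by auto
  have "config_graph p q C = config_graph p q (T \<union> {(a, c), (b, d)})"
    unfolding G swap_graph_replace[OF T(3,4)] C'eq[symmetric] ..
  moreover have "config p q r (T \<union> {(a, c), (b, d)})"
    using C' unfolding swap_config_iff[OF refl refl T s] C'eq[symmetric] .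
  ultimately have "C = T \<union> {(a, c), (b, d)}" using config_graph_inj[OF C] by blast
  then show ?thesis unfolding swap_def using s T C'eq by blast
qed

lemma elementary_move_imp_swap:
  assumes C: "config p q r C" and C': "config p q r C'"
    and mv: "elementary_move (config_graph p q C') (config_graph p q C)"
  shows "\<exists>a b c d. swap p q C' C a b c d"
  using mv
proof (cases rule: elementary_move.cases)
  case (case1 a b c d)
  have m: "a < p" "b < p" "c < q" "d < q" "(Suc a, Suc d) \<in> C'" "(Suc b, Suc c) \<in> C'"
    using case1 by (simp_all add: edge_config_graph)
  have "swap p q C' C (Suc a) (Suc b) (Suc c) (Suc d)"
    by (rule swapI_graph[OF C C']) (use case1 m in \<open>simp_all add: point_edge_def point_mark_def insert_commute\<close>)
  then show ?thesis by blast
next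
  case (case2_plus a b c)
  have m: "a < p" "b < p" "c < q" "(Suc a, Suc c) \<in> C'" "(Suc b, 0) \<in> C'"
    using case2_plus by (simp_all add: edge_config_graph pos_mark_config_graph)
  have "swap p q C' C (Suc a) (Suc b) 0 (Suc c)"
    by (rule swapI_graph[OF C C']) (use case2_plus m in \<open>simp_all add: point_edge_def point_mark_def\<close>)
  then show ?thesis by blast
next
  case (case2_minus c d a)
  have m: "a < p" "c < q" "d < q" "(Suc a, Suc c) \<in> C'" "(0, Suc d) \<in> C'"
    using case2_minus by (simp_all add: edge_config_graph neg_mark_config_graph)
  have "swap p q C' C 0 (Suc a) (Suc c) (Suc d)"
    by (rule swapI_graph[OF C C']) (use case2_minus m in \<open>simp_all add: point_edge_def point_mark_def\<close>)
  then show ?thesis by blast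
next
  case (case3_plus a b c)
  have m: "a < p" "b < p" "c < q" "(Suc b, Suc c) \<in> C'" "(Suc a, Suc q) \<in> C'"
    using case3_plus by (simp_all add: edge_config_graph free_pos_config_graph[OF C'])
  have "swap p q C' C (Suc a) (Suc b) (Suc c) (Suc q)"
    by (rule swapI_graph[OF C C']) (use case3_plus m in \<open>simp_all add: point_edge_def point_mark_def\<close>)
  then show ?thesis by blast
next
  case (case3_minus c d a)
  have m: "a < p" "c < q" "d < q" "(Suc a, Suc d) \<in> C'" "(Suc p, Suc c) \<in> C'"
    using case3_minus by (simp_all add: edge_config_graph free_neg_config_graph[OF C'])
  have "swap p q C' C (Suc a) (Suc p) (Suc c) (Suc d)"
    by (rule swapI_graph[OF C C']) (use case3_minus m in \<open>simp_all add: point_edge_def point_mark_def\<close>)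
  then show ?thesis by blast
next
  case (case4_plus a c)
  have m: "a < p" "c < q" "(Suc a, Suc c) \<in> C'" using case4_plus by (simp_all add: edge_config_graph)
  \<comment> \<open>The swap partner of the edge is the phantom \<open>(Suc p, 0)\<close>.\<close>
  have "swap p q C' C (Suc a) (Suc p) 0 (Suc c)"
    by (rule swapI_graph[OF C C']) (use case4_plus m in \<open>simp_all add: point_edge_def point_mark_def phantoms_def\<close>)
  then show ?thesis by blast
next
  case (case4_minus a c)
  have m: "a < p" "c < q" "(Suc a, Suc c) \<in> C'" using case4_minus by (simp_all add: edge_config_graph)
  \<comment> \<open>The swap partner of the edge is the phantom \<open>(0, Suc q)\<close>.\<close>
  have "swap p q C' C 0 (Suc a) (Suc c) (Suc q)"
    by (rule swapI_graph[OF C C']) (use case4_minus m in \<open>simp_all add: point_edge_def point_mark_def phantoms_def\<close>)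
  then show ?thesis by blast
next
  case (case5_plus a b)
  have m: "a < p" "b < p" "(Suc b, 0) \<in> C'" "(Suc a, Suc q) \<in> C'"
    using case5_plus by (simp_all add: pos_mark_config_graph free_pos_config_graph[OF C'])
  have "swap p q C' C (Suc a) (Suc b) 0 (Suc q)"
    by (rule swapI_graph[OF C C']) (use case5_plus m in \<open>simp_all add: point_edge_def point_mark_def\<close>)
  then show ?thesis by blast
next
  case (case5_minus c d)
  have m: "c < q" "d < q" "(0, Suc d) \<in> C'" "(Suc p, Suc c) \<in> C'"
    using case5_minus by (simp_all add: neg_mark_config_graph free_neg_config_graph[OF C'])
  have "swap p q C' C 0 (Suc p) (Suc c) (Suc d)"
    by (rule swapI_graph[OF C C']) (use case5_minus m in \<open>simp_all add: point_edge_def point_mark_def\<close>)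
  then show ?thesis by blast
qed

section \<open>From matrices to configurations\<close>

lemma col_ones_lead_mat:
  assumes ld: "lead_fun p q r ld" and k: "k < r"
  shows "col_ones (lead_mat p q r ld) k = lead_rows p (ld k)"
  using lead_rows_less[of "ld k" p q] lead_fun_range[OF ld k] k unfolding col_ones_def lead_mat_def
  by (auto split: if_splits)

lemma mat_graph_lead_mat:
  assumes ld: "lead_fun p q r ld"
  shows "mat_graph p q r (lead_mat p q r ld) = config_graph p q (points p q r ld)"
proof -
  let ?C = "points p q r ld"
  have mem: "x \<in> ?C \<longleftrightarrow> (\<exists>k<r. ld k = x)" if "fst x \<le> p" "snd x \<le> q" for x
  proof -
    have "x \<in> ?C \<longleftrightarrow> x \<in> nonfree p q ?C" using that by (simp add: nonfree_def)
    then show ?thesis unfolding nonfree_points[OF ld] by (auto simp: image_iff)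
  qed
  have edge: "(\<exists>k<r. col_ones (lead_mat p q r ld) k = {i, p + j}) \<longleftrightarrow> (Suc i, Suc j) \<in> ?C" if "i < p" "j < q" for i j
  proof -
    have "lead_rows p (ld k) = {i, p + j} \<longleftrightarrow> ld k = (Suc i, Suc j)" if k: "k < r" for k
    proof
      assume e: "lead_rows p (ld k) = {i, p + j}"
      have "i \<in> lead_rows p (ld k)" "p + j \<in> lead_rows p (ld k)" unfolding e by auto
      then show "ld k = (Suc i, Suc j)"
        using lead_fun_range[OF ld k] \<open>i < p\<close> unfolding lead_rows_iff by (auto simp: prod_eq_iff)
    qed (auto simp: lead_rows_def)
    then show ?thesis using mem[of "(Suc i, Suc j)"] that by (simp add: col_ones_lead_mat[OF ld] cong: conj_cong)
  qed
  have pos: "(\<exists>k<r. col_ones (lead_mat p q r ld) k = {i}) \<longleftrightarrow> (Suc i, 0) \<in> ?C" if "i < p" for i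
  proof -
    have "lead_rows p (ld k) = {i} \<longleftrightarrow> ld k = (Suc i, 0)" if k: "k < r" for k
    proof
      assume e: "lead_rows p (ld k) = {i}"
      have "i \<in> lead_rows p (ld k)" "snd (ld k) \<noteq> 0 \<Longrightarrow> p + snd (ld k) - 1 \<in> {i}"
        unfolding e[symmetric] by (auto simp: lead_rows_def e[unfolded lead_rows_def])
      then show "ld k = (Suc i, 0)"
        using lead_fun_range[OF ld k] \<open>i < p\<close> unfolding lead_rows_iff
        by (cases "snd (ld k) = 0") (auto simp: prod_eq_iff)
    qed (auto simp: lead_rows_def)
    then show ?thesis using mem[of "(Suc i, 0)"] that by (simp add: col_ones_lead_mat[OF ld] cong: conj_cong)
  qed
  have neg: "(\<exists>k<r. col_ones (lead_mat p q r ld) k = {p + j}) \<longleftrightarrow> (0, Suc j) \<in> ?C" if "j < q" for j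
  proof -
    have "lead_rows p (ld k) = {p + j} \<longleftrightarrow> ld k = (0, Suc j)" if k: "k < r" for k
    proof
      assume e: "lead_rows p (ld k) = {p + j}"
      have "p + j \<in> lead_rows p (ld k)" "fst (ld k) \<noteq> 0 \<Longrightarrow> fst (ld k) - 1 \<in> {p + j}"
        unfolding e[symmetric] by (auto simp: lead_rows_def e[unfolded lead_rows_def])
      then show "ld k = (0, Suc j)"
        using lead_fun_range[OF ld k] unfolding lead_rows_iff
        by (cases "fst (ld k) = 0") (auto simp: prod_eq_iff)
    qed (auto simp: lead_rows_def)
    then show ?thesis using mem[of "(0, Suc j)"] that by (simp add: col_ones_lead_mat[OF ld] cong: conj_cong)
  qed
  have E: "edges (mat_graph p q r (lead_mat p q r ld)) = edges (config_graph p q ?C)"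
  proof
    show "edges (mat_graph p q r (lead_mat p q r ld)) \<subseteq> edges (config_graph p q ?C)"
    proof
      fix e assume "e \<in> edges (mat_graph p q r (lead_mat p q r ld))"
      then obtain i j where ij: "e = {Pos i, Neg j}" "i < p" "j < q"
        "\<exists>k<r. col_ones (lead_mat p q r ld) k = {i, p + j}"
        unfolding mat_graph_def by auto
      show "e \<in> edges (config_graph p q ?C)" unfolding ij(1) edge_config_graph using edge[OF ij(2,3)] ij(2-4) by simp
    qed
    show "edges (config_graph p q ?C) \<subseteq> edges (mat_graph p q r (lead_mat p q r ld))"
    proof
      fix e assume "e \<in> edges (config_graph p q ?C)"
      then show "e \<in> edges (mat_graph p q r (lead_mat p q r ld))"
      proof (rule edges_config_graphE)
        fix i j assume ij: "e = {Pos i, Neg j}" "i < p" "j < q" "(Suc i, Suc j) \<in> ?C"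
        then show ?thesis using edge[OF ij(2,3)] unfolding mat_graph_def by auto
      qed
    qed
  qed
  have M: "marks (mat_graph p q r (lead_mat p q r ld)) = marks (config_graph p q ?C)"
  proof (rule Set.set_eqI)
    fix v
    show "v \<in> marks (mat_graph p q r (lead_mat p q r ld)) \<longleftrightarrow> v \<in> marks (config_graph p q ?C)"
    proof (cases v)
      case (Pos i)
      have "v \<in> marks (mat_graph p q r (lead_mat p q r ld)) \<longleftrightarrow>
          i < p \<and> (\<exists>k<r. col_ones (lead_mat p q r ld) k = {i})"
        unfolding mat_graph_def Pos by auto
      then show ?thesis using pos unfolding Pos pos_mark_config_graph by blast
    next
      case (Neg j)
      have "v \<in> marks (mat_graph p q r (lead_mat p q r ld)) \<longleftrightarrow>
          j < q \<and> (\<exists>k<r. col_ones (lead_mat p q r ld) k = {p + j})"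
        unfolding mat_graph_def Neg by auto
      then show ?thesis using neg unfolding Neg neg_mark_config_graph by blast
    qed
  qed
  have "verts (mat_graph p q r (lead_mat p q r ld)) = verts (config_graph p q ?C)"
    by (simp add: mat_graph_def config_graph_def)
  then show ?thesis using E M by (intro marked_graph.equality) auto
qed

text \<open>\<open>l m\<close> is the row of the entry \<open>1\<close> in column \<open>m\<close>,
  counted from \<open>1\<close>, with \<open>0\<close> for a zero column; it becomes one coordinate
  of a point.\<close>

lemma part_perms_leads:
  assumes \<tau>: "\<tau> \<in> part_perms p r"
  obtains l where "\<And>m. m < r \<Longrightarrow> l m \<le> p" "\<And>i m. i < p \<Longrightarrow> m < r \<Longrightarrow> \<tau> $$ (i, m) = of_bool (l m = Suc i)"
    "\<And>m m'. m < r \<Longrightarrow> m' < r \<Longrightarrow> m \<noteq> m' \<Longrightarrow> l m = l m' \<Longrightarrow> l m = 0"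
proof -
  have ent: "\<tau> $$ (i, m) = 0 \<or> \<tau> $$ (i, m) = 1" if "i < p" "m < r" for i m
    using \<tau> that unfolding part_perms_def by auto
  have row: "m = m'" if h: "i < p" "m < r" "m' < r" "\<tau> $$ (i, m) = 1" "\<tau> $$ (i, m') = 1" for i m m'
  proof -
    have "card {k. k < r \<and> \<tau> $$ (i, k) = 1} \<le> Suc 0" using \<tau> h(1) unfolding part_perms_def by auto
    moreover have "finite {k. k < r \<and> \<tau> $$ (i, k) = 1}" by simp
    ultimately show ?thesis using h(2-5) by (subst (asm) card_le_Suc0_iff_eq) auto
  qed
  have col: "i = i'" if h: "i < p" "i' < p" "m < r" "\<tau> $$ (i, m) = 1" "\<tau> $$ (i', m) = 1" for i i' m
  proof -
    have "card {k. k < p \<and> \<tau> $$ (k, m) = 1} \<le> Suc 0" using \<tau> h(3) unfolding part_perms_def by auto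
    moreover have "finite {k. k < p \<and> \<tau> $$ (k, m) = 1}" by simp
    ultimately show ?thesis using h by (subst (asm) card_le_Suc0_iff_eq) auto
  qed
  have "\<exists>x\<le>p. \<forall>i<p. \<tau> $$ (i, m) = of_bool (x = Suc i)" if m: "m < r" for m
  proof (cases "\<exists>i<p. \<tau> $$ (i, m) = 1")
    case True
    then obtain i where i: "i < p" "\<tau> $$ (i, m) = 1" by auto
    have "\<tau> $$ (i', m) = of_bool (Suc i = Suc i')" if i': "i' < p" for i'
      using ent[OF i' m] col[OF i(1) i' m i(2)] i(2) by (cases "i = i'") auto
    then show ?thesis using i(1) by (intro exI[of _ "Suc i"]) auto
  next
    case False
    then show ?thesis using ent m by (intro exI[of _ 0]) auto
  qed
  then obtain l where l: "\<And>m. m < r \<Longrightarrow> l m \<le> p \<and> (\<forall>i<p. \<tau> $$ (i, m) = of_bool (l m = Suc i))" by metis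
  show ?thesis
  proof (rule that[of l])
    fix m m' assume m: "m < r" "m' < r" "m \<noteq> m'" "l m = l m'"
    show "l m = 0"
    proof (rule ccontr)
      assume "l m \<noteq> 0"
      then obtain i where i: "l m = Suc i" "i < p" using l[OF m(1)] by (cases "l m") auto
      then show False using row[of i m m'] l m by auto
    qed
  qed (use l in auto)
qed

text \<open>Full rank rules out zero columns, that is, the point \<open>(0, 0)\<close>. The other
  properties come from the two blocks being partial permutation matrices.\<close>

lemma T_mats_lead_mat:
  assumes \<omega>: "\<omega> \<in> T_mats p q r"
  obtains ld where "lead_fun p q r ld" "\<omega> = lead_mat p q r ld"
proof -
  obtain \<tau>1 \<tau>2 where \<tau>: "\<omega> = \<tau>1 @\<^sub>r \<tau>2" "\<tau>1 \<in> part_perms p r" "\<tau>2 \<in> part_perms q r" "mat_rank (p + q) \<omega> = r"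
    using \<omega> unfolding T_mats_def by auto
  have c: "\<tau>1 \<in> carrier_mat p r" "\<tau>2 \<in> carrier_mat q r" using \<tau>(2,3) unfolding part_perms_def by auto
  have wc: "\<omega> \<in> carrier_mat (p + q) r" by (rule T_mats_carrier[OF \<omega>])
  obtain l1 where l1: "\<And>m. m < r \<Longrightarrow> l1 m \<le> p" "\<And>i m. i < p \<Longrightarrow> m < r \<Longrightarrow> \<tau>1 $$ (i, m) = of_bool (l1 m = Suc i)"
    "\<And>m m'. m < r \<Longrightarrow> m' < r \<Longrightarrow> m \<noteq> m' \<Longrightarrow> l1 m = l1 m' \<Longrightarrow> l1 m = 0"
    using part_perms_leads[OF \<tau>(2)] by metis
  obtain l2 where l2: "\<And>m. m < r \<Longrightarrow> l2 m \<le> q" "\<And>i m. i < q \<Longrightarrow> m < r \<Longrightarrow> \<tau>2 $$ (i, m) = of_bool (l2 m = Suc i)"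
    "\<And>m m'. m < r \<Longrightarrow> m' < r \<Longrightarrow> m \<noteq> m' \<Longrightarrow> l2 m = l2 m' \<Longrightarrow> l2 m = 0"
    using part_perms_leads[OF \<tau>(3)] by metis
  define ld where "ld m = (l1 m, l2 m)" for m
  have ent: "\<omega> $$ (i, m) = of_bool (i \<in> lead_rows p (ld m))" if i: "i < p + q" and m: "m < r" for i m
  proof (cases "i < p")
    case True
    then have "\<omega> $$ (i, m) = \<tau>1 $$ (i, m)" unfolding \<tau>(1) append_rows_def using c m by simp
    then show ?thesis using l1(2)[OF True m] True by (auto simp: lead_rows_iff ld_def)
  next
    case False
    then have "\<omega> $$ (i, m) = \<tau>2 $$ (i - p, m)" unfolding \<tau>(1) append_rows_def using c m i by simp
    then show ?thesis using l2(2)[of "i - p" m] l1(1)[OF m] i m False by (auto simp: lead_rows_iff ld_def)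
  qed
  have e: "\<omega> = lead_mat p q r ld" unfolding lead_mat_def using ent wc by (intro eq_matI) auto
  have nz: "ld m \<noteq> (0, 0)" if m: "m < r" for m
  proof
    assume z: "ld m = (0, 0)"
    have "\<omega> *\<^sub>v unit_vec r m = col \<omega> m" using mult_unit_vec_col[OF wc m] .
    also have "\<dots> = 0\<^sub>v (p + q)"
      by (rule eq_vecI) (use wc m ent z in \<open>auto simp: lead_rows_def\<close>)
    finally have "\<omega> *\<^sub>v unit_vec r m = 0\<^sub>v (p + q)" .
    moreover have "inj_mat \<omega>" using inj_mat_iff_rank[OF wc] \<tau>(4) by simp
    ultimately have "unit_vec r m = (0\<^sub>v r :: complex vec)" using wc unfolding inj_mat_def by auto
    then have "unit_vec r m $ m = (0 :: complex)" using m by simp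
    then show False using m by simp
  qed
  have "lead_fun p q r ld"
    by (rule lead_funI) (use nz l1(1,3) l2(1,3) in \<open>auto simp: ld_def\<close>)
  then show ?thesis using that e by blast
qed

lemma T_bar_lead_fun:
  assumes c: "c \<in> T_bar p q r"
  obtains ld where "lead_fun p q r ld" "orbit_of p q c = orb p q r ld"
    "graph_class p q r c = config_graph p q (points p q r ld)"
proof -
  obtain \<omega> where \<omega>: "\<omega> \<in> T_mats p q r" "c = col_perm_rel p q r `` {\<omega>}"
    using c unfolding T_bar_def by (rule quotientE)
  have mem: "\<omega> \<in> c" unfolding \<omega>(2) by (rule equiv_class_self[OF equiv_col_perm_rel \<omega>(1)])
  obtain ld where ld: "lead_fun p q r ld" "\<omega> = lead_mat p q r ld" using T_mats_lead_mat[OF \<omega>(1)] .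
  show ?thesis
  proof (rule that[OF ld(1)])
    show "orbit_of p q c = orb p q r ld"
      unfolding orbit_of_def col_space_class_rep[OF c mem] orb_alt[OF ld(1)] ld(2) ..
    show "graph_class p q r c = config_graph p q (points p q r ld)"
      unfolding graph_class_rep[OF c mem] ld(2) by (rule mat_graph_lead_mat[OF ld(1)])
  qed
qed

section \<open>Covering relations and the boundary\<close>

lemma K_orbits_orb:
  assumes "Q \<in> K_orbits p q r"
  obtains ld where "lead_fun p q r ld" "Q = orb p q r ld"
  using assms K_orbit_is_orb unfolding K_orbits_def by blast

lemma K_orbit_self:
  assumes y: "y \<in> dflag_variety p q r"
  shows "y \<in> K_orbit p q y"
proof -
  obtain A k where x: "(A, k) \<in> frames p q r" "y = frame_map p q (A, k)" using variety_has_frame[OF y] .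
  have "K_act (1\<^sub>m (p + q)) y = y"
    using K_act_frame_map(1)[OF K_group_one x(1)] x K_group_carrier[of k p q] by (auto simp: frames_iff)
  then show ?thesis unfolding K_orbit_def using K_group_one by force
qed

lemma orb_in_K_orbits:
  assumes ld: "lead_fun p q r ld"
  shows "orb p q r ld \<in> K_orbits p q r"
proof -
  have "(lead_mat p q r ld, 1\<^sub>m (p + q)) \<in> frames p q r" by (rule has_leads_one_frames(1)[OF ld has_leads_lead_mat[OF ld]])
  then have "frame_map p q (lead_mat p q r ld, 1\<^sub>m (p + q)) \<in> dflag_variety p q r" by (rule frame_mapI)
  then show ?thesis unfolding orb_alt[OF ld] K_orbits_def frame_map_one by (rule imageI)
qed

lemma swap_closure_psubset:
  assumes ld: "lead_fun p q r ld" and ld': "lead_fun p q r ld'"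
    and sw: "swap p q (points p q r ld') (points p q r ld) a b c d"
  shows "zariski p q r closure_of orb p q r ld \<subset> zariski p q r closure_of orb p q r ld'"
  using orb_closure_psubset_imp[OF ld points_config[OF ld'] sw] orb_cong_points[OF _ ld'] by metis

text \<open>The larger closure extends a longest chain of the smaller one.\<close>

lemma orb_dim_less:
  assumes ld: "lead_fun p q r ld" and ld': "lead_fun p q r ld'"
    and sub: "zariski p q r closure_of orb p q r ld \<subset> zariski p q r closure_of orb p q r ld'"
  shows "orb_dim p q r ld < orb_dim p q r ld'"
proof -
  have "orb p q r ld \<subseteq> zariski p q r closure_of orb p q r ld"
    using closure_of_subset orb_subset[OF ld] topspace_zariski by metis
  then have "chain_in (zariski p q r) (zariski p q r closure_of orb p q r ld) (orb_dim p q r ld)"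
    by (rule chain_in_mono[OF _ closure_of_subset_topspace]) (unfold orb_dim_def, rule orb_chain[OF ld])
  then have "chain_in (zariski p q r) (zariski p q r closure_of orb p q r ld') (Suc (orb_dim p q r ld))"
    by (rule chain_in_extend[OF closedin_closure_of closedin_closure_of sub irreducible_in_closure[OF orb_irreducible[OF ld']]])
  then show ?thesis using chain_in_closure_le[OF ld'] by force
qed

text \<open>An interpolation: between two nested closures there is one obtained from the larger by a
  single swap of codimension one. The covers and the components of a boundary both follow from
  it.\<close>

lemma closure_psubset_imp_swap:
  assumes ld: "lead_fun p q r ld" and ld': "lead_fun p q r ld'"
    and sub: "zariski p q r closure_of orb p q r ld \<subset> zariski p q r closure_of orb p q r ld'"
  obtains ldw a b c d where "lead_fun p q r ldw" "swap p q (points p q r ld') (points p q r ldw) a b c d"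
    "orb_dim p q r ld' = orb_dim p q r ldw + 1"
    "zariski p q r closure_of orb p q r ld \<subseteq> zariski p q r closure_of orb p q r ldw"
    "zariski p q r closure_of orb p q r ldw \<subset> zariski p q r closure_of orb p q r ld'"
proof -
  have ne: "points p q r ld \<noteq> points p q r ld'" using sub orb_closure_eq_iff[OF ld ld'] by auto
  have le: "cnt (points p q r ld') i j \<le> cnt (points p q r ld) i j" if "i \<le> p" "j \<le> q" for i j
    using sub orb_closure_subset_iff[OF ld ld'] that by auto
  obtain w a b c d where w: "swap p q (points p q r ld') w a b c d" "config p q r w" "ll_pairs w = ll_pairs (points p q r ld') + 1"
    "\<And>i j. i \<le> p \<Longrightarrow> j \<le> q \<Longrightarrow> cnt w i j \<le> cnt (points p q r ld) i j"
    using exists_swap_below[OF points_config[OF ld] points_config[OF ld'] ne le] by metis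
  obtain ldw where ldw: "lead_fun p q r ldw" "points p q r ldw = w" by (rule config_lead_fun[OF w(2)])
  show ?thesis
  proof (rule that[OF ldw(1)])
    show sw: "swap p q (points p q r ld') (points p q r ldw) a b c d" using w(1) ldw(2) by simp
    show "orb_dim p q r ld' = orb_dim p q r ldw + 1"
      using card_slice_index[OF ldw(1)] card_slice_index[OF ld'] w(3) unfolding ldw(2) orb_dim_def by linarith
    show "zariski p q r closure_of orb p q r ld \<subseteq> zariski p q r closure_of orb p q r ldw"
      using orb_closure_subset_iff[OF ld ldw(1)] w(4) ldw(2) by simp
    show "zariski p q r closure_of orb p q r ldw \<subset> zariski p q r closure_of orb p q r ld'"
      by (rule swap_closure_psubset[OF ldw(1) ld' sw])
  qed
qed

lemma orbit_covers_iff: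
  assumes ld: "lead_fun p q r ld" and ld': "lead_fun p q r ld'"
  shows "orbit_covers p q r (orb p q r ld') (orb p q r ld) \<longleftrightarrow>
    orb_dim p q r ld' = orb_dim p q r ld + 1 \<and> (\<exists>a b c d. swap p q (points p q r ld') (points p q r ld) a b c d)"
proof
  let ?cl = "\<lambda>ld. zariski p q r closure_of orb p q r ld"
  assume cov: "orbit_covers p q r (orb p q r ld') (orb p q r ld)"
  then have sub: "?cl ld \<subset> ?cl ld'" unfolding orbit_covers_def orbit_closure_def by simp
  obtain ldw a b c d where w: "lead_fun p q r ldw" "swap p q (points p q r ld') (points p q r ldw) a b c d"
    "orb_dim p q r ld' = orb_dim p q r ldw + 1" "?cl ld \<subseteq> ?cl ldw" "?cl ldw \<subset> ?cl ld'"
    by (rule closure_psubset_imp_swap[OF ld ld' sub])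
  have "\<not> ?cl ld \<subset> ?cl ldw"
    using cov w(5) orb_in_K_orbits[OF w(1)] unfolding orbit_covers_def orbit_closure_def by blast
  then have "?cl ld = ?cl ldw" using w(4) by blast
  then have e: "points p q r ld = points p q r ldw" using orb_closure_eq_iff[OF ld w(1)] by simp
  have "orb_dim p q r ld = orb_dim p q r ldw"
    using card_slice_index[OF ld] card_slice_index[OF w(1)] e unfolding orb_dim_def by simp
  then show "orb_dim p q r ld' = orb_dim p q r ld + 1 \<and> (\<exists>a b c d. swap p q (points p q r ld') (points p q r ld) a b c d)"
    using w(2,3) e by auto
next
  assume h: "orb_dim p q r ld' = orb_dim p q r ld + 1 \<and> (\<exists>a b c d. swap p q (points p q r ld') (points p q r ld) a b c d)"
  then obtain a b c d where sw: "swap p q (points p q r ld') (points p q r ld) a b c d" by blast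
  show "orbit_covers p q r (orb p q r ld') (orb p q r ld)"
    unfolding orbit_covers_def orbit_closure_def
  proof (intro conjI notI swap_closure_psubset[OF ld ld' sw])
    assume "\<exists>R\<in>K_orbits p q r. zariski p q r closure_of orb p q r ld \<subset> zariski p q r closure_of R \<and>
      zariski p q r closure_of R \<subset> zariski p q r closure_of orb p q r ld'"
    then obtain R where R: "R \<in> K_orbits p q r" "zariski p q r closure_of orb p q r ld \<subset> zariski p q r closure_of R"
      "zariski p q r closure_of R \<subset> zariski p q r closure_of orb p q r ld'" by blast
    obtain ldr where ldr: "lead_fun p q r ldr" "R = orb p q r ldr" by (rule K_orbits_orb[OF R(1)])
    \<comment> \<open>An orbit strictly in between would have a dimension strictly between two
      consecutive integers.\<close>
    have "orb_dim p q r ld < orb_dim p q r ldr" "orb_dim p q r ldr < orb_dim p q r ld'"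
      using orb_dim_less[OF ld ldr(1)] orb_dim_less[OF ldr(1) ld'] R(2,3) unfolding ldr(2) by auto
    then show False using h by simp
  qed
qed

text \<open>An orbit that meets a closure at one point lies in it, since the counts depend only on
  the orbit. Hence the boundary is a union of orbit closures.\<close>

lemma boundary_eq_Union:
  assumes ld': "lead_fun p q r ld'"
  shows "zariski p q r closure_of orb p q r ld' - orb p q r ld' =
    \<Union>{zariski p q r closure_of orb p q r ld |ld. lead_fun p q r ld \<and>
       zariski p q r closure_of orb p q r ld \<subset> zariski p q r closure_of orb p q r ld'}"
proof (intro equalityI subsetI)
  let ?cl = "\<lambda>ld. zariski p q r closure_of orb p q r ld"
  fix y assume y: "y \<in> ?cl ld' - orb p q r ld'"
  have "?cl ld' \<subseteq> dflag_variety p q r" using closure_of_subset_topspace topspace_zariski by metis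
  then have "y \<in> dflag_variety p q r" using y by blast
  then obtain ld where ld: "lead_fun p q r ld" "K_orbit p q y = orb p q r ld" by (rule K_orbit_is_orb)
  have yorb: "y \<in> orb p q r ld" unfolding ld(2)[symmetric] by (rule K_orbit_self[OF \<open>y \<in> dflag_variety p q r\<close>])
  have "?cl ld \<subseteq> ?cl ld'"
    using orb_closure_subset_iff[OF ld(1) ld'] closure_imp_cnt_le[OF ld(1) ld' yorb] y by auto
  moreover have "?cl ld \<noteq> ?cl ld'"
    using orb_closure_eq_iff[OF ld(1) ld'] orb_cong_points[OF ld(1) ld'] yorb y by auto
  moreover have "y \<in> ?cl ld" using closure_of_subset orb_subset[OF ld(1)] topspace_zariski yorb by (metis subsetD)
  ultimately show "y \<in> \<Union>{?cl ld |ld. lead_fun p q r ld \<and> ?cl ld \<subset> ?cl ld'}" using ld(1) by blast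
next
  let ?cl = "\<lambda>ld. zariski p q r closure_of orb p q r ld"
  fix y assume "y \<in> \<Union>{?cl ld |ld. lead_fun p q r ld \<and> ?cl ld \<subset> ?cl ld'}"
  then obtain ld where ld: "lead_fun p q r ld" "?cl ld \<subset> ?cl ld'" "y \<in> ?cl ld" by blast
  have "y \<notin> orb p q r ld'"
  proof
    assume "y \<in> orb p q r ld'"
    then have "?cl ld' \<subseteq> ?cl ld"
      using orb_closure_subset_iff[OF ld' ld(1)] closure_imp_cnt_le[OF ld' ld(1) _ ld(3)] by auto
    then show False using ld(2) by blast
  qed
  then show "y \<in> ?cl ld' - orb p q r ld'" using ld by blast
qed

lemma finite_orb_closures: "finite {zariski p q r closure_of orb p q r ld |ld. lead_fun p q r ld}"
proof -
  \<comment> \<open>\<open>SOME\<close> picks a lead function for a set of points. The orbit depends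
    only on the points, so the finitely many subsets of the grid yield all closures.\<close>
  let ?f = "\<lambda>C. zariski p q r closure_of orb p q r (SOME ld. lead_fun p q r ld \<and> points p q r ld = C)"
  have "zariski p q r closure_of orb p q r ld \<in> ?f ` Pow ({0..Suc p} \<times> {0..Suc q})" if ld: "lead_fun p q r ld" for ld
  proof (rule image_eqI)
    let ?ld = "SOME ld'. lead_fun p q r ld' \<and> points p q r ld' = points p q r ld"
    have "lead_fun p q r ?ld \<and> points p q r ?ld = points p q r ld" by (rule someI[of _ ld]) (use ld in simp)
    then show "zariski p q r closure_of orb p q r ld = ?f (points p q r ld)"
      using orb_cong_points[of p q r ?ld ld] ld by simp
    show "points p q r ld \<in> Pow ({0..Suc p} \<times> {0..Suc q})" using points_config[OF ld] unfolding config_def by blast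
  qed
  then have "{zariski p q r closure_of orb p q r ld |ld. lead_fun p q r ld} \<subseteq> ?f ` Pow ({0..Suc p} \<times> {0..Suc q})" by blast
  then show ?thesis by (rule finite_subset) simp
qed

text \<open>A component is irreducible and covered by finitely many smaller orbit closures, so it
  lies in one of them. That one lies in a closure of codimension one inside the boundary, and
  maximality of the component gives equality.\<close>

lemma boundary_equidim:
  assumes ld': "lead_fun p q r ld'"
  shows "equidim_codim_one p q r (zariski p q r closure_of orb p q r ld' - orb p q r ld') (zariski p q r closure_of orb p q r ld')"
  unfolding equidim_codim_one_def
proof
  let ?T = "zariski p q r" and ?cl = "\<lambda>ld. zariski p q r closure_of orb p q r ld"
  let ?B = "?cl ld' - orb p q r ld'"
  fix Z assume Z: "Z \<in> irreducible_components (subtopology ?T ?B)"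
  have BT: "?B \<subseteq> topspace ?T" using closure_of_subset_topspace[of ?T "orb p q r ld'"] by blast
  then have tB: "topspace (subtopology ?T ?B) = ?B" by auto
  have sub: "subtopology (subtopology ?T ?B) S = subtopology ?T S" if "S \<subseteq> ?B" for S
    using that by (simp add: subtopology_subtopology inf.absorb2)
  have irr: "irreducible_top (subtopology (subtopology ?T ?B) S) \<longleftrightarrow> irreducible_in ?T S" if "S \<subseteq> ?B" for S
    unfolding sub[OF that] by (rule irreducible_top_subtopology[OF subset_trans[OF that BT]])
  have ZB: "Z \<subseteq> ?B" using Z unfolding irreducible_components_def tB by simp
  have Zi: "irreducible_in ?T Z" using Z irr[OF ZB] unfolding irreducible_components_def by simp
  have Zmax: "Y = Z" if "Y \<subseteq> ?B" "irreducible_in ?T Y" "Z \<subseteq> Y" for Y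
    using Z that irr[OF that(1)] unfolding irreducible_components_def tB by simp
  let ?\<C> = "{?cl ld |ld. lead_fun p q r ld \<and> ?cl ld \<subset> ?cl ld'}"
  have "finite ?\<C>" by (rule finite_subset[OF _ finite_orb_closures[of p q r]]) blast
  moreover have "Z \<subseteq> \<Union>?\<C>" using ZB unfolding boundary_eq_Union[OF ld'] .
  moreover have "closedin ?T C" if C: "C \<in> ?\<C>" for C
  proof -
    obtain ld where "C = ?cl ld" using C by blast
    then show ?thesis by simp
  qed
  ultimately obtain C where "C \<in> ?\<C>" "Z \<subseteq> C" using irreducible_in_closed_cover[OF Zi, of ?\<C>] by meson
  then obtain ld where ld: "lead_fun p q r ld" "?cl ld \<subset> ?cl ld'" "Z \<subseteq> ?cl ld" by blast
  obtain ldw a b c d where w: "lead_fun p q r ldw" "swap p q (points p q r ld') (points p q r ldw) a b c d"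
    "orb_dim p q r ld' = orb_dim p q r ldw + 1" "?cl ld \<subseteq> ?cl ldw" "?cl ldw \<subset> ?cl ld'"
    by (rule closure_psubset_imp_swap[OF ld(1) ld' ld(2)])
  have wB: "?cl ldw \<subseteq> ?B" unfolding boundary_eq_Union[OF ld'] using w(1,5) by blast
  have "?cl ldw = Z"
    by (rule Zmax[OF wB irreducible_in_closure[OF orb_irreducible[OF w(1)]]]) (use ld(3) w(4) in blast)
  then have "zdim p q r Z = enat (orb_dim p q r ldw)" using zdim_orb(2)[OF w(1)] by simp
  then show "zdim p q r Z + 1 = zdim p q r (?cl ld')"
    using zdim_orb(2)[OF ld'] w(3) by (simp add: one_enat_def)
qed

theorem theorem2p3:
  fixes p q r :: nat
  assumes "p \<ge> 1" and "q \<ge> 1" and "r \<le> p + q"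
  shows "(\<forall>\<omega>\<in>T_bar p q r. \<forall>\<omega>'\<in>T_bar p q r.
            orbit_covers p q r (orbit_of p q \<omega>') (orbit_of p q \<omega>) \<longleftrightarrow>
              zdim p q r (orbit_of p q \<omega>') = zdim p q r (orbit_of p q \<omega>) + 1 \<and>
              elementary_move (graph_class p q r \<omega>') (graph_class p q r \<omega>)) \<and>
         (\<forall>Q\<in>K_orbits p q r. \<not> closedin (zariski p q r) Q \<longrightarrow>
            equidim_codim_one p q r (orbit_closure p q r Q - Q) (orbit_closure p q r Q))"
proof (intro conjI ballI impI)
  fix \<omega> \<omega>' assume \<omega>: "\<omega> \<in> T_bar p q r" "\<omega>' \<in> T_bar p q r"
  obtain ld where ld: "lead_fun p q r ld" "orbit_of p q \<omega> = orb p q r ld"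
    "graph_class p q r \<omega> = config_graph p q (points p q r ld)" by (rule T_bar_lead_fun[OF \<omega>(1)])
  obtain ld' where ld': "lead_fun p q r ld'" "orbit_of p q \<omega>' = orb p q r ld'"
    "graph_class p q r \<omega>' = config_graph p q (points p q r ld')" by (rule T_bar_lead_fun[OF \<omega>(2)])
  have "elementary_move (graph_class p q r \<omega>') (graph_class p q r \<omega>) \<longleftrightarrow>
      (\<exists>a b c d. swap p q (points p q r ld') (points p q r ld) a b c d)"
    unfolding ld(3) ld'(3)
    using elementary_move_imp_swap[OF points_config[OF ld(1)] points_config[OF ld'(1)]]
      swap_imp_elementary_move[OF _ points_config[OF ld'(1)]] by blast
  then show "orbit_covers p q r (orbit_of p q \<omega>') (orbit_of p q \<omega>) \<longleftrightarrow>
      zdim p q r (orbit_of p q \<omega>') = zdim p q r (orbit_of p q \<omega>) + 1 \<and>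
      elementary_move (graph_class p q r \<omega>') (graph_class p q r \<omega>)"
    unfolding ld(2) ld'(2) orbit_covers_iff[OF ld(1) ld'(1)] zdim_orb(1)[OF ld(1)] zdim_orb(1)[OF ld'(1)]
    by (simp add: one_enat_def)
next
  fix Q assume "Q \<in> K_orbits p q r"
  then obtain ld where ld: "lead_fun p q r ld" "Q = orb p q r ld" by (rule K_orbits_orb)
  show "equidim_codim_one p q r (orbit_closure p q r Q - Q) (orbit_closure p q r Q)"
    unfolding ld(2) orbit_closure_def by (rule boundary_equidim[OF ld(1)])
qed

end
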